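(* Let $\varphi\in\mathcal S(\mathbb R^d)$ with $\|\varphi\|_{L^2}=1$. Let $a\in S^m_\rho$ for some $m\in\mathbb R$, $\rho\in[0,1/2)$, with $a\ge0$. For every $N\in\mathbb N$ there exists $C_N>0$ such that, for every $h\in(0,1]$, $$C_N^{-1}\boldsymbol\lambda'_{\mathrm{ess}}(a,h)-C_Nh^N\le\inf\sigma_{\mathrm{ess}}(A_{a,h})\le C_N\big(\boldsymbol\lambda'_{\mathrm{ess}}(a,h)+h^N\big),$$ where $$\boldsymbol\lambda'_{\mathrm{ess}}(a,h):=\liminf_{(x_0,\omega_0)\to\infty}\ \sup_{(x,\omega)\in B((x_0,\omega_0),h^{1/2})}a(x,\omega,h)\in[0,+\infty].$$ In particular, $\sigma(A_{a,h})$ is purely discrete if and only if $$\lim_{(x_0,\omega_0)\to\infty}\ \sup_{(x,\omega)\in B((x_0,\omega_0),h^{1/2})}a(x,\omega,h)=+\infty.$$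
   Context: $B((x_0,\omega_0),r)$ is the Euclidean ball in $\mathbb R^{2d}$. $\sigma$ and $\sigma_{\mathrm{ess}}$ denote spectrum and essential spectrum; $\inf\emptyset=+\infty$; "purely discrete" means consisting of isolated eigenvalues of finite multiplicity. $S^m_\rho$ is the space of families of smooth functions $a(\cdot,h)$ on $\mathbb R^{2d}$, $h\in(0,1]$, such that for some $N_0\in\mathbb N$ and all $\alpha,\beta\in\mathbb N^d$ with $|\alpha|+|\beta|\ge N_0$, $$\sup_{(x,\omega,h)\in\mathbb R^{2d}\times(0,1]}|\partial_x^\alpha\partial_\omega^\beta a(x,\omega,h)|\,h^{m+\rho(|\alpha|+|\beta|)}<\infty.$$ For $h>0$, the generalized coherent states are $\varphi^h_{(x_0,\omega_0)}(x)=h^{-d/4}e^{\frac ih\omega_0\cdot x}\varphi(h^{-1/2}(x-x_0))$, $x,x_0,\omega_0\in\mathbb R^d$. For $a\ge0$ in $S^m_\rho$ and $h\in(0,1]$, the quadratic form $$Q_{a,h}(f)=(2\pi h)^{-d}\int_{\mathbb R^{2d}}a(x,\omega,h)|\langle f,\varphi^h_{(x,\omega)}\rangle|^2\,dx\,d\omega$$ with domain $\mathcal D_{a,h}=\{f\in L^2(\mathbb R^d):Q_{a,h}(f)<\infty\}$ is densely defined, nonnegative and closed. $A_{a,h}$ (the anti-Wick operator with symbol $a(\cdot,h)$ and window $\varphi$) denotes the unique self-adjoint operator on $L^2(\mathbb R^d)$ associated with it: $\mathrm{dom}\,A_{a,h}\subset\mathcal D_{a,h}$ and $\langle A_{a,h}f,g\rangle=Q_{a,h}(f,g)$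 for $f\in\mathrm{dom}\,A_{a,h}$, $g\in\mathcal D_{a,h}$. *)

theory Defs
  imports "HOL-Analysis.Analysis"
begin

section \<open>The Hilbert space of square-integrable functions\<close>

definition square_integrable :: "('a::euclidean_space \<Rightarrow> complex) \<Rightarrow> bool" where
  "square_integrable f \<longleftrightarrow>
     f \<in> borel_measurable lborel \<and> integrable lborel (\<lambda>x. (cmod (f x))\<^sup>2)"

definition l2rel :: "('a::euclidean_space \<Rightarrow> complex) \<Rightarrow> ('a \<Rightarrow> complex) \<Rightarrow> bool" where
  "l2rel f g \<longleftrightarrow> square_integrable f \<and> square_integrable g \<and> (AE x in lborel. f x = g x)"

lemma square_integrable_zero: "square_integrable (\<lambda>x. 0)"
  by (simp add: square_integrable_def)

lemma square_integrable_scale: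
  assumes "square_integrable f"
  shows "square_integrable (\<lambda>x. c * f x)"
  using assms by (auto simp: square_integrable_def norm_mult power_mult_distrib)

lemma square_integrable_add:
  assumes "square_integrable f" "square_integrable g"
  shows "square_integrable (\<lambda>x. f x + g x)"
proof -
  have [measurable]: "f \<in> borel_measurable lborel" "g \<in> borel_measurable lborel"
    using assms by (auto simp: square_integrable_def)
  have "integrable lborel (\<lambda>x. 2 * (cmod (f x))\<^sup>2 + 2 * (cmod (g x))\<^sup>2)"
    using assms by (auto simp: square_integrable_def)
  then have "integrable lborel (\<lambda>x. (cmod (f x + g x))\<^sup>2)"
  proof (rule Bochner_Integration.integrable_bound)
    show "AE x in lborel. norm ((cmod (f x + g x))\<^sup>2)
            \<le> norm (2 * (cmod (f x))\<^sup>2 + 2 * (cmod (g x))\<^sup>2)"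
    proof (rule AE_I2)
      fix x
      have "(cmod (f x + g x))\<^sup>2 \<le> (cmod (f x) + cmod (g x))\<^sup>2"
        by (intro power_mono norm_triangle_ineq) simp
      also have "\<dots> \<le> 2 * (cmod (f x))\<^sup>2 + 2 * (cmod (g x))\<^sup>2"
        using sum_squares_bound[of "cmod (f x)" "cmod (g x)"] by (simp add: power2_sum)
      finally show "norm ((cmod (f x + g x))\<^sup>2)
            \<le> norm (2 * (cmod (f x))\<^sup>2 + 2 * (cmod (g x))\<^sup>2)" by simp
    qed
  qed simp
  then show ?thesis by (simp add: square_integrable_def)
qed

lemma borel_measurable_cnj [measurable (raw)]:
  "f \<in> borel_measurable M \<Longrightarrow> (\<lambda>x. cnj (f x)) \<in> borel_measurable M"
  by (rule borel_measurable_continuous_on[where f = cnj]) (intro continuous_intros)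

lemma square_integrable_mult_cnj:
  assumes "square_integrable f" "square_integrable g"
  shows "integrable lborel (\<lambda>x. f x * cnj (g x))"
proof -
  have [measurable]: "f \<in> borel_measurable lborel" "g \<in> borel_measurable lborel"
    using assms by (auto simp: square_integrable_def)
  have "integrable lborel (\<lambda>x. (cmod (f x))\<^sup>2 + (cmod (g x))\<^sup>2)"
    using assms by (auto simp: square_integrable_def)
  then show ?thesis
  proof (rule Bochner_Integration.integrable_bound)
    show "AE x in lborel. norm (f x * cnj (g x))
            \<le> norm ((cmod (f x))\<^sup>2 + (cmod (g x))\<^sup>2)"
    proof (rule AE_I2)
      fix x
      have "0 \<le> cmod (f x) * cmod (g x)" by simp
      moreover have "2 * (cmod (f x) * cmod (g x)) \<le> (cmod (f x))\<^sup>2 + (cmod (g x))\<^sup>2"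
        using sum_squares_bound[of "cmod (f x)" "cmod (g x)"] by simp
      ultimately have "cmod (f x) * cmod (g x) \<le> (cmod (f x))\<^sup>2 + (cmod (g x))\<^sup>2"
        by linarith
      then show "norm (f x * cnj (g x)) \<le> norm ((cmod (f x))\<^sup>2 + (cmod (g x))\<^sup>2)"
        by (simp add: norm_mult)
    qed
  qed simp
qed

quotient_type (overloaded) 'a l2 = "'a::euclidean_space \<Rightarrow> complex" / partial: l2rel
  morphisms rep_l2 abs_l2
proof (rule part_equivpI)
  show "\<exists>f::'a \<Rightarrow> complex. l2rel f f"
    by (intro exI[of _ "\<lambda>x. 0"]) (simp add: l2rel_def square_integrable_zero)
  show "symp (l2rel :: ('a \<Rightarrow> complex) \<Rightarrow> _)"
    by (auto simp: symp_def l2rel_def elim: AE_mp)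
  show "transp (l2rel :: ('a \<Rightarrow> complex) \<Rightarrow> _)"
    by (auto simp: transp_def l2rel_def elim!: AE_mp)
qed

lift_definition cinner :: "'a::euclidean_space l2 \<Rightarrow> 'a l2 \<Rightarrow> complex" is
  "\<lambda>f g. (\<integral>x. f x * cnj (g x) \<partial>lborel)"
proof -
  fix f f' g g' :: "'a \<Rightarrow> complex"
  assume *: "l2rel f f'" "l2rel g g'"
  then have [measurable]: "f \<in> borel_measurable lborel" "g \<in> borel_measurable lborel"
      "f' \<in> borel_measurable lborel" "g' \<in> borel_measurable lborel"
    by (auto simp: l2rel_def square_integrable_def)
  have "AE x in lborel. f x = f' x" "AE x in lborel. g x = g' x"
    using * by (auto simp: l2rel_def)
  then have "AE x in lborel. f x * cnj (g x) = f' x * cnj (g' x)"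
    by eventually_elim simp
  then show "(\<integral>x. f x * cnj (g x) \<partial>lborel) = (\<integral>x. f' x * cnj (g' x) \<partial>lborel)"
    by (intro integral_cong_AE) measurable
qed

lift_definition scaleC :: "complex \<Rightarrow> 'a::euclidean_space l2 \<Rightarrow> 'a l2"  (infixr \<open>*\<^sub>C\<close> 75) is
  "\<lambda>c f x. c * f x"
  by (auto simp: l2rel_def square_integrable_scale)

instantiation l2 :: (euclidean_space) real_inner
begin

lift_definition zero_l2 :: "'a l2" is "\<lambda>x. 0"
  by (simp add: l2rel_def square_integrable_zero)

lift_definition plus_l2 :: "'a l2 \<Rightarrow> 'a l2 \<Rightarrow> 'a l2" is "\<lambda>f g x. f x + g x"
  by (auto simp: l2rel_def square_integrable_add)

definition uminus_l2 :: "'a l2 \<Rightarrow> 'a l2" where "- f = (- 1) *\<^sub>C f"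
definition minus_l2 :: "'a l2 \<Rightarrow> 'a l2 \<Rightarrow> 'a l2" where "f - g = f + (- g :: 'a l2)"
definition scaleR_l2 :: "real \<Rightarrow> 'a l2 \<Rightarrow> 'a l2" where "r *\<^sub>R f = complex_of_real r *\<^sub>C f"
definition inner_l2 :: "'a l2 \<Rightarrow> 'a l2 \<Rightarrow> real" where "inner f g = Re (cinner f g)"
definition norm_l2 :: "'a l2 \<Rightarrow> real" where "norm f = sqrt (inner f (f :: 'a l2))"
definition sgn_l2 :: "'a l2 \<Rightarrow> 'a l2" where "sgn f = complex_of_real (inverse (norm f)) *\<^sub>C (f :: 'a l2)"
definition dist_l2 :: "'a l2 \<Rightarrow> 'a l2 \<Rightarrow> real" where "dist f g = norm (f - g :: 'a l2)"
definition uniformity_l2 :: "('a l2 \<times> 'a l2) filter" where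
  "uniformity_l2 = (INF e\<in>{0<..}. principal {(f, g :: 'a l2). dist f g < e})"
definition open_l2 :: "'a l2 set \<Rightarrow> bool" where
  "open_l2 (U :: 'a l2 set) \<longleftrightarrow> (\<forall>f\<in>U. eventually (\<lambda>(f', g). f' = f \<longrightarrow> g \<in> U) uniformity)"

instance
proof
  fix f g k :: "'a l2" and r s :: real
  show "f + g + k = f + (g + k)"
    by transfer (auto simp: l2rel_def add.assoc intro!: square_integrable_add)
  show "f + g = g + f"
    by transfer (auto simp: l2rel_def add.commute intro!: square_integrable_add)
  show "0 + f = f"
    by transfer (auto simp: l2rel_def)
  show "- f + f = 0"
    unfolding uminus_l2_def
    by transfer (auto simp: l2rel_def square_integrable_zero)
  show "f - g = f + - g" by (simp add: minus_l2_def)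
  show "r *\<^sub>R (f + g) = r *\<^sub>R f + r *\<^sub>R g"
    unfolding scaleR_l2_def
    by transfer (auto simp: l2rel_def distrib_left intro!: square_integrable_add square_integrable_scale)
  show "(r + s) *\<^sub>R f = r *\<^sub>R f + s *\<^sub>R f"
    unfolding scaleR_l2_def
    by transfer (auto simp: l2rel_def distrib_right intro!: square_integrable_add square_integrable_scale)
  show "r *\<^sub>R s *\<^sub>R f = (r * s) *\<^sub>R f"
    unfolding scaleR_l2_def
    by transfer (auto simp: l2rel_def mult.assoc intro!: square_integrable_scale)
  show "1 *\<^sub>R f = f"
    unfolding scaleR_l2_def by transfer (auto simp: l2rel_def)
  show "dist f g = norm (f - g)" by (simp add: dist_l2_def)
  show "sgn f = inverse (norm f) *\<^sub>R f" by (simp add: sgn_l2_def scaleR_l2_def)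
  show "(uniformity :: ('a l2 \<times> 'a l2) filter)
      = (INF e\<in>{0<..}. principal {(f, g). dist f g < e})"
    by (rule uniformity_l2_def)
  show "open U =  (\<forall>f\<in>U. eventually (\<lambda>(f', g). f' = f \<longrightarrow> g \<in> U) uniformity)" for U :: "'a l2 set"
    by (rule open_l2_def)
  show "inner f g = inner g f"
  proof -
    have "cinner f g = cnj (cinner g f)"
      by transfer (simp add: mult.commute flip: Bochner_Integration.integral_cnj)
    then show ?thesis by (simp add: inner_l2_def)
  qed
  have add: "cinner (f + g) k = cinner f k + cinner g k"
    by transfer (auto simp: l2rel_def distrib_right square_integrable_mult_cnj
        intro!: Bochner_Integration.integral_add)
  then show "inner (f + g) k = inner f k + inner g k"
    by (simp add: inner_l2_def)
  have "cinner (complex_of_real r *\<^sub>C f) g = complex_of_real r * cinner f g"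
    by transfer (simp add: mult.assoc)
  then show "inner (r *\<^sub>R f) g = r * inner f g"
    by (simp add: inner_l2_def scaleR_l2_def)
  have self: "inner (abs_l2 F) (abs_l2 F) = (\<integral>x. (cmod (F x))\<^sup>2 \<partial>lborel)"
    if "square_integrable F" for F :: "'a \<Rightarrow> complex"
  proof -
    have "l2rel F F" using that by (simp add: l2rel_def)
    then have "cinner (abs_l2 F) (abs_l2 F) = (\<integral>x. F x * cnj (F x) \<partial>lborel)"
      by (simp add: cinner.abs_eq)
    also have "\<dots> = (\<integral>x. complex_of_real ((cmod (F x))\<^sup>2) \<partial>lborel)"
      by (simp only: complex_norm_square[symmetric])
    also have "\<dots> = complex_of_real (\<integral>x. (cmod (F x))\<^sup>2 \<partial>lborel)"
      by (rule integral_complex_of_real)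
    finally show ?thesis by (simp add: inner_l2_def)
  qed
  obtain F where F: "f = abs_l2 F" "l2rel F F"
    by (metis Quotient3_l2 Quotient3_abs_rep Quotient3_rep_reflp)
  then have sF: "square_integrable F" by (simp add: l2rel_def)
  show "0 \<le> inner f f"
    using self[OF sF] by (simp add: F(1))
  show "inner f f = 0 \<longleftrightarrow> f = 0"
  proof -
    have "inner f f = 0 \<longleftrightarrow> (AE x in lborel. (cmod (F x))\<^sup>2 = 0)"
      using sF unfolding F(1) self[OF sF]
      by (intro integral_nonneg_eq_0_iff_AE) (auto simp: square_integrable_def)
    also have "\<dots> \<longleftrightarrow> l2rel F (\<lambda>x. 0)"
      using sF by (simp add: l2rel_def square_integrable_zero)
    also have "\<dots> \<longleftrightarrow> f = 0"
      unfolding F(1) zero_l2_def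
      using F(2) Quotient3_rel[OF Quotient3_l2, of F "\<lambda>x. 0"]
      by (auto simp: l2rel_def square_integrable_zero)
    finally show ?thesis .
  qed
  show "norm f = sqrt (inner f f)" by (simp add: norm_l2_def)
qed

end

section \<open>Unbounded operators and their spectra\<close>

text \<open>An unbounded operator is given by its graph, a set of pairs \<open>(f, A f)\<close>; its domain is
  the library's \<^const>\<open>Domain\<close> of that relation.\<close>

definition linear_operator :: "('a::euclidean_space l2 \<times> 'a l2) set \<Rightarrow> bool" where
  "linear_operator A \<longleftrightarrow> single_valued A \<and> (0, 0) \<in> A \<and>
     (\<forall>(f, u)\<in>A. \<forall>(g, v)\<in>A. (f + g, u + v) \<in> A) \<and>
     (\<forall>c. \<forall>(f, u)\<in>A. (c *\<^sub>C f, c *\<^sub>C u) \<in> A)"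

definition adjoint_graph ::
    "('a::euclidean_space l2 \<times> 'a l2) set \<Rightarrow> ('a l2 \<times> 'a l2) set" where
  "adjoint_graph A = {(g, v). \<forall>(f, u)\<in>A. cinner u g = cinner f v}"

definition self_adjoint :: "('a::euclidean_space l2 \<times> 'a l2) set \<Rightarrow> bool" where
  "self_adjoint A \<longleftrightarrow>
     linear_operator A \<and> closure (Domain A) = UNIV \<and> adjoint_graph A = A"

definition resolvent_set :: "('a::euclidean_space l2 \<times> 'a l2) set \<Rightarrow> complex set" where
  "resolvent_set A = {z. (\<forall>v. \<exists>!f. \<exists>u. (f, u) \<in> A \<and> u - z *\<^sub>C f = v) \<and>
     (\<exists>C. \<forall>(f, u)\<in>A. norm f \<le> C * norm (u - z *\<^sub>C f))}"

definition spectrum :: "('a::euclidean_space l2 \<times> 'a l2) set \<Rightarrow> complex set" where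
  "spectrum A = - resolvent_set A"

definition eigenspace ::
    "('a::euclidean_space l2 \<times> 'a l2) set \<Rightarrow> complex \<Rightarrow> 'a l2 set" where
  "eigenspace A z = {f. (f, z *\<^sub>C f) \<in> A}"

definition finite_dimensional :: "'a::euclidean_space l2 set \<Rightarrow> bool" where
  "finite_dimensional V \<longleftrightarrow>
     (\<exists>B. finite B \<and> (\<forall>f\<in>V. \<exists>c. f = (\<Sum>b\<in>B. c b *\<^sub>C b)))"

definition discrete_spectrum :: "('a::euclidean_space l2 \<times> 'a l2) set \<Rightarrow> complex set" where
  "discrete_spectrum A = {z. z isolated_in spectrum A \<and>
     eigenspace A z \<noteq> {0} \<and> finite_dimensional (eigenspace A z)}"

definition ess_spectrum :: "('a::euclidean_space l2 \<times> 'a l2) set \<Rightarrow> complex set" where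
  "ess_spectrum A = spectrum A - discrete_spectrum A"

definition purely_discrete_spectrum :: "('a::euclidean_space l2 \<times> 'a l2) set \<Rightarrow> bool" where
  "purely_discrete_spectrum A \<longleftrightarrow> spectrum A \<subseteq> discrete_spectrum A"

text \<open>The spectrum of a self-adjoint operator is real, so passing to real parts loses nothing;
  in \<^typ>\<open>ereal\<close> the infimum of the empty set is \<open>\<infinity>\<close>.\<close>

definition inf_ess_spectrum :: "('a::euclidean_space l2 \<times> 'a l2) set \<Rightarrow> ereal" where
  "inf_ess_spectrum A = (INF z\<in>ess_spectrum A. ereal (Re z))"

section \<open>Smooth functions, Schwartz functions and symbols\<close>

text \<open>A multi-index is encoded as a list of basis vectors, its order being the length of the
  list. For smooth functions partial derivatives commute, so that the derivatives along lists
  of length \<open>k\<close> are exactly the derivatives of order \<open>k\<close>.\<close>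

primrec partials ::
    "'a::euclidean_space list \<Rightarrow> ('a \<Rightarrow> 'b::real_normed_vector) \<Rightarrow> 'a \<Rightarrow> 'b" where
  "partials [] f = f"
| "partials (b # bs) f = (\<lambda>x. frechet_derivative (partials bs f) (at x) b)"

definition smooth :: "('a::euclidean_space \<Rightarrow> 'b::real_normed_vector) \<Rightarrow> bool" where
  "smooth f \<longleftrightarrow> (\<forall>bs\<in>lists Basis. \<forall>x. partials bs f differentiable (at x))"

definition schwartz :: "('a::euclidean_space \<Rightarrow> complex) \<Rightarrow> bool" where
  "schwartz f \<longleftrightarrow> smooth f \<and>
     (\<forall>bs\<in>lists Basis. \<forall>k::nat. \<exists>C. \<forall>x. norm x ^ k * cmod (partials bs f x) \<le> C)"

definition symbol_class :: "real \<Rightarrow> real \<Rightarrow> (real \<Rightarrow> 'a::euclidean_space \<Rightarrow> real) set" where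
  "symbol_class m \<rho> = {a. (\<forall>h\<in>{0<..1}. smooth (a h)) \<and>
     (\<exists>N0::nat. \<forall>bs\<in>lists Basis. length bs \<ge> N0 \<longrightarrow>
        (\<exists>C. \<forall>h\<in>{0<..1}. \<forall>z.
           \<bar>partials bs (a h) z\<bar> * h powr (m + \<rho> * real (length bs)) \<le> C))}"

section \<open>Anti-Wick operators\<close>

definition coherent_state ::
    "('a::euclidean_space \<Rightarrow> complex) \<Rightarrow> real \<Rightarrow> 'a \<times> 'a \<Rightarrow> 'a \<Rightarrow> complex" where
  "coherent_state \<phi> h = (\<lambda>(x0, \<omega>0) x.
     complex_of_real (h powr (- (real DIM('a) / 4))) *
       exp (\<i> / complex_of_real h * complex_of_real (inner \<omega>0 x)) *
       \<phi> ((h powr (- (1/2))) *\<^sub>R (x - x0)))"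

text \<open>In the following definitions the symbol is a function \<open>b\<close> on phase space, i.e. \<open>a h\<close> for a
  symbol family \<open>a\<close>.\<close>

definition antiwick_quadratic_form ::
    "('a::euclidean_space \<Rightarrow> complex) \<Rightarrow> real \<Rightarrow> ('a \<times> 'a \<Rightarrow> real) \<Rightarrow> 'a l2 \<Rightarrow> ennreal" where
  "antiwick_quadratic_form \<phi> h b f = ennreal (1 / (2 * pi * h) ^ DIM('a)) *
     (\<integral>\<^sup>+ z. ennreal (b z * (cmod (cinner f (abs_l2 (coherent_state \<phi> h z))))\<^sup>2) \<partial>lborel)"

definition antiwick_form_domain ::
    "('a::euclidean_space \<Rightarrow> complex) \<Rightarrow> real \<Rightarrow> ('a \<times> 'a \<Rightarrow> real) \<Rightarrow> 'a l2 set" where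
  "antiwick_form_domain \<phi> h b = {f. antiwick_quadratic_form \<phi> h b f < \<infinity>}"

text \<open>The sesquilinear form of the quadratic form; by Cauchy-Schwarz the integral converges
  absolutely for \<open>f\<close>, \<open>g\<close> in the form domain.\<close>

definition antiwick_form ::
    "('a::euclidean_space \<Rightarrow> complex) \<Rightarrow> real \<Rightarrow> ('a \<times> 'a \<Rightarrow> real) \<Rightarrow> 'a l2 \<Rightarrow> 'a l2 \<Rightarrow> complex" where
  "antiwick_form \<phi> h b f g = complex_of_real (1 / (2 * pi * h) ^ DIM('a)) *
     (\<integral> z. complex_of_real (b z) * cinner f (abs_l2 (coherent_state \<phi> h z)) *
         cinner (abs_l2 (coherent_state \<phi> h z)) g \<partial>lborel)"

definition antiwick_operator ::
    "('a::euclidean_space \<Rightarrow> complex) \<Rightarrow> real \<Rightarrow> ('a \<times> 'a \<Rightarrow> real) \<Rightarrow> ('a l2 \<times> 'a l2) set" where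
  "antiwick_operator \<phi> h b = (THE A. self_adjoint A \<and>
     Domain A \<subseteq> antiwick_form_domain \<phi> h b \<and>
     (\<forall>(f, u)\<in>A. \<forall>g\<in>antiwick_form_domain \<phi> h b. cinner u g = antiwick_form \<phi> h b f g))"

definition local_sup :: "(real \<Rightarrow> 'a::euclidean_space \<times> 'a \<Rightarrow> real) \<Rightarrow> real \<Rightarrow> 'a \<times> 'a \<Rightarrow> ereal" where
  "local_sup a h p = (SUP z\<in>ball p (h powr (1/2)). ereal (a h z))"

definition lambda_ess :: "(real \<Rightarrow> 'a::euclidean_space \<times> 'a \<Rightarrow> real) \<Rightarrow> real \<Rightarrow> ereal" where
  "lambda_ess a h = Liminf at_infinity (local_sup a h)"

end

(* After the scaling z = sqrt h * w the coherent states form a Parseval frame whose Gram matrix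
   decays rapidly, uniformly in h (Moyal's identity and integration by parts). By Taylor's formula
   the scaled symbol b agrees along every line with a polynomial of degree < K up to O(h^N) on unit
   scale, since each derivative gains a factor h^(1/2 - rho).

   Upper bound: if b <= s on unit balls escaping to infinity, then the coherent states at their
   centres are weakly null and have energy O(s + h^N).

   Lower bound: if every unit ball near infinity contains a point with b >= mu, then, as b is nearly
   polynomial on lines, {b < delta * mu} fills only a small part of each large ball. A Schur test
   shows that frame coefficients cannot concentrate on such a set, so that the form is at least
   c * mu up to a finite-rank error. *)

theory Submission
  imports Defs "HOL-Probability.Probability"
begin

subsection \<open>The complex Hilbert space of square-integrable functions\<close>

text \<open>No spectral theorem is invoked. All statements about spectra rest on one criterion: for
  self-adjoint \<open>A\<close>, a point \<open>z\<close> is in the resolvent set exactly when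
  \<open>norm ((A - z) f)\<close> dominates \<open>c * norm f\<close> for some \<open>c > 0\<close>.
  From it come both halves of a min-max principle at the bottom of the essential spectrum:
  coercivity up to finitely many functionals bounds it from below, the energy along a weakly null
  sequence of unit vectors bounds it from above.

  Symbols may be unbounded, so the operator exists only through its form. Here the near-polynomial
  behaviour on lines has a second use: it forces polynomial growth, which the decay of the Gram
  matrix absorbs, so that every coherent state has finite energy and the form is densely defined.

  The constant is uniform in \<open>h\<close> because \<open>\<kappa>\<close>, the decay constants
  \<open>\<Gamma>\<close> and the degree \<open>K\<close> are fixed before \<open>h\<close>, with
  \<open>K * (1/2 - \<rho>)\<close> at least \<open>N + m\<close>; the symbol then enters only
  through an error \<open>M\<close> of size \<open>h^N\<close>. The lower bound needs
  \<open>M\<close> small against \<open>\<mu>\<close>; when it is not, the asserted bound is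
  nonpositive and holds trivially.\<close>

lemma l2_cases:
  obtains F where "square_integrable F" "f = abs_l2 F"
proof -
  obtain F where F: "f = abs_l2 F" "l2rel F F"
    by (metis Quotient3_l2 Quotient3_abs_rep Quotient3_rep_reflp)
  then show ?thesis using that by (auto simp: l2rel_def)
qed

lemma l2rel_refl: "square_integrable F \<Longrightarrow> l2rel F F"
  by (simp add: l2rel_def)

lemma cinner_abs_l2:
  assumes "square_integrable F" "square_integrable G"
  shows "cinner (abs_l2 F) (abs_l2 G) = (\<integral>x. F x * cnj (G x) \<partial>lborel)"
  by (rule cinner.abs_eq) (simp_all add: l2rel_refl assms)

lemma abs_l2_add:
  assumes "square_integrable F" "square_integrable G"
  shows "abs_l2 F + abs_l2 G = abs_l2 (\<lambda>x. F x + G x)"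
  by (rule plus_l2.abs_eq) (simp_all add: l2rel_refl assms)

lemma abs_l2_scale:
  assumes "square_integrable F"
  shows "c *\<^sub>C abs_l2 F = abs_l2 (\<lambda>x. c * F x)"
  by (rule scaleC.abs_eq) (simp_all add: l2rel_refl assms)

lemma cinner_commute: "cinner f g = cnj (cinner g f)"
  by transfer (simp add: mult.commute flip: Bochner_Integration.integral_cnj)

lemma cinner_add_left: "cinner (f + g) k = cinner f k + cinner g k"
  by transfer (auto simp: l2rel_def distrib_right square_integrable_mult_cnj
      intro!: Bochner_Integration.integral_add)

lemma cinner_scaleC_left: "cinner (c *\<^sub>C f) k = c * cinner f k"
  by transfer (simp add: mult.assoc)

lemma cinner_add_right: "cinner k (f + g) = cinner k f + cinner k g"
  by (metis cinner_add_left cinner_commute complex_cnj_add)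

lemma cinner_scaleC_right: "cinner k (c *\<^sub>C f) = cnj c * cinner k f"
  by (metis cinner_scaleC_left cinner_commute complex_cnj_mult)

lemma scaleC_minus_one: "(-1) *\<^sub>C f = - f"
  by (simp add: uminus_l2_def)

lemma cinner_minus_left: "cinner (- f) k = - cinner f k"
  by (simp add: cinner_scaleC_left flip: scaleC_minus_one)

lemma cinner_minus_right: "cinner k (- f) = - cinner k f"
  by (simp add: cinner_scaleC_right flip: scaleC_minus_one)

lemma cinner_diff_left: "cinner (f - g) k = cinner f k - cinner g k"
  by (simp add: cinner_add_left cinner_minus_left flip: add_uminus_conv_diff)

lemma cinner_diff_right: "cinner k (f - g) = cinner k f - cinner k g"
  by (simp add: cinner_add_right cinner_minus_right flip: add_uminus_conv_diff)

lemma cinner_zero_left [simp]: "cinner 0 k = 0"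
  using cinner_diff_left[of k k k] by simp

lemma cinner_zero_right [simp]: "cinner k 0 = 0"
  using cinner_diff_right[of k k k] by simp

lemma cinner_sum_left: "cinner (sum F S) k = (\<Sum>i\<in>S. cinner (F i) k)"
  by (induction S rule: infinite_finite_induct) (auto simp: cinner_add_left)

lemma cinner_sum_right: "cinner k (sum F S) = (\<Sum>i\<in>S. cinner k (F i))"
  by (induction S rule: infinite_finite_induct) (auto simp: cinner_add_right)

lemmas cinner_simps = cinner_add_left cinner_add_right cinner_diff_left cinner_diff_right
  cinner_scaleC_left cinner_scaleC_right cinner_minus_left cinner_minus_right

lemma Re_cinner_self: "Re (cinner f f) = (norm f)\<^sup>2"
  by (simp add: power2_norm_eq_inner inner_l2_def)

lemma cinner_self: "cinner f f = complex_of_real ((norm f)\<^sup>2)"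
proof -
  have "Im (cinner f f) = 0"
    using cinner_commute[of f f] by (simp add: complex_eq_iff)
  then show ?thesis
    by (simp add: complex_eq_iff Re_cinner_self)
qed

lemma Re_cinner_commute: "Re (cinner f g) = Re (cinner g f)"
  by (metis cinner_commute complex_cnj(1) complex.collapse complex.sel(1))

lemma scaleC_of_real: "complex_of_real r *\<^sub>C f = r *\<^sub>R (f :: 'a::euclidean_space l2)"
  by (simp add: scaleR_l2_def)

lemma scaleC_scaleC: "c *\<^sub>C d *\<^sub>C f = (c * d) *\<^sub>C f"
  by transfer (auto simp: l2rel_def mult.assoc intro!: square_integrable_scale)

lemma scaleC_add_right: "c *\<^sub>C (f + g) = c *\<^sub>C f + c *\<^sub>C g"
  by transfer (auto simp: l2rel_def distrib_left intro!: square_integrable_add square_integrable_scale)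

lemma scaleC_add_left: "(c + d) *\<^sub>C f = c *\<^sub>C f + d *\<^sub>C f"
  by transfer (auto simp: l2rel_def distrib_right intro!: square_integrable_add square_integrable_scale)

lemma scaleC_one [simp]: "1 *\<^sub>C f = f"
  by transfer (auto simp: l2rel_def)

lemma scaleC_zero_left [simp]: "0 *\<^sub>C f = 0"
  by transfer (auto simp: l2rel_def square_integrable_zero)

lemma scaleC_zero_right [simp]: "c *\<^sub>C 0 = 0"
  by transfer (auto simp: l2rel_def square_integrable_zero)

lemma scaleC_minus_left: "(- c) *\<^sub>C f = - (c *\<^sub>C f)"
  by (metis mult_minus1 scaleC_minus_one scaleC_scaleC)

lemma scaleC_minus_right: "c *\<^sub>C (- f) = - (c *\<^sub>C f)"
  by (metis mult.commute scaleC_minus_one scaleC_scaleC)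

lemma scaleC_diff_right: "c *\<^sub>C (f - g) = c *\<^sub>C f - c *\<^sub>C g"
  by (simp add: scaleC_add_right scaleC_minus_right flip: add_uminus_conv_diff)

lemma scaleC_diff_left: "(c - d) *\<^sub>C f = c *\<^sub>C f - d *\<^sub>C f"
  by (simp add: scaleC_add_left scaleC_minus_left flip: add_uminus_conv_diff)

lemma scaleC_sum_right: "c *\<^sub>C (sum F S) = (\<Sum>i\<in>S. c *\<^sub>C F i)"
  by (induction S rule: infinite_finite_induct) (auto simp: scaleC_add_right)

lemma norm_scaleC: "norm (c *\<^sub>C f) = cmod c * norm f"
proof -
  have "cinner (c *\<^sub>C f) (c *\<^sub>C f) = (c * cnj c) * cinner f f"
    by (simp add: cinner_simps mult.assoc)
  also have "\<dots> = complex_of_real ((cmod c * norm f)\<^sup>2)"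
    by (simp add: cinner_self power_mult_distrib flip: complex_norm_square)
  finally have "(norm (c *\<^sub>C f))\<^sup>2 = (cmod c * norm f)\<^sup>2"
    by (metis Re_cinner_self Re_complex_of_real)
  then show ?thesis by simp
qed

lemma norm_add_sq:
  "(norm (f + g))\<^sup>2 = (norm f)\<^sup>2 + 2 * Re (cinner f g) + (norm (g :: 'a::euclidean_space l2))\<^sup>2"
  using Re_cinner_commute[of f g] by (simp add: cinner_simps flip: Re_cinner_self)

lemma norm_diff_sq:
  "(norm (f - g))\<^sup>2 = (norm f)\<^sup>2 - 2 * Re (cinner f g) + (norm (g :: 'a::euclidean_space l2))\<^sup>2"
  using Re_cinner_commute[of f g] by (simp add: cinner_simps flip: Re_cinner_self)

text \<open>The norm comes from \<open>inner\<close>, the real part of \<open>cinner\<close>.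
  Rotating \<open>f\<close> by the phase of the pairing makes the pairing real, and the real
  Cauchy-Schwarz inequality applies.\<close>

lemma cmod_cinner_le: "cmod (cinner f g) \<le> norm f * norm g"
proof -
  \<comment> \<open>A vanishing pairing gives \<open>c = 0\<close>, so only
    \<open>cmod c \<le> 1\<close> is recorded.\<close>
  define c where "c = cnj (sgn (cinner f g))"
  have "cmod c \<le> 1" by (simp add: c_def norm_sgn)
  have "cmod (cinner f g) = Re (c * cinner f g)"
  proof (cases "cinner f g = 0")
    case False
    have "cnj (cinner f g) * cinner f g = complex_of_real (cmod (cinner f g) * cmod (cinner f g))"
      by (metis complex_norm_square mult.commute power2_eq_square)
    then have "c * cinner f g = complex_of_real (cmod (cinner f g))"
      using False by (simp add: c_def sgn_eq)
    then show ?thesis by simp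
  qed simp
  also have "\<dots> = inner (c *\<^sub>C f) g"
    by (simp add: inner_l2_def cinner_simps)
  also have "\<dots> \<le> norm (c *\<^sub>C f) * norm g"
    by (rule norm_cauchy_schwarz)
  also have "\<dots> \<le> norm f * norm g"
    using \<open>cmod c \<le> 1\<close> by (intro mult_right_mono) (auto simp: norm_scaleC intro: mult_left_le_one_le)
  finally show ?thesis .
qed

lemma bounded_bilinear_cinner:
  "bounded_bilinear (cinner :: 'a::euclidean_space l2 \<Rightarrow> 'a l2 \<Rightarrow> complex)"
proof
  show "\<exists>K. \<forall>a b. cmod (cinner a b) \<le> norm (a::'a l2) * norm b * K"
    by (rule exI[of _ 1]) (auto intro: cmod_cinner_le)
qed (auto simp: cinner_simps scaleC_of_real[symmetric] scaleR_conv_of_real)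

lemmas tendsto_cinner [tendsto_intros] = bounded_bilinear.tendsto[OF bounded_bilinear_cinner]
lemmas continuous_on_cinner [continuous_intros] =
  bounded_bilinear.continuous_on[OF bounded_bilinear_cinner]

lemma bounded_linear_scaleC: "bounded_linear (\<lambda>f. c *\<^sub>C f)"
proof (rule bounded_linear_intro[where K = "cmod c"])
  show "c *\<^sub>C (r *\<^sub>R x) = r *\<^sub>R (c *\<^sub>C x)" for r and x :: "'a l2"
    by (simp add: scaleC_of_real[symmetric] scaleC_scaleC mult.commute)
qed (auto simp: norm_scaleC scaleC_add_right)

lemmas tendsto_scaleC [tendsto_intros] = bounded_linear.tendsto[OF bounded_linear_scaleC]

lemma norm_abs_l2:
  assumes "square_integrable F"
  shows "(norm (abs_l2 F))\<^sup>2 = (\<integral>x. (cmod (F x))\<^sup>2 \<partial>lborel)"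
proof -
  have "cinner (abs_l2 F) (abs_l2 F) = (\<integral>x. complex_of_real ((cmod (F x))\<^sup>2) \<partial>lborel)"
    unfolding cinner_abs_l2[OF assms assms] by (simp only: complex_norm_square[symmetric])
  also have "\<dots> = complex_of_real (\<integral>x. (cmod (F x))\<^sup>2 \<partial>lborel)"
    by (rule integral_complex_of_real)
  finally show ?thesis using Re_cinner_self[of "abs_l2 F"] by simp
qed

lemma nn_norm_abs_l2:
  assumes "square_integrable F"
  shows "ennreal ((norm (abs_l2 F))\<^sup>2) = (\<integral>\<^sup>+x. ennreal ((cmod (F x))\<^sup>2) \<partial>lborel)"
  unfolding norm_abs_l2[OF assms]
  by (rule nn_integral_eq_integral[symmetric]) (use assms in \<open>auto simp: square_integrable_def\<close>)

section \<open>Completeness of the space of square-integrable functions\<close>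

lemma square_integrable_diff:
  assumes "square_integrable f" "square_integrable g"
  shows "square_integrable (\<lambda>x. f x - g x)"
  using square_integrable_add[OF assms(1) square_integrable_scale[OF assms(2), of "-1"]] by simp

lemma abs_l2_diff:
  assumes "square_integrable F" "square_integrable G"
  shows "abs_l2 F - abs_l2 G = abs_l2 (\<lambda>x. F x - G x)"
  using assms abs_l2_scale[OF assms(2), of "-1"]
  by (simp add: scaleC_minus_one abs_l2_add square_integrable_scale
      flip: add_uminus_conv_diff)
     (use abs_l2_add[OF assms(1) square_integrable_scale[OF assms(2), of "-1"]] in simp)

lemma square_integrableI_nn:
  assumes [measurable]: "F \<in> borel_measurable lborel"
    and "(\<integral>\<^sup>+x. ennreal ((cmod (F x))\<^sup>2) \<partial>lborel) < \<infinity>"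
  shows "square_integrable F"
  using assms unfolding square_integrable_def
  by (auto intro!: integrableI_bounded)

text \<open>With steps below \<open>4\<^sup>-\<^sup>k\<close>, the weighted sum \<open>\<Sum>2\<^sup>k |F\<^sub>k\<^sub>+\<^sub>1 - F\<^sub>k|\<^sup>2\<close> is finite almost everywhere,
  which makes a fast Cauchy sequence converge pointwise.\<close>

lemma l2_fast_cauchy_converges:
  fixes X :: "nat \<Rightarrow> 'a::euclidean_space l2"
  assumes fast: "\<And>k. norm (X (Suc k) - X k) \<le> (1/4) ^ k" and C: "Cauchy X"
  shows "convergent X"
proof -
  have "\<exists>F. square_integrable F \<and> X k = abs_l2 F" for k
    by (rule l2_cases[of "X k"]) auto
  then obtain F where F: "\<And>k. square_integrable (F k)" "\<And>k. X k = abs_l2 (F k)"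
    by metis
  have [measurable]: "F k \<in> borel_measurable lborel" for k
    using F(1) by (auto simp: square_integrable_def)
  define d where "d k x = (cmod (F (Suc k) x - F k x))\<^sup>2" for k x
  have [measurable]: "d k \<in> borel_measurable lborel" for k
    unfolding d_def by measurable
  have "(\<integral>\<^sup>+x. (\<Sum>k. ennreal (2^k * d k x)) \<partial>lborel) = (\<Sum>k. \<integral>\<^sup>+x. ennreal (2^k * d k x) \<partial>lborel)"
    by (rule nn_integral_suminf) measurable
  also have "\<dots> \<le> (\<Sum>k. ennreal ((1/8)^k))"
  proof (rule suminf_le)
    fix k
    have "(\<integral>\<^sup>+x. ennreal (2^k * d k x) \<partial>lborel) = ennreal (2^k) * (\<integral>\<^sup>+x. ennreal (d k x) \<partial>lborel)"
      by (subst nn_integral_cmult[symmetric]) (auto simp: ennreal_mult d_def)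
    also have "(\<integral>\<^sup>+x. ennreal (d k x) \<partial>lborel) = ennreal ((norm (X (Suc k) - X k))\<^sup>2)"
      unfolding F(2) abs_l2_diff[OF F(1) F(1)] d_def
      by (subst nn_norm_abs_l2) (auto intro!: square_integrable_diff F)
    also have "ennreal (2^k) * \<dots> \<le> ennreal (2^k * ((1/4)^k)\<^sup>2)"
      by (subst ennreal_mult) (auto intro!: mult_left_mono ennreal_leI power_mono fast)
    also have "2^k * ((1/4::real)^k)\<^sup>2 = (1/8)^k"
      by (simp add: power_mult_distrib[symmetric] power2_eq_square)
    finally show "(\<integral>\<^sup>+x. ennreal (2^k * d k x) \<partial>lborel) \<le> ennreal ((1/8)^k)" .
  qed auto
  also have "\<dots> < \<infinity>"
    by (subst suminf_ennreal_eq[OF _ sums_divide[of _ _ 1, simplified, OF geometric_sums]]) auto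
  finally have "AE x in lborel. (\<Sum>k. ennreal (2^k * d k x)) \<noteq> \<infinity>"
    by (intro nn_integral_PInf_AE) auto
  then have conv: "AE x in lborel. convergent (\<lambda>k. F k x)"
  proof eventually_elim
    case (elim x)
    then have sm: "summable (\<lambda>k. 2^k * d k x)"
      by (intro summable_suminf_not_top) (auto simp: d_def)
    have "eventually (\<lambda>k. 2^k * d k x < 1) sequentially"
      using summable_LIMSEQ_zero[OF sm] by (rule order_tendstoD) simp
    \<comment> \<open>Summands eventually below 1 mean that \<open>d k x\<close> is at most
      \<open>(1/2)^k\<close>, so the increments decay geometrically with ratio
      \<open>sqrt (1/2)\<close> and the telescoping series converges.\<close>
    then have "eventually (\<lambda>k. norm (F (Suc k) x - F k x) \<le> (sqrt (1/2))^k) sequentially"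
    proof eventually_elim
      case (elim k)
      then have "d k x \<le> (1/2)^k" by (simp add: field_simps power_divide)
      then have "cmod (F (Suc k) x - F k x) \<le> sqrt ((1/2)^k)"
        unfolding d_def using real_le_rsqrt by blast
      then show ?case by (simp add: real_sqrt_power)
    qed
    then have "summable (\<lambda>k. F (Suc k) x - F k x)"
      by (rule summable_comparison_test_ev) (auto intro!: summable_geometric)
    then show "convergent (\<lambda>k. F k x)"
      using convergent_add_const_iff[of "- F 0 x" "\<lambda>k. F k x"]
      unfolding summable_iff_convergent sum_lessThan_telescope[of "\<lambda>k. F k x"] by simp
  qed
  define G where "G x = lim (\<lambda>k. F k x)" for x
  have [measurable]: "G \<in> borel_measurable lborel"
    unfolding G_def by (rule borel_measurable_lim_metric) simp
  have lim: "AE x in lborel. (\<lambda>k. F k x) \<longlonglongrightarrow> G x"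
    using conv by eventually_elim (simp add: G_def convergent_LIMSEQ_iff)
  \<comment> \<open>Fatou's lemma in \<open>j\<close> transfers the Cauchy estimate for
    \<open>X j - X k\<close> to the pointwise limit. It is used twice: for the square integrability
    of \<open>G\<close> and for convergence in norm.\<close>
  have fatou: "(\<integral>\<^sup>+x. ennreal ((cmod (G x - F k x))\<^sup>2) \<partial>lborel) \<le> ennreal (e\<^sup>2)"
    if k: "\<And>j. j \<ge> k \<Longrightarrow> norm (X j - X k) \<le> e" for k e
  proof -
    have "(\<integral>\<^sup>+x. ennreal ((cmod (G x - F k x))\<^sup>2) \<partial>lborel)
        = (\<integral>\<^sup>+x. liminf (\<lambda>j. ennreal ((cmod (F j x - F k x))\<^sup>2)) \<partial>lborel)"
    proof (rule nn_integral_cong_AE)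
      show "AE x in lborel. ennreal ((cmod (G x - F k x))\<^sup>2)
          = liminf (\<lambda>j. ennreal ((cmod (F j x - F k x))\<^sup>2))"
        using lim
      proof eventually_elim
        case (elim x)
        then have "(\<lambda>j. ennreal ((cmod (F j x - F k x))\<^sup>2)) \<longlonglongrightarrow> ennreal ((cmod (G x - F k x))\<^sup>2)"
          by (intro tendsto_intros) auto
        then show ?case
          by (rule lim_imp_Liminf[OF sequentially_bot, symmetric])
      qed
    qed
    also have "\<dots> \<le> liminf (\<lambda>j. \<integral>\<^sup>+x. ennreal ((cmod (F j x - F k x))\<^sup>2) \<partial>lborel)"
      by (rule nn_integral_liminf) simp
    also have "\<dots> = liminf (\<lambda>j. ennreal ((norm (X j - X k))\<^sup>2))"
      unfolding F(2) abs_l2_diff[OF F(1) F(1)]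
      by (subst nn_norm_abs_l2) (auto intro!: square_integrable_diff F)
    also have "\<dots> \<le> ennreal (e\<^sup>2)"
      by (rule Liminf_le)
         (auto intro!: eventually_sequentiallyI[of k] ennreal_leI power_mono k)
    finally show ?thesis .
  qed
  obtain M where M: "\<And>j. j \<ge> M \<Longrightarrow> norm (X j - X M) \<le> 1"
    using CauchyD[OF C, of 1] by (meson less_imp_le order_refl zero_less_one)
  have "square_integrable (\<lambda>x. G x - F M x)"
    using fatou[OF M] by (intro square_integrableI_nn) (auto simp: le_less_trans)
  from square_integrable_add[OF this F(1)[of M]] have G: "square_integrable G" by simp
  have "X \<longlonglongrightarrow> abs_l2 G"
  proof (rule LIMSEQ_I)
    fix r :: real assume r: "r > 0"
    obtain M where M: "\<And>j k. j \<ge> M \<Longrightarrow> k \<ge> M \<Longrightarrow> norm (X j - X k) < r/2"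
      using CauchyD[OF C, of "r/2"] r by auto
    have "norm (X k - abs_l2 G) < r" if "k \<ge> M" for k
    proof -
      have "ennreal ((norm (abs_l2 G - X k))\<^sup>2) = (\<integral>\<^sup>+x. ennreal ((cmod (G x - F k x))\<^sup>2) \<partial>lborel)"
        unfolding F(2) abs_l2_diff[OF G F(1)]
        by (subst nn_norm_abs_l2) (auto intro!: square_integrable_diff F G)
      also have "\<dots> \<le> ennreal ((r/2)\<^sup>2)"
        by (rule fatou) (use M that in \<open>auto intro: less_imp_le\<close>)
      finally have "(norm (abs_l2 G - X k))\<^sup>2 \<le> (r/2)\<^sup>2"
        by (subst (asm) ennreal_le_iff) auto
      then have "norm (abs_l2 G - X k) \<le> r/2"
        by (rule power2_le_imp_le) (use r in simp)
      then show ?thesis using r by (simp add: norm_minus_commute)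
    qed
    then show "\<exists>no. \<forall>n\<ge>no. norm (X n - abs_l2 G) < r" by blast
  qed
  then show ?thesis by (rule convergentI)
qed

instance l2 :: (euclidean_space) banach
proof
  fix X :: "nat \<Rightarrow> 'a l2" assume C: "Cauchy X"
  have "\<exists>N. \<forall>m\<ge>N. \<forall>n\<ge>N. norm (X m - X n) < (1/4)^k" for k
    using CauchyD[OF C, of "(1/4)^k"] by simp
  then obtain N where N: "\<And>k m n. m \<ge> N k \<Longrightarrow> n \<ge> N k \<Longrightarrow> norm (X m - X n) < (1/4)^k"
    by metis
  \<comment> \<open>The partial sums dominate \<open>N k\<close>, and the summand \<open>k\<close>
    makes the sequence strictly increasing.\<close>
  define r where "r k = (\<Sum>i\<le>k. N i) + k" for k
  have rN: "N k \<le> r k" for k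
    unfolding r_def by (metis atMost_iff finite_atMost le_add1 member_le_sum order_refl
        order_trans zero_le)
  have sm: "strict_mono r"
    unfolding strict_mono_Suc_iff r_def by auto
  have mono: "r k \<le> r (Suc k)" for k
    using sm by (simp add: strict_mono_less_eq)
  have "norm ((X \<circ> r) (Suc k) - (X \<circ> r) k) \<le> (1/4)^k" for k
    unfolding o_def by (rule less_imp_le[OF N[OF order_trans[OF rN mono] rN]])
  then have "convergent (X \<circ> r)"
    by (intro l2_fast_cauchy_converges Cauchy_subseq_Cauchy C sm)
  then show "convergent X"
    unfolding convergent_def by (metis Cauchy_converges_subseq[OF C sm] o_def)
qed

subsection \<open>Closed forms and orthogonal projections\<close>

text \<open>The first-order condition at a minimum: near \<open>t = 0\<close> a nonzero linear term
  would win against the quadratic one.\<close>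

lemma linear_part_zero:
  fixes a b :: real
  assumes "\<And>t. 0 \<le> 2 * t * a + t\<^sup>2 * b"
  shows "a = 0"
proof (rule ccontr)
  assume a: "a \<noteq> 0"
  \<comment> \<open>Positive and larger than \<open>b\<close>, so that at
    \<open>t = - a / \<beta>\<close> the linear term outweighs the quadratic one.\<close>
  define \<beta> where "\<beta> = \<bar>b\<bar> + 1"
  have \<beta>: "\<beta> > 0" "b < \<beta>" by (auto simp: \<beta>_def)
  have "0 \<le> 2 * (- a / \<beta>) * a + (- a / \<beta>)\<^sup>2 * b"
    by (rule assms)
  also have "\<dots> = (a\<^sup>2 / \<beta>) * (b / \<beta> - 2)"
    using \<beta> by (simp add: field_simps power2_eq_square)
  also have "\<dots> < 0"
  proof (rule mult_pos_neg)
    show "0 < a\<^sup>2 / \<beta>" using a \<beta> by simp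
    show "b / \<beta> - 2 < 0" using \<beta> by (simp add: divide_less_eq)
  qed
  finally show False by simp
qed

text \<open>The algebra behind every Cauchy-Schwarz inequality for a semidefinite form below. For
  \<open>c > 0\<close> the polynomial is evaluated at its minimizer \<open>- b / c\<close>;
  \<open>c = 0\<close> forces \<open>b = 0\<close>, and \<open>c < 0\<close> is impossible.\<close>

lemma discriminant_le:
  fixes a b c :: real
  assumes "\<And>t. 0 \<le> a + 2 * t * b + t\<^sup>2 * c"
  shows "b\<^sup>2 \<le> a * c"
proof -
  have a: "0 \<le> a" using assms[of 0] by simp
  show ?thesis
  proof (cases "c = 0")
    case True
    then have *: "0 \<le> a + 2 * t * b" for t using assms[of t] by simp
    have "b = 0"
    proof (rule ccontr)
      assume "b \<noteq> 0"
      then have "2 * (- (a + 1) / (2 * b)) * b = - (a + 1)" by (simp add: field_simps)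
      then show False using *[of "- (a + 1) / (2 * b)"] by linarith
    qed
    then show ?thesis using True by simp
  next
    case False
    have "0 \<le> c"
    proof (rule ccontr)
      assume "\<not> 0 \<le> c"
      define X where "X = a + 2 * \<bar>b\<bar> + 1"
      \<comment> \<open>Chosen so that
        \<open>\<beta> * c \<le> - (a + 2 * \<bar>b\<bar> + 1)\<close>, which makes the polynomial
        negative at \<open>\<beta>\<close>.\<close>
      define \<beta> where "\<beta> = X / (- c) + 1"
      have X: "0 \<le> X" using a by (simp add: X_def)
      have "0 \<le> X / (- c)" using X \<open>\<not> 0 \<le> c\<close> by (intro divide_nonneg_nonneg) auto
      then have b1: "\<beta> \<ge> 1" by (simp add: \<beta>_def)
      have "\<beta> * c = - X + c"
        using \<open>\<not> 0 \<le> c\<close> by (simp add: \<beta>_def field_simps)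
      then have "\<beta> * c \<le> - (a + 2 * \<bar>b\<bar> + 1)"
        using \<open>\<not> 0 \<le> c\<close> by (simp add: X_def)
      then have "\<beta> * (\<beta> * c) \<le> \<beta> * (- (a + 2 * \<bar>b\<bar> + 1))"
        using b1 by (intro mult_left_mono) auto
      then have "\<beta> * (\<beta> * c) \<le> - (\<beta> * a) - 2 * (\<beta> * \<bar>b\<bar>) - \<beta>"
        by (simp add: algebra_simps)
      moreover have "\<beta> * b \<le> \<beta> * \<bar>b\<bar>"
        using b1 by (intro mult_left_mono) auto
      moreover have "a \<le> \<beta> * a" using b1 a by (simp add: mult_le_cancel_right1)
      moreover have "0 \<le> a + 2 * (\<beta> * b) + \<beta> * (\<beta> * c)"
        using assms[of \<beta>] by (simp add: power2_eq_square mult.assoc)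
      ultimately show False using b1 by linarith
    qed
    have "0 \<le> a + 2 * (- b / c) * b + (- b / c)\<^sup>2 * c" by (rule assms)
    then show ?thesis
      using False \<open>0 \<le> c\<close> by (simp add: field_simps power2_eq_square)
  qed
qed

lemma half_parallelogram:
  "2 * (norm ((1/2) *\<^sub>R (a + b)))\<^sup>2 + (norm (a - b))\<^sup>2 / 2
    = (norm a)\<^sup>2 + (norm (b :: 'a::euclidean_space l2))\<^sup>2"
  unfolding norm_scaleR power_mult_distrib norm_add_sq norm_diff_sq by (simp add: field_simps)

definition csubspace :: "'a::euclidean_space l2 set \<Rightarrow> bool" where
  "csubspace K \<longleftrightarrow> 0 \<in> K \<and> (\<forall>f\<in>K. \<forall>g\<in>K. f + g \<in> K) \<and> (\<forall>c. \<forall>f\<in>K. c *\<^sub>C f \<in> K)"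

lemma csubspace_zero: "csubspace K \<Longrightarrow> 0 \<in> K"
  and csubspace_add: "csubspace K \<Longrightarrow> f \<in> K \<Longrightarrow> g \<in> K \<Longrightarrow> f + g \<in> K"
  and csubspace_scaleC: "csubspace K \<Longrightarrow> f \<in> K \<Longrightarrow> c *\<^sub>C f \<in> K"
  by (auto simp: csubspace_def)

lemma csubspace_minus: "csubspace K \<Longrightarrow> f \<in> K \<Longrightarrow> - f \<in> K"
  using csubspace_scaleC[of K f "-1"] by (simp add: scaleC_minus_one)

lemma csubspace_diff: "csubspace K \<Longrightarrow> f \<in> K \<Longrightarrow> g \<in> K \<Longrightarrow> f - g \<in> K"
  using csubspace_add[of K f "- g"] by (simp add: csubspace_minus)

lemma csubspace_sum: "csubspace K \<Longrightarrow> (\<And>i. i \<in> S \<Longrightarrow> F i \<in> K) \<Longrightarrow> sum F S \<in> K"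
  by (induction S rule: infinite_finite_induct) (auto simp: csubspace_zero csubspace_add)

lemma csubspace_closure:
  assumes "csubspace K" shows "csubspace (closure K)"
  unfolding csubspace_def
proof (intro conjI ballI allI)
  show "0 \<in> closure K" using assms closure_subset by (auto simp: csubspace_def)
next
  fix f g assume "f \<in> closure K" "g \<in> closure K"
  then obtain F G where "\<And>n. F n \<in> K" "F \<longlonglongrightarrow> f" "\<And>n. G n \<in> K" "G \<longlonglongrightarrow> g"
    by (metis closure_sequential)
  then show "f + g \<in> closure K"
    unfolding closure_sequential
    by (intro exI[of _ "\<lambda>n. F n + G n"]) (auto intro: tendsto_add csubspace_add[OF assms])
next
  fix c f assume "f \<in> closure K"
  then obtain F where "\<And>n. F n \<in> K" "F \<longlonglongrightarrow> f"
    by (metis closure_sequential)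
  then show "c *\<^sub>C f \<in> closure K"
    unfolding closure_sequential
    by (intro exI[of _ "\<lambda>n. c *\<^sub>C F n"]) (auto intro: tendsto_scaleC csubspace_scaleC[OF assms])
qed

text \<open>Closedness is encoded as lower semicontinuity along norm-convergent sequences of bounded
  energy. This is what Fatou's lemma supplies for integral forms and what the direct method of the
  calculus of variations consumes.\<close>

locale closed_form =
  fixes D :: "'a::euclidean_space l2 set" and q :: "'a l2 \<Rightarrow> 'a l2 \<Rightarrow> complex"
  assumes csubspace_D: "csubspace D"
    and q_add_left: "f \<in> D \<Longrightarrow> g \<in> D \<Longrightarrow> k \<in> D \<Longrightarrow> q (f + g) k = q f k + q g k"
    and q_scaleC_left: "f \<in> D \<Longrightarrow> k \<in> D \<Longrightarrow> q (c *\<^sub>C f) k = c * q f k"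
    and q_commute: "f \<in> D \<Longrightarrow> g \<in> D \<Longrightarrow> q f g = cnj (q g f)"
    and q_nonneg: "f \<in> D \<Longrightarrow> 0 \<le> Re (q f f)"
    and q_lsc: "(\<And>n. F n \<in> D) \<Longrightarrow> (\<And>n. Re (q (F n) (F n)) \<le> r) \<Longrightarrow> F \<longlonglongrightarrow> f
        \<Longrightarrow> f \<in> D \<and> Re (q f f) \<le> r"
begin

lemmas add_D = csubspace_add[OF csubspace_D]
lemmas scaleC_D = csubspace_scaleC[OF csubspace_D]
lemmas diff_D = csubspace_diff[OF csubspace_D]

lemma q_add_right: "f \<in> D \<Longrightarrow> g \<in> D \<Longrightarrow> k \<in> D \<Longrightarrow> q k (f + g) = q k f + q k g"
  by (metis add_D complex_cnj_add q_add_left q_commute)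

lemma q_scaleC_right: "f \<in> D \<Longrightarrow> k \<in> D \<Longrightarrow> q k (c *\<^sub>C f) = cnj c * q k f"
  by (metis scaleC_D complex_cnj_mult q_scaleC_left q_commute)

lemma q_form_add:
  assumes "f \<in> D" "g \<in> D"
  shows "Re (q (f + g) (f + g)) = Re (q f f) + 2 * Re (q f g) + Re (q g g)"
  using q_commute[OF assms(2,1)] assms
  by (simp add: q_add_left q_add_right add_D)

lemma q_form_scaleC:
  assumes "f \<in> D"
  shows "Re (q (c *\<^sub>C f) (c *\<^sub>C f)) = (cmod c)\<^sup>2 * Re (q f f)"
proof -
  have "q (c *\<^sub>C f) (c *\<^sub>C f) = c * q f (c *\<^sub>C f)"
    by (rule q_scaleC_left) (auto simp: assms scaleC_D)
  also have "\<dots> = (c * cnj c) * q f f"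
    using assms by (simp add: q_scaleC_right mult.assoc)
  also have "\<dots> = complex_of_real ((cmod c)\<^sup>2) * q f f"
    by (simp only: complex_norm_square)
  finally show ?thesis by simp
qed

lemma q_form_diff:
  assumes "f \<in> D" "g \<in> D"
  shows "Re (q (f - g) (f - g)) = Re (q f f) - 2 * Re (q f g) + Re (q g g)"
proof -
  have eq: "f - g = f + (-1) *\<^sub>C g" by (simp add: scaleC_minus_one)
  show ?thesis
    unfolding eq q_form_add[OF assms(1) scaleC_D[OF assms(2)]] q_form_scaleC[OF assms(2)]
      q_scaleC_right[OF assms(2,1)] by simp
qed

lemma minimizer_exists:
  "\<exists>g\<in>D. \<forall>k\<in>D. Re (q g g) + (norm (g - u))\<^sup>2 \<le> Re (q k k) + (norm (k - u))\<^sup>2"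
proof -
  define N where "N k = Re (q k k) + (norm (k - u))\<^sup>2" for k
  define d where "d = Inf (N ` D)"
  have bdd: "bdd_below (N ` D)"
    by (rule bdd_belowI[of _ 0]) (auto simp: N_def q_nonneg)
  have ne: "N ` D \<noteq> {}" using csubspace_zero[OF csubspace_D] by auto
  have dN: "d \<le> N k" if "k \<in> D" for k
    unfolding d_def using bdd that by (intro cInf_lower) auto
  have "\<exists>g\<in>D. N g < d + 1 / real (Suc n)" for n
    using cInf_lessD[OF ne, of "d + 1 / real (Suc n)"] by (auto simp: d_def)
  then obtain G where G: "\<And>n. G n \<in> D" "\<And>n. N (G n) < d + 1 / real (Suc n)"
    by metis
  have arith: "x \<le> 2 * ((a + c) + (b + e) - 2 * d)"
    if "2 * m \<le> a + b" "2 * n + x / 2 = c + e" "d \<le> m + n" for x a b c d e m n :: real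
    using that by argo
  have par: "(norm (g - g'))\<^sup>2 \<le> 2 * (N g + N g' - 2 * d)" if g: "g \<in> D" "g' \<in> D" for g g'
  proof -
    \<comment> \<open>The midpoint competes in the minimization. Convexity of \<open>q\<close> and
      the parallelogram law then bound \<open>g - g'\<close> by the amounts by which
      \<open>g\<close> and \<open>g'\<close> exceed the infimum.\<close>
    define m where "m = (1/2) *\<^sub>C (g + g')"
    have mD: "m \<in> D" using g by (simp add: m_def add_D scaleC_D)
    have "0 \<le> Re (q ((1/2) *\<^sub>C (g - g')) ((1/2) *\<^sub>C (g - g')))"
      using g by (intro q_nonneg scaleC_D diff_D)
    then have 1: "2 * Re (q m m) \<le> Re (q g g) + Re (q g' g')"
      using g by (simp add: m_def q_form_scaleC add_D diff_D q_form_add q_form_diff power_divide)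
    have "(g - u) + (g' - u) = (g + g') - (u + u)" by simp
    then have mu: "m - u = (1/2) *\<^sub>R ((g - u) + (g' - u))"
      using scaleC_of_real[of "1/2" "g + g'"]
      by (simp only: m_def scaleR_diff_right scaleR_half_double) simp
    have gg: "g - g' = (g - u) - (g' - u)" by simp
    have 2: "2 * (norm (m - u))\<^sup>2 + (norm (g - g'))\<^sup>2 / 2 = (norm (g - u))\<^sup>2 + (norm (g' - u))\<^sup>2"
      unfolding mu gg by (rule half_parallelogram)
    show ?thesis
      by (rule arith[OF 1 2 dN[OF mD, unfolded N_def], folded N_def])
  qed
  have "Cauchy G"
  proof (rule CauchyI)
    fix e :: real assume e: "e > 0"
    obtain M :: nat where M: "4 / e\<^sup>2 < real M" using reals_Archimedean2 by blast
    have small: "1 / real (Suc n) < e\<^sup>2 / 4" if "n \<ge> M" for n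
    proof -
      have "4 / e\<^sup>2 < real (Suc n)" using M that by linarith
      then show ?thesis using e by (simp add: field_simps)
    qed
    have "norm (G m - G n) < e" if "m \<ge> M" "n \<ge> M" for m n
    proof -
      have "(norm (G m - G n))\<^sup>2 < e\<^sup>2"
        using par[OF G(1)[of m] G(1)[of n]] G(2)[of m] G(2)[of n] small[OF that(1)] small[OF that(2)]
        by argo
      then show ?thesis using e by (simp add: power2_less_imp_less)
    qed
    then show "\<exists>M. \<forall>m\<ge>M. \<forall>n\<ge>M. norm (G m - G n) < e" by blast
  qed
  then obtain g where g: "G \<longlonglongrightarrow> g"
    by (auto simp: Cauchy_convergent_iff convergent_def)
  have lim: "(\<lambda>n. (norm (G n - u))\<^sup>2) \<longlonglongrightarrow> (norm (g - u))\<^sup>2"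
    by (intro tendsto_intros g)
  \<comment> \<open>Lower semicontinuity is stated with a constant bound, so an initial segment is
    dropped to obtain such a bound up to \<open>e\<close>.\<close>
  have step: "g \<in> D \<and> Re (q g g) \<le> d - (norm (g - u))\<^sup>2 + e" if e: "e > 0" for e
  proof -
    have "\<forall>\<^sub>F n in sequentially. (norm (G n - u))\<^sup>2 > (norm (g - u))\<^sup>2 - e/2"
      using order_tendstoD(1)[OF lim] e by simp
    moreover have "\<forall>\<^sub>F n in sequentially. inverse (real (Suc n)) < e/2"
      by (rule order_tendstoD(2)[OF LIMSEQ_inverse_real_of_nat]) (use e in simp)
    ultimately have "\<forall>\<^sub>F n in sequentially. Re (q (G n) (G n)) \<le> d - (norm (g - u))\<^sup>2 + e"
    proof eventually_elim
      case (elim n)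
      then show ?case using G(2)[of n] unfolding N_def inverse_eq_divide by linarith
    qed
    then obtain M where M: "\<And>n. n \<ge> M \<Longrightarrow> Re (q (G n) (G n)) \<le> d - (norm (g - u))\<^sup>2 + e"
      by (auto simp: eventually_sequentially)
    show ?thesis
      by (rule q_lsc[of "\<lambda>n. G (n + M)"]) (use G M LIMSEQ_ignore_initial_segment[OF g] in auto)
  qed
  have "Re (q g g) \<le> d - (norm (g - u))\<^sup>2"
    by (rule field_le_epsilon) (use step in auto)
  moreover have "g \<in> D" using step[of 1] by simp
  ultimately show ?thesis using dN unfolding N_def by (intro bexI[of _ g]) force+
qed

text \<open>The Euler-Lagrange equation of the minimizer, that is, the weak form of
  \<open>(A + 1) g = u\<close>. Real perturbations give the real part; testing with
  \<open>\<i>\<close> times \<open>k\<close> gives the imaginary part.\<close>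

lemma variational_solution:
  "\<exists>g\<in>D. \<forall>k\<in>D. q g k + cinner g k = cinner u k"
proof -
  obtain g where g: "g \<in> D" and
    min: "\<And>k. k \<in> D \<Longrightarrow> Re (q g g) + (norm (g - u))\<^sup>2 \<le> Re (q k k) + (norm (k - u))\<^sup>2"
    using minimizer_exists by blast
  have re: "Re (q g k + cinner g k - cinner u k) = 0" if k: "k \<in> D" for k
  proof (rule linear_part_zero)
    fix t :: real
    have tk: "t *\<^sub>R k = complex_of_real t *\<^sub>C k" by (simp add: scaleC_of_real)
    have eq: "g + t *\<^sub>R k - u = (g - u) + complex_of_real t *\<^sub>C k" by (simp add: tk)
    have "(norm (g + t *\<^sub>R k - u))\<^sup>2
        = (norm (g - u))\<^sup>2 + 2 * t * Re (cinner (g - u) k) + t\<^sup>2 * (norm k)\<^sup>2"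
      unfolding eq norm_add_sq[of "g - u"] cinner_scaleC_right norm_scaleC
      by (simp add: power_mult_distrib)
    moreover have "Re (q (g + t *\<^sub>R k) (g + t *\<^sub>R k))
        = Re (q g g) + 2 * t * Re (q g k) + t\<^sup>2 * Re (q k k)"
      unfolding tk q_form_add[OF g scaleC_D[OF k]] q_form_scaleC[OF k] q_scaleC_right[OF k g] by simp
    moreover have "g + t *\<^sub>R k \<in> D" using g k unfolding tk by (simp add: add_D scaleC_D)
    ultimately show "0 \<le> 2 * t * Re (q g k + cinner g k - cinner u k)
        + t\<^sup>2 * (Re (q k k) + (norm k)\<^sup>2)"
      using min[of "g + t *\<^sub>R k"] by (simp add: cinner_simps algebra_simps)
  qed
  have "q g k + cinner g k - cinner u k = 0" if k: "k \<in> D" for k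
  proof -
    have "Re (q g (\<i> *\<^sub>C k) + cinner g (\<i> *\<^sub>C k) - cinner u (\<i> *\<^sub>C k)) = 0"
      by (rule re) (use k in \<open>simp add: scaleC_D\<close>)
    then have "Im (q g k + cinner g k - cinner u k) = 0"
      using g k by (simp add: q_scaleC_right cinner_simps)
    with re[OF k] show ?thesis by (simp add: complex_eq_iff)
  qed
  then show ?thesis using g by auto
qed

end

text \<open>The zero form on \<open>K\<close> is closed because \<open>K\<close> is, and its
  variational equation is exactly orthogonality of the residual.\<close>

lemma projection_exists:
  assumes K: "csubspace K" "closed K"
  shows "\<exists>p\<in>K. \<forall>k\<in>K. cinner (f - p) k = 0"
proof -
  interpret closed_form K "\<lambda>_ _. 0"
  proof unfold_locales
    show "f \<in> K \<and> Re 0 \<le> r"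
      if "\<And>n. F n \<in> K" "\<And>n::nat. Re 0 \<le> r" "F \<longlonglongrightarrow> f" for F r f
      using closed_sequentially[OF K(2), of F f] that by simp
  qed (simp_all add: K)
  have "\<exists>p\<in>K. \<forall>k\<in>K. 0 + cinner p k = cinner f k"
    by (rule variational_solution)
  then obtain p where "p \<in> K" "\<forall>k\<in>K. 0 + cinner p k = cinner f k"
    by blast
  then show ?thesis by (intro bexI[of _ p] ballI) (simp_all add: cinner_diff_left)
qed

definition proj :: "'a::euclidean_space l2 set \<Rightarrow> 'a l2 \<Rightarrow> 'a l2" where
  "proj K f = (SOME p. p \<in> K \<and> (\<forall>k\<in>K. cinner (f - p) k = 0))"

lemma csubspace_eq_UNIV:
  assumes "csubspace K" "closed K" "\<And>f. (\<And>k. k \<in> K \<Longrightarrow> cinner f k = 0) \<Longrightarrow> f = 0"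
  shows "K = UNIV"
proof -
  have "f \<in> K" for f
  proof -
    obtain p where p: "p \<in> K" "\<And>k. k \<in> K \<Longrightarrow> cinner (f - p) k = 0"
      using projection_exists[OF assms(1,2), of f] by blast
    then have "f - p = 0" using assms(3) by blast
    then show ?thesis using p by simp
  qed
  then show ?thesis by blast
qed

lemma csubspace_dense:
  assumes "csubspace K" "\<And>f. (\<And>k. k \<in> K \<Longrightarrow> cinner f k = 0) \<Longrightarrow> f = 0"
  shows "closure K = UNIV"
  by (rule csubspace_eq_UNIV) (use assms closure_subset csubspace_closure in blast)+

lemma dense_orthogonal_zero:
  assumes "closure K = UNIV" "\<And>k. k \<in> K \<Longrightarrow> cinner v k = 0"
  shows "v = 0"
proof -
  have "v \<in> closure K" using assms by simp
  then obtain G where G: "\<And>n. G n \<in> K" "G \<longlonglongrightarrow> v" by (metis closure_sequential)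
  have "(\<lambda>n. cinner v (G n)) \<longlonglongrightarrow> cinner v v" by (intro tendsto_intros G)
  then have "cinner v v = 0"
    using assms(2)[OF G(1)] by (simp add: LIMSEQ_const_iff)
  then show ?thesis by (simp add: cinner_self)
qed

context
  fixes K :: "'a::euclidean_space l2 set"
  assumes K: "csubspace K" "closed K"
begin

lemma proj_mem: "proj K f \<in> K"
  and proj_orth: "k \<in> K \<Longrightarrow> cinner (f - proj K f) k = 0"
proof -
  have "\<exists>p. p \<in> K \<and> (\<forall>k\<in>K. cinner (f - p) k = 0)" using projection_exists[OF K, of f] by blast
  from someI_ex[OF this] show "proj K f \<in> K" "k \<in> K \<Longrightarrow> cinner (f - proj K f) k = 0"
    unfolding proj_def by blast+
qed

lemma proj_unique:
  assumes "p \<in> K" "\<And>k. k \<in> K \<Longrightarrow> cinner (f - p) k = 0"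
  shows "proj K f = p"
proof -
  have "proj K f - p \<in> K" using assms(1) proj_mem csubspace_diff[OF K(1)] by blast
  then have "cinner (proj K f - p) (proj K f - p) = 0"
    using assms(2)[of "proj K f - p"] proj_orth[of "proj K f - p" f] by (simp add: cinner_diff_left)
  then show ?thesis by (simp add: cinner_self)
qed

lemma cinner_proj_left: "k \<in> K \<Longrightarrow> cinner (proj K f) k = cinner f k"
  using proj_orth[of k f] by (simp add: cinner_diff_left)

lemma proj_add: "proj K (f + g) = proj K f + proj K g"
  by (rule proj_unique)
     (simp_all add: csubspace_add[OF K(1)] proj_mem cinner_proj_left cinner_simps)

lemma proj_scaleC: "proj K (c *\<^sub>C f) = c *\<^sub>C proj K f"
  by (rule proj_unique)
     (simp_all add: csubspace_scaleC[OF K(1)] proj_mem cinner_proj_left cinner_simps)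

lemma proj_fix: "k \<in> K \<Longrightarrow> proj K k = k"
  by (rule proj_unique) simp_all

lemma proj_eq_zero: "(\<And>k. k \<in> K \<Longrightarrow> cinner f k = 0) \<Longrightarrow> proj K f = 0"
  by (rule proj_unique) (simp_all add: csubspace_zero[OF K(1)])

lemma cinner_proj_right: "k \<in> K \<Longrightarrow> cinner k (proj K f) = cinner k f"
  by (metis cinner_commute cinner_proj_left)

lemma cinner_proj: "cinner (proj K f) g = cinner f (proj K g)"
  by (metis cinner_proj_left cinner_proj_right proj_mem)

lemma proj_norm_sq: "(norm f)\<^sup>2 = (norm (proj K f))\<^sup>2 + (norm (f - proj K f))\<^sup>2"
  using norm_add_sq[of "f - proj K f" "proj K f"] proj_orth[OF proj_mem] by simp

lemma norm_proj_le: "norm (proj K f) \<le> norm f"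
  by (rule power2_le_imp_le) (use proj_norm_sq[of f] in auto)

lemma bounded_linear_proj: "bounded_linear (proj K)"
  by (rule bounded_linear_intro[where K = 1])
     (auto simp: proj_add norm_proj_le proj_scaleC simp flip: scaleC_of_real)

end

subsection \<open>Finite-dimensional subspaces\<close>

definition cspan :: "'a::euclidean_space l2 set \<Rightarrow> 'a l2 set" where
  "cspan B = {\<Sum>b\<in>B. c b *\<^sub>C b | c. True}"

lemma finite_dimensional_iff: "finite_dimensional V \<longleftrightarrow> (\<exists>B. finite B \<and> V \<subseteq> cspan B)"
  unfolding finite_dimensional_def cspan_def by blast

lemma csubspace_cspan: "csubspace (cspan B)"
  unfolding csubspace_def
proof (intro conjI ballI allI)
  show "0 \<in> cspan B" unfolding cspan_def by (auto intro!: exI[of _ "\<lambda>_. 0"])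
  show "f + g \<in> cspan B" if "f \<in> cspan B" "g \<in> cspan B" for f g
    using that unfolding cspan_def
    by (auto simp: sum.distrib[symmetric] scaleC_add_left[symmetric])
  show "c *\<^sub>C f \<in> cspan B" if "f \<in> cspan B" for c f
    using that unfolding cspan_def by (auto simp: scaleC_sum_right scaleC_scaleC)
qed

lemma cspan_base: "finite B \<Longrightarrow> b \<in> B \<Longrightarrow> b \<in> cspan B"
  unfolding cspan_def
  by (auto intro!: exI[of _ "\<lambda>b'. if b' = b then 1 else 0"] simp: if_distrib[of "\<lambda>c. c *\<^sub>C _"] cong: if_cong)

lemma cspan_minimal: "csubspace V \<Longrightarrow> B \<subseteq> V \<Longrightarrow> cspan B \<subseteq> V"
  unfolding cspan_def by (auto intro!: csubspace_sum csubspace_scaleC)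

lemma cspan_mono: "finite B' \<Longrightarrow> B \<subseteq> B' \<Longrightarrow> cspan B \<subseteq> cspan B'"
  by (rule cspan_minimal[OF csubspace_cspan]) (use cspan_base in blast)

text \<open>Finitely many functionals that separate the points of \<open>E\<close> embed it into a
  finite-dimensional space. The induction removes one functional at a time: its kernel has
  codimension at most one in \<open>E\<close>.\<close>

lemma finite_dimensional_if_separated:
  assumes "finite B" "csubspace E" "\<And>f. f \<in> E \<Longrightarrow> (\<And>b. b \<in> B \<Longrightarrow> cinner f b = 0) \<Longrightarrow> f = 0"
  shows "finite_dimensional E"
  using assms
proof (induction B arbitrary: E rule: finite_induct)
  case empty
  then have "E \<subseteq> cspan {}" by (auto simp: cspan_def)
  then show ?case unfolding finite_dimensional_iff by blast
next
  case (insert b B)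
  define E' where "E' = {f \<in> E. cinner f b = 0}"
  have E': "csubspace E'"
    using insert.prems(1) unfolding csubspace_def E'_def by (auto simp: cinner_simps)
  have "finite_dimensional E'"
    by (rule insert.IH[OF E']) (use insert.prems(2) in \<open>auto simp: E'_def\<close>)
  then obtain C where C: "finite C" "E' \<subseteq> cspan C" unfolding finite_dimensional_iff by blast
  show ?case
  proof (cases "E' = E")
    case True
    then show ?thesis using C unfolding finite_dimensional_iff by blast
  next
    case False
    then obtain k where k: "k \<in> E" "cinner k b \<noteq> 0" unfolding E'_def by blast
    have "f \<in> cspan (insert k C)" if f: "f \<in> E" for f
    proof -
      define c where "c = cinner f b / cinner k b"
      have "f - c *\<^sub>C k \<in> E'"
        using f k insert.prems(1)
        by (auto simp: E'_def cinner_simps c_def csubspace_diff csubspace_scaleC)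
      then have "f - c *\<^sub>C k \<in> cspan (insert k C)"
        using C cspan_mono[of "insert k C" C] by blast
      moreover have "c *\<^sub>C k \<in> cspan (insert k C)"
        using C by (intro csubspace_scaleC[OF csubspace_cspan] cspan_base) auto
      ultimately show ?thesis
        using csubspace_add[OF csubspace_cspan] by fastforce
    qed
    then show ?thesis unfolding finite_dimensional_iff using C(1) by blast
  qed
qed

definition orthonormal :: "'a::euclidean_space l2 set \<Rightarrow> bool" where
  "orthonormal B \<longleftrightarrow> (\<forall>b\<in>B. \<forall>b'\<in>B. cinner b b' = (if b = b' then 1 else 0))"

lemma orthonormal_expansion:
  assumes "finite B" "orthonormal B" "f \<in> cspan B"
  shows "f = (\<Sum>b\<in>B. cinner f b *\<^sub>C b)"
proof -
  obtain c where c: "f = (\<Sum>b\<in>B. c b *\<^sub>C b)" using assms(3) unfolding cspan_def by blast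
  have "cinner f b = c b" if "b \<in> B" for b
  proof -
    have "cinner f b = (\<Sum>b'\<in>B. c b' * (if b = b' then 1 else 0))"
      unfolding c cinner_sum_left using assms(2) that
      by (intro sum.cong refl) (auto simp: cinner_simps orthonormal_def)
    then show ?thesis using assms(1) that by (simp add: if_distrib cong: if_cong)
  qed
  then show ?thesis by (subst c) (auto intro!: sum.cong)
qed

text \<open>Gram-Schmidt; a vector whose residual \<open>r\<close> vanishes contributes no new basis
  element.\<close>

lemma orthonormal_basis_exists:
  assumes "finite B"
  shows "\<exists>C. finite C \<and> orthonormal C \<and> cspan B \<subseteq> cspan C"
  using assms
proof (induction B rule: finite_induct)
  case empty
  show ?case by (rule exI[of _ "{}"]) (auto simp: orthonormal_def)
next
  case (insert b B)
  then obtain C where C: "finite C" "orthonormal C" "cspan B \<subseteq> cspan C" by blast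
  define r where "r = b - (\<Sum>c\<in>C. cinner b c *\<^sub>C c)"
  have r: "cinner r c = 0" if "c \<in> C" for c
  proof -
    have "cinner (\<Sum>c\<in>C. cinner b c *\<^sub>C c) c = (\<Sum>c'\<in>C. cinner b c' * (if c = c' then 1 else 0))"
      unfolding cinner_sum_left using C(2) that
      by (intro sum.cong refl) (auto simp: cinner_simps orthonormal_def)
    then show ?thesis using C(1) that by (simp add: r_def cinner_simps if_distrib cong: if_cong)
  qed
  define C' where "C' = (if r = 0 then C else insert ((1 / complex_of_real (norm r)) *\<^sub>C r) C)"
  have fin: "finite C'" using C by (simp add: C'_def)
  have sub: "cspan C \<subseteq> cspan C'" by (rule cspan_mono[OF fin]) (auto simp: C'_def)
  have orth: "orthonormal C'"
  proof (cases "r = 0")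
    case True
    then show ?thesis using C by (simp add: C'_def)
  next
    case False
    define e where "e = (1 / complex_of_real (norm r)) *\<^sub>C r"
    have "cinner e e = 1" using False by (simp add: e_def cinner_scaleC_left cinner_scaleC_right cinner_self[of r] power2_eq_square)
    moreover have "cinner e c = 0" "cinner c e = 0" if "c \<in> C" for c
      using r[OF that] cinner_commute[of c r] by (simp_all add: e_def cinner_simps)
    ultimately show ?thesis
      using C(2) False unfolding C'_def orthonormal_def e_def[symmetric] by auto
  qed
  have "r \<in> cspan C'"
  proof (cases "r = 0")
    case True
    then show ?thesis by (simp add: csubspace_zero[OF csubspace_cspan])
  next
    case False
    have "complex_of_real (norm r) *\<^sub>C ((1 / complex_of_real (norm r)) *\<^sub>C r) \<in> cspan C'"
      by (intro csubspace_scaleC[OF csubspace_cspan] cspan_base[OF fin])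
         (use False in \<open>auto simp: C'_def\<close>)
    then show ?thesis using False by (simp add: scaleC_scaleC)
  qed
  moreover have "(\<Sum>c\<in>C. cinner b c *\<^sub>C c) \<in> cspan C" unfolding cspan_def by blast
  ultimately have "b \<in> cspan C'"
    using csubspace_add[OF csubspace_cspan, of r C' "\<Sum>c\<in>C. cinner b c *\<^sub>C c"] sub
    by (auto simp: r_def)
  moreover have "B \<subseteq> cspan C'" using C(3) sub cspan_base[OF insert.hyps(1)] by blast
  ultimately have "cspan (insert b B) \<subseteq> cspan C'"
    by (intro cspan_minimal[OF csubspace_cspan]) auto
  then show ?case using fin orth by blast
qed

subsection \<open>Resolvent sets and essential spectra of self-adjoint operators\<close>

lemma self_adjoint_linear:
  assumes "self_adjoint A"
  shows op_zero: "(0, 0) \<in> A"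
    and op_add: "(f, u) \<in> A \<Longrightarrow> (g, v) \<in> A \<Longrightarrow> (f + g, u + v) \<in> A"
    and op_scaleC: "(f, u) \<in> A \<Longrightarrow> (c *\<^sub>C f, c *\<^sub>C u) \<in> A"
    and op_single: "(f, u) \<in> A \<Longrightarrow> (f, v) \<in> A \<Longrightarrow> u = v"
proof -
  have *: "linear_operator A" using assms by (simp add: self_adjoint_def)
  show "(0, 0) \<in> A" using * by (simp add: linear_operator_def)
  show "(f, u) \<in> A \<Longrightarrow> (g, v) \<in> A \<Longrightarrow> (f + g, u + v) \<in> A"
    using * unfolding linear_operator_def by blast
  show "(f, u) \<in> A \<Longrightarrow> (c *\<^sub>C f, c *\<^sub>C u) \<in> A"
    using * unfolding linear_operator_def by blast
  show "(f, u) \<in> A \<Longrightarrow> (f, v) \<in> A \<Longrightarrow> u = v"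
    using * unfolding linear_operator_def single_valued_def by blast
qed

lemma op_diff:
  assumes "self_adjoint A" "(f, u) \<in> A" "(g, v) \<in> A"
  shows "(f - g, u - v) \<in> A"
  using op_add[OF assms(1,2) op_scaleC[OF assms(1,3), of "-1"]] by (simp add: scaleC_minus_one)

lemma op_scaleR:
  assumes "self_adjoint A" "(f, u) \<in> A"
  shows "(r *\<^sub>R f, r *\<^sub>R u) \<in> A"
  using op_scaleC[OF assms, of "complex_of_real r"] by (simp add: scaleC_of_real)

lemma op_sum:
  assumes "self_adjoint A" "\<And>i. i \<in> S \<Longrightarrow> (F i, U i) \<in> A"
  shows "(sum F S, sum U S) \<in> A"
  using assms(2)
  by (induction S rule: infinite_finite_induct) (simp_all add: op_zero[OF assms(1)] op_add[OF assms(1)])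

lemma op_symmetric:
  assumes "self_adjoint A" "(f, u) \<in> A" "(g, v) \<in> A"
  shows "cinner u g = cinner f v"
proof -
  have "(g, v) \<in> adjoint_graph A" using assms by (simp add: self_adjoint_def)
  then show ?thesis using assms(2) unfolding adjoint_graph_def by blast
qed

lemma op_adjointI:
  assumes "self_adjoint A" "\<And>f u. (f, u) \<in> A \<Longrightarrow> cinner u g = cinner f v"
  shows "(g, v) \<in> A"
proof -
  have "(g, v) \<in> adjoint_graph A" using assms(2) unfolding adjoint_graph_def by blast
  then show ?thesis using assms(1) by (simp add: self_adjoint_def)
qed

text \<open>A self-adjoint graph equals its adjoint graph, and the latter is cut out by equations
  that are continuous in both entries.\<close>

lemma op_closed:
  assumes A: "self_adjoint A" and FU: "\<And>n::nat. (F n, U n) \<in> A" and "F \<longlonglongrightarrow> f" "U \<longlonglongrightarrow> u"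
  shows "(f, u) \<in> A"
proof (rule op_adjointI[OF A])
  fix g v assume gv: "(g, v) \<in> A"
  have "(\<lambda>n. cinner v (F n)) \<longlonglongrightarrow> cinner v f" by (intro tendsto_intros assms)
  moreover have "(\<lambda>n. cinner g (U n)) \<longlonglongrightarrow> cinner g u" by (intro tendsto_intros assms)
  moreover have "cinner v (F n) = cinner g (U n)" for n by (rule op_symmetric[OF A gv FU])
  ultimately show "cinner v f = cinner g u" using LIMSEQ_unique by auto
qed

lemma op_quadratic_real:
  assumes "self_adjoint A" "(f, u) \<in> A"
  shows "Im (cinner u f) = 0"
  using op_symmetric[OF assms assms(2)] cinner_commute[of f u] by (simp add: complex_eq_iff)

text \<open>Quantitative injectivity of \<open>A - z\<close>. For positive \<open>c\<close> it
  characterizes the resolvent set of a self-adjoint operator, and the spectral arguments work with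
  this bound in place of resolvent operators.\<close>

definition bounded_below ::
    "('a::euclidean_space l2 \<times> 'a l2) set \<Rightarrow> complex \<Rightarrow> real \<Rightarrow> bool" where
  "bounded_below A z c \<longleftrightarrow> (\<forall>(f, u)\<in>A. c * norm f \<le> norm (u - z *\<^sub>C f))"

lemma bounded_belowD: "bounded_below A z c \<Longrightarrow> (f, u) \<in> A \<Longrightarrow> c * norm f \<le> norm (u - z *\<^sub>C f)"
  unfolding bounded_below_def by blast

text \<open>The pairing of \<open>(A - Re z) f\<close> with \<open>f\<close> is real, so the cross
  term with \<open>\<i> * Im z\<close> times \<open>f\<close> has no real part and Pythagoras
  applies.\<close>

lemma op_norm_shift:
  assumes A: "self_adjoint A" "(f, u) \<in> A"
  shows "(norm (u - z *\<^sub>C f))\<^sup>2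
      = (norm (u - complex_of_real (Re z) *\<^sub>C f))\<^sup>2 + (Im z)\<^sup>2 * (norm f)\<^sup>2"
proof -
  define w where "w = u - complex_of_real (Re z) *\<^sub>C f"
  have eq: "u - z *\<^sub>C f = w - (\<i> * complex_of_real (Im z)) *\<^sub>C f"
    unfolding w_def by (subst complex_eq[of z]) (simp only: scaleC_add_left diff_diff_eq)
  have "Im (cinner w f) = 0"
    using op_quadratic_real[OF A] by (simp add: w_def cinner_simps cinner_self)
  then have "Re (cinner w ((\<i> * complex_of_real (Im z)) *\<^sub>C f)) = 0"
    by (simp add: cinner_simps)
  then show ?thesis
    unfolding eq norm_diff_sq[of w] w_def[symmetric]
    by (simp add: norm_scaleC norm_mult power_mult_distrib)
qed

lemma bounded_below_nonreal:
  assumes "self_adjoint A"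
  shows "bounded_below A z \<bar>Im z\<bar>"
  unfolding bounded_below_def
proof (clarify)
  fix f u assume "(f, u) \<in> A"
  from op_norm_shift[OF assms this, of z]
  have "(\<bar>Im z\<bar> * norm f)\<^sup>2 \<le> (norm (u - z *\<^sub>C f))\<^sup>2"
    by (simp add: power_mult_distrib)
  then show "\<bar>Im z\<bar> * norm f \<le> norm (u - z *\<^sub>C f)"
    by (rule power2_le_imp_le) simp
qed

text \<open>The bound makes the range closed. Its orthogonal complement is the kernel of
  \<open>A - cnj z\<close>, on which the same bound holds, so it is trivial.\<close>

lemma bounded_below_range:
  assumes A: "self_adjoint A" and c: "c > 0" and bb: "bounded_below A z c"
  shows "\<exists>f u. (f, u) \<in> A \<and> u - z *\<^sub>C f = v"
proof -
  define R where "R = {v. \<exists>f u. (f, u) \<in> A \<and> u - z *\<^sub>C f = v}"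
  have RI: "u - z *\<^sub>C f \<in> R" if "(f, u) \<in> A" for f u using that unfolding R_def by blast
  have "csubspace R"
    unfolding csubspace_def
  proof (intro conjI ballI allI)
    show "0 \<in> R" using RI[OF op_zero[OF A]] by simp
    fix v assume "v \<in> R"
    then obtain f u where fu: "(f, u) \<in> A" "v = u - z *\<^sub>C f" unfolding R_def by blast
    show "d *\<^sub>C v \<in> R" for d
      using RI[OF op_scaleC[OF A fu(1), of d]] fu(2)
      by (simp add: scaleC_diff_right scaleC_scaleC mult.commute)
    fix v' assume "v' \<in> R"
    then obtain f' u' where fu': "(f', u') \<in> A" "v' = u' - z *\<^sub>C f'" unfolding R_def by blast
    show "v + v' \<in> R"
      using RI[OF op_add[OF A fu(1) fu'(1)]] unfolding fu(2) fu'(2)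
      by (simp add: scaleC_add_right add_diff_add)
  qed
  moreover have "closed R"
    unfolding closed_sequential_limits
  proof (intro allI impI)
    fix V v assume V: "(\<forall>n. V n \<in> R) \<and> V \<longlonglongrightarrow> v"
    then have "V n \<in> R" for n by blast
    then have "\<exists>f u. (f, u) \<in> A \<and> u - z *\<^sub>C f = V n" for n
      by (simp add: R_def)
    then obtain F U where FU: "\<And>n. (F n, U n) \<in> A" "\<And>n. V n = U n - z *\<^sub>C F n"
      by metis
    have CV: "Cauchy V" using V LIMSEQ_imp_Cauchy by blast
    have "Cauchy F"
    proof (rule CauchyI)
      fix e :: real assume e: "e > 0"
      obtain M where M: "\<And>m n. m \<ge> M \<Longrightarrow> n \<ge> M \<Longrightarrow> norm (V m - V n) < c * e"
        using CauchyD[OF CV, of "c * e"] e c by auto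
      have "norm (F m - F n) < e" if "m \<ge> M" "n \<ge> M" for m n
      proof -
        have "V m - V n = (U m - U n) - z *\<^sub>C (F m - F n)"
          by (simp add: FU(2) scaleC_diff_right algebra_simps)
        then have "c * norm (F m - F n) \<le> norm (V m - V n)"
          using bounded_belowD[OF bb op_diff[OF A FU(1)[of m] FU(1)[of n]]] by simp
        then have "c * norm (F m - F n) < c * e" using M[OF that] by linarith
        then show ?thesis using c by simp
      qed
      then show "\<exists>M. \<forall>m\<ge>M. \<forall>n\<ge>M. norm (F m - F n) < e" by blast
    qed
    then obtain f where f: "F \<longlonglongrightarrow> f" by (auto simp: Cauchy_convergent_iff convergent_def)
    have "(\<lambda>n. V n + z *\<^sub>C F n) \<longlonglongrightarrow> v + z *\<^sub>C f"
      using V f by (intro tendsto_intros) auto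
    then have "U \<longlonglongrightarrow> v + z *\<^sub>C f" by (simp add: FU(2))
    then have "(f, v + z *\<^sub>C f) \<in> A" by (rule op_closed[OF A FU(1) f])
    from RI[OF this] show "v \<in> R" by simp
  qed
  moreover have "v = 0" if v: "\<And>k. k \<in> R \<Longrightarrow> cinner v k = 0" for v
  proof -
    have "(v, cnj z *\<^sub>C v) \<in> A"
    proof (rule op_adjointI[OF A])
      fix f u assume "(f, u) \<in> A"
      then have "cinner (u - z *\<^sub>C f) v = 0"
        using v[OF RI] cinner_commute[of "u - z *\<^sub>C f" v] by simp
      then show "cinner u v = cinner f (cnj z *\<^sub>C v)" by (simp add: cinner_simps)
    qed
    note vA = this
    \<comment> \<open>By \<open>op_norm_shift\<close> the two norms depend on \<open>Im z\<close>
      only through its square, so they agree for \<open>z\<close> and \<open>cnj z\<close>.\<close>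
    have "norm (cnj z *\<^sub>C v - z *\<^sub>C v) = norm (cnj z *\<^sub>C v - cnj z *\<^sub>C v)"
      using op_norm_shift[OF A vA, of z] op_norm_shift[OF A vA, of "cnj z"] by simp
    then have "c * norm v \<le> 0" using bounded_belowD[OF bb vA] by simp
    then show "v = 0" using c by (simp add: mult_le_0_iff)
  qed
  ultimately have "R = UNIV" by (rule csubspace_eq_UNIV)
  then show ?thesis unfolding R_def by blast
qed

text \<open>The lower bound already contains surjectivity, by \<open>bounded_below_range\<close>;
  injectivity and boundedness of the inverse are immediate from it.\<close>

lemma resolvent_set_iff:
  assumes A: "self_adjoint A"
  shows "z \<in> resolvent_set A \<longleftrightarrow> (\<exists>c>0. bounded_below A z c)"
proof
  assume "z \<in> resolvent_set A"
  then obtain C where C: "\<forall>(f, u)\<in>A. norm f \<le> C * norm (u - z *\<^sub>C f)"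
    unfolding resolvent_set_def by blast
  have "bounded_below A z (1 / (\<bar>C\<bar> + 1))"
    unfolding bounded_below_def
  proof clarify
    fix f u assume "(f, u) \<in> A"
    then have "norm f \<le> C * norm (u - z *\<^sub>C f)" using C by blast
    also have "\<dots> \<le> (\<bar>C\<bar> + 1) * norm (u - z *\<^sub>C f)" by (rule mult_right_mono) auto
    finally show "1 / (\<bar>C\<bar> + 1) * norm f \<le> norm (u - z *\<^sub>C f)" by (simp add: field_simps)
  qed
  then show "\<exists>c>0. bounded_below A z c" by (intro exI[of _ "1 / (\<bar>C\<bar> + 1)"]) simp
next
  assume "\<exists>c>0. bounded_below A z c"
  then obtain c where c: "c > 0" "bounded_below A z c" by blast
  have uniq: "f = f'" if "(f, u) \<in> A" "(f', u') \<in> A" "u - z *\<^sub>C f = u' - z *\<^sub>C f'" for f u f' u'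
  proof -
    have "(u - u') - z *\<^sub>C (f - f') = 0" using that(3) by (simp add: scaleC_diff_right algebra_simps)
    then have "c * norm (f - f') \<le> 0"
      using bounded_belowD[OF c(2) op_diff[OF A that(1,2)]] by simp
    then show "f = f'" using c(1) by (simp add: mult_le_0_iff)
  qed
  have "\<exists>!f. \<exists>u. (f, u) \<in> A \<and> u - z *\<^sub>C f = v" for v
    using bounded_below_range[OF A c, of v] uniq by (metis (no_types, lifting))
  moreover have "\<forall>(f, u)\<in>A. norm f \<le> (1 / c) * norm (u - z *\<^sub>C f)"
  proof clarify
    fix f u assume "(f, u) \<in> A"
    from bounded_belowD[OF c(2) this] show "norm f \<le> (1 / c) * norm (u - z *\<^sub>C f)"
      using c(1) by (simp add: field_simps)
  qed
  ultimately show "z \<in> resolvent_set A" unfolding resolvent_set_def by blast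
qed

lemma spectrum_real:
  assumes "self_adjoint A" "z \<in> spectrum A"
  shows "Im z = 0"
proof (rule ccontr)
  assume "Im z \<noteq> 0"
  then have "z \<in> resolvent_set A"
    using bounded_below_nonreal[OF assms(1), of z] unfolding resolvent_set_iff[OF assms(1)]
    by (intro exI[of _ "\<bar>Im z\<bar>"]) simp
  then show False using assms(2) by (simp add: spectrum_def)
qed

lemma bounded_below_perturb:
  assumes "bounded_below A z c"
  shows "bounded_below A z' (c - cmod (z' - z))"
  unfolding bounded_below_def
proof clarify
  fix f u assume fu: "(f, u) \<in> A"
  have "u - z *\<^sub>C f = (u - z' *\<^sub>C f) + (z' - z) *\<^sub>C f" by (simp add: scaleC_diff_left)
  then have "norm (u - z *\<^sub>C f) \<le> norm (u - z' *\<^sub>C f) + cmod (z' - z) * norm f"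
    by (metis norm_scaleC norm_triangle_ineq)
  then show "(c - cmod (z' - z)) * norm f \<le> norm (u - z' *\<^sub>C f)"
    using bounded_belowD[OF assms fu] by (simp add: left_diff_distrib)
qed

lemma closed_spectrum:
  assumes A: "self_adjoint A"
  shows "closed (spectrum A)"
proof -
  have "open (resolvent_set A)"
    unfolding open_dist
  proof
    fix z assume "z \<in> resolvent_set A"
    then obtain c where c: "c > 0" "bounded_below A z c" unfolding resolvent_set_iff[OF A] by blast
    have "z' \<in> resolvent_set A" if "dist z' z < c" for z'
      unfolding resolvent_set_iff[OF A]
      using bounded_below_perturb[OF c(2), of z'] that
      by (intro exI[of _ "c - cmod (z' - z)"]) (simp add: dist_norm)
    then show "\<exists>e>0. \<forall>y. dist y z < e \<longrightarrow> y \<in> resolvent_set A" using c(1) by blast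
  qed
  then show ?thesis by (simp add: spectrum_def open_closed)
qed

text \<open>A point with negative real part stays at distance at least \<open>- Re z\<close> from
  the numerical range, and this distance serves as lower bound.\<close>

lemma spectrum_nonneg:
  assumes A: "self_adjoint A" and pos: "\<And>f u. (f, u) \<in> A \<Longrightarrow> 0 \<le> Re (cinner u f)"
    and z: "z \<in> spectrum A"
  shows "0 \<le> Re z"
proof (rule ccontr)
  assume neg: "\<not> 0 \<le> Re z"
  have "bounded_below A z (- Re z)"
    unfolding bounded_below_def
  proof clarify
    fix f u assume fu: "(f, u) \<in> A"
    have "(- Re z * norm f) * norm f \<le> Re (cinner (u - z *\<^sub>C f) f)"
      using pos[OF fu] by (simp add: cinner_simps cinner_self power2_eq_square)
    also have "\<dots> \<le> norm (u - z *\<^sub>C f) * norm f"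
      using cmod_cinner_le complex_Re_le_cmod order_trans by blast
    finally show "- Re z * norm f \<le> norm (u - z *\<^sub>C f)"
      by (cases "f = 0") (auto intro: mult_right_le_imp_le)
  qed
  then have "z \<in> resolvent_set A"
    unfolding resolvent_set_iff[OF A] using neg by (intro exI[of _ "- Re z"]) simp
  then show False using z by (simp add: spectrum_def)
qed

lemma eigenspace_csubspace:
  assumes A: "self_adjoint A"
  shows "csubspace (eigenspace A z)"
  unfolding csubspace_def eigenspace_def
proof (intro conjI ballI allI)
  show "0 \<in> {f. (f, z *\<^sub>C f) \<in> A}" using op_zero[OF A] by simp
  show "f + g \<in> {f. (f, z *\<^sub>C f) \<in> A}"
    if "f \<in> {f. (f, z *\<^sub>C f) \<in> A}" "g \<in> {f. (f, z *\<^sub>C f) \<in> A}" for f g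
    using that op_add[OF A] by (simp add: scaleC_add_right)
  show "c *\<^sub>C f \<in> {f. (f, z *\<^sub>C f) \<in> A}" if "f \<in> {f. (f, z *\<^sub>C f) \<in> A}" for c f
    using op_scaleC[OF A, of f "z *\<^sub>C f" c] that by (simp add: scaleC_scaleC mult.commute)
qed

lemma eigenspace_closed:
  assumes A: "self_adjoint A"
  shows "closed (eigenspace A z)"
  unfolding closed_sequential_limits eigenspace_def
proof (intro allI impI CollectI)
  fix F f assume "(\<forall>n. F n \<in> {f. (f, z *\<^sub>C f) \<in> A}) \<and> F \<longlonglongrightarrow> f"
  then have F: "\<And>n. (F n, z *\<^sub>C F n) \<in> A" "F \<longlonglongrightarrow> f" by auto
  show "(f, z *\<^sub>C f) \<in> A"
    by (rule op_closed[OF A F(1) F(2)]) (intro tendsto_intros F)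
qed

text \<open>Bolzano-Weierstrass once for each vector of \<open>B\<close>. In
  \<open>ess_spectrum_ge\<close> this is the compactness that neutralizes the finite-rank
  error.\<close>

lemma bounded_subsequence_cinner:
  assumes "finite B" and bd: "\<And>n::nat. norm (F n) \<le> M"
  shows "\<exists>r. strict_mono r \<and> (\<forall>b\<in>B. convergent (\<lambda>n. cinner (F (r n)) b))"
  using assms(1)
proof (induction B rule: finite_induct)
  case empty
  show ?case by (rule exI[of _ id]) (simp add: strict_mono_def)
next
  case (insert b B)
  then obtain r where r: "strict_mono r" "\<And>b. b \<in> B \<Longrightarrow> convergent (\<lambda>n. cinner (F (r n)) b)"
    by blast
  have "bounded (range (\<lambda>n. cinner (F (r n)) b))"
  proof (rule boundedI)
    fix x assume "x \<in> range (\<lambda>n. cinner (F (r n)) b)"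
    then obtain n where "x = cinner (F (r n)) b" by blast
    then have "norm x \<le> norm (F (r n)) * norm b" by (simp add: cmod_cinner_le)
    also have "\<dots> \<le> M * norm b" by (intro mult_right_mono bd) simp
    finally show "norm x \<le> M * norm b" .
  qed
  then obtain l s where s: "strict_mono s" "((\<lambda>n. cinner (F (r n)) b) \<circ> s) \<longlonglongrightarrow> l"
    using bounded_imp_convergent_subsequence by metis
  have "convergent (\<lambda>n. cinner (F ((r \<circ> s) n)) b')" if "b' \<in> insert b B" for b'
  proof (cases "b' = b")
    case True
    then show ?thesis using s(2) by (auto simp: convergent_def o_def)
  next
    case False
    then show ?thesis
      using convergent_subseq_convergent[OF r(2) s(1), of b'] that by (simp add: o_def)
  qed
  moreover have "strict_mono (r \<circ> s)" using r(1) s(1) by (rule strict_mono_o)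
  ultimately show ?case by blast
qed

lemma sum_square_Cauchy:
  fixes x :: "'b \<Rightarrow> nat \<Rightarrow> complex"
  assumes "finite B" "\<And>b. b \<in> B \<Longrightarrow> Cauchy (x b)" "e > 0"
  shows "\<exists>M. \<forall>m\<ge>M. \<forall>n\<ge>M. (\<Sum>b\<in>B. (cmod (x b m - x b n))\<^sup>2) < e"
  using assms
proof (induction B arbitrary: e rule: finite_induct)
  case empty
  then show ?case by simp
next
  case (insert b B)
  obtain M1 where M1: "\<And>m n. m \<ge> M1 \<Longrightarrow> n \<ge> M1 \<Longrightarrow> (\<Sum>b\<in>B. (cmod (x b m - x b n))\<^sup>2) < e/2"
    using insert.IH[of "e/2"] insert.prems by auto
  obtain M2 where M2: "\<And>m n. m \<ge> M2 \<Longrightarrow> n \<ge> M2 \<Longrightarrow> cmod (x b m - x b n) < sqrt (e/2)"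
    using CauchyD[of "x b" "sqrt (e/2)"] insert.prems by auto
  have "(\<Sum>b\<in>insert b B. (cmod (x b m - x b n))\<^sup>2) < e" if "m \<ge> max M1 M2" "n \<ge> max M1 M2" for m n
  proof -
    have "(cmod (x b m - x b n))\<^sup>2 < (sqrt (e/2))\<^sup>2"
      using M2[of m n] that by (intro power_strict_mono) auto
    then have "(cmod (x b m - x b n))\<^sup>2 < e/2" using insert.prems by simp
    moreover have "(\<Sum>b\<in>B. (cmod (x b m - x b n))\<^sup>2) < e/2" using M1[of m n] that by simp
    ultimately show ?thesis using insert.hyps by simp
  qed
  then show ?case by blast
qed

text \<open>Suppose \<open>Re z < \<mu>\<close>. Approximate eigenvectors at \<open>z\<close> on
  which the functionals of \<open>B\<close> converge form a Cauchy sequence, since the form exceeds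
  \<open>Re z\<close> up to these functionals. Hence \<open>A - z\<close> is bounded below on the
  orthogonal complement of the eigenspace \<open>E\<close>, which isolates \<open>z\<close>;
  moreover \<open>B\<close> separates \<open>E\<close>, which is therefore finite-dimensional. So
  \<open>z\<close> would belong to the discrete spectrum.\<close>

theorem ess_spectrum_ge:
  assumes A: "self_adjoint A" and B: "finite B"
    and lower: "\<And>f u. (f, u) \<in> A \<Longrightarrow>
        \<mu> * (norm f)\<^sup>2 - C * (\<Sum>b\<in>B. (cmod (cinner f b))\<^sup>2) \<le> Re (cinner u f)"
    and C: "C \<ge> 0" and z: "z \<in> ess_spectrum A"
  shows "\<mu> \<le> Re z"
proof (rule ccontr)
  assume "\<not> \<mu> \<le> Re z"
  then have less: "Re z < \<mu>" by simp
  have zs: "z \<in> spectrum A" "z \<notin> discrete_spectrum A" using z by (auto simp: ess_spectrum_def)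
  have zr: "z = complex_of_real (Re z)" using spectrum_real[OF A zs(1)] by (simp add: complex_eq_iff)
  define \<kappa> where "\<kappa> = Re z"
  have z\<kappa>: "z = complex_of_real \<kappa>" using zr by (simp add: \<kappa>_def)
  define E where "E = eigenspace A z"
  note E = eigenspace_csubspace[OF A, of z, folded E_def] eigenspace_closed[OF A, of z, folded E_def]
  have EA: "(f, z *\<^sub>C f) \<in> A" if "f \<in> E" for f using that by (simp add: E_def eigenspace_def)
  have gap: "\<exists>c>0. \<forall>(f, u)\<in>A. (\<forall>k\<in>E. cinner f k = 0) \<longrightarrow> c * norm f \<le> norm (u - z *\<^sub>C f)"
  proof (rule ccontr)
    assume neg: "\<not> ?thesis"
    have "\<exists>f u. (f, u) \<in> A \<and> norm f = 1 \<and> (\<forall>k\<in>E. cinner f k = 0)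
        \<and> norm (u - z *\<^sub>C f) < 1 / real (Suc n)" for n
    proof -
      obtain f u where fu: "(f, u) \<in> A" "\<forall>k\<in>E. cinner f k = 0"
          "norm (u - z *\<^sub>C f) < 1 / real (Suc n) * norm f"
        using neg by (force simp: not_le dest: spec[of _ "1 / real (Suc n)"])
      then have f0: "norm f > 0" using norm_ge_zero[of "u - z *\<^sub>C f"] by (cases "f = 0") auto
      define r where "r = inverse (norm f)"
      have "(r *\<^sub>R f, r *\<^sub>R u) \<in> A" by (rule op_scaleR[OF A fu(1)])
      moreover have "norm (r *\<^sub>R f) = 1" using f0 by (simp add: r_def)
      moreover have "\<forall>k\<in>E. cinner (r *\<^sub>R f) k = 0"
        using fu(2) by (simp add: cinner_simps flip: scaleC_of_real)
      moreover have "r *\<^sub>R u - z *\<^sub>C (r *\<^sub>R f) = r *\<^sub>R (u - z *\<^sub>C f)"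
        by (simp add: scaleC_scaleC scaleC_diff_right mult.commute flip: scaleC_of_real)
      then have "norm (r *\<^sub>R u - z *\<^sub>C (r *\<^sub>R f)) = norm (u - z *\<^sub>C f) / norm f"
        using f0 by (simp add: r_def divide_inverse_commute)
      then have "norm (r *\<^sub>R u - z *\<^sub>C (r *\<^sub>R f)) < 1 / real (Suc n)"
        using fu(3) f0 by (simp only: pos_divide_less_eq)
      ultimately show ?thesis by blast
    qed
    then obtain F U where FU: "\<And>n. (F n, U n) \<in> A" "\<And>n. norm (F n) = 1"
        "\<And>n. \<forall>k\<in>E. cinner (F n) k = 0" "\<And>n. norm (U n - z *\<^sub>C F n) < 1 / real (Suc n)"
      by metis
    obtain r where r: "strict_mono r" "\<And>b. b \<in> B \<Longrightarrow> convergent (\<lambda>n. cinner (F (r n)) b)"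
      using bounded_subsequence_cinner[OF B, of F 1] FU(2) by auto
    define G where "G n = F (r n)" for n
    define W where "W n = U (r n) - z *\<^sub>C F (r n)" for n
    have W: "norm (W n) \<le> 1 / real (Suc n)" for n
    proof -
      have "norm (W n) < 1 / real (Suc (r n))" unfolding W_def by (rule FU(4))
      also have "\<dots> \<le> 1 / real (Suc n)"
        using seq_suble[OF r(1), of n] by (intro divide_left_mono) auto
      finally show ?thesis by simp
    qed
    have W0: "W \<longlonglongrightarrow> 0"
      by (rule Lim_null_comparison[OF always_eventually LIMSEQ_inverse_real_of_nat])
         (use W in \<open>simp add: inverse_eq_divide\<close>)
    \<comment> \<open>The hypothesis is applied to a difference of two approximate eigenvectors. Up
      to a small error its energy is \<open>\<kappa>\<close> times the squared norm, strictly less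
      than \<open>\<mu>\<close> times it, so the functionals of \<open>B\<close> control the
      difference.\<close>
    have diff: "(\<mu> - \<kappa>) * (norm (G m - G n))\<^sup>2
        \<le> C * (\<Sum>b\<in>B. (cmod (cinner (G m) b - cinner (G n) b))\<^sup>2)
          + 2 * (1 / real (Suc m) + 1 / real (Suc n))" for m n
    proof -
      let ?g = "G m - G n" let ?w = "W m - W n"
      have gA: "(?g, ?w + z *\<^sub>C ?g) \<in> A"
        using op_diff[OF A FU(1)[of "r m"] FU(1)[of "r n"]]
        by (simp add: G_def W_def scaleC_diff_right algebra_simps)
      have "Re (cinner (?w + z *\<^sub>C ?g) ?g) = Re (cinner ?w ?g) + \<kappa> * (norm ?g)\<^sup>2"
        by (simp add: cinner_add_left cinner_scaleC_left cinner_self z\<kappa>)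
      moreover have "Re (cinner ?w ?g) \<le> norm ?w * norm ?g"
        using cmod_cinner_le complex_Re_le_cmod order_trans by blast
      moreover have "norm ?w * norm ?g \<le> (1 / real (Suc m) + 1 / real (Suc n)) * 2"
      proof (intro mult_mono)
        show "norm ?w \<le> 1 / real (Suc m) + 1 / real (Suc n)"
          using norm_triangle_ineq4[of "W m" "W n"] W[of m] W[of n] by linarith
        show "norm ?g \<le> 2"
          using norm_triangle_ineq4[of "G m" "G n"] FU(2) by (simp add: G_def)
      qed auto
      moreover note lower[OF gA]
      ultimately show ?thesis by (simp add: cinner_diff_left left_diff_distrib)
    qed
    have "Cauchy G"
    proof (rule CauchyI)
      fix e :: real assume e: "e > 0"
      define \<epsilon> where "\<epsilon> = (\<mu> - \<kappa>) * e\<^sup>2"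
      have \<epsilon>: "\<epsilon> > 0" using e less by (simp add: \<epsilon>_def \<kappa>_def)
      have "\<exists>M. \<forall>m\<ge>M. \<forall>n\<ge>M. (\<Sum>b\<in>B. (cmod (cinner (G m) b - cinner (G n) b))\<^sup>2) < \<epsilon> / (2 * (C + 1))"
        by (rule sum_square_Cauchy[OF B])
           (use r(2) \<epsilon> C in \<open>auto simp: G_def Cauchy_convergent_iff\<close>)
      then obtain M1 where M1: "\<And>m n. m \<ge> M1 \<Longrightarrow> n \<ge> M1 \<Longrightarrow>
          (\<Sum>b\<in>B. (cmod (cinner (G m) b - cinner (G n) b))\<^sup>2) < \<epsilon> / (2 * (C + 1))"
        by blast
      obtain M2 :: nat where M2: "8 / \<epsilon> < real M2" using reals_Archimedean2 by blast
      have small: "1 / real (Suc n) < \<epsilon> / 8" if "n \<ge> M2" for n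
      proof -
        have "8 / \<epsilon> < real (Suc n)" using M2 that by linarith
        then show ?thesis using \<epsilon> by (simp add: field_simps)
      qed
      have "norm (G m - G n) < e" if "m \<ge> max M1 M2" "n \<ge> max M1 M2" for m n
      proof -
        have "C * (\<Sum>b\<in>B. (cmod (cinner (G m) b - cinner (G n) b))\<^sup>2) \<le> C * (\<epsilon> / (2 * (C + 1)))"
          using M1[of m n] that C by (intro mult_left_mono) auto
        also have "\<dots> \<le> \<epsilon> / 2" using C \<epsilon> by (simp add: field_simps)
        finally have "(\<mu> - \<kappa>) * (norm (G m - G n))\<^sup>2 < \<epsilon>"
          using diff[of m n] small[of m] small[of n] that by auto
        then have "(norm (G m - G n))\<^sup>2 < e\<^sup>2"
          using less by (simp add: \<epsilon>_def \<kappa>_def)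
        then show ?thesis using e by (simp add: power2_less_imp_less)
      qed
      then show "\<exists>M. \<forall>m\<ge>M. \<forall>n\<ge>M. norm (G m - G n) < e" by blast
    qed
    then obtain f where f: "G \<longlonglongrightarrow> f" by (auto simp: Cauchy_convergent_iff convergent_def)
    have "(\<lambda>n. W n + z *\<^sub>C G n) \<longlonglongrightarrow> 0 + z *\<^sub>C f" by (intro tendsto_intros W0 f)
    then have lim: "(\<lambda>n. W n + z *\<^sub>C G n) \<longlonglongrightarrow> z *\<^sub>C f" by simp
    have "(f, z *\<^sub>C f) \<in> A"
      by (rule op_closed[OF A _ f lim]) (use FU(1) in \<open>simp add: W_def G_def\<close>)
    \<comment> \<open>The limit is a unit eigenvector and, being a limit of vectors orthogonal to
      \<open>E\<close>, orthogonal to itself.\<close>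
    then have fE: "f \<in> E" by (simp add: E_def eigenspace_def)
    have "(\<lambda>n. cinner (G n) f) \<longlonglongrightarrow> cinner f f" by (intro tendsto_intros f)
    then have "cinner f f = 0" using FU(3) fE by (simp add: G_def LIMSEQ_const_iff)
    moreover have "(\<lambda>n. norm (G n)) \<longlonglongrightarrow> norm f" by (intro tendsto_intros f)
    then have "norm f = 1" using FU(2) by (simp add: G_def LIMSEQ_const_iff)
    ultimately show False by (simp add: cinner_self)
  qed
  then obtain c where c: "c > 0"
    "\<And>f u. (f, u) \<in> A \<Longrightarrow> (\<And>k. k \<in> E \<Longrightarrow> cinner f k = 0) \<Longrightarrow> c * norm f \<le> norm (u - z *\<^sub>C f)"
    by blast
  have res: "z' \<in> resolvent_set A" if z': "z' \<noteq> z" "cmod (z' - z) < c" for z'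
  proof -
    \<comment> \<open>On \<open>E\<close> the operator \<open>A - z'\<close> is multiplication by
      \<open>z - z'\<close>; on the orthogonal complement the gap \<open>c\<close> shrinks by at
      most \<open>cmod (z' - z)\<close>. Both parts are invariant, so the smaller constant serves
      for all vectors.\<close>
    define d where "d = min (c - cmod (z' - z)) (cmod (z' - z))"
    have d: "d > 0" using z' by (simp add: d_def)
    have "bounded_below A z' d"
      unfolding bounded_below_def
    proof clarify
      fix f u assume fu: "(f, u) \<in> A"
      define e where "e = proj E f"
      define g where "g = f - e"
      have eE: "e \<in> E" by (simp add: e_def proj_mem[OF E])
      have gE: "cinner g k = 0" if "k \<in> E" for k using that by (simp add: g_def e_def proj_orth[OF E])
      have gA: "(g, u - z *\<^sub>C e) \<in> A" unfolding g_def by (rule op_diff[OF A fu EA[OF eE]])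
      define h where "h = (u - z *\<^sub>C e) - z' *\<^sub>C g"
      have hE: "cinner h k = 0" if "k \<in> E" for k
        using op_symmetric[OF A gA EA[OF that]] gE[OF that]
        by (simp add: h_def cinner_diff_left[of _ "z' *\<^sub>C g"] cinner_scaleC_left cinner_scaleC_right)
      have eq: "u - z' *\<^sub>C f = (z - z') *\<^sub>C e + h"
        by (simp add: h_def g_def scaleC_diff_left scaleC_diff_right)
      have "cinner h e = 0" by (rule hE[OF eE])
      then have "cinner e h = 0" using cinner_commute[of e h] by simp
      then have sq: "(norm (u - z' *\<^sub>C f))\<^sup>2 = (cmod (z' - z) * norm e)\<^sup>2 + (norm h)\<^sup>2"
        unfolding eq norm_add_sq by (simp add: cinner_scaleC_left norm_scaleC norm_minus_commute)
      have "(u - z *\<^sub>C e) - z *\<^sub>C g = h + (z' - z) *\<^sub>C g" by (simp add: h_def scaleC_diff_left)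
      then have "c * norm g \<le> norm h + cmod (z' - z) * norm g"
        using c(2)[OF gA gE] norm_triangle_ineq[of h "(z' - z) *\<^sub>C g"] by (simp add: norm_scaleC)
      then have "(c - cmod (z' - z)) * norm g \<le> norm h" by (simp add: left_diff_distrib)
      moreover have "d * norm g \<le> (c - cmod (z' - z)) * norm g"
        by (rule mult_right_mono) (simp_all add: d_def)
      ultimately have "(d * norm g)\<^sup>2 \<le> (norm h)\<^sup>2" using d by (intro power_mono) auto
      moreover have "(d * norm e)\<^sup>2 \<le> (cmod (z' - z) * norm e)\<^sup>2"
        using d by (intro power_mono mult_right_mono) (auto simp: d_def)
      moreover have "(d * norm f)\<^sup>2 = (d * norm e)\<^sup>2 + (d * norm g)\<^sup>2"
        using proj_norm_sq[OF E, of f] by (simp add: g_def e_def power_mult_distrib distrib_left)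
      ultimately have "(d * norm f)\<^sup>2 \<le> (norm (u - z' *\<^sub>C f))\<^sup>2" using sq by linarith
      then show "d * norm f \<le> norm (u - z' *\<^sub>C f)" by (rule power2_le_imp_le) simp
    qed
    then show ?thesis unfolding resolvent_set_iff[OF A] using d by blast
  qed
  have "E \<noteq> {0}"
  proof
    assume "E = {0}"
    then have "bounded_below A z c" unfolding bounded_below_def using c(2) by auto
    then have "z \<in> resolvent_set A" unfolding resolvent_set_iff[OF A] using c(1) by blast
    then show False using zs(1) by (simp add: spectrum_def)
  qed
  moreover have "finite_dimensional E"
  proof (rule finite_dimensional_if_separated[OF B E(1)])
    fix f assume f: "f \<in> E" "\<And>b. b \<in> B \<Longrightarrow> cinner f b = 0"
    have "\<mu> * (norm f)\<^sup>2 \<le> \<kappa> * (norm f)\<^sup>2"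
      using lower[OF EA[OF f(1)]] f(2) by (simp add: cinner_scaleC_left cinner_self z\<kappa>)
    then show "f = 0" using less by (auto simp: \<kappa>_def mult_le_cancel_right not_le)
  qed
  moreover have "z isolated_in spectrum A"
    unfolding isolated_in_def
  proof (intro conjI exI[of _ "ball z c"])
    have "z' = z" if "z' \<in> ball z c" "z' \<in> spectrum A" for z'
      using res[of z'] that by (auto simp: spectrum_def dist_norm norm_minus_commute)
    then show "ball z c \<inter> spectrum A = {z}"
      using zs(1) c(1) by auto
  qed (use zs in auto)
  ultimately have "z \<in> discrete_spectrum A" by (simp add: discrete_spectrum_def E_def)
  then show False using zs(2) by blast
qed

subsection \<open>The self-adjoint operator of a closed form\<close>

locale dense_closed_form = closed_form D q
  for D :: "'a::euclidean_space l2 set" and q :: "'a l2 \<Rightarrow> 'a l2 \<Rightarrow> complex" +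
  assumes dense: "closure D = UNIV"
begin

text \<open>The operator of the representation theorem for closed forms. Density of \<open>D\<close>
  makes the representing vector \<open>v\<close> unique.\<close>

definition form_operator :: "('a l2 \<times> 'a l2) set" where
  "form_operator = {(f, v). f \<in> D \<and> (\<forall>g\<in>D. cinner v g = q f g)}"

lemma form_operatorI: "f \<in> D \<Longrightarrow> (\<And>g. g \<in> D \<Longrightarrow> cinner v g = q f g) \<Longrightarrow> (f, v) \<in> form_operator"
  by (simp add: form_operator_def)

lemma form_operatorD:
  assumes "(f, v) \<in> form_operator"
  shows "f \<in> D" "g \<in> D \<Longrightarrow> cinner v g = q f g"
  using assms by (simp_all add: form_operator_def)

lemma form_operator_single:
  assumes "(f, u) \<in> form_operator" "(f, v) \<in> form_operator"
  shows "u = v"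
proof -
  have "u - v = 0"
    by (rule dense_orthogonal_zero[OF dense])
       (simp add: cinner_diff_left form_operatorD(2)[OF assms(1)] form_operatorD(2)[OF assms(2)])
  then show ?thesis by simp
qed

lemma form_operator_linear: "linear_operator form_operator"
proof -
  have "single_valued form_operator"
    unfolding single_valued_def using form_operator_single by blast
  moreover have "(0, 0) \<in> form_operator"
  proof (rule form_operatorI)
    show "0 \<in> D" by (rule csubspace_zero[OF csubspace_D])
    then show "cinner 0 g = q 0 g" if "g \<in> D" for g
      using q_scaleC_left[OF _ that, of 0 0] by simp
  qed
  moreover have "(f + g, u + v) \<in> form_operator"
    if "(f, u) \<in> form_operator" "(g, v) \<in> form_operator" for f u g v
    using that by (simp add: form_operator_def add_D q_add_left cinner_add_left)
  moreover have "(c *\<^sub>C f, c *\<^sub>C u) \<in> form_operator" if "(f, u) \<in> form_operator" for c f u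
    using that by (simp add: form_operator_def scaleC_D q_scaleC_left cinner_scaleC_left)
  ultimately show ?thesis unfolding linear_operator_def by fast
qed

text \<open>The variational equation says that \<open>A + 1\<close> is onto. Together with symmetry
  this gives both density of the domain and self-adjointness.\<close>

lemma form_operator_plus_one_surj: "\<exists>f. (f, u - f) \<in> form_operator"
proof -
  obtain f where f: "f \<in> D" "\<forall>k\<in>D. q f k + cinner f k = cinner u k"
    using variational_solution[of u] by (elim bexE)
  have "(f, u - f) \<in> form_operator"
  proof (rule form_operatorI[OF f(1)])
    fix g assume "g \<in> D"
    then have "q f g + cinner f g = cinner u g" using f(2) by blast
    then show "cinner (u - f) g = q f g" by (simp add: cinner_diff_left algebra_simps)
  qed
  then show ?thesis by blast
qed

lemma form_operator_symmetric:
  assumes "(f, u) \<in> form_operator" "(g, v) \<in> form_operator"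
  shows "cinner u g = cinner f v"
  using form_operatorD[OF assms(1)] form_operatorD[OF assms(2)] q_commute[of f g]
    cinner_commute[of f v]
  by simp

text \<open>For \<open>f\<close> orthogonal to the domain, solve \<open>(A + 1) g = f\<close> and
  test with \<open>g\<close>: the sum of the squared norm of \<open>g\<close> and its energy
  vanishes, so \<open>g = 0\<close> and then \<open>f = 0\<close>.\<close>

lemma form_operator_domain_dense: "closure (Domain form_operator) = UNIV"
proof (rule csubspace_dense)
  have lin: "single_valued form_operator \<and> (0, 0) \<in> form_operator \<and>
     (\<forall>(f, u)\<in>form_operator. \<forall>(g, v)\<in>form_operator. (f + g, u + v) \<in> form_operator) \<and>
     (\<forall>c. \<forall>(f, u)\<in>form_operator. (c *\<^sub>C f, c *\<^sub>C u) \<in> form_operator)"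
    using form_operator_linear unfolding linear_operator_def .
  show "csubspace (Domain form_operator)"
    unfolding csubspace_def
  proof (intro conjI ballI allI)
    show "0 \<in> Domain form_operator" using lin by blast
    show "f + g \<in> Domain form_operator"
      if fg: "f \<in> Domain form_operator" "g \<in> Domain form_operator" for f g
    proof -
      obtain u where "(f, u) \<in> form_operator" using fg(1) by (rule DomainE)
      moreover obtain v where "(g, v) \<in> form_operator" using fg(2) by (rule DomainE)
      ultimately have "(f + g, u + v) \<in> form_operator" using lin by blast
      then show ?thesis by blast
    qed
    show "c *\<^sub>C f \<in> Domain form_operator" if f: "f \<in> Domain form_operator" for c f
    proof -
      obtain u where "(f, u) \<in> form_operator" using f by (rule DomainE)
      then have "(c *\<^sub>C f, c *\<^sub>C u) \<in> form_operator" using lin by blast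
      then show ?thesis by blast
    qed
  qed
  fix f assume f: "\<And>k. k \<in> Domain form_operator \<Longrightarrow> cinner f k = 0"
  obtain g where g: "(g, f - g) \<in> form_operator" using form_operator_plus_one_surj by blast
  have gD: "g \<in> D" by (rule form_operatorD(1)[OF g])
  have "cinner f g = 0" by (rule f) (use g in blast)
  moreover have "cinner (f - g) g = q g g" by (rule form_operatorD(2)[OF g gD])
  ultimately have "- ((norm g)\<^sup>2) = Re (q g g)"
    by (simp add: cinner_diff_left cinner_self flip: of_real_minus)
       (metis Re_complex_of_real of_real_minus of_real_power)
  then have "g = 0" using q_nonneg[OF gD] by (simp add: power2_eq_square) (metis
        add.inverse_inverse add.inverse_neutral antisym_conv le_minus_iff mult_eq_0_iff norm_eq_zero
        zero_le_square)
  have "(0, f) \<in> form_operator" using g \<open>g = 0\<close> by simp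
  then show "f = 0" by (rule form_operator_single) (use lin in blast)
qed

text \<open>For \<open>(g, v)\<close> in the adjoint graph, solve \<open>(A + 1) w = v + g\<close>.
  Then \<open>g - w\<close> is orthogonal to the range of \<open>A + 1\<close>, which is
  everything.\<close>

lemma form_operator_self_adjoint: "self_adjoint form_operator"
  unfolding self_adjoint_def
proof (intro conjI form_operator_linear form_operator_domain_dense equalityI subrelI)
  fix g v assume "(g, v) \<in> form_operator"
  then show "(g, v) \<in> adjoint_graph form_operator"
    unfolding adjoint_graph_def using form_operator_symmetric by blast
next
  fix g v assume "(g, v) \<in> adjoint_graph form_operator"
  then have gv: "cinner u g = cinner f v" if "(f, u) \<in> form_operator" for f u
    using that unfolding adjoint_graph_def by blast
  obtain w where w: "(w, (v + g) - w) \<in> form_operator" using form_operator_plus_one_surj by blast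
  have "g - w = 0"
  proof -
    obtain f where f: "(f, (g - w) - f) \<in> form_operator" using form_operator_plus_one_surj by blast
    have "cinner (g - w) (g - w) = cinner (((g - w) - f) + f) g - cinner (((g - w) - f) + f) w"
      by (simp add: cinner_diff_right)
    also have "\<dots> = (cinner f v + cinner f g) - (cinner f (v + g - w) + cinner f w)"
      unfolding cinner_add_left gv[OF f] form_operator_symmetric[OF f w] by simp
    also have "\<dots> = 0" by (simp add: cinner_simps)
    finally show ?thesis by (simp add: cinner_self)
  qed
  then show "(g, v) \<in> form_operator" using w by simp
qed

text \<open>Any such \<open>A\<close> is contained in the form operator, and a self-adjoint operator
  has no proper symmetric extension. This settles the definite description in
  \<open>antiwick_operator\<close>.\<close>

lemma form_operator_unique:
  assumes A: "self_adjoint A" and dom: "Domain A \<subseteq> D"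
    and form: "\<forall>(f, u)\<in>A. \<forall>g\<in>D. cinner u g = q f g"
  shows "A = form_operator"
proof (intro equalityI subrelI)
  fix f u assume "(f, u) \<in> A"
  then show "(f, u) \<in> form_operator" using dom form by (intro form_operatorI) blast+
next
  fix g v assume gv: "(g, v) \<in> form_operator"
  show "(g, v) \<in> A"
  proof (rule op_adjointI[OF A])
    fix f u assume "(f, u) \<in> A"
    then have "(f, u) \<in> form_operator" using dom form by (intro form_operatorI) blast+
    then show "cinner u g = cinner f v" by (rule form_operator_symmetric[OF _ gv])
  qed
qed

lemma form_operator_quadratic:
  "(f, u) \<in> form_operator \<Longrightarrow> Re (cinner u f) = Re (q f f)"
  using form_operatorD by metis

end

lemma scaleR_scaleC_commute: "r *\<^sub>R (c *\<^sub>C f) = c *\<^sub>C (r *\<^sub>R f)"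
  by (simp add: scaleC_scaleC mult.commute flip: scaleC_of_real)

subsection \<open>The bottom of the spectrum\<close>

text \<open>If \<open>\<kappa> = inf \<parallel>(A - x)f\<parallel>\<close> over unit vectors, then minimizing sequences \<open>f\<^sub>n\<close> give the approximate
  eigenvectors \<open>f\<^sub>n \<plusminus> \<kappa>(A - x)\<^sup>-\<^sup>1f\<^sub>n\<close> of \<open>A\<close> at \<open>x \<plusminus> \<kappa>\<close>, at least one of which does not tend to zero.\<close>

lemma bounded_below_spectral_distance:
  assumes A: "self_adjoint A" and r: "r > 0"
    and res: "\<And>y::real. \<bar>y - x\<bar> < r \<Longrightarrow> complex_of_real y \<in> resolvent_set A"
  shows "bounded_below A (complex_of_real x) r"
proof (rule ccontr)
  assume "\<not> ?thesis"
  then obtain f1 u1 where f1: "(f1, u1) \<in> A" "norm (u1 - complex_of_real x *\<^sub>C f1) < r * norm f1"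
    unfolding bounded_below_def by (auto simp: not_le)
  then have f1n: "norm f1 > 0" using norm_ge_zero[of "u1 - complex_of_real x *\<^sub>C f1"]
    by (cases "f1 = 0") auto
  \<comment> \<open>Graph elements are written as \<open>(f, b + x f)\<close>, so that
    \<open>b\<close> stands for \<open>(A - x) f\<close>.\<close>
  define S where "S = {norm b | f b. (f, b + complex_of_real x *\<^sub>C f) \<in> A \<and> norm f = 1}"
  define \<kappa> where "\<kappa> = Inf S"
  have S0: "bdd_below S" by (rule bdd_belowI[of _ 0]) (auto simp: S_def)
  have scale: "((1 / norm f) *\<^sub>R f, (1 / norm f) *\<^sub>R b + complex_of_real x *\<^sub>C ((1 / norm f) *\<^sub>R f)) \<in> A"
    if "(f, b + complex_of_real x *\<^sub>C f) \<in> A" for f b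
    using op_scaleR[OF A that, of "1 / norm f"]
    unfolding scaleR_add_right scaleR_scaleC_commute .
  have S1: "norm b / norm f \<in> S" if "(f, b + complex_of_real x *\<^sub>C f) \<in> A" "f \<noteq> 0" for f b
    unfolding S_def using scale[OF that(1)] that(2)
    by (intro CollectI exI[of _ "(1 / norm f) *\<^sub>R f"] exI[of _ "(1 / norm f) *\<^sub>R b"]) simp
  have \<kappa>le: "\<kappa> * norm f \<le> norm b" if "(f, b + complex_of_real x *\<^sub>C f) \<in> A" for f b
  proof (cases "f = 0")
    case False
    have "\<kappa> \<le> norm b / norm f" unfolding \<kappa>_def by (rule cInf_lower[OF S1[OF that False] S0])
    then show ?thesis using False by (simp add: pos_le_divide_eq)
  qed simp
  have mem1: "norm (u1 - complex_of_real x *\<^sub>C f1) / norm f1 \<in> S"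
    by (rule S1) (use f1 f1n in auto)
  have \<kappa>r: "\<kappa> < r"
  proof -
    have "\<kappa> \<le> norm (u1 - complex_of_real x *\<^sub>C f1) / norm f1"
      unfolding \<kappa>_def by (rule cInf_lower[OF mem1 S0])
    also have "\<dots> < r" using f1(2) f1n by (simp add: pos_divide_less_eq)
    finally show ?thesis .
  qed
  have xres: "complex_of_real x \<in> resolvent_set A" by (rule res) (use r in simp)
  then obtain c where c: "c > 0" "bounded_below A (complex_of_real x) c"
    unfolding resolvent_set_iff[OF A] by blast
  have "c \<le> \<kappa>"
    unfolding \<kappa>_def
  proof (rule cInf_greatest)
    show "S \<noteq> {}" using mem1 by blast
    fix y assume "y \<in> S"
    then obtain f b where fb: "y = norm b" "(f, b + complex_of_real x *\<^sub>C f) \<in> A" "norm f = 1"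
      unfolding S_def by blast
    show "c \<le> y" using bounded_belowD[OF c(2) fb(2)] fb by simp
  qed
  then have \<kappa>0: "\<kappa> > 0" using c by simp
  have "\<exists>f b. (f, b + complex_of_real x *\<^sub>C f) \<in> A \<and> norm f = 1 \<and> norm b < \<kappa> + 1 / real (Suc n)" for n
  proof -
    have "\<exists>y\<in>S. y < \<kappa> + 1 / real (Suc n)"
      by (rule cInf_lessD) (use mem1 in \<open>auto simp: \<kappa>_def\<close>)
    then show ?thesis unfolding S_def by blast
  qed
  then obtain F B where FB: "\<And>n. (F n, B n + complex_of_real x *\<^sub>C F n) \<in> A" "\<And>n. norm (F n) = 1"
      "\<And>n. norm (B n) < \<kappa> + 1 / real (Suc n)" by metis
  have "\<exists>g. (g, F n + complex_of_real x *\<^sub>C g) \<in> A" for n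
  proof -
    obtain g u where "(g, u) \<in> A" "u - complex_of_real x *\<^sub>C g = F n"
      using bounded_below_range[OF A c] by blast
    then have "(g, F n + complex_of_real x *\<^sub>C g) \<in> A" by (simp add: eq_diff_eq[symmetric] algebra_simps)
    then show ?thesis by blast
  qed
  then obtain G where G: "\<And>n. (G n, F n + complex_of_real x *\<^sub>C G n) \<in> A" by metis
  \<comment> \<open>Since \<open>G n\<close> is the image of \<open>F n\<close> under the inverse of
    \<open>A - x\<close> and \<open>B n\<close> its image under \<open>A - x\<close>, moving
    \<open>A - x\<close> across the pairing leaves the squared norm of \<open>F n\<close>.\<close>
  have GB: "Re (cinner (G n) (B n)) = 1" for n
  proof -
    have "cinner (F n + complex_of_real x *\<^sub>C G n) (F n) = cinner (G n) (B n + complex_of_real x *\<^sub>C F n)"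
      by (rule op_symmetric[OF A G FB(1)])
    then have "cinner (G n) (B n) = cinner (F n) (F n)" by (simp add: cinner_simps)
    then show ?thesis by (simp add: cinner_self FB(2))
  qed
  \<comment> \<open>Expanding the square with \<open>GB\<close> and using
    \<open>\<kappa> * norm (G n) \<le> 1\<close> leaves only the excess of the minimizing sequence:
    the vectors \<open>F n\<close> nearly satisfy \<open>(A - x)^2 f = \<kappa>^2 f\<close> after
    one inversion.\<close>
  have near: "(norm (\<kappa>\<^sup>2 *\<^sub>R G n - B n))\<^sup>2 \<le> (\<kappa> + 1 / real (Suc n))\<^sup>2 - \<kappa>\<^sup>2" for n
  proof -
    have "\<kappa> * norm (G n) \<le> 1" using \<kappa>le[OF G[of n]] FB(2) by simp
    then have "(\<kappa> * norm (G n))\<^sup>2 \<le> 1" using \<kappa>0 by (simp add: power_le_one)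
    then have "\<kappa>\<^sup>2 * (\<kappa> * norm (G n))\<^sup>2 \<le> \<kappa>\<^sup>2 * 1" by (intro mult_left_mono) auto
    moreover have "(norm (B n))\<^sup>2 \<le> (\<kappa> + 1 / real (Suc n))\<^sup>2"
      using FB(3)[of n] by (intro power_mono) auto
    moreover have "(norm (\<kappa>\<^sup>2 *\<^sub>R G n - B n))\<^sup>2 = \<kappa>\<^sup>2 * (\<kappa> * norm (G n))\<^sup>2 - 2 * \<kappa>\<^sup>2 + (norm (B n))\<^sup>2"
      unfolding norm_diff_sq
      by (simp add: GB cinner_scaleC_left norm_scaleC power_mult_distrib norm_mult power2_eq_square
          flip: scaleC_of_real)
    ultimately show ?thesis by linarith
  qed
  have near0: "(\<lambda>n. \<kappa>\<^sup>2 *\<^sub>R G n - B n) \<longlonglongrightarrow> 0"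
  proof -
    have "(\<lambda>n. (\<kappa> + 1 / real (Suc n))\<^sup>2 - \<kappa>\<^sup>2) \<longlonglongrightarrow> (\<kappa> + 0)\<^sup>2 - \<kappa>\<^sup>2"
      by (intro tendsto_intros LIMSEQ_inverse_real_of_nat[unfolded inverse_eq_divide])
    then have "(\<lambda>n. (\<kappa> + 1 / real (Suc n))\<^sup>2 - \<kappa>\<^sup>2) \<longlonglongrightarrow> 0" by simp
    then have "(\<lambda>n. (norm (\<kappa>\<^sup>2 *\<^sub>R G n - B n))\<^sup>2) \<longlonglongrightarrow> 0"
      by (rule Lim_null_comparison[rotated]) (use near in simp)
    then have "(\<lambda>n. sqrt ((norm (\<kappa>\<^sup>2 *\<^sub>R G n - B n))\<^sup>2)) \<longlonglongrightarrow> sqrt 0" by (intro tendsto_intros)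
    then show ?thesis by (simp add: tendsto_norm_zero_iff)
  qed
  \<comment> \<open>\<open>A - x - s \<kappa>\<close> sends \<open>F n + s \<kappa> G n\<close> to
    \<open>B n - \<kappa>^2 G n\<close>, which tends to zero; because
    \<open>0 < \<kappa> < r\<close>, the point \<open>x + s \<kappa>\<close> is still in the
    resolvent set.\<close>
  have to0: "(\<lambda>n. F n + (s * \<kappa>) *\<^sub>R G n) \<longlonglongrightarrow> 0" if s: "s = 1 \<or> s = -1" for s :: real
  proof -
    have "complex_of_real (x + s * \<kappa>) \<in> resolvent_set A"
      by (rule res) (use s \<kappa>r \<kappa>0 in auto)
    then obtain d where d: "d > 0" "bounded_below A (complex_of_real (x + s * \<kappa>)) d"
      unfolding resolvent_set_iff[OF A] by blast
    have ss: "s * s = 1" using s by auto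
    have bound: "norm (F n + (s * \<kappa>) *\<^sub>R G n) \<le> norm (\<kappa>\<^sup>2 *\<^sub>R G n - B n) / d" for n
    proof -
      have "((s * \<kappa>) *\<^sub>R G n, (s * \<kappa>) *\<^sub>R (F n + complex_of_real x *\<^sub>C G n)) \<in> A"
        by (rule op_scaleR[OF A G])
      from op_add[OF A FB(1)[of n] this]
      have 1: "(F n + (s * \<kappa>) *\<^sub>R G n, (B n + x *\<^sub>R F n) + (s * \<kappa>) *\<^sub>R (F n + x *\<^sub>R G n)) \<in> A"
        by (simp add: scaleC_of_real)
      have 2: "(B n + x *\<^sub>R F n) + (s * \<kappa>) *\<^sub>R (F n + x *\<^sub>R G n)
          - complex_of_real (x + s * \<kappa>) *\<^sub>C (F n + (s * \<kappa>) *\<^sub>R G n) = - (\<kappa>\<^sup>2 *\<^sub>R G n - B n)"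
      proof -
        have "(s * \<kappa>) * (s * \<kappa>) = \<kappa>\<^sup>2" using ss by (simp add: power2_eq_square algebra_simps)
        moreover have "(B n + x *\<^sub>R F n) + t *\<^sub>R (F n + x *\<^sub>R G n) - (x + t) *\<^sub>R (F n + t *\<^sub>R G n)
            = - ((t * t) *\<^sub>R G n - B n)" for t
          by (simp add: algebra_simps)
        ultimately show ?thesis
          unfolding scaleC_of_real by simp
      qed
      have "d * norm (F n + (s * \<kappa>) *\<^sub>R G n) \<le> norm (\<kappa>\<^sup>2 *\<^sub>R G n - B n)"
        using bounded_belowD[OF d(2) 1] unfolding 2 norm_minus_cancel .
      then show ?thesis using d(1) by (simp add: pos_le_divide_eq mult.commute)
    qed
    have "(\<lambda>n. norm (\<kappa>\<^sup>2 *\<^sub>R G n - B n) / d) \<longlonglongrightarrow> norm (0::'a l2) / d"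
      by (intro tendsto_intros near0) (use d in auto)
    then have "(\<lambda>n. norm (\<kappa>\<^sup>2 *\<^sub>R G n - B n) / d) \<longlonglongrightarrow> 0" by simp
    then show ?thesis by (rule Lim_null_comparison[rotated]) (use bound in simp)
  qed
  \<comment> \<open>Adding the two signs cancels \<open>G n\<close> and leaves twice the unit vector
    \<open>F n\<close>.\<close>
  have "(\<lambda>n. (F n + (1 * \<kappa>) *\<^sub>R G n) + (F n + (-1 * \<kappa>) *\<^sub>R G n)) \<longlonglongrightarrow> 0 + 0"
    by (intro tendsto_add to0) auto
  then have "(\<lambda>n. F n + F n) \<longlonglongrightarrow> 0" by simp
  then have "(\<lambda>n. norm (F n + F n)) \<longlonglongrightarrow> 0" by (rule tendsto_norm_zero)
  moreover have "norm (F n + F n) = 2" for n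
    using norm_scaleR[of 2 "F n"] FB(2)[of n] by (simp add: scaleR_2)
  ultimately show False by (simp add: LIMSEQ_const_iff)
qed

text \<open>The shifted form \<open>q - m\<close> is nonnegative at \<open>f + t g\<close> for every
  real \<open>t\<close>; the discriminant of this polynomial in \<open>t\<close> gives the
  inequality.\<close>

lemma (in closed_form) q_Cauchy_Schwarz:
  assumes "f \<in> D" "g \<in> D" and low: "\<And>k. k \<in> D \<Longrightarrow> m * (norm k)\<^sup>2 \<le> Re (q k k)"
  shows "(Re (q f g) - m * Re (cinner f g))\<^sup>2
    \<le> (Re (q f f) - m * (norm f)\<^sup>2) * (Re (q g g) - m * (norm g)\<^sup>2)"
proof (rule discriminant_le)
  fix t :: real
  define k where "k = complex_of_real t *\<^sub>C g"
  have kD: "k \<in> D" using assms by (simp add: k_def scaleC_D)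
  have "Re (q (f + k) (f + k)) = Re (q f f) + 2 * t * Re (q f g) + t\<^sup>2 * Re (q g g)"
    unfolding q_form_add[OF assms(1) kD] unfolding k_def
    by (simp add: q_form_scaleC[OF assms(2)] q_scaleC_right[OF assms(2,1)])
  moreover have "(norm (f + k))\<^sup>2 = (norm f)\<^sup>2 + 2 * t * Re (cinner f g) + t\<^sup>2 * (norm g)\<^sup>2"
    unfolding norm_add_sq k_def by (simp add: cinner_scaleC_right norm_scaleC power_mult_distrib)
  ultimately show "0 \<le> (Re (q f f) - m * (norm f)\<^sup>2) + 2 * t * (Re (q f g) - m * Re (cinner f g))
      + t\<^sup>2 * (Re (q g g) - m * (norm g)\<^sup>2)"
    using low[OF add_D[OF assms(1) kD]] by (simp add: algebra_simps)
qed

text \<open>With \<open>B = A - m \<ge> 0\<close>, a gap \<open>(0, 2s)\<close> in the spectrum gives \<open>\<parallel>Bf\<parallel>\<^sup>2 \<ge> 2s\<langle>Bf, f\<rangle>\<close>, so the bounded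
  operator \<open>S = B(B + 1)\<^sup>-\<^sup>1\<close> satisfies \<open>\<parallel>Sy\<parallel>\<^sup>2 \<ge> c\<langle>Sy, y\<rangle>\<close>; Cauchy-Schwarz for \<open>\<langle>S\<cdot>, \<cdot>\<rangle>\<close> turns this
  into \<open>S \<ge> c\<close> on the range of \<open>S\<close>, which is dense because \<open>B\<close> is injective.\<close>

lemma (in dense_closed_form) form_gap:
  assumes low: "\<And>g. g \<in> D \<Longrightarrow> m * (norm g)\<^sup>2 \<le> Re (q g g)"
    and s: "s > 0"
    and res: "\<And>y::real. m < y \<Longrightarrow> y < m + 2 * s \<Longrightarrow> complex_of_real y \<in> resolvent_set form_operator"
    and inj: "\<And>f. (f, complex_of_real m *\<^sub>C f) \<in> form_operator \<Longrightarrow> f = 0"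
  shows "\<exists>c>0. \<forall>g\<in>D. (m + c) * (norm g)\<^sup>2 \<le> Re (q g g)"
proof -
  note A = form_operator_self_adjoint
  \<comment> \<open>The graph of \<open>B = A - m\<close>.\<close>
  define \<Gamma> where "\<Gamma> = {(f, b). (f, b + m *\<^sub>R f) \<in> form_operator}"
  have \<Gamma>: "(f, b + m *\<^sub>R f) \<in> form_operator" if "(f, b) \<in> \<Gamma>" for f b using that by (simp add: \<Gamma>_def)
  have \<Gamma>sym: "cinner b f' = cinner f b'" if "(f, b) \<in> \<Gamma>" "(f', b') \<in> \<Gamma>" for f b f' b'
    using op_symmetric[OF A \<Gamma>[OF that(1)] \<Gamma>[OF that(2)]]
    by (simp add: cinner_simps flip: scaleC_of_real)
  have \<Gamma>pos: "0 \<le> Re (cinner b f)" if "(f, b) \<in> \<Gamma>" for f b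
    using form_operator_quadratic[OF \<Gamma>[OF that]] low[OF form_operatorD(1)[OF \<Gamma>[OF that]]]
    by (simp add: cinner_simps cinner_self flip: scaleC_of_real)
  have \<Gamma>lin: "(f + t *\<^sub>R f', b + t *\<^sub>R b') \<in> \<Gamma>" if "(f, b) \<in> \<Gamma>" "(f', b') \<in> \<Gamma>" for f b f' b' t
    using op_add[OF A \<Gamma>[OF that(1)] op_scaleR[OF A \<Gamma>[OF that(2)], of t]]
    by (simp add: \<Gamma>_def scaleR_add_right algebra_simps)
  \<comment> \<open>The gap from \<open>m\<close> to \<open>m + 2 * s\<close> has centre
    \<open>m + s\<close> and radius \<open>s\<close>. Squaring the resulting bound for
    \<open>B - s\<close> yields the inequality \<open>gap\<close>.\<close>
  have "bounded_below form_operator (complex_of_real (m + s)) s"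
    by (rule bounded_below_spectral_distance[OF A s], rule res) (use s in \<open>auto simp: abs_less_iff\<close>)
  have gap: "2 * s * Re (cinner b f) \<le> (norm b)\<^sup>2" if fb: "(f, b) \<in> \<Gamma>" for f b
  proof -
    have "s * norm f \<le> norm (b + m *\<^sub>R f - complex_of_real (m + s) *\<^sub>C f)"
      by (rule bounded_belowD[OF _ \<Gamma>[OF fb]]) fact
    also have "b + m *\<^sub>R f - complex_of_real (m + s) *\<^sub>C f = b - s *\<^sub>R f"
      by (simp add: scaleC_add_left scaleC_of_real)
    finally have "(s * norm f)\<^sup>2 \<le> (norm (b - s *\<^sub>R f))\<^sup>2" using s by (intro power_mono) auto
    then show ?thesis
      unfolding norm_diff_sq by (simp add: cinner_simps norm_scaleC norm_mult power_mult_distrib flip: scaleC_of_real)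
  qed
  have surj: "\<exists>f b. (f, b) \<in> \<Gamma> \<and> b + f = y" for y
  proof -
    have "bounded_below form_operator (complex_of_real (m - 1)) 1"
      unfolding bounded_below_def
    proof clarify
      fix f u assume fu: "(f, u) \<in> form_operator"
      define b where "b = u - m *\<^sub>R f"
      have "(f, b) \<in> \<Gamma>" using fu by (simp add: \<Gamma>_def b_def)
      then have "norm f * norm f \<le> Re (cinner (b + f) f)"
        using \<Gamma>pos[of f b] by (simp add: cinner_add_left cinner_self power2_eq_square)
      also have "\<dots> \<le> norm (b + f) * norm f"
        using cmod_cinner_le complex_Re_le_cmod order_trans by blast
      finally have "norm f \<le> norm (b + f)"
        by (cases "f = 0") (auto intro: mult_right_le_imp_le)
      moreover have "u - complex_of_real (m - 1) *\<^sub>C f = b + f"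
        by (simp add: b_def scaleC_diff_left scaleC_of_real)
      ultimately show "1 * norm f \<le> norm (u - complex_of_real (m - 1) *\<^sub>C f)" by simp
    qed
    from bounded_below_range[OF A _ this, of y] obtain f u
      where fu: "(f, u) \<in> form_operator" "u - complex_of_real (m - 1) *\<^sub>C f = y" by auto
    have "(f, u - m *\<^sub>R f) \<in> \<Gamma>" using fu by (simp add: \<Gamma>_def)
    moreover have "(u - m *\<^sub>R f) + f = y" using fu(2) by (simp add: scaleC_diff_left scaleC_of_real algebra_simps)
    ultimately show ?thesis by blast
  qed
  have contr: "norm f \<le> norm (b + f)" if "(f, b) \<in> \<Gamma>" for f b
  proof -
    have "(norm f)\<^sup>2 \<le> (norm (b + f))\<^sup>2" using \<Gamma>pos[OF that] by (simp add: norm_add_sq)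
    then show ?thesis by (rule power2_le_imp_le) simp
  qed
  have \<Gamma>diff: "(f - f', b - b') \<in> \<Gamma>" if "(f, b) \<in> \<Gamma>" "(f', b') \<in> \<Gamma>" for f b f' b'
    using \<Gamma>lin[OF that, of "-1"] by simp
  \<comment> \<open>The value at \<open>2 * s\<close> of the increasing function
    \<open>t / (1 + t)\<close>, which describes \<open>S\<close> in terms of
    \<open>B\<close>.\<close>
  define c where "c = 2 * s / (1 + 2 * s)"
  have c: "c > 0" using s by (simp add: c_def)
  \<comment> \<open>For \<open>y = b + f\<close> the operator \<open>S\<close> sends
    \<open>y\<close> to \<open>b\<close>, so this is the form of \<open>S\<close> at
    \<open>y\<close>.\<close>
  define P where "P f b = Re (cinner b (b + f))" for f b :: "'a l2"
  have P1: "c * P f b \<le> (norm b)\<^sup>2" if "(f, b) \<in> \<Gamma>" for f b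
  proof -
    have "P f b = (norm b)\<^sup>2 + Re (cinner b f)" by (simp add: P_def cinner_add_right cinner_self)
    then have "2 * s * P f b \<le> (1 + 2 * s) * (norm b)\<^sup>2" using gap[OF that] by (simp add: algebra_simps)
    then show ?thesis using s by (simp add: c_def field_simps)
  qed
  have Pnn: "0 \<le> P f b" if "(f, b) \<in> \<Gamma>" for f b
    using \<Gamma>pos[OF that] by (simp add: P_def cinner_add_right cinner_self)
  have PCS: "(Re (cinner b (b' + f')))\<^sup>2 \<le> P f b * P f' b'" if X: "(f, b) \<in> \<Gamma>" and Y: "(f', b') \<in> \<Gamma>" for f b f' b'
  proof (rule discriminant_le)
    fix t :: real
    have "cinner b' (b + f) = cinner (b' + f') b"
      by (simp add: cinner_add_left cinner_add_right \<Gamma>sym[OF Y X])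
    then have "Re (cinner b' (b + f)) = Re (cinner b (b' + f'))" using Re_cinner_commute by metis
    moreover have "P (f + t *\<^sub>R f') (b + t *\<^sub>R b')
        = P f b + t * Re (cinner b (b' + f')) + t * Re (cinner b' (b + f)) + t\<^sup>2 * P f' b'"
      by (simp add: P_def cinner_simps power2_eq_square algebra_simps flip: scaleC_of_real)
    ultimately have "P (f + t *\<^sub>R f') (b + t *\<^sub>R b')
        = P f b + 2 * t * Re (cinner b (b' + f')) + t\<^sup>2 * P f' b'"
      by simp
    then show "0 \<le> P f b + 2 * t * Re (cinner b (b' + f')) + t\<^sup>2 * P f' b'"
      using Pnn[OF \<Gamma>lin[OF X Y, of t]] by simp
  qed
  \<comment> \<open>Here \<open>y = b' + f'\<close> equals \<open>b = S x\<close> with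
    \<open>x = b + f\<close>. Cauchy-Schwarz bounds the fourth power of \<open>norm b\<close> by the
    product of the forms of \<open>S\<close> at \<open>x\<close> and at \<open>y\<close>, and
    \<open>P1\<close> bounds the first factor by the squared norm of \<open>b\<close> over
    \<open>c\<close>.\<close>
  have range: "c * (norm (b' + f'))\<^sup>2 \<le> P f' b'"
    if X: "(f, b) \<in> \<Gamma>" and Y: "(f', b') \<in> \<Gamma>" and eq: "b' + f' = b" for f b f' b'
  proof (cases "b = 0")
    case True
    then show ?thesis using Pnn[OF Y] eq by simp
  next
    case False
    have "((norm b)\<^sup>2)\<^sup>2 \<le> P f b * P f' b'" using PCS[OF X Y] by (simp add: eq cinner_self)
    then have "c * ((norm b)\<^sup>2)\<^sup>2 \<le> c * (P f b * P f' b')" using c by simp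
    also have "\<dots> \<le> (norm b)\<^sup>2 * P f' b'"
      using mult_right_mono[OF P1[OF X] Pnn[OF Y]] by (simp add: mult.assoc)
    finally have "(norm b)\<^sup>2 * (c * (norm b)\<^sup>2) \<le> (norm b)\<^sup>2 * P f' b'"
      by (simp add: power2_eq_square mult.left_commute mult.assoc)
    then show ?thesis using False by (simp add: eq)
  qed
  define R where "R = {b. \<exists>f. (f, b) \<in> \<Gamma>}"
  \<comment> \<open>The orthogonal complement of the range of \<open>B\<close> is its kernel, which
    is trivial by \<open>inj\<close>.\<close>
  have cl: "closure R = UNIV"
  proof (rule csubspace_dense)
    have "(0, 0) \<in> \<Gamma>" using op_zero[OF A] by (simp add: \<Gamma>_def)
    moreover have "(f + f', b + b') \<in> \<Gamma>" if "(f, b) \<in> \<Gamma>" "(f', b') \<in> \<Gamma>" for f b f' b'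
      using \<Gamma>lin[OF that, of 1] by simp
    moreover have "(d *\<^sub>C f, d *\<^sub>C b) \<in> \<Gamma>" if "(f, b) \<in> \<Gamma>" for d f b
      using op_scaleC[OF A \<Gamma>[OF that], of d] by (simp add: \<Gamma>_def scaleC_add_right scaleR_scaleC_commute)
    ultimately show "csubspace R" unfolding csubspace_def R_def by blast
    fix v assume v: "\<And>k. k \<in> R \<Longrightarrow> cinner v k = 0"
    have "(v, complex_of_real m *\<^sub>C v) \<in> form_operator"
    proof (rule op_adjointI[OF A])
      fix f u assume "(f, u) \<in> form_operator"
      then have "(f, u - m *\<^sub>R f) \<in> \<Gamma>" by (simp add: \<Gamma>_def)
      then have "u - m *\<^sub>R f \<in> R" unfolding R_def by blast
      then have "cinner (u - m *\<^sub>R f) v = 0" using v cinner_commute[of _ v] by simp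
      then show "cinner u v = cinner f (complex_of_real m *\<^sub>C v)"
        by (simp add: cinner_simps flip: scaleC_of_real)
    qed
    then show "v = 0" by (rule inj)
  qed
  have all: "c * (norm (b + f))\<^sup>2 \<le> P f b" if fb: "(f, b) \<in> \<Gamma>" for f b
  proof -
    have "b + f \<in> closure R" using cl by simp
    then obtain Y where Y: "\<And>n. Y n \<in> R" "Y \<longlonglongrightarrow> b + f" unfolding closure_sequential by blast
    have "\<exists>f' b'. (f', b') \<in> \<Gamma> \<and> b' + f' = Y n" for n by (rule surj)
    then obtain F B where FB: "\<And>n. (F n, B n) \<in> \<Gamma>" "\<And>n. B n + F n = Y n" by metis
    have "norm (F n - f) \<le> norm (Y n - (b + f))" for n
      using contr[OF \<Gamma>diff[OF FB(1)[of n] fb]] FB(2)[of n] by (simp add: algebra_simps)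
    moreover have "(\<lambda>n. norm (Y n - (b + f))) \<longlonglongrightarrow> 0"
      using Y(2) by (simp add: LIM_zero tendsto_norm_zero)
    ultimately have "(\<lambda>n. F n - f) \<longlonglongrightarrow> 0"
      by (intro Lim_null_comparison[of "\<lambda>n. F n - f" "\<lambda>n. norm (Y n - (b + f))"]) simp_all
    then have F: "F \<longlonglongrightarrow> f" by (simp add: LIM_zero_iff)
    have "(\<lambda>n. Y n - F n) \<longlonglongrightarrow> (b + f) - f" by (intro tendsto_intros Y F)
    moreover have "Y n - F n = B n" for n by (simp add: FB(2)[symmetric])
    ultimately have B: "B \<longlonglongrightarrow> b" by simp
    have "c * (norm (B n + F n))\<^sup>2 \<le> P (F n) (B n)" for n
    proof -
      obtain f' where "(f', Y n) \<in> \<Gamma>" using Y(1)[of n] unfolding R_def by blast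
      from range[OF this FB(1) FB(2)] show ?thesis .
    qed
    moreover have "(\<lambda>n. c * (norm (B n + F n))\<^sup>2) \<longlonglongrightarrow> c * (norm (b + f))\<^sup>2"
      by (intro tendsto_intros B F)
    moreover have "(\<lambda>n. P (F n) (B n)) \<longlonglongrightarrow> P f b"
      unfolding P_def by (intro tendsto_intros B F)
    ultimately show ?thesis using LIMSEQ_le by blast
  qed
  \<comment> \<open>From \<open>all\<close>: \<open>c\<close> times the squared norm of
    \<open>f\<close> is at most \<open>P f b\<close>, and by \<open>gap\<close> this is at most
    \<open>1 + 1 / (2 * s)\<close> times the squared norm of \<open>b\<close>.\<close>
  define d where "d = sqrt (c / (1 + 1 / (2 * s)))"
  have d: "d > 0" using c s by (simp add: d_def add_pos_pos)
  have "bounded_below form_operator (complex_of_real m) d"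
    unfolding bounded_below_def
  proof clarify
    fix f u assume fu: "(f, u) \<in> form_operator"
    define b where "b = u - m *\<^sub>R f"
    have fb: "(f, b) \<in> \<Gamma>" using fu by (simp add: \<Gamma>_def b_def)
    have "c * (norm f)\<^sup>2 \<le> c * (norm (b + f))\<^sup>2"
      using contr[OF fb] c by (intro mult_left_mono power_mono) auto
    also have "\<dots> \<le> P f b" by (rule all[OF fb])
    also have "P f b = (norm b)\<^sup>2 + Re (cinner b f)" by (simp add: P_def cinner_add_right cinner_self)
    also have "Re (cinner b f) \<le> (norm b)\<^sup>2 / (2 * s)"
      using gap[OF fb] s by (simp add: pos_le_divide_eq mult.commute)
    finally have "c * (norm f)\<^sup>2 \<le> (1 + 1 / (2 * s)) * (norm b)\<^sup>2" by (simp add: distrib_right)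
    moreover have p: "1 + 1 / (2 * s) > 0" using s by (simp add: add_pos_pos)
    ultimately have "c / (1 + 1 / (2 * s)) * (norm f)\<^sup>2 \<le> (norm b)\<^sup>2"
      by (simp add: pos_divide_le_eq mult.commute)
    moreover have "d\<^sup>2 = c / (1 + 1 / (2 * s))" using c p by (simp add: d_def)
    ultimately have "(d * norm f)\<^sup>2 \<le> (norm b)\<^sup>2" by (simp add: power_mult_distrib)
    then have "d * norm f \<le> norm b" by (rule power2_le_imp_le) simp
    then show "d * norm f \<le> norm (u - complex_of_real m *\<^sub>C f)" by (simp add: b_def scaleC_of_real)
  qed
  note bb = this
  have "(m + d) * (norm g)\<^sup>2 \<le> Re (q g g)" if g: "g \<in> D" for g
  proof (cases "g = 0")
    case True
    then show ?thesis using q_nonneg[OF g] by simp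
  next
    case False
    \<comment> \<open>The bound passes from the operator to the form by duality. With
      \<open>f\<close> the preimage of \<open>g\<close> under \<open>A - m\<close>, the shifted form
      at \<open>(f, g)\<close> is the squared norm of \<open>g\<close>, and at \<open>(f, f)\<close>
      it is at most this squared norm divided by \<open>d\<close>; Cauchy-Schwarz for the shifted
      form does the rest.\<close>
    obtain f u where fu: "(f, u) \<in> form_operator" "u - complex_of_real m *\<^sub>C f = g"
      using bounded_below_range[OF form_operator_self_adjoint d bb] by blast
    have fD: "f \<in> D" by (rule form_operatorD(1)[OF fu(1)])
    have u: "u = g + m *\<^sub>R f" using fu(2) by (simp add: scaleC_of_real algebra_simps)
    have qfg: "Re (q f k) - m * Re (cinner f k) = Re (cinner g k)" if "k \<in> D" for k
      using form_operatorD(2)[OF fu(1) that, symmetric] unfolding u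
      by (simp add: cinner_simps flip: scaleC_of_real)
    define G where "G = Re (q g g) - m * (norm g)\<^sup>2"
    have "((norm g)\<^sup>2)\<^sup>2 \<le> Re (cinner g f) * G"
      using q_Cauchy_Schwarz[OF fD g low] qfg[OF g] qfg[OF fD] by (simp add: G_def Re_cinner_self)
    also have "\<dots> \<le> (norm g * norm f) * G"
      using low[OF g] cmod_cinner_le[of g f] complex_Re_le_cmod[of "cinner g f"]
      by (intro mult_right_mono) (auto simp: G_def)
    also have "\<dots> \<le> (norm g * (norm g / d)) * G"
    proof (intro mult_right_mono mult_left_mono)
      show "norm f \<le> norm g / d"
        using bounded_belowD[OF bb fu(1)] fu(2) d by (simp add: pos_le_divide_eq mult.commute)
      show "0 \<le> G" using low[OF g] by (simp add: G_def)
    qed simp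
    finally have "(norm g)\<^sup>2 * (d * (norm g)\<^sup>2) \<le> (norm g)\<^sup>2 * G"
      using d by (simp add: power2_eq_square field_simps)
    then have "d * (norm g)\<^sup>2 \<le> G" using False by simp
    then show ?thesis by (simp add: G_def distrib_right)
  qed
  then show ?thesis using d by blast
qed

lemma (in dense_closed_form) inf_ess_spectrum_ge:
  assumes B: "finite B" and C: "C \<ge> 0"
    and lower: "\<And>f. f \<in> D \<Longrightarrow>
        \<mu> * (norm f)\<^sup>2 - C * (\<Sum>b\<in>B. (cmod (cinner f b))\<^sup>2) \<le> Re (q f f)"
  shows "ereal \<mu> \<le> inf_ess_spectrum form_operator"
  unfolding inf_ess_spectrum_def
proof (rule INF_greatest)
  fix z assume z: "z \<in> ess_spectrum form_operator"
  have "\<mu> \<le> Re z"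
  proof (rule ess_spectrum_ge[OF form_operator_self_adjoint B _ C z])
    fix f u assume fu: "(f, u) \<in> form_operator"
    show "\<mu> * (norm f)\<^sup>2 - C * (\<Sum>b\<in>B. (cmod (cinner f b))\<^sup>2) \<le> Re (cinner u f)"
      using lower[OF form_operatorD(1)[OF fu]] form_operator_quadratic[OF fu] by simp
  qed
  then show "ereal \<mu> \<le> ereal (Re z)" by simp
qed

text \<open>Adding a large multiple of the projection onto the finitely many eigenspaces below \<open>\<nu>'\<close> moves all
  of the spectrum below \<open>\<nu>'\<close> away, while the form along a weakly null sequence is unchanged in the
  limit. The infimum of the new form is then isolated from the spectrum above it and not attained,
  contradicting the lemma \<open>form_gap\<close>.\<close>

theorem (in dense_closed_form) inf_ess_spectrum_le:
  assumes F: "\<And>n::nat. F n \<in> D" "\<And>n. norm (F n) = 1" "\<And>n. Re (q (F n) (F n)) \<le> \<nu>"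
    and weak: "\<And>g. (\<lambda>n. cinner (F n) g) \<longlonglongrightarrow> 0"
  shows "inf_ess_spectrum form_operator \<le> ereal \<nu>"
proof (rule ccontr)
  assume "\<not> ?thesis"
  then obtain \<nu>' where \<nu>': "\<nu> < \<nu>'" "ereal \<nu>' < inf_ess_spectrum form_operator"
    using ereal_dense2[of "ereal \<nu>"] by (auto simp: not_le)
  note A = form_operator_self_adjoint
  define S where "S = {z \<in> spectrum form_operator. Re z \<le> \<nu>'}"
  have disc: "z \<in> discrete_spectrum form_operator" if "z \<in> S" for z
  proof (rule ccontr)
    assume "z \<notin> discrete_spectrum form_operator"
    then have "inf_ess_spectrum form_operator \<le> ereal (Re z)"
      unfolding inf_ess_spectrum_def using that by (intro INF_lower) (simp add: ess_spectrum_def S_def)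
    also have "\<dots> \<le> ereal \<nu>'" using that by (simp add: S_def)
    finally show False using \<nu>'(2) by simp
  qed
  have real: "complex_of_real (Re z) = z" "0 \<le> Re z" "Re z \<le> \<nu>'" if z: "z \<in> S" for z
  proof -
    have zs: "z \<in> spectrum form_operator" using z by (simp add: S_def)
    show "complex_of_real (Re z) = z" using spectrum_real[OF A zs] by (simp add: complex_eq_iff)
    show "0 \<le> Re z"
    proof (rule spectrum_nonneg[OF A _ zs])
      fix f u assume fu: "(f, u) \<in> form_operator"
      show "0 \<le> Re (cinner u f)"
        using form_operator_quadratic[OF fu] q_nonneg[OF form_operatorD(1)[OF fu]] by simp
    qed
    show "Re z \<le> \<nu>'" using z by (simp add: S_def)
  qed
  \<comment> \<open>\<open>S\<close> is closed and bounded, hence compact. An accumulation point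
    would lie in \<open>S\<close> and yet be isolated in the spectrum.\<close>
  have finS: "finite S"
  proof (rule ccontr)
    assume inf: "infinite S"
    have "closed S"
    proof -
      have "S = spectrum form_operator \<inter> {z. Re z \<le> \<nu>'}" by (auto simp: S_def)
      then show ?thesis using closed_spectrum[OF A] closed_halfspace_Re_le by (simp add: closed_Int)
    qed
    moreover have "bounded S"
    proof (rule boundedI)
      fix z assume "z \<in> S"
      note r = real[OF this]
      have "norm z = \<bar>Re z\<bar>" by (subst r(1)[symmetric]) (simp only: norm_of_real)
      then show "norm z \<le> \<nu>'" using r by simp
    qed
    ultimately have "compact S" by (simp add: compact_eq_bounded_closed)
    then obtain x where x: "x \<in> S" "x islimpt S"
      using inf unfolding compact_eq_Bolzano_Weierstrass by blast
    have "x islimpt spectrum form_operator"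
      by (rule islimpt_subset[OF x(2)]) (auto simp: S_def)
    moreover have "x isolated_in spectrum form_operator"
      using disc[OF x(1)] by (simp add: discrete_spectrum_def)
    ultimately show False by (simp add: isolated_in_islimpt_iff)
  qed
  define E where "E z = eigenspace form_operator z" for z
  have E: "csubspace (E z)" "closed (E z)" for z
    unfolding E_def by (rule eigenspace_csubspace[OF A], rule eigenspace_closed[OF A])
  have EA: "(k, z *\<^sub>C k) \<in> form_operator" if "k \<in> E z" for k z
    using that by (simp add: E_def eigenspace_def)
  have orthE: "cinner k l = 0" if "z \<in> S" "w \<in> S" "z \<noteq> w" "k \<in> E z" "l \<in> E w" for z w k l
  proof -
    have "cinner (z *\<^sub>C k) l = cinner k (w *\<^sub>C l)" by (rule op_symmetric[OF A EA EA]) fact+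
    moreover have "cnj w = w" using real(1)[OF that(2)] by (metis complex_cnj_complex_of_real)
    ultimately have "(z - w) * cinner k l = 0" by (simp add: cinner_simps left_diff_distrib)
    then show ?thesis using that(3) by simp
  qed
  define P where "P f = (\<Sum>z\<in>S. proj (E z) f)" for f
  have Pfix: "P k = k" if z: "z \<in> S" "k \<in> E z" for z k
  proof -
    have "proj (E w) k = (if w = z then k else 0)" if w: "w \<in> S" for w
    proof (cases "w = z")
      case True
      then show ?thesis using proj_fix[OF E z(2)] by simp
    next
      case False
      have "proj (E w) k = 0"
        by (rule proj_eq_zero[OF E]) (rule orthE[OF z(1) w _ z(2)], use False in auto)
      then show ?thesis using False by simp
    qed
    then have "P k = (\<Sum>w\<in>S. if w = z then k else 0)" unfolding P_def by (intro sum.cong refl)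
    then show ?thesis using finS z(1) by simp
  qed
  have cP: "cinner (P f) g = cinner f (P g)" for f g
    unfolding P_def cinner_sum_left cinner_sum_right by (intro sum.cong refl cinner_proj E)
  have Ppos: "0 \<le> Re (cinner (P f) f)" for f
  proof -
    have "cinner (proj (E z) f) f = cinner (proj (E z) f) (proj (E z) f)" for z
      using cinner_proj[OF E, of z "proj (E z) f" f] proj_fix[OF E proj_mem[OF E], of z f] by simp
    then show ?thesis
      unfolding P_def cinner_sum_left by (auto simp: cinner_self intro!: sum_nonneg)
  qed
  have blP: "bounded_linear P"
    unfolding P_def by (intro bounded_linear_sum bounded_linear_proj E)
  have Padd: "P (f + g) = P f + P g" for f g by (rule linear_add[OF bounded_linear.linear[OF blP]])
  have PscaleC: "P (c *\<^sub>C f) = c *\<^sub>C P f" for c f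
    unfolding P_def scaleC_sum_right by (intro sum.cong refl proj_scaleC E)
  \<comment> \<open>Eigenvalues in \<open>S\<close> are nonnegative, so adding
    \<open>\<nu>' + 1\<close> lifts them to at least 1 above every
    \<open>y < \<nu>'\<close>.\<close>
  define \<tau> where "\<tau> = complex_of_real (\<nu>' + 1)"
  define q' where "q' f g = q f g + \<tau> * cinner (P f) g" for f g
  have q'self: "Re (q' f f) = Re (q f f) + (\<nu>' + 1) * Re (cinner (P f) f)" for f
    by (simp add: q'_def \<tau>_def)
  have "0 \<le> Re (q (F 0) (F 0))" by (rule q_nonneg[OF F(1)])
  then have \<nu>0: "0 \<le> \<nu>" using F(3)[of 0] by simp
  interpret N: dense_closed_form D q'
  proof unfold_locales
    show "q' (f + g) k = q' f k + q' g k" if "f \<in> D" "g \<in> D" "k \<in> D" for f g k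
      using that by (simp add: q'_def q_add_left Padd cinner_add_left distrib_left)
    show "q' (c *\<^sub>C f) k = c * q' f k" if "f \<in> D" "k \<in> D" for f k c
      using that by (simp add: q'_def q_scaleC_left PscaleC cinner_scaleC_left distrib_left)
    show "q' f g = cnj (q' g f)" if "f \<in> D" "g \<in> D" for f g
      using q_commute[OF that] cP[of f g] cinner_commute[of f "P g"]
      by (simp add: q'_def \<tau>_def)
    show "0 \<le> Re (q' f f)" if "f \<in> D" for f
      using q_nonneg[OF that] Ppos[of f] \<nu>0 \<nu>'(1) by (simp add: q'self)
    show "f \<in> D \<and> Re (q' f f) \<le> r"
      if G: "\<And>n. G n \<in> D" "\<And>n. Re (q' (G n) (G n)) \<le> r" "G \<longlonglongrightarrow> f" for G r f
    proof -
      \<comment> \<open>\<open>P\<close> is bounded, so its contribution converges along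
        \<open>G\<close>; on a tail it is known up to \<open>e\<close>, and lower semicontinuity is
        needed for \<open>q\<close> only.\<close>
      define a where "a = (\<nu>' + 1) * Re (cinner (P f) f)"
      have lim: "(\<lambda>n. (\<nu>' + 1) * Re (cinner (P (G n)) (G n))) \<longlonglongrightarrow> a"
        unfolding a_def by (intro tendsto_intros bounded_linear.tendsto[OF blP] G(3))
      have step: "f \<in> D \<and> Re (q f f) \<le> r - a + e" if "e > 0" for e
      proof -
        have "\<forall>\<^sub>F n in sequentially. a - e < (\<nu>' + 1) * Re (cinner (P (G n)) (G n))"
          by (rule order_tendstoD(1)[OF lim]) (use that in simp)
        then obtain M where M: "\<And>n. n \<ge> M \<Longrightarrow> a - e < (\<nu>' + 1) * Re (cinner (P (G n)) (G n))"
          unfolding eventually_sequentially by blast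
        show ?thesis
        proof (rule q_lsc[of "\<lambda>n. G (n + M)"])
          show "Re (q (G (n + M)) (G (n + M))) \<le> r - a + e" for n
            using M[of "n + M"] G(2)[of "n + M"] unfolding q'self by simp
        qed (use G LIMSEQ_ignore_initial_segment[OF G(3)] in simp_all)
      qed
      have "Re (q f f) \<le> r - a" by (rule field_le_epsilon) (use step in blast)
      then show ?thesis using step[of 1] unfolding q'self a_def by simp
    qed
  qed (simp_all add: csubspace_D dense)
  have NA: "(f, v - \<tau> *\<^sub>C P f) \<in> form_operator" if "(f, v) \<in> N.form_operator" for f v
  proof (rule form_operatorI)
    show "f \<in> D" by (rule N.form_operatorD(1)[OF that])
    show "cinner (v - \<tau> *\<^sub>C P f) g = q f g" if "g \<in> D" for g
      using N.form_operatorD(2)[OF \<open>(f, v) \<in> N.form_operator\<close> that]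
      by (simp add: q'_def cinner_diff_left cinner_scaleC_left)
  qed
  define X where "X = {Re (q' f f) | f. f \<in> D \<and> norm f = 1}"
  define m where "m = Inf X"
  have Xbdd: "bdd_below X" by (rule bdd_belowI[of _ 0]) (auto simp: X_def N.q_nonneg)
  have mle: "m \<le> Re (q' f f)" if "f \<in> D" "norm f = 1" for f
    unfolding m_def by (rule cInf_lower[OF _ Xbdd]) (use that in \<open>auto simp: X_def\<close>)
  \<comment> \<open>\<open>P\<close> has finite rank, which turns weak convergence to zero into norm
    convergence; the proof expands in a finite orthonormal family.\<close>
  have PF: "(\<lambda>n. P (F n)) \<longlonglongrightarrow> 0"
  proof -
    have "(\<lambda>n. proj (E z) (F n)) \<longlonglongrightarrow> 0" if z: "z \<in> S" for z
    proof -
      have "finite_dimensional (E z)" using disc[OF z] by (simp add: discrete_spectrum_def E_def)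
      then obtain B0 where B0: "finite B0" "E z \<subseteq> cspan B0" unfolding finite_dimensional_iff by blast
      obtain B where B: "finite B" "orthonormal B" "cspan B0 \<subseteq> cspan B"
        using orthonormal_basis_exists[OF B0(1)] by blast
      have "proj (E z) (F n) = (\<Sum>b\<in>B. cinner (F n) (proj (E z) b) *\<^sub>C b)" for n
      proof -
        have "proj (E z) (F n) \<in> cspan B" using proj_mem[OF E] B0(2) B(3) by blast
        from orthonormal_expansion[OF B(1,2) this] show ?thesis
          by (simp only: cinner_proj[OF E])
      qed
      moreover have "(\<lambda>n. \<Sum>b\<in>B. cinner (F n) (proj (E z) b) *\<^sub>C b) \<longlonglongrightarrow> (\<Sum>b\<in>B. 0)"
      proof (rule tendsto_sum)
        fix b
        have "(\<lambda>n. cmod (cinner (F n) (proj (E z) b)) * norm b) \<longlonglongrightarrow> 0"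
          by (rule tendsto_mult_left_zero[OF tendsto_norm_zero[OF weak]])
        then have "(\<lambda>n. norm (cinner (F n) (proj (E z) b) *\<^sub>C b)) \<longlonglongrightarrow> 0"
          unfolding norm_scaleC .
        then show "(\<lambda>n. cinner (F n) (proj (E z) b) *\<^sub>C b) \<longlonglongrightarrow> 0"
          by (rule tendsto_norm_zero_cancel)
      qed
      ultimately show ?thesis by (simp only: sum.neutral_const)
    qed
    then have "(\<lambda>n. \<Sum>z\<in>S. proj (E z) (F n)) \<longlonglongrightarrow> (\<Sum>z\<in>S. 0)" by (rule tendsto_sum)
    then show ?thesis by (simp add: P_def)
  qed
  have m\<nu>: "m \<le> \<nu>"
  proof (rule LIMSEQ_le_const)
    show "(\<lambda>n. \<nu> + (\<nu>' + 1) * norm (P (F n))) \<longlonglongrightarrow> \<nu>"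
      using tendsto_add[OF tendsto_const[of \<nu>]
          tendsto_mult_right_zero[OF tendsto_norm_zero[OF PF], of "\<nu>' + 1"]] by simp
    have "m \<le> \<nu> + (\<nu>' + 1) * norm (P (F n))" for n
    proof -
      have "Re (cinner (P (F n)) (F n)) \<le> norm (P (F n))"
        using cmod_cinner_le[of "P (F n)" "F n"] complex_Re_le_cmod[of "cinner (P (F n)) (F n)"] F(2)[of n]
        by simp
      then have "(\<nu>' + 1) * Re (cinner (P (F n)) (F n)) \<le> (\<nu>' + 1) * norm (P (F n))"
        using \<nu>0 \<nu>'(1) by (intro mult_left_mono) auto
      then show ?thesis using mle[OF F(1,2), of n] F(3)[of n] unfolding q'self by linarith
    qed
    then show "\<exists>N. \<forall>n\<ge>N. m \<le> \<nu> + (\<nu>' + 1) * norm (P (F n))" by blast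
  qed
  have low: "m * (norm g)\<^sup>2 \<le> Re (q' g g)" if g: "g \<in> D" for g
  proof (cases "g = 0")
    case True
    then show ?thesis using N.q_nonneg[OF g] by simp
  next
    case False
    define c where "c = complex_of_real (1 / norm g)"
    have "m \<le> Re (q' (c *\<^sub>C g) (c *\<^sub>C g))"
      by (rule mle) (use g False in \<open>simp_all add: scaleC_D norm_scaleC c_def norm_divide\<close>)
    also have "\<dots> = Re (q' g g) / (norm g)\<^sup>2"
      unfolding N.q_form_scaleC[OF g] by (simp add: c_def norm_divide power_divide)
    finally show ?thesis using False by (simp add: pos_le_divide_eq)
  qed
  \<comment> \<open>The distance from \<open>m\<close> to the other points of the finite set
    \<open>S\<close>. Staying within \<open>d\<close> of \<open>m\<close> and below
    \<open>\<nu>'\<close> avoids the spectrum of the original operator.\<close>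
  obtain d where d: "d > 0" "\<And>x. x \<in> S \<Longrightarrow> x \<noteq> complex_of_real m \<Longrightarrow> d \<le> dist (complex_of_real m) x"
    using finite_set_avoid[OF finS, of "complex_of_real m"] by blast
  define s where "s = min d (\<nu>' - m) / 2"
  have s: "s > 0" using d m\<nu> \<nu>'(1) by (simp add: s_def)
  have "complex_of_real y \<in> resolvent_set N.form_operator" if y: "m < y" "y < m + 2 * s" for y
  proof -
    have ym: "y - m < d" "y < \<nu>'" using y by (simp_all add: s_def)
    have "complex_of_real y \<notin> S"
    proof
      assume "complex_of_real y \<in> S"
      then have "d \<le> dist (complex_of_real m) (complex_of_real y)" by (rule d(2)) (use y in simp)
      also have "\<dots> = \<bar>m - y\<bar>" by (simp only: dist_of_real dist_real_def)
      finally show False using ym y by simp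
    qed
    then have "complex_of_real y \<notin> spectrum form_operator" using ym by (simp add: S_def)
    then have "complex_of_real y \<in> resolvent_set form_operator" by (simp add: spectrum_def)
    then obtain c where c: "c > 0" "bounded_below form_operator (complex_of_real y) c"
      unfolding resolvent_set_iff[OF A] by blast
    \<comment> \<open>On the complement of the eigenspaces nothing has changed and \<open>c\<close>
      is available; on their span the shifted eigenvalues exceed \<open>y\<close> by at least
      1.\<close>
    define c' where "c' = min c 1"
    have c': "c' > 0" using c by (simp add: c'_def)
    have "bounded_below N.form_operator (complex_of_real y) c'"
      unfolding bounded_below_def
    proof clarify
      fix f v assume fv: "(f, v) \<in> N.form_operator"
      define u where "u = v - \<tau> *\<^sub>C P f"
      have fu: "(f, u) \<in> form_operator" using NA[OF fv] by (simp add: u_def)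
      define e where "e z = proj (E z) f" for z
      have eE: "e z \<in> E z" for z by (simp add: e_def proj_mem[OF E])
      have Pe: "P f = (\<Sum>z\<in>S. e z)" by (simp add: P_def e_def)
      define g where "g = f - P f"
      have PP: "P (P f) = P f"
      proof -
        have "P (P f) = (\<Sum>z\<in>S. P (e z))"
          unfolding Pe by (rule linear_sum[OF bounded_linear.linear[OF blP]])
        also have "\<dots> = P f" unfolding Pe by (intro sum.cong refl) (rule Pfix[OF _ eE])
        finally show ?thesis .
      qed
      have gE: "cinner g k = 0" if "z \<in> S" "k \<in> E z" for z k
        using Pfix[OF that] cP[of f k] by (simp add: g_def cinner_diff_left)
      have gA: "(g, u - (\<Sum>z\<in>S. z *\<^sub>C e z)) \<in> form_operator"
        unfolding g_def Pe by (intro op_diff[OF A fu] op_sum[OF A] EA eE)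
      define h where "h = u - (\<Sum>z\<in>S. z *\<^sub>C e z) - complex_of_real y *\<^sub>C g"
      define w where "w = (\<Sum>z\<in>S. (z + \<tau> - complex_of_real y) *\<^sub>C e z)"
      have eq: "v - complex_of_real y *\<^sub>C f = h + w"
      proof -
        have "w = (\<Sum>z\<in>S. z *\<^sub>C e z) + \<tau> *\<^sub>C P f - complex_of_real y *\<^sub>C P f"
          unfolding w_def Pe scaleC_sum_right sum.distrib[symmetric] sum_subtractf[symmetric]
          by (intro sum.cong refl) (simp add: scaleC_add_left scaleC_diff_left)
        moreover have "complex_of_real y *\<^sub>C f = complex_of_real y *\<^sub>C g + complex_of_real y *\<^sub>C P f"
          by (simp add: g_def flip: scaleC_add_right)
        moreover have "v = u + \<tau> *\<^sub>C P f" by (simp add: u_def)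
        ultimately show ?thesis unfolding h_def by (simp add: algebra_simps)
      qed
      have hE: "cinner h k = 0" if "z \<in> S" "k \<in> E z" for z k
        using op_symmetric[OF A gA EA[OF that(2)]] gE[OF that]
        unfolding h_def cinner_diff_left[of _ "complex_of_real y *\<^sub>C g"]
        by (simp add: cinner_scaleC_left cinner_scaleC_right)
      have hw: "cinner h w = 0"
        unfolding w_def cinner_sum_right cinner_scaleC_right using hE eE by simp
      have ew: "cinner (e z) (P f) = complex_of_real ((norm (e z))\<^sup>2)" if "z \<in> S" for z
        using cinner_proj_right[OF E eE, of z f] cP[of "e z" f] Pfix[OF that eE] cinner_self[of "e z"]
        by (simp add: e_def)
      \<comment> \<open>Each component of \<open>w\<close> is that of \<open>P f\<close> multiplied
        by \<open>z + \<tau> - y\<close>, whose real part is at least 1. Pairing \<open>w\<close>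
        with \<open>P f\<close> therefore gives \<open>norm (P f) \<le> norm w\<close>.\<close>
      have "(norm (P f))\<^sup>2 = Re (cinner (P f) (P f))" by (simp only: Re_cinner_self)
      also have "\<dots> = (\<Sum>z\<in>S. Re (cinner (e z) (P f)))"
        by (subst (1) Pe) (simp only: cinner_sum_left Re_sum)
      also have "\<dots> \<le> (\<Sum>z\<in>S. Re (cinner ((z + \<tau> - complex_of_real y) *\<^sub>C e z) (P f)))"
      proof (rule sum_mono)
        fix z assume z: "z \<in> S"
        have "1 * (norm (e z))\<^sup>2 \<le> (Re z + (\<nu>' + 1) - y) * (norm (e z))\<^sup>2"
          using real(2)[OF z] ym by (intro mult_right_mono) auto
        then show "Re (cinner (e z) (P f)) \<le> Re (cinner ((z + \<tau> - complex_of_real y) *\<^sub>C e z) (P f))"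
          by (simp add: cinner_scaleC_left ew[OF z] \<tau>_def)
      qed
      also have "\<dots> = Re (cinner w (P f))" by (simp only: w_def cinner_sum_left Re_sum)
      also have "\<dots> \<le> norm w * norm (P f)"
        using cmod_cinner_le complex_Re_le_cmod order_trans by blast
      finally have Pw: "norm (P f) \<le> norm w"
        by (cases "P f = 0") (auto simp: power2_eq_square)
      have "c' * norm g \<le> c * norm g" by (rule mult_right_mono) (simp_all add: c'_def)
      also have "\<dots> \<le> norm h" using bounded_belowD[OF c(2) gA] by (simp add: h_def)
      finally have 1: "(c' * norm g)\<^sup>2 \<le> (norm h)\<^sup>2" using c' by (intro power_mono) auto
      have "c' * norm (P f) \<le> 1 * norm (P f)" by (rule mult_right_mono) (simp_all add: c'_def)
      then have 2: "(c' * norm (P f))\<^sup>2 \<le> (norm w)\<^sup>2" using c' Pw by (intro power_mono) auto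
      have "cinner (P f) g = 0"
        using cP[of f g] cP[of f f] cP[of f "P f"] PP by (simp add: g_def cinner_diff_right)
      then have "cinner g (P f) = 0" using cinner_commute[of g "P f"] by simp
      then have 3: "(norm f)\<^sup>2 = (norm g)\<^sup>2 + (norm (P f))\<^sup>2"
        using norm_add_sq[of g "P f"] by (simp add: g_def)
      have "(norm (v - complex_of_real y *\<^sub>C f))\<^sup>2 = (norm h)\<^sup>2 + (norm w)\<^sup>2"
        unfolding eq norm_add_sq by (simp add: hw)
      then have "(c' * norm f)\<^sup>2 \<le> (norm (v - complex_of_real y *\<^sub>C f))\<^sup>2"
        using 1 2 unfolding power_mult_distrib 3 distrib_left by linarith
      then show "c' * norm f \<le> norm (v - complex_of_real y *\<^sub>C f)" by (rule power2_le_imp_le) simp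
    qed
    then show ?thesis unfolding resolvent_set_iff[OF N.form_operator_self_adjoint] using c' by blast
  qed
  note Nres = this
  \<comment> \<open>An eigenvector of the perturbed operator at \<open>m\<close> is orthogonal to
    every \<open>E z\<close>, because \<open>m - \<tau> - z\<close> is negative. So \<open>P\<close>
    annihilates it and it is an eigenvector of the original operator at \<open>m\<close>, a number
    below \<open>\<nu>'\<close>; then either it lies in one of the spaces \<open>E z\<close> or
    \<open>m\<close> is in the resolvent set.\<close>
  have Ninj: "f = 0" if f: "(f, complex_of_real m *\<^sub>C f) \<in> N.form_operator" for f
  proof -
    have fA: "(f, complex_of_real m *\<^sub>C f - \<tau> *\<^sub>C P f) \<in> form_operator" by (rule NA[OF f])
    have fk: "cinner f k = 0" if z: "z \<in> S" "k \<in> E z" for z k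
    proof -
      have "cinner (complex_of_real m *\<^sub>C f - \<tau> *\<^sub>C P f) k = cinner f (z *\<^sub>C k)"
        by (rule op_symmetric[OF A fA EA[OF z(2)]])
      moreover have "cinner (P f) k = cinner f k" using cP[of f k] Pfix[OF z] by simp
      moreover have "cnj z = z" using real(1)[OF z(1)] by (metis complex_cnj_complex_of_real)
      ultimately have "(complex_of_real m - \<tau> - z) * cinner f k = 0"
        by (simp add: cinner_simps left_diff_distrib)
      moreover have "Re (complex_of_real m - \<tau> - z) < 0"
        using real(2)[OF z(1)] m\<nu> \<nu>'(1) by (simp add: \<tau>_def)
      ultimately show ?thesis by (metis less_irrefl mult_eq_0_iff zero_complex.simps(1))
    qed
    have "P f = 0" unfolding P_def by (intro sum.neutral ballI proj_eq_zero[OF E] fk)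
    then have fm: "(f, complex_of_real m *\<^sub>C f) \<in> form_operator" using fA by simp
    show "f = 0"
    proof (cases "complex_of_real m \<in> S")
      case True
      have "f \<in> E (complex_of_real m)" using fm by (simp add: E_def eigenspace_def)
      then have "cinner f f = 0" by (rule fk[OF True])
      then show ?thesis by (simp add: cinner_self)
    next
      case False
      then have "complex_of_real m \<in> resolvent_set form_operator"
        using m\<nu> \<nu>'(1) by (simp add: S_def spectrum_def)
      then obtain c where c: "c > 0" "bounded_below form_operator (complex_of_real m) c"
        unfolding resolvent_set_iff[OF A] by blast
      from bounded_belowD[OF c(2) fm] show ?thesis using c(1) by (simp add: mult_le_0_iff)
    qed
  qed
  \<comment> \<open>The gap lifts all energies of unit vectors to at least \<open>m + c\<close>,
    although \<open>m\<close> is their infimum.\<close>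
  obtain c where c: "c > 0" "\<And>g. g \<in> D \<Longrightarrow> (m + c) * (norm g)\<^sup>2 \<le> Re (q' g g)"
    using N.form_gap[OF low s Nres Ninj] by blast
  have "m + c \<le> m"

  proof (subst (2) m_def, rule cInf_greatest)
    show "X \<noteq> {}" unfolding X_def using F(1,2) by blast
    fix y assume "y \<in> X"
    then obtain f where "f \<in> D" "norm f = 1" "y = Re (q' f f)" unfolding X_def by blast
    then show "m + c \<le> y" using c(2)[of f] by simp
  qed
  then show False using c(1) by simp
qed

subsection \<open>Integrals over Euclidean spaces\<close>

lemma nn_integral_lborel_affine:
  fixes t :: "'a::euclidean_space"
  assumes c: "c \<noteq> 0" and [measurable]: "f \<in> borel_measurable borel"
  shows "(\<integral>\<^sup>+x. f x \<partial>lborel) = ennreal (\<bar>c\<bar> ^ DIM('a)) * (\<integral>\<^sup>+x. f (t + c *\<^sub>R x) \<partial>lborel)"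
proof -
  have "(\<integral>\<^sup>+x. f x \<partial>lborel)
      = (\<integral>\<^sup>+x. f x \<partial>density (distr lborel borel (\<lambda>x. t + c *\<^sub>R x)) (\<lambda>_. \<bar>c\<bar> ^ DIM('a)))"
    using lborel_affine[OF c, of t] by metis
  also have "\<dots> = ennreal (\<bar>c\<bar> ^ DIM('a)) * (\<integral>\<^sup>+x. f (t + c *\<^sub>R x) \<partial>lborel)"
    by (simp add: nn_integral_density nn_integral_distr nn_integral_cmult)
  finally show ?thesis .
qed

lemma integral_lborel_affine:
  fixes t :: "'a::euclidean_space" and f :: "'a \<Rightarrow> 'b::{banach, second_countable_topology}"
  assumes c: "c \<noteq> 0" and [measurable]: "f \<in> borel_measurable borel"
  shows "(\<integral>x. f x \<partial>lborel) = (\<bar>c\<bar> ^ DIM('a)) *\<^sub>R (\<integral>x. f (t + c *\<^sub>R x) \<partial>lborel)"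
proof -
  have "(\<integral>x. f x \<partial>lborel)
      = (\<integral>x. f x \<partial>density (distr lborel borel (\<lambda>x. t + c *\<^sub>R x)) (\<lambda>_. \<bar>c\<bar> ^ DIM('a)))"
    using lborel_affine[OF c, of t] by metis
  also have "\<dots> = (\<bar>c\<bar> ^ DIM('a)) *\<^sub>R (\<integral>x. f (t + c *\<^sub>R x) \<partial>lborel)"
    by (simp add: integral_density integral_distr)
  finally show ?thesis .
qed

lemma nn_integral_lborel_translate:
  fixes t :: "'a::euclidean_space"
  assumes "f \<in> borel_measurable borel"
  shows "(\<integral>\<^sup>+x. f (x + t) \<partial>lborel) = (\<integral>\<^sup>+x. f x \<partial>lborel)"
  using nn_integral_lborel_affine[of 1 f t] assms by (simp add: add.commute)

lemma integral_lborel_translate: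
  fixes t :: "'a::euclidean_space" and f :: "'a \<Rightarrow> 'b::{banach, second_countable_topology}"
  assumes "f \<in> borel_measurable borel"
  shows "(\<integral>x. f (x + t) \<partial>lborel) = (\<integral>x. f x \<partial>lborel)"
  using integral_lborel_affine[of 1 f t] assms by (simp add: add.commute)

lemma integrable_lborel_translate:
  fixes t :: "'a::euclidean_space" and f :: "'a \<Rightarrow> 'b::{banach, second_countable_topology}"
  assumes "integrable lborel f"
  shows "integrable lborel (\<lambda>x. f (x + t))"
proof -
  have [measurable]: "f \<in> borel_measurable borel" using borel_measurable_integrable[OF assms] by simp
  show ?thesis
    using assms nn_integral_lborel_translate[of "\<lambda>x. ennreal (norm (f x))" t]
    by (simp add: integrable_iff_bounded)
qed

lemma integrable_cauchy_real: "integrable lborel (\<lambda>t::real. 1 / (1 + \<bar>t\<bar>)\<^sup>2)"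
proof (rule Bochner_Integration.integrable_bound)
  show "integrable lborel (\<lambda>t::real. inverse (1 + t\<^sup>2))"
    using integrable_inverse_1_plus_square by (simp add: set_integrable_def)
  show "AE t::real in lborel. norm (1 / (1 + \<bar>t\<bar>)\<^sup>2) \<le> norm (inverse (1 + t\<^sup>2))"
  proof (rule AE_I2)
    fix t :: real
    have pos: "0 < 1 + t\<^sup>2" by (simp add: add_pos_nonneg)
    moreover have le: "1 + t\<^sup>2 \<le> (1 + \<bar>t\<bar>)\<^sup>2" by (simp add: power2_sum)
    ultimately have "inverse ((1 + \<bar>t\<bar>)\<^sup>2) \<le> inverse (1 + t\<^sup>2)" by (intro le_imp_inverse_le)
    then show "norm (1 / (1 + \<bar>t\<bar>)\<^sup>2) \<le> norm (inverse (1 + t\<^sup>2))"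
      using pos by (simp add: inverse_eq_divide)
  qed
qed simp

text \<open>Since each coordinate is bounded by the norm, the integrand is at most a product of
  one-dimensional factors with quadratic decay. This explains the exponent: twice the
  dimension.\<close>

lemma integrable_decay: "integrable lborel (\<lambda>z::'a::euclidean_space. 1 / (1 + norm z) ^ (2 * DIM('a)))"
proof (rule integrableI_bounded)
  define g where "g t = ennreal (1 / (1 + \<bar>t\<bar>)\<^sup>2)" for t :: real
  have [measurable]: "g \<in> borel_measurable borel" unfolding g_def by measurable
  have "(\<integral>\<^sup>+z. ennreal (norm (1 / (1 + norm z) ^ (2 * DIM('a)))) \<partial>(lborel :: 'a measure))
      \<le> (\<integral>\<^sup>+z. (\<Prod>b\<in>Basis. g (z \<bullet> b)) \<partial>(lborel :: 'a measure))"
  proof (rule nn_integral_mono)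
    fix z :: 'a
    have "norm (1 / (1 + norm z) ^ (2 * DIM('a))) = (\<Prod>b\<in>(Basis::'a set). 1 / (1 + norm z)\<^sup>2)"
      by (simp add: power_mult power_divide add_nonneg_nonneg abs_of_nonneg)
    also have "\<dots> \<le> (\<Prod>b\<in>Basis. 1 / (1 + \<bar>z \<bullet> b\<bar>)\<^sup>2)"
    proof (intro prod_mono conjI)
      fix b :: 'a assume "b \<in> Basis"
      then have "\<bar>z \<bullet> b\<bar> \<le> norm z" by (rule Basis_le_norm)
      then show "1 / (1 + norm z)\<^sup>2 \<le> 1 / (1 + \<bar>z \<bullet> b\<bar>)\<^sup>2"
        by (intro divide_left_mono power_mono mult_pos_pos zero_less_power) (auto simp: add_pos_nonneg)
    qed simp
    finally have "ennreal (norm (1 / (1 + norm z) ^ (2 * DIM('a))))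
        \<le> ennreal (\<Prod>b\<in>Basis. 1 / (1 + \<bar>z \<bullet> b\<bar>)\<^sup>2)" by (rule ennreal_leI)
    also have "\<dots> = (\<Prod>b\<in>Basis. g (z \<bullet> b))"
      unfolding g_def by (rule prod_ennreal[symmetric]) simp
    finally show "ennreal (norm (1 / (1 + norm z) ^ (2 * DIM('a)))) \<le> (\<Prod>b\<in>Basis. g (z \<bullet> b))" .
  qed
  also have "\<dots> = (\<Prod>b\<in>(Basis::'a set). (\<integral>\<^sup>+t. g t \<partial>lborel))"
    by (rule nn_integral_lborel_prod) simp_all
  also have "\<dots> < \<infinity>"
  proof -
    have "(\<integral>\<^sup>+t. g t \<partial>lborel) < \<infinity>"
      using integrable_cauchy_real unfolding g_def integrable_iff_bounded by simp
    then show ?thesis by (simp add: power_less_top_ennreal)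
  qed
  finally show "(\<integral>\<^sup>+z. ennreal (norm (1 / (1 + norm z) ^ (2 * DIM('a)))) \<partial>(lborel :: 'a measure)) < \<infinity>" .
qed simp

definition decay_integral :: "'a::euclidean_space itself \<Rightarrow> real" where
  "decay_integral _ = (\<integral>z. 1 / (1 + norm (z::'a)) ^ (2 * DIM('a)) \<partial>lborel)"

lemma decay_integral_nonneg: "0 \<le> decay_integral TYPE('a::euclidean_space)"
  unfolding decay_integral_def by (intro integral_nonneg_AE) (auto simp: add_nonneg_nonneg)

lemma nn_integral_decay:
  "(\<integral>\<^sup>+z. ennreal (1 / (1 + norm (z - w :: 'a::euclidean_space)) ^ (2 * DIM('a))) \<partial>lborel)
    = ennreal (decay_integral TYPE('a))"
proof -
  have "(\<integral>\<^sup>+z. ennreal (1 / (1 + norm (z + (- w) :: 'a)) ^ (2 * DIM('a))) \<partial>lborel)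
      = (\<integral>\<^sup>+z. ennreal (1 / (1 + norm (z :: 'a)) ^ (2 * DIM('a))) \<partial>lborel)"
    by (rule nn_integral_lborel_translate) measurable
  also have "\<dots> = ennreal (decay_integral TYPE('a))"
    unfolding decay_integral_def
    by (rule nn_integral_eq_integral[OF integrable_decay]) (auto simp: add_nonneg_nonneg)
  finally show ?thesis by simp
qed

text \<open>This replaces integration in polar coordinates around \<open>w\<close>: a set that meets every ray from
  \<open>w\<close> in a small set has small measure, as one sees by averaging over dilations.\<close>

lemma emeasure_le_by_dilation:
  fixes w :: "'a::euclidean_space"
  assumes F [measurable]: "F \<in> sets borel" and \<epsilon>: "\<epsilon> \<ge> 0"
    and ray: "\<And>v. norm v \<le> 2 * R \<Longrightarrow> emeasure lborel {s \<in> {1/2..1::real}. w + s *\<^sub>R v \<in> F} \<le> ennreal \<epsilon>"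
  shows "emeasure lborel (F \<inter> cball w R) \<le> ennreal (2 * \<epsilon>) * emeasure lborel (cball (0::'a) (2 * R))"
proof -
  define H where "H s v = (indicator {1/2..1} s * (if norm v \<le> 2 * R then 1 else 0) * indicator F (w + s *\<^sub>R v) :: ennreal)"
    for s :: real and v :: 'a
  have [measurable]: "case_prod H \<in> borel_measurable (lborel \<Otimes>\<^sub>M lborel)"
  proof -
    have m: "(\<lambda>p. w + fst p *\<^sub>R snd p) \<in> (lborel :: real measure) \<Otimes>\<^sub>M (lborel :: 'a measure) \<rightarrow>\<^sub>M borel"
      by measurable
    have [measurable]: "(\<lambda>p. indicator F (w + fst p *\<^sub>R snd p) :: ennreal)
        \<in> borel_measurable ((lborel :: real measure) \<Otimes>\<^sub>M (lborel :: 'a measure))"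
      by (rule measurable_compose[OF m borel_measurable_indicator[OF F]])
    show ?thesis unfolding H_def split_beta' by measurable
  qed
  let ?m = "emeasure lborel (F \<inter> cball w R)"
  \<comment> \<open>Substitute \<open>x = w + s v\<close>. The Jacobian is at most 1 because
    \<open>s \<le> 1\<close>, and \<open>s \<ge> 1/2\<close> keeps \<open>v\<close> in the ball of
    radius \<open>2 * R\<close>.\<close>
  have "indicator {1/2..1} s * ?m \<le> (\<integral>\<^sup>+v. H s v \<partial>lborel)" for s :: real
  proof (cases "s \<in> {1/2..1}")
    case True
    have "?m = (\<integral>\<^sup>+v. indicator (F \<inter> cball w R) v \<partial>lborel)" by simp
    also have "\<dots> = ennreal (\<bar>s\<bar> ^ DIM('a)) * (\<integral>\<^sup>+v. indicator (F \<inter> cball w R) (w + s *\<^sub>R v) \<partial>lborel)"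
      by (rule nn_integral_lborel_affine) (use True F in \<open>auto intro!: borel_measurable_indicator\<close>)
    also have "\<dots> \<le> 1 * (\<integral>\<^sup>+v. indicator (F \<inter> cball w R) (w + s *\<^sub>R v) \<partial>lborel)"
      using True by (intro mult_right_mono) (auto simp: power_le_one)
    also have "\<dots> \<le> 1 * (\<integral>\<^sup>+v. H s v \<partial>lborel)"
    proof (intro mult_left_mono nn_integral_mono)
      fix v :: 'a
      have "norm v \<le> 2 * R" if "dist w (w + s *\<^sub>R v) \<le> R"
      proof -
        have "(1/2) * norm v \<le> \<bar>s\<bar> * norm v" using True by (intro mult_right_mono) auto
        also have "\<dots> \<le> R" using that by (simp add: dist_norm)
        finally show ?thesis by simp
      qed
      then show "indicator (F \<inter> cball w R) (w + s *\<^sub>R v) \<le> H s v"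
        using True by (auto simp: H_def indicator_def)
    qed simp
    finally show ?thesis using True by simp
  qed simp
  then have "(\<integral>\<^sup>+s. indicator {1/2..1::real} s * ?m \<partial>lborel) \<le> (\<integral>\<^sup>+s. (\<integral>\<^sup>+v. H s v \<partial>lborel) \<partial>(lborel :: real measure))"
    by (intro nn_integral_mono)
  also have "\<dots> = (\<integral>\<^sup>+v. (\<integral>\<^sup>+s. H s v \<partial>lborel) \<partial>lborel)"
    by (rule lborel_pair.Fubini'[symmetric]) simp
  also have "\<dots> \<le> (\<integral>\<^sup>+v. ennreal \<epsilon> * indicator (cball 0 (2 * R)) v \<partial>(lborel :: 'a measure))"
  proof (rule nn_integral_mono)
    fix v :: 'a
    show "(\<integral>\<^sup>+s. H s v \<partial>lborel) \<le> ennreal \<epsilon> * indicator (cball 0 (2 * R)) v"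
    proof (cases "norm v \<le> 2 * R")
      case True
      have "(\<integral>\<^sup>+s. H s v \<partial>lborel) = (\<integral>\<^sup>+s. indicator {s \<in> {1/2..1}. w + s *\<^sub>R v \<in> F} s \<partial>lborel)"
        using True by (intro nn_integral_cong) (auto simp: H_def indicator_def)
      also have "\<dots> = emeasure lborel {s \<in> {1/2..1}. w + s *\<^sub>R v \<in> F}"
        by (rule nn_integral_indicator) measurable
      also have "\<dots> \<le> ennreal \<epsilon>" by (rule ray[OF True])
      finally show ?thesis using True by (simp add: indicator_def)
    qed (simp add: H_def)
  qed
  also have "\<dots> = ennreal \<epsilon> * emeasure lborel (cball (0::'a) (2 * R))"
    by (simp add: nn_integral_cmult_indicator)
  \<comment> \<open>The interval of dilations has length \<open>1/2\<close>, whence the factor 2 in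
    the claim.\<close>
  finally have "ennreal (1/2) * ?m \<le> ennreal \<epsilon> * emeasure lborel (cball (0::'a) (2 * R))"
    by (simp add: nn_integral_multc)
  then have le: "ennreal 2 * (ennreal (1/2) * ?m) \<le> ennreal 2 * (ennreal \<epsilon> * emeasure lborel (cball (0::'a) (2 * R)))"
    by (rule mult_left_mono) simp
  have "ennreal 2 * ennreal (1/2) = 1" by (subst ennreal_mult[symmetric]) simp_all
  then have "?m = ennreal 2 * (ennreal (1/2) * ?m)" by (simp only: mult.assoc[symmetric] mult_1_left)
  also note le
  also have "ennreal 2 * (ennreal \<epsilon> * X) = ennreal (2 * \<epsilon>) * X" for X
    using \<epsilon> by (simp only: mult.assoc[symmetric] ennreal_mult zero_le_numeral)
  finally show ?thesis .
qed

subsection \<open>Polynomials on separated nodes\<close>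

text \<open>Dividing by \<open>x - s\<close> at one node leaves a quotient of smaller degree that is
  at most \<open>2 * \<delta> / \<eta>\<close> at the remaining nodes, because they keep distance
  \<open>\<eta>\<close> from \<open>s\<close>. Induction on the nodes then gives an explicit
  constant.\<close>

lemma poly_bound_from_nodes:
  fixes p :: "real poly"
  assumes "finite S" "degree p < card S" "0 < \<eta>"
    and "\<And>s s'. s \<in> S \<Longrightarrow> s' \<in> S \<Longrightarrow> s \<noteq> s' \<Longrightarrow> \<eta> \<le> \<bar>s - s'\<bar>"
    and "\<And>s. s \<in> S \<Longrightarrow> \<bar>poly p s\<bar> \<le> \<delta>" and "\<And>s. s \<in> S \<Longrightarrow> \<bar>t - s\<bar> \<le> T"
  shows "\<bar>poly p t\<bar> \<le> \<delta> * (1 + 2 * T / \<eta>) ^ card S"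
  using assms
proof (induction S arbitrary: p \<delta> rule: finite_induct)
  case empty
  then show ?case by simp
next
  case (insert s S)
  have \<delta>: "0 \<le> \<delta>" using insert.prems(4)[of s] by simp
  have T: "0 \<le> T" using insert.prems(5)[of s] by simp
  define X where "X = (1 + 2 * T / \<eta>) ^ card S"
  have base: "1 \<le> 1 + 2 * T / \<eta>" using T insert.prems(2) by simp
  then have X: "1 \<le> X" unfolding X_def by (rule one_le_power)
  \<comment> \<open>One factor of the power is expanded to match the recursion:
    \<open>\<delta>\<close> for the value at \<open>s\<close>, and
    \<open>T * 2 * \<delta> / \<eta>\<close> for the quotient.\<close>
  have goal: "\<delta> * (1 + 2 * T / \<eta>) ^ card (insert s S) = \<delta> * X + 2 * \<delta> / \<eta> * T * X"
    using insert.hyps by (simp add: X_def algebra_simps)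
  show ?case
  proof (cases "S = {}")
    case True
    then have "degree p = 0" using insert.prems(1) by simp
    then obtain a where "p = [:a:]" by (rule degree_eq_zeroE)
    then have "\<bar>poly p t\<bar> \<le> \<delta>" using insert.prems(4)[of s] by simp
    also have "\<dots> \<le> \<delta> * (1 + 2 * T / \<eta>) ^ card (insert s S)"
      using \<delta> one_le_power[OF base] by (simp add: mult_le_cancel_left1)
    finally show ?thesis .
  next
    case False
    define q where "q = synthetic_div p s"
    have p: "poly p x = (x - s) * poly q x + poly p s" for x
      by (subst synthetic_div_correct'[of s p, symmetric]) (simp add: q_def algebra_simps)
    have "card S > 0" using False insert.hyps by (simp add: card_gt_0_iff)
    then have dq: "degree q < card S"
      using insert.prems(1) insert.hyps by (simp add: q_def degree_synthetic_div)
    have "\<bar>poly q t\<bar> \<le> (2 * \<delta> / \<eta>) * X"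
      unfolding X_def
    proof (rule insert.IH[OF dq insert.prems(2)])
      fix s' assume s': "s' \<in> S"
      then have ne: "s \<noteq> s'" using insert.hyps by blast
      have sep: "\<eta> \<le> \<bar>s' - s\<bar>" using insert.prems(3)[of s' s] s' ne by auto
      have "\<bar>s' - s\<bar> * \<bar>poly q s'\<bar> = \<bar>poly p s' - poly p s\<bar>"
        using p[of s'] by (simp add: abs_mult[symmetric])
      also have "\<dots> \<le> 2 * \<delta>" using insert.prems(4)[of s] insert.prems(4)[of s'] s' by auto
      finally have "\<eta> * \<bar>poly q s'\<bar> \<le> 2 * \<delta>"
        using mult_right_mono[OF sep, of "\<bar>poly q s'\<bar>"] by simp
      then show "\<bar>poly q s'\<bar> \<le> 2 * \<delta> / \<eta>" using insert.prems(2) by (simp add: pos_le_divide_eq mult.commute)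
    qed (use insert.prems in auto)
    then have "\<bar>t - s\<bar> * \<bar>poly q t\<bar> \<le> T * ((2 * \<delta> / \<eta>) * X)"
      using insert.prems(5)[of s] T by (intro mult_mono) auto
    then have "\<bar>poly p t\<bar> \<le> T * ((2 * \<delta> / \<eta>) * X) + \<delta>"
      using insert.prems(4)[of s] abs_triangle_ineq[of "(t - s) * poly q t" "poly p s"]
      by (subst p) (simp add: abs_mult)
    moreover have "\<delta> \<le> \<delta> * X" using \<delta> X by (simp add: mult_le_cancel_left1)
    moreover have "T * ((2 * \<delta> / \<eta>) * X) = 2 * \<delta> / \<eta> * T * X" by simp
    ultimately show ?thesis unfolding goal by linarith
  qed
qed

text \<open>Greedy selection: if \<open>k\<close> separated points of \<open>E\<close> cannot be
  extended, the intervals of radius \<open>\<eta>\<close> about them cover \<open>E\<close>.\<close>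

lemma separated_nodes_or_small:
  fixes E :: "real set"
  assumes E: "E \<in> sets borel" and \<eta>: "0 < \<eta>"
  shows "(\<exists>S\<subseteq>E. finite S \<and> card S = k \<and> (\<forall>s\<in>S. \<forall>s'\<in>S. s \<noteq> s' \<longrightarrow> \<eta> \<le> \<bar>s - s'\<bar>))
    \<or> emeasure lborel E \<le> ennreal (2 * real k * \<eta>)"
proof (induction k)
  case 0
  show ?case by (intro disjI1 exI[of _ "{}"]) simp
next
  case (Suc k)
  have mono: "ennreal (2 * real k * \<eta>) \<le> ennreal (2 * real (Suc k) * \<eta>)"
    using \<eta> by (intro ennreal_leI mult_right_mono) auto
  show ?case
  proof (cases "emeasure lborel E \<le> ennreal (2 * real k * \<eta>)")
    case True
    then show ?thesis using mono order_trans by blast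
  next
    case False
    then obtain S where S: "S \<subseteq> E" "finite S" "card S = k"
      "\<And>s s'. s \<in> S \<Longrightarrow> s' \<in> S \<Longrightarrow> s \<noteq> s' \<Longrightarrow> \<eta> \<le> \<bar>s - s'\<bar>" using Suc.IH by blast
    show ?thesis
    proof (cases "\<exists>x\<in>E. \<forall>s\<in>S. \<eta> \<le> \<bar>x - s\<bar>")
      case True
      then obtain x where x: "x \<in> E" "\<And>s. s \<in> S \<Longrightarrow> \<eta> \<le> \<bar>x - s\<bar>" by blast
      have "x \<notin> S" using x(2)[of x] \<eta> by auto
      then have "card (insert x S) = Suc k" using S by simp
      moreover have "\<eta> \<le> \<bar>s - s'\<bar>" if "s \<in> insert x S" "s' \<in> insert x S" "s \<noteq> s'" for s s'
        using that x(2)[of s] x(2)[of s'] S(4)[of s s'] by (auto simp: abs_minus_commute)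
      ultimately show ?thesis using S x by (intro disjI1 exI[of _ "insert x S"]) auto
    next
      case False
      then have "E \<subseteq> (\<Union>s\<in>S. {s - \<eta>..s + \<eta>})" by (force simp: not_le abs_less_iff)
      then have "emeasure lborel E \<le> emeasure lborel (\<Union>s\<in>S. {s - \<eta>..s + \<eta>})"
        by (rule emeasure_mono) (simp add: S(2) sets.finite_UN)
      also have "\<dots> \<le> (\<Sum>s\<in>S. emeasure lborel {s - \<eta>..s + \<eta>})"
        by (rule emeasure_subadditive_finite) (use S in auto)
      also have "\<dots> = (\<Sum>s\<in>S. ennreal (2 * \<eta>))"
        using \<eta> by (intro sum.cong refl) simp
      also have "\<dots> = ennreal (2 * real k * \<eta>)"
        using S(3) \<eta> by (simp add: ennreal_of_nat_eq_real_of_nat ennreal_mult[symmetric] mult.left_commute)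
      finally show ?thesis using mono order_trans by blast
    qed
  qed
qed

subsection \<open>Localized tight frames\<close>

text \<open>A continuous Parseval frame: \<open>\<kappa>\<close> normalizes the measure and
  \<open>\<Gamma> k\<close> bounds the off-diagonal decay of order \<open>k\<close> of its Gram
  kernel. Both are parameters apart from \<open>\<psi>\<close>, so that estimates in terms of them
  hold uniformly over a family of frames.\<close>

locale localized_frame =
  fixes \<kappa> :: real and \<Gamma> :: "nat \<Rightarrow> real" and \<psi> :: "'w::euclidean_space \<Rightarrow> 'a::euclidean_space l2"
  assumes \<kappa>_pos: "0 < \<kappa>"
    and continuous_\<psi>: "continuous_on UNIV \<psi>"
    and norm_\<psi>: "norm (\<psi> w) = 1"
    and parseval: "ennreal \<kappa> * (\<integral>\<^sup>+w. ennreal ((cmod (cinner f (\<psi> w)))\<^sup>2) \<partial>lborel) = ennreal ((norm f)\<^sup>2)"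
    and decay: "(1 + norm (z - w)) ^ k * cmod (cinner (\<psi> z) (\<psi> w)) \<le> \<Gamma> k"
begin

lemma measurable_coeff [measurable]: "(\<lambda>w. cinner f (\<psi> w)) \<in> borel_measurable borel"
  by (intro borel_measurable_continuous_onI continuous_intros continuous_\<psi>)

lemma \<Gamma>_ge_1: "1 \<le> \<Gamma> k"
  using decay[of 0 0 k] norm_\<psi>[of 0] by (simp add: cinner_self)

lemma integrable_coeff_sq: "integrable lborel (\<lambda>w. (cmod (cinner f (\<psi> w)))\<^sup>2)"
proof (rule integrableI_bounded)
  have "(\<integral>\<^sup>+w. ennreal ((cmod (cinner f (\<psi> w)))\<^sup>2) \<partial>lborel) \<noteq> \<infinity>"
  proof
    assume "(\<integral>\<^sup>+w. ennreal ((cmod (cinner f (\<psi> w)))\<^sup>2) \<partial>lborel) = \<infinity>"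
    then show False using parseval[of f] \<kappa>_pos by (simp add: ennreal_mult_top)
  qed
  then show "(\<integral>\<^sup>+w. ennreal (norm ((cmod (cinner f (\<psi> w)))\<^sup>2)) \<partial>lborel) < \<infinity>"
    by (simp add: less_top)
qed measurable

lemma parseval_integral: "\<kappa> * (\<integral>w. (cmod (cinner f (\<psi> w)))\<^sup>2 \<partial>lborel) = (norm f)\<^sup>2"
proof -
  have "ennreal (\<kappa> * (\<integral>w. (cmod (cinner f (\<psi> w)))\<^sup>2 \<partial>lborel))
      = ennreal \<kappa> * (\<integral>\<^sup>+w. ennreal ((cmod (cinner f (\<psi> w)))\<^sup>2) \<partial>lborel)"
    using \<kappa>_pos by (subst nn_integral_eq_integral[OF integrable_coeff_sq]) (auto simp: ennreal_mult')
  then have "ennreal (\<kappa> * (\<integral>w. (cmod (cinner f (\<psi> w)))\<^sup>2 \<partial>lborel)) = ennreal ((norm f)\<^sup>2)"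
    using parseval by simp
  then show ?thesis using \<kappa>_pos by (subst (asm) ennreal_inj) (auto intro!: mult_nonneg_nonneg)
qed

lemma integrable_coeff_mult: "integrable lborel (\<lambda>w. cinner f (\<psi> w) * cnj (cinner g (\<psi> w)))"
proof (rule Bochner_Integration.integrable_bound)
  show "integrable lborel (\<lambda>w. (cmod (cinner f (\<psi> w)))\<^sup>2 + (cmod (cinner g (\<psi> w)))\<^sup>2)"
    by (intro Bochner_Integration.integrable_add integrable_coeff_sq)
  have "x * y \<le> x\<^sup>2 + y\<^sup>2" if "0 \<le> x" "0 \<le> y" for x y :: real
    using sum_squares_bound[of x y] mult_nonneg_nonneg[OF that] by linarith
  then show "AE w in lborel. norm (cinner f (\<psi> w) * cnj (cinner g (\<psi> w)))
      \<le> norm ((cmod (cinner f (\<psi> w)))\<^sup>2 + (cmod (cinner g (\<psi> w)))\<^sup>2)"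
    by (intro AE_I2) (simp add: norm_mult)
qed measurable

lemma Re_polarized:
  "Re (cinner f g) = \<kappa> * (\<integral>w. Re (cinner f (\<psi> w) * cnj (cinner g (\<psi> w))) \<partial>lborel)"
proof -
  have sq: "(cmod (cinner (f + g) (\<psi> w)))\<^sup>2 = (cmod (cinner f (\<psi> w)))\<^sup>2
      + 2 * Re (cinner f (\<psi> w) * cnj (cinner g (\<psi> w))) + (cmod (cinner g (\<psi> w)))\<^sup>2" for w
    unfolding cinner_add_left cmod_power2 by (simp add: power2_eq_square algebra_simps)
  have "(norm (f + g))\<^sup>2 = \<kappa> * (\<integral>w. (cmod (cinner f (\<psi> w)))\<^sup>2 \<partial>lborel)
      + 2 * (\<kappa> * (\<integral>w. Re (cinner f (\<psi> w) * cnj (cinner g (\<psi> w))) \<partial>lborel))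
      + \<kappa> * (\<integral>w. (cmod (cinner g (\<psi> w)))\<^sup>2 \<partial>lborel)"
    unfolding parseval_integral[of "f + g", symmetric] sq
    using integrable_coeff_sq[of f] integrable_coeff_sq[of g] integrable_Re[OF integrable_coeff_mult[of f g]]
    by (simp add: distrib_left del: times_complex.simps)
  then show ?thesis unfolding parseval_integral norm_add_sq by simp
qed

lemma polarized: "cinner f g = complex_of_real \<kappa> * (\<integral>w. cinner f (\<psi> w) * cnj (cinner g (\<psi> w)) \<partial>lborel)"
proof (rule complex_eqI)
  let ?I = "\<integral>w. cinner f (\<psi> w) * cnj (cinner g (\<psi> w)) \<partial>lborel"
  have "Re ?I = (\<integral>w. Re (cinner f (\<psi> w) * cnj (cinner g (\<psi> w))) \<partial>lborel)"
    by (rule integral_Re[symmetric, OF integrable_coeff_mult])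
  then show "Re (cinner f g) = Re (complex_of_real \<kappa> * ?I)"
    unfolding Re_polarized by simp
  have "Im (cinner f g) = Re (cinner f (\<i> *\<^sub>C g))" by (simp add: cinner_scaleC_right)
  also have "\<dots> = \<kappa> * (\<integral>w. Re (cinner f (\<psi> w) * cnj (cinner (\<i> *\<^sub>C g) (\<psi> w))) \<partial>lborel)"
    by (rule Re_polarized)
  also have "(\<lambda>w. Re (cinner f (\<psi> w) * cnj (cinner (\<i> *\<^sub>C g) (\<psi> w))))
      = (\<lambda>w. Im (cinner f (\<psi> w) * cnj (cinner g (\<psi> w))))"
    by (simp add: cinner_scaleC_left fun_eq_iff)
  also have "(\<integral>w. Im (cinner f (\<psi> w) * cnj (cinner g (\<psi> w))) \<partial>lborel) = Im ?I"
    by (rule integral_Im[OF integrable_coeff_mult])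
  finally show "Im (cinner f g) = Im (complex_of_real \<kappa> * ?I)" by simp
qed

text \<open>A convolution majorant of the Gram kernel. Twice the dimension gives integrability; the
  one additional power makes the mass beyond distance \<open>R\<close> at most a constant over
  \<open>1 + R\<close>.\<close>

definition kernel :: "'w \<Rightarrow> real" where
  "kernel z = \<Gamma> (2 * DIM('w) + 1) / (1 + norm z) ^ (2 * DIM('w) + 1)"

lemma kernel_measurable [measurable]: "kernel \<in> borel_measurable borel"
  unfolding kernel_def by measurable

lemma kernel_nonneg: "0 \<le> kernel z"
  using \<Gamma>_ge_1[of "2 * DIM('w) + 1"] by (simp add: kernel_def add_nonneg_nonneg)

lemma gram_le_kernel: "cmod (cinner (\<psi> z) (\<psi> w)) \<le> kernel (z - w)"
  using decay[of z w "2 * DIM('w) + 1"]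
  by (simp add: kernel_def pos_le_divide_eq add_pos_nonneg zero_less_power mult.commute)

lemma kernel_le: "kernel z \<le> \<Gamma> (2 * DIM('w) + 1)"
  using \<Gamma>_ge_1[of "2 * DIM('w) + 1"] one_le_power[of "1 + norm z" "2 * DIM('w) + 1"]
  by (simp add: kernel_def pos_divide_le_eq mult_le_cancel_left1)

lemma kernel_le_far:
  assumes "0 \<le> R" "R \<le> norm z"
  shows "kernel z \<le> \<Gamma> (2 * DIM('w) + 1) / (1 + R) * (1 / (1 + norm z) ^ (2 * DIM('w)))"
proof -
  have "\<Gamma> (2 * DIM('w) + 1) / ((1 + norm z) * (1 + norm z) ^ (2 * DIM('w)))
      \<le> \<Gamma> (2 * DIM('w) + 1) / ((1 + R) * (1 + norm z) ^ (2 * DIM('w)))"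
    using assms \<Gamma>_ge_1[of "2 * DIM('w) + 1"]
    by (intro divide_left_mono mult_right_mono mult_pos_pos zero_less_power) (auto simp: add_pos_nonneg)
  then show ?thesis by (simp add: kernel_def)
qed

definition kernel_mass :: real where
  "kernel_mass = \<Gamma> (2 * DIM('w) + 1) * decay_integral TYPE('w)"

lemma kernel_mass_nonneg: "0 \<le> kernel_mass"
  using \<Gamma>_ge_1[of "2 * DIM('w) + 1"] decay_integral_nonneg[where 'a='w] by (simp add: kernel_mass_def)

lemma nn_integral_kernel: "(\<integral>\<^sup>+z. ennreal (kernel (z - w)) \<partial>lborel) \<le> ennreal kernel_mass"
proof -
  have "(\<integral>\<^sup>+z. ennreal (kernel (z - w)) \<partial>lborel)
      \<le> (\<integral>\<^sup>+z. ennreal (\<Gamma> (2 * DIM('w) + 1)) * ennreal (1 / (1 + norm (z - w)) ^ (2 * DIM('w))) \<partial>lborel)"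
  proof (rule nn_integral_mono)
    fix z
    show "ennreal (kernel (z - w)) \<le> ennreal (\<Gamma> (2 * DIM('w) + 1)) * ennreal (1 / (1 + norm (z - w)) ^ (2 * DIM('w)))"
      using kernel_le_far[of 0 "z - w"] \<Gamma>_ge_1[of "2 * DIM('w) + 1"]
      by (subst ennreal_mult[symmetric]) (auto intro!: ennreal_leI simp: add_nonneg_nonneg)
  qed
  also have "\<dots> = ennreal kernel_mass"
    using \<Gamma>_ge_1[of "2 * DIM('w) + 1"]
    by (simp add: nn_integral_cmult nn_integral_decay kernel_mass_def ennreal_mult decay_integral_nonneg)
  finally show ?thesis .
qed

text \<open>The coefficient at \<open>w\<close> is reproduced by integrating the other coefficients
  against the Gram kernel. Cauchy-Schwarz with the kernel split into two square roots gives the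
  squared bound.\<close>

lemma coeff_sq_le:
  "ennreal ((cmod (cinner f (\<psi> w)))\<^sup>2)
    \<le> ennreal (\<kappa>\<^sup>2 * kernel_mass) * (\<integral>\<^sup>+z. ennreal ((cmod (cinner f (\<psi> z)))\<^sup>2 * kernel (z - w)) \<partial>lborel)"
proof -
  let ?a = "\<lambda>z. ennreal (cmod (cinner f (\<psi> z)) * sqrt (kernel (z - w)))"
  let ?b = "\<lambda>z. ennreal (sqrt (kernel (z - w)))"
  have 1: "ennreal (cmod (cinner f (\<psi> w))) \<le> ennreal \<kappa> * (\<integral>\<^sup>+z. ?a z * ?b z \<partial>lborel)"
  proof -
    have "cmod (cinner f (\<psi> w)) = \<kappa> * cmod (\<integral>z. cinner f (\<psi> z) * cnj (cinner (\<psi> w) (\<psi> z)) \<partial>lborel)"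
      using \<kappa>_pos by (subst polarized) (simp add: norm_mult)
    also have "ennreal \<dots> = ennreal \<kappa> * ennreal (cmod (\<integral>z. cinner f (\<psi> z) * cnj (cinner (\<psi> w) (\<psi> z)) \<partial>lborel))"
      using \<kappa>_pos by (simp add: ennreal_mult)
    also have "\<dots> \<le> ennreal \<kappa> * (\<integral>\<^sup>+z. ennreal (cmod (cinner f (\<psi> z) * cnj (cinner (\<psi> w) (\<psi> z)))) \<partial>lborel)"
      by (intro mult_left_mono integral_norm_bound_ennreal integrable_coeff_mult) simp
    also have "\<dots> \<le> ennreal \<kappa> * (\<integral>\<^sup>+z. ?a z * ?b z \<partial>lborel)"
    proof (intro mult_left_mono nn_integral_mono)
      fix z
      have "?a z * ?b z = ennreal (cmod (cinner f (\<psi> z)) * (sqrt (kernel (z - w)) * sqrt (kernel (z - w))))"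
        by (subst ennreal_mult[symmetric]) (simp_all add: kernel_nonneg)
      also have "sqrt (kernel (z - w)) * sqrt (kernel (z - w)) = kernel (z - w)"
        by (simp add: kernel_nonneg)
      finally have eq: "?a z * ?b z = ennreal (cmod (cinner f (\<psi> z)) * kernel (z - w))" .
      have "cmod (cinner (\<psi> w) (\<psi> z)) \<le> kernel (z - w)"
        using gram_le_kernel[of w z] by (simp add: kernel_def norm_minus_commute)
      then show "ennreal (cmod (cinner f (\<psi> z) * cnj (cinner (\<psi> w) (\<psi> z)))) \<le> ?a z * ?b z"
        unfolding eq by (intro ennreal_leI) (simp add: norm_mult mult_left_mono)
    qed simp
    finally show ?thesis .
  qed
  have "ennreal ((cmod (cinner f (\<psi> w)))\<^sup>2) = (ennreal (cmod (cinner f (\<psi> w))))\<^sup>2"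
    by (simp add: ennreal_power)
  also have "\<dots> \<le> (ennreal \<kappa> * (\<integral>\<^sup>+z. ?a z * ?b z \<partial>lborel))\<^sup>2"
    by (rule power_mono[OF 1]) simp
  also have "\<dots> \<le> (ennreal \<kappa>)\<^sup>2 * ((\<integral>\<^sup>+z. (?a z)\<^sup>2 \<partial>lborel) * (\<integral>\<^sup>+z. (?b z)\<^sup>2 \<partial>lborel))"
    unfolding power_mult_distrib by (intro mult_left_mono Cauchy_Schwarz_nn_integral) simp_all
  also have "(\<integral>\<^sup>+z. (?b z)\<^sup>2 \<partial>lborel) = (\<integral>\<^sup>+z. ennreal (kernel (z - w)) \<partial>lborel)"
    by (intro nn_integral_cong) (simp add: ennreal_power kernel_nonneg)
  also have "(\<integral>\<^sup>+z. (?a z)\<^sup>2 \<partial>lborel)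
      = (\<integral>\<^sup>+z. ennreal ((cmod (cinner f (\<psi> z)))\<^sup>2 * kernel (z - w)) \<partial>lborel)"
    by (intro nn_integral_cong) (simp add: ennreal_power power_mult_distrib kernel_nonneg)
  also have "(ennreal \<kappa>)\<^sup>2 * ((\<integral>\<^sup>+z. ennreal ((cmod (cinner f (\<psi> z)))\<^sup>2 * kernel (z - w)) \<partial>lborel)
        * (\<integral>\<^sup>+z. ennreal (kernel (z - w)) \<partial>lborel))
      \<le> (ennreal \<kappa>)\<^sup>2 * ((\<integral>\<^sup>+z. ennreal ((cmod (cinner f (\<psi> z)))\<^sup>2 * kernel (z - w)) \<partial>lborel)
        * ennreal kernel_mass)"
    by (intro mult_left_mono nn_integral_kernel) simp_all
  also have "\<dots> = ennreal (\<kappa>\<^sup>2 * kernel_mass)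
      * (\<integral>\<^sup>+z. ennreal ((cmod (cinner f (\<psi> z)))\<^sup>2 * kernel (z - w)) \<partial>lborel)"
    using \<kappa>_pos kernel_mass_nonneg by (simp add: ennreal_mult ennreal_power mult.commute mult.left_commute mult.assoc)
  finally show ?thesis .
qed

text \<open>The Schur test: integrate \<open>coeff_sq_le\<close> over \<open>F\<close> and exchange
  the integrals, so that only the kernel mass on \<open>F\<close> as seen from each point
  \<open>z\<close> enters.\<close>

lemma schur_bound:
  assumes F [measurable]: "F \<in> sets borel" and \<epsilon>: "0 \<le> \<epsilon>"
    and small: "\<And>z. (\<integral>\<^sup>+w. ennreal (kernel (z - w)) * indicator F w \<partial>lborel) \<le> ennreal \<epsilon>"
  shows "ennreal \<kappa> * (\<integral>\<^sup>+w. ennreal ((cmod (cinner f (\<psi> w)))\<^sup>2) * indicator F w \<partial>lborel)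
    \<le> ennreal (\<kappa>\<^sup>2 * kernel_mass * \<epsilon> * (norm f)\<^sup>2)"
proof -
  let ?c = "ennreal (\<kappa>\<^sup>2 * kernel_mass)"
  let ?V = "\<lambda>z. ennreal ((cmod (cinner f (\<psi> z)))\<^sup>2)"
  have k: "ennreal ((cmod (cinner f (\<psi> z)))\<^sup>2 * kernel (z - w)) = ?V z * ennreal (kernel (z - w))" for z w
    by (simp add: ennreal_mult kernel_nonneg)
  have [measurable]: "(\<lambda>p. kernel (snd p - fst p)) \<in> borel_measurable (lborel \<Otimes>\<^sub>M lborel)"
    by measurable
  have "(\<integral>\<^sup>+w. ?V w * indicator F w \<partial>lborel)
      \<le> (\<integral>\<^sup>+w. ?c * (\<integral>\<^sup>+z. ?V z * ennreal (kernel (z - w)) * indicator F w \<partial>lborel) \<partial>lborel)"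
  proof (rule nn_integral_mono)
    fix w
    show "?V w * indicator F w \<le> ?c * (\<integral>\<^sup>+z. ?V z * ennreal (kernel (z - w)) * indicator F w \<partial>lborel)"
      using coeff_sq_le[of f w] unfolding k by (auto simp: indicator_def)
  qed
  also have "\<dots> = ?c * (\<integral>\<^sup>+w. (\<integral>\<^sup>+z. ?V z * ennreal (kernel (z - w)) * indicator F w \<partial>lborel) \<partial>lborel)"
    by (rule nn_integral_cmult) measurable
  also have "(\<integral>\<^sup>+w. (\<integral>\<^sup>+z. ?V z * ennreal (kernel (z - w)) * indicator F w \<partial>lborel) \<partial>lborel)
      = (\<integral>\<^sup>+z. (\<integral>\<^sup>+w. ?V z * ennreal (kernel (z - w)) * indicator F w \<partial>lborel) \<partial>lborel)"
    by (rule lborel_pair.Fubini') measurable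
  also have "\<dots> \<le> (\<integral>\<^sup>+z. ?V z * ennreal \<epsilon> \<partial>lborel)"
  proof (rule nn_integral_mono)
    fix z
    have "(\<integral>\<^sup>+w. ?V z * ennreal (kernel (z - w)) * indicator F w \<partial>lborel)
        = ?V z * (\<integral>\<^sup>+w. ennreal (kernel (z - w)) * indicator F w \<partial>lborel)"
      unfolding mult.assoc by (rule nn_integral_cmult) measurable
    also have "\<dots> \<le> ?V z * ennreal \<epsilon>" by (intro mult_left_mono small) simp
    finally show "(\<integral>\<^sup>+w. ?V z * ennreal (kernel (z - w)) * indicator F w \<partial>lborel) \<le> ?V z * ennreal \<epsilon>" .
  qed
  also have "\<dots> = (\<integral>\<^sup>+z. ?V z \<partial>lborel) * ennreal \<epsilon>"
    by (rule nn_integral_multc) measurable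
  finally have "(\<integral>\<^sup>+w. ?V w * indicator F w \<partial>lborel) \<le> ?c * ((\<integral>\<^sup>+z. ?V z \<partial>lborel) * ennreal \<epsilon>)"
    by (simp add: mult_left_mono)
  then have "ennreal \<kappa> * (\<integral>\<^sup>+w. ?V w * indicator F w \<partial>lborel)
      \<le> ennreal \<kappa> * (?c * ((\<integral>\<^sup>+z. ?V z \<partial>lborel) * ennreal \<epsilon>))"
    by (rule mult_left_mono) simp
  also have "\<dots> = ?c * ((ennreal \<kappa> * (\<integral>\<^sup>+z. ?V z \<partial>lborel)) * ennreal \<epsilon>)"
    by (simp only: mult.assoc mult.left_commute)
  also have "\<dots> = ennreal (\<kappa>\<^sup>2 * kernel_mass * \<epsilon> * (norm f)\<^sup>2)"
    unfolding parseval using \<epsilon> kernel_mass_nonneg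
    by (simp add: ennreal_mult[symmetric] mult.assoc mult.commute mult.left_commute)
  finally show ?thesis .
qed

text \<open>Frame vectors that escape to infinity are weakly null: in \<open>coeff_sq_le\<close> the
  kernel centred at \<open>W n\<close> tends to zero pointwise, and dominated convergence
  applies.\<close>

lemma coeff_tendsto_zero:
  assumes "filterlim W at_infinity sequentially"
  shows "(\<lambda>n. cinner f (\<psi> (W n))) \<longlonglongrightarrow> 0"
proof -
  let ?g = "\<lambda>n z. (cmod (cinner f (\<psi> z)))\<^sup>2 * kernel (z - W n)"
  define G where "G = \<Gamma> (2 * DIM('w) + 1)"
  have int: "integrable lborel (\<lambda>z. (cmod (cinner f (\<psi> z)))\<^sup>2 * G)"
    by (intro integrable_mult_left integrable_coeff_sq)
  have bound: "norm (?g n z) \<le> (cmod (cinner f (\<psi> z)))\<^sup>2 * G" for n z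
    using kernel_le[of "z - W n"] kernel_nonneg[of "z - W n"] by (simp add: G_def mult_left_mono)
  have lim: "(\<lambda>n. ?g n z) \<longlonglongrightarrow> 0" for z
  proof -
    have "filterlim (\<lambda>n. W n) at_infinity sequentially" by (rule assms)
    then have inf: "filterlim (\<lambda>n. norm (W n)) at_top sequentially"
      by (rule filterlim_at_infinity_imp_norm_at_top)
    have "(\<lambda>n. kernel (z - W n)) \<longlonglongrightarrow> 0"
    proof (rule Lim_null_comparison)
      show "\<forall>\<^sub>F n in sequentially. norm (kernel (z - W n)) \<le> G * inverse (1 - norm z + norm (W n))"
        using filterlim_at_top_dense[THEN iffD1, OF inf, rule_format, of "norm z"]
      proof eventually_elim
        case (elim n)
        have "1 - norm z + norm (W n) \<le> 1 + norm (z - W n)"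
          using norm_triangle_ineq2[of "W n" z] by (simp add: norm_minus_commute)
        also have "\<dots> \<le> (1 + norm (z - W n)) ^ (2 * DIM('w) + 1)"
          by (rule self_le_power) simp_all
        finally have "kernel (z - W n) \<le> G / (1 - norm z + norm (W n))"
          unfolding kernel_def G_def using elim \<Gamma>_ge_1[of "2 * DIM('w) + 1"]
          by (intro divide_left_mono mult_pos_pos zero_less_power) (auto simp: add_pos_nonneg)
        then show ?case using kernel_nonneg[of "z - W n"] by (simp add: divide_inverse)
      qed
      have "filterlim (\<lambda>n. (1 - norm z) + norm (W n)) at_top sequentially"
        by (rule filterlim_tendsto_add_at_top[OF tendsto_const inf])
      then have "(\<lambda>n. inverse ((1 - norm z) + norm (W n))) \<longlonglongrightarrow> 0"
        by (rule tendsto_inverse_0_at_top)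
      from tendsto_mult_right_zero[OF this]
      show "(\<lambda>n. G * inverse (1 - norm z + norm (W n))) \<longlonglongrightarrow> 0" .
    qed
    from tendsto_mult_right_zero[OF this] show ?thesis .
  qed
  have conv: "(\<lambda>n. \<integral>z. ?g n z \<partial>lborel) \<longlonglongrightarrow> (\<integral>z. 0 \<partial>(lborel :: 'w measure))"
    by (rule integral_dominated_convergence[OF _ _ int]) (use lim bound in auto)
  have le: "(cmod (cinner f (\<psi> (W n))))\<^sup>2 \<le> (\<kappa>\<^sup>2 * kernel_mass) * (\<integral>z. ?g n z \<partial>lborel)" for n
  proof -
    have "integrable lborel (?g n)"
    proof (rule Bochner_Integration.integrable_bound[OF int])
      show "AE z in lborel. norm (?g n z) \<le> norm ((cmod (cinner f (\<psi> z)))\<^sup>2 * G)"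
        by (rule AE_I2, rule order_trans[OF bound]) simp
    qed measurable
    then have "(\<integral>\<^sup>+z. ennreal (?g n z) \<partial>lborel) = ennreal (\<integral>z. ?g n z \<partial>lborel)"
      by (rule nn_integral_eq_integral) (simp add: kernel_nonneg)
    then have "ennreal ((cmod (cinner f (\<psi> (W n))))\<^sup>2) \<le> ennreal (\<kappa>\<^sup>2 * kernel_mass) * ennreal (\<integral>z. ?g n z \<partial>lborel)"
      using coeff_sq_le[of f "W n"] by simp
    also have "\<dots> = ennreal ((\<kappa>\<^sup>2 * kernel_mass) * (\<integral>z. ?g n z \<partial>lborel))"
      using kernel_mass_nonneg by (subst ennreal_mult) (auto intro!: integral_nonneg_AE simp: kernel_nonneg)
    finally show ?thesis
      using kernel_mass_nonneg by (subst (asm) ennreal_le_iff) (auto intro!: mult_nonneg_nonneg integral_nonneg_AE simp: kernel_nonneg)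
  qed
  have "(\<lambda>n. (cmod (cinner f (\<psi> (W n))))\<^sup>2) \<longlonglongrightarrow> 0"
  proof (rule Lim_null_comparison[OF always_eventually])
    show "\<forall>n. norm ((cmod (cinner f (\<psi> (W n))))\<^sup>2) \<le> (\<kappa>\<^sup>2 * kernel_mass) * (\<integral>z. ?g n z \<partial>lborel)"
      using le by simp
    show "(\<lambda>n. (\<kappa>\<^sup>2 * kernel_mass) * (\<integral>z. ?g n z \<partial>lborel)) \<longlonglongrightarrow> 0"
      using tendsto_mult_right_zero[of "\<lambda>n. \<integral>z. ?g n z \<partial>lborel"] conv by simp
  qed
  then have "(\<lambda>n. sqrt ((cmod (cinner f (\<psi> (W n))))\<^sup>2)) \<longlonglongrightarrow> sqrt 0" by (intro tendsto_intros)
  then show ?thesis by (simp add: tendsto_norm_zero_iff)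
qed

lemma eq_zero_if_orthogonal: "(\<And>w. cinner f (\<psi> w) = 0) \<Longrightarrow> f = 0"
  using parseval_integral[of f] by simp

end

subsection \<open>Symbols that are nearly polynomial along lines\<close>

text \<open>\<open>M\<close> measures the deviation from a polynomial at unit distance. The
  polynomial may depend on the base point and the direction; only one-variable polynomials on rays
  are ever used.\<close>

definition tame :: "nat \<Rightarrow> real \<Rightarrow> ('w::euclidean_space \<Rightarrow> real) \<Rightarrow> bool" where
  "tame K M b \<longleftrightarrow> continuous_on UNIV b \<and> 0 < K \<and> 0 \<le> M \<and>
     (\<forall>w v. \<exists>p. degree p < K \<and> (\<forall>t\<ge>0. \<bar>b (w + t *\<^sub>R v) - poly p t\<bar> \<le> M * (t * norm v) ^ K))"

text \<open>The approximation error is paid at the nodes, where it is amplified by the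
  extrapolation, and once more at \<open>t\<close>.\<close>

lemma tame_node_bound:
  assumes b: "tame K M b" and S: "finite S" "card S = K" "S \<subseteq> {0..T}" and \<eta>: "0 < \<eta>"
    and sep: "\<And>s s'. s \<in> S \<Longrightarrow> s' \<in> S \<Longrightarrow> s \<noteq> s' \<Longrightarrow> \<eta> \<le> \<bar>s - s'\<bar>"
    and t: "0 \<le> t" "t \<le> T" and T: "T * norm v \<le> \<rho>"
    and small: "\<And>s. s \<in> S \<Longrightarrow> \<bar>b (w + s *\<^sub>R v)\<bar> \<le> \<delta>"
  shows "\<bar>b (w + t *\<^sub>R v)\<bar> \<le> (\<delta> + M * \<rho> ^ K) * (1 + 2 * T / \<eta>) ^ K + M * \<rho> ^ K"
proof -
  obtain p where p: "degree p < K" "\<And>t. 0 \<le> t \<Longrightarrow> \<bar>b (w + t *\<^sub>R v) - poly p t\<bar> \<le> M * (t * norm v) ^ K"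
    using b unfolding tame_def by blast
  have M: "0 \<le> M" using b by (simp add: tame_def)
  have err: "\<bar>b (w + s *\<^sub>R v) - poly p s\<bar> \<le> M * \<rho> ^ K" if s: "0 \<le> s" "s \<le> T" for s
  proof -
    have "s * norm v \<le> T * norm v" using s by (intro mult_right_mono) auto
    then have "(s * norm v) ^ K \<le> \<rho> ^ K" using s T by (intro power_mono) auto
    then have "M * (s * norm v) ^ K \<le> M * \<rho> ^ K" by (rule mult_left_mono) (rule M)
    then show ?thesis using p(2)[OF s(1)] by linarith
  qed
  have "\<bar>poly p t\<bar> \<le> (\<delta> + M * \<rho> ^ K) * (1 + 2 * T / \<eta>) ^ card S"
  proof (rule poly_bound_from_nodes[OF S(1) _ \<eta> sep])
    show "degree p < card S" using p(1) S(2) by simp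
    fix s assume s: "s \<in> S"
    then have s': "0 \<le> s" "s \<le> T" using S(3) by auto
    show "\<bar>poly p s\<bar> \<le> \<delta> + M * \<rho> ^ K" using err[OF s'] small[OF s] by linarith
    show "\<bar>t - s\<bar> \<le> T" using s' t by linarith
  qed
  then show ?thesis using err[OF t] unfolding S(2) by linarith
qed

text \<open>Extrapolation along the ray from \<open>w0\<close> to \<open>w\<close>, with nodes in
  the unit ball. The error in the node values grows like the distance to the power \<open>K\<close>
  and the amplification contributes \<open>K\<close> more powers, whence
  \<open>2 * K\<close>.\<close>

lemma tame_growth:
  assumes b: "tame K M b" and s: "\<And>w. w \<in> ball w0 1 \<Longrightarrow> \<bar>b w\<bar> \<le> s"
  shows "\<bar>b w\<bar> \<le> ((1 + 2 * real K) ^ K + 1) * (s + M) * (1 + norm (w - w0)) ^ (2 * K)"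
proof -
  define R where "R = norm (w - w0)"
  define X where "X = 1 + R"
  define A where "A = (1 + 2 * real K) ^ K"
  have R: "0 \<le> R" by (simp add: R_def)
  have X: "1 \<le> X" using R by (simp add: X_def)
  have XK: "1 \<le> X ^ n" for n using X by (rule one_le_power)
  have M: "0 \<le> M" and K: "0 < K" using b by (auto simp: tame_def)
  have s0: "0 \<le> s" using s[of w0] by simp
  have A: "1 \<le> A" unfolding A_def by (rule one_le_power) simp
  have "\<bar>b w\<bar> \<le> (A + 1) * (s + M) * X ^ (2 * K)"
  proof (cases "R < 1")
    case True
    then have "\<bar>b w\<bar> \<le> s" by (intro s) (simp add: R_def dist_norm norm_minus_commute)
    also have "\<dots> \<le> s + M" using M by simp
    also have "\<dots> \<le> ((A + 1) * X ^ (2 * K)) * (s + M)"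
    proof -
      have "1 * 1 \<le> (A + 1) * X ^ (2 * K)" using A XK by (intro mult_mono) auto
      then have "1 * (s + M) \<le> ((A + 1) * X ^ (2 * K)) * (s + M)"
        using s0 M by (intro mult_right_mono) auto
      then show ?thesis by simp
    qed
    finally show ?thesis by (simp add: mult_ac)
  next
    case False
    define v where "v = (1 / R) *\<^sub>R (w - w0)"
    have Rp: "0 < R" using False by simp
    have nv: "norm v = 1" using Rp by (simp add: v_def R_def[symmetric])
    have wv: "w0 + R *\<^sub>R v = w" using Rp by (simp add: v_def)
    \<comment> \<open>Equally spaced nodes in \<open>[0, 1)\<close>: strictly inside the unit ball
      and \<open>1 / real K\<close> apart.\<close>
    define S where "S = (\<lambda>i. real i / real K) ` {..<K}"
    have inj: "inj_on (\<lambda>i. real i / real K) {..<K}" using K by (auto intro!: inj_onI)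
    have "\<bar>b (w0 + R *\<^sub>R v)\<bar> \<le> (s + M * R ^ K) * (1 + 2 * R / (1 / real K)) ^ K + M * R ^ K"
    proof (rule tame_node_bound[OF b])
      show "finite S" by (simp add: S_def)
      show "card S = K" unfolding S_def by (simp add: card_image[OF inj])
      show "S \<subseteq> {0..R}"
      proof
        fix x assume "x \<in> S"
        then obtain i where i: "i < K" "x = real i / real K" by (auto simp: S_def)
        then have "x < 1" by simp
        moreover have "0 \<le> x" using i by simp
        ultimately show "x \<in> {0..R}" using False by auto
      qed
      show "1 / real K \<le> \<bar>x - y\<bar>" if xy: "x \<in> S" "y \<in> S" "x \<noteq> y" for x y
      proof -
        obtain i j where ij: "x = real i / real K" "y = real j / real K" using xy by (auto simp: S_def)
        then have "i \<noteq> j" using xy(3) by auto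
        then have "1 \<le> \<bar>real i - real j\<bar>" by linarith
        then have "1 / real K \<le> \<bar>real i - real j\<bar> / real K" using K by (simp add: divide_right_mono)
        then show ?thesis using K by (simp add: ij diff_divide_distrib[symmetric] abs_divide)
      qed
      show "\<bar>b (w0 + x *\<^sub>R v)\<bar> \<le> s" if x: "x \<in> S" for x
      proof (rule s)
        obtain i where i: "i < K" "x = real i / real K" using x by (auto simp: S_def)
        then have "\<bar>x\<bar> < 1" by simp
        then show "w0 + x *\<^sub>R v \<in> ball w0 1" by (simp add: dist_norm nv)
      qed
    qed (use R K nv in auto)
    also have "1 + 2 * R / (1 / real K) \<le> (1 + 2 * real K) * X"
      using R by (simp add: X_def algebra_simps)
    then have "(1 + 2 * R / (1 / real K)) ^ K \<le> ((1 + 2 * real K) * X) ^ K"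
      using R by (intro power_mono) auto
    then have "(s + M * R ^ K) * (1 + 2 * R / (1 / real K)) ^ K \<le> ((s + M) * X ^ K) * (A * X ^ K)"
    proof (intro mult_mono)
      have "s * 1 \<le> s * X ^ K" using s0 XK by (intro mult_left_mono) auto
      moreover have "M * R ^ K \<le> M * X ^ K" using M R by (intro mult_left_mono power_mono) (auto simp: X_def)
      ultimately show "s + M * R ^ K \<le> (s + M) * X ^ K" by (simp add: distrib_right)
      show "(1 + 2 * R / (1 / real K)) ^ K \<le> A * X ^ K"
        if "(1 + 2 * R / (1 / real K)) ^ K \<le> ((1 + 2 * real K) * X) ^ K"
        using that by (simp add: A_def power_mult_distrib)
      show "0 \<le> (s + M) * X ^ K" using s0 M X by simp
      show "0 \<le> (1 + 2 * R / (1 / real K)) ^ K" using R by simp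
    qed
    also have "M * R ^ K \<le> (s + M) * (X ^ K * X ^ K)"
    proof (rule mult_mono)
      have "R ^ K * 1 \<le> X ^ K * X ^ K" using R XK X by (intro mult_mono power_mono) (auto simp: X_def)
      then show "R ^ K \<le> X ^ K * X ^ K" by simp
    qed (use s0 M R in auto)
    finally have "\<bar>b w\<bar> \<le> (s + M) * X ^ K * (A * X ^ K) + (s + M) * (X ^ K * X ^ K)"
      unfolding wv by simp
    moreover have "X ^ (2 * K) = X ^ K * X ^ K" by (simp add: mult_2 power_add)
    ultimately show ?thesis by (simp add: algebra_simps)
  qed
  then show ?thesis by (simp add: A_def X_def R_def)
qed

lemma tame_continuous: "tame K M b \<Longrightarrow> continuous_on UNIV b"
  by (simp add: tame_def)

text \<open>Growth of order \<open>2 * K\<close> meets the square of Gram decay of order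
  \<open>K + DIM('w)\<close>, which leaves exactly the integrable weight of
  \<open>integrable_decay\<close>.\<close>

lemma (in localized_frame) form_at_frame_vector:
  assumes b: "tame K M b" and pos: "\<And>w. 0 \<le> b w" and s: "\<And>w. w \<in> ball w0 1 \<Longrightarrow> b w \<le> s"
  shows "ennreal \<kappa> * (\<integral>\<^sup>+w. ennreal (b w * (cmod (cinner (\<psi> w0) (\<psi> w)))\<^sup>2) \<partial>lborel)
    \<le> ennreal (\<kappa> * ((1 + 2 * real K) ^ K + 1) * (\<Gamma> (K + DIM('w)))\<^sup>2 * decay_integral TYPE('w) * (s + M))"
proof -
  define A where "A = ((1 + 2 * real K) ^ K + 1) * (s + M)"
  define G where "G = \<Gamma> (K + DIM('w))"
  have s0: "0 \<le> s" using s[of w0] pos[of w0] by simp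
  have M: "0 \<le> M" using b by (simp add: tame_def)
  have A0: "0 \<le> A" unfolding A_def using s0 M by (intro mult_nonneg_nonneg add_nonneg_nonneg) auto
  have pt: "b w * (cmod (cinner (\<psi> w0) (\<psi> w)))\<^sup>2 \<le> (A * G\<^sup>2) * (1 / (1 + norm (w - w0)) ^ (2 * DIM('w)))" for w
  proof -
    define r where "r = 1 + norm (w - w0)"
    have r: "0 < r" by (simp add: r_def add_pos_nonneg)
    have "b w \<le> A * r ^ (2 * K)"
      using tame_growth[OF b, of w0 s w] s pos by (simp add: A_def r_def)
    moreover have "r ^ (K + DIM('w)) * cmod (cinner (\<psi> w0) (\<psi> w)) \<le> G"
      using decay[of w0 w "K + DIM('w)"] by (simp add: G_def r_def norm_minus_commute)
    then have "(r ^ (K + DIM('w)) * cmod (cinner (\<psi> w0) (\<psi> w)))\<^sup>2 \<le> G\<^sup>2"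
      using r by (intro power_mono) auto
    ultimately have "b w * (r ^ (K + DIM('w)) * cmod (cinner (\<psi> w0) (\<psi> w)))\<^sup>2 \<le> (A * r ^ (2 * K)) * G\<^sup>2"
      using A0 r by (intro mult_mono) auto
    moreover have "(r ^ (K + DIM('w)))\<^sup>2 = r ^ (2 * K) * r ^ (2 * DIM('w))"
      by (simp add: power_mult[symmetric] power_add[symmetric] mult.commute distrib_right)
    ultimately have "r ^ (2 * K) * (b w * (cmod (cinner (\<psi> w0) (\<psi> w)))\<^sup>2 * r ^ (2 * DIM('w)))
        \<le> r ^ (2 * K) * (A * G\<^sup>2)"
      by (simp add: power_mult_distrib mult_ac)
    then have "b w * (cmod (cinner (\<psi> w0) (\<psi> w)))\<^sup>2 * r ^ (2 * DIM('w)) \<le> A * G\<^sup>2"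
      using r by (simp add: mult_le_cancel_left_pos)
    then show ?thesis using r by (simp add: r_def[symmetric] pos_le_divide_eq)
  qed
  have "(\<integral>\<^sup>+w. ennreal (b w * (cmod (cinner (\<psi> w0) (\<psi> w)))\<^sup>2) \<partial>lborel)
      \<le> (\<integral>\<^sup>+w. ennreal (A * G\<^sup>2) * ennreal (1 / (1 + norm (w - w0)) ^ (2 * DIM('w))) \<partial>lborel)"
    using A0 by (intro nn_integral_mono, subst ennreal_mult[symmetric])
      (auto intro!: ennreal_leI pt simp: add_nonneg_nonneg simp del: times_divide_eq_right)
  also have "\<dots> = ennreal (A * G\<^sup>2) * ennreal (decay_integral TYPE('w))"
    by (simp add: nn_integral_cmult nn_integral_decay)
  finally have "ennreal \<kappa> * (\<integral>\<^sup>+w. ennreal (b w * (cmod (cinner (\<psi> w0) (\<psi> w)))\<^sup>2) \<partial>lborel)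
      \<le> ennreal \<kappa> * (ennreal (A * G\<^sup>2) * ennreal (decay_integral TYPE('w)))"
    by (rule mult_left_mono) simp
  also have "\<dots> = ennreal (\<kappa> * (A * G\<^sup>2 * decay_integral TYPE('w)))"
    using \<kappa>_pos A0 decay_integral_nonneg[where 'a='w] by (simp add: ennreal_mult)
  also have "\<kappa> * (A * G\<^sup>2 * decay_integral TYPE('w))
      = \<kappa> * ((1 + 2 * real K) ^ K + 1) * (\<Gamma> (K + DIM('w)))\<^sup>2 * decay_integral TYPE('w) * (s + M)"
    by (simp add: A_def G_def mult_ac)
  finally show ?thesis .
qed

subsection \<open>The lower bound for the form of a tame symbol\<close>

text \<open>Where \<open>b\<close> reaches \<open>\<mu>\<close> on every unit ball, the set \<open>{b < \<delta>\<mu>}\<close> is uniformly small on large balls,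
  because \<open>b\<close> is nearly polynomial there. By the Schur bound the frame coefficients of a unit vector
  cannot concentrate on such a set. The remaining bounded region contributes a finite-rank error.\<close>

theorem frame_form_lower_bound:
  fixes \<kappa> :: real and \<Gamma> :: "nat \<Rightarrow> real" and K :: nat
  assumes K: "0 < K"
  shows "\<exists>c>0. \<exists>C>0. \<forall>(\<psi> :: 'w::euclidean_space \<Rightarrow> 'a::euclidean_space l2) b M \<mu> R0.
    localized_frame \<kappa> \<Gamma> \<psi> \<longrightarrow> tame K M b \<longrightarrow> (\<forall>w. 0 \<le> b w) \<longrightarrow> 0 < \<mu> \<longrightarrow> C * M \<le> \<mu> \<longrightarrow>
    (\<forall>w. R0 \<le> norm w \<longrightarrow> (\<exists>w1\<in>ball w 1. \<mu> \<le> b w1)) \<longrightarrow>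
    (\<exists>B C'. finite B \<and> 0 \<le> C' \<and> (\<forall>f.
      ennreal (c * \<mu> * (norm f)\<^sup>2 - C' * (\<Sum>k\<in>B. (cmod (cinner f k))\<^sup>2))
      \<le> ennreal \<kappa> * (\<integral>\<^sup>+w. ennreal (b w * (cmod (cinner f (\<psi> w)))\<^sup>2) \<partial>lborel)))"
proof (cases "\<exists>\<psi> :: 'w \<Rightarrow> 'a l2. localized_frame \<kappa> \<Gamma> \<psi>")
  \<comment> \<open>Without any frame for these constants the claim is vacuous. In the other case a
    single frame shows that \<open>\<kappa>\<close> is positive and each \<open>\<Gamma> k\<close>
    at least 1, so the constants can be chosen before the frame is given.\<close>
  case False
  then show ?thesis by (intro exI[of _ "1::real"] conjI) auto
next
  case True
  then obtain \<psi>0 :: "'w \<Rightarrow> 'a l2" where "localized_frame \<kappa> \<Gamma> \<psi>0" by blast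
  then have \<kappa>: "0 < \<kappa>" and \<Gamma>1: "1 \<le> \<Gamma> k" for k
    using localized_frame.\<kappa>_pos localized_frame.\<Gamma>_ge_1 by blast+
  define G where "G = \<Gamma> (2 * DIM('w) + 1)"
  have G: "1 \<le> G" unfolding G_def by (rule \<Gamma>1)
  define I where "I = decay_integral TYPE('w)"
  have I: "0 \<le> I" unfolding I_def by (rule decay_integral_nonneg)
  define N1 where "N1 = G * I"
  have N1: "0 \<le> N1" using G I by (simp add: N1_def)
  \<comment> \<open>Kernel mass on the bad set; this value lets the Schur bound absorb half of the
    squared norm of \<open>f\<close>.\<close>
  define \<epsilon> where "\<epsilon> = 1 / (2 * \<kappa>\<^sup>2 * (N1 + 1))"
  have \<epsilon>: "0 < \<epsilon>" using \<kappa> N1 by (simp add: \<epsilon>_def)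
  have \<epsilon>half: "\<kappa>\<^sup>2 * N1 * \<epsilon> \<le> 1/2"
  proof -
    have "\<kappa>\<^sup>2 * N1 * \<epsilon> = (N1 / (N1 + 1)) / 2" using \<kappa> N1 by (simp add: \<epsilon>_def)
    also have "\<dots> \<le> 1 / 2" using N1 by (intro divide_right_mono) auto
    finally show ?thesis .
  qed
  \<comment> \<open>Beyond distance \<open>R\<close> the kernel has mass at most
    \<open>\<epsilon> / 2\<close>.\<close>
  define R where "R = max 1 (2 * N1 / \<epsilon>)"
  have R: "1 \<le> R" by (simp add: R_def)
  have Rtail: "N1 / (1 + R) \<le> \<epsilon> / 2"
  proof -
    have "2 * N1 / \<epsilon> \<le> 1 + R" by (simp add: R_def)
    then have "2 * N1 \<le> \<epsilon> * (1 + R)" using \<epsilon> by (simp add: pos_divide_le_eq mult.commute)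
    then show ?thesis using R by (simp add: pos_divide_le_eq)
  qed
  define R1 where "R1 = R + 1"
  define VB where "VB = measure lborel (cball (0::'w) (2 * R1))"
  have VB: "0 \<le> VB" "emeasure lborel (cball (0::'w) (2 * R1)) = ennreal VB"
    unfolding VB_def using emeasure_bounded_finite[OF bounded_cball, of "0::'w" "2 * R1"]
    by (simp_all add: emeasure_eq_ennreal_measure less_top)
  \<comment> \<open>Makes the contribution from within distance \<open>R\<close> at most
    \<open>\<epsilon> / 2\<close>: the kernel is at most \<open>G\<close>, and the bad set has
    measure at most \<open>4 * K * \<eta> * VB\<close>, by covering on rays and averaging over
    dilations.\<close>
  define \<eta> where "\<eta> = \<epsilon> / (8 * G * (VB + 1) * real K)"
  have \<eta>: "0 < \<eta>" using \<epsilon> G VB K by (simp add: \<eta>_def)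
  have \<eta>small: "G * (4 * real K * \<eta> * VB) \<le> \<epsilon> / 2"
  proof -
    have "G * (4 * real K * \<eta> * VB) = (\<epsilon> / 2) * (VB / (VB + 1))"
    proof -
      define W where "W = VB + 1"
      have "G \<noteq> 0" "W \<noteq> 0" "real K \<noteq> 0" using G VB K by (auto simp: W_def)
      then show ?thesis unfolding \<eta>_def W_def[symmetric] by simp
    qed
    also have "\<dots> \<le> (\<epsilon> / 2) * 1" using \<epsilon> VB by (intro mult_left_mono) auto
    finally show ?thesis by simp
  qed
  define \<Lambda> where "\<Lambda> = (1 + 2 * 1 / \<eta>) ^ K"
  have \<Lambda>: "1 \<le> \<Lambda>" unfolding \<Lambda>_def using \<eta> by (intro one_le_power) simp
  \<comment> \<open>Values below \<open>\<delta> * \<mu>\<close> at the nodes extrapolate to at most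
    \<open>\<mu> / 4\<close>.\<close>
  define \<delta> where "\<delta> = 1 / (4 * \<Lambda>)"
  have \<delta>: "0 < \<delta>" using \<Lambda> by (simp add: \<delta>_def)
  \<comment> \<open>The condition \<open>C * M \<le> \<mu>\<close> keeps the two error terms of
    \<open>tame_node_bound\<close> together below \<open>\<mu> / 4\<close>.\<close>
  define C where "C = 4 * (\<Lambda> + 1) * (2 * R1) ^ K"
  have C: "0 < C" using \<Lambda> R by (simp add: C_def R1_def)
  show ?thesis
  proof (rule exI[of _ "\<delta> / 4"], rule conjI[rotated], rule exI[of _ C], intro conjI allI impI)
    show "0 < \<delta> / 4" using \<delta> by simp
    show "0 < C" by (rule C)
    fix \<psi> :: "'w \<Rightarrow> 'a l2" and b :: "'w \<Rightarrow> real" and M \<mu> R0 :: real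
    assume "localized_frame \<kappa> \<Gamma> \<psi>" and b: "tame K M b" and pos: "\<forall>w. 0 \<le> b w" and \<mu>: "0 < \<mu>"
      and CM: "C * M \<le> \<mu>" and big: "\<forall>w. R0 \<le> norm w \<longrightarrow> (\<exists>w1\<in>ball w 1. \<mu> \<le> b w1)"
    interpret localized_frame \<kappa> \<Gamma> \<psi> by fact
    have M: "0 \<le> M" using b by (simp add: tame_def)
    have contb: "continuous_on UNIV b" by (rule tame_continuous[OF b])
    have [measurable]: "b \<in> borel_measurable borel"
      by (rule borel_measurable_continuous_onI[OF contb])
    define F where "F = {w. b w < \<delta> * \<mu>}"
    have F [measurable]: "F \<in> sets borel" unfolding F_def by measurable
    have local_small: "emeasure lborel (F \<inter> cball w1 R1) \<le> ennreal (4 * real K * \<eta> * VB)" if w1: "\<mu> \<le> b w1" for w1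
    proof -
      have "emeasure lborel (F \<inter> cball w1 R1)
          \<le> ennreal (2 * (2 * real K * \<eta>)) * emeasure lborel (cball (0::'w) (2 * R1))"
      proof (rule emeasure_le_by_dilation[OF F])
        show "0 \<le> 2 * real K * \<eta>" using \<eta> by simp
        fix v :: 'w assume v: "norm v \<le> 2 * R1"
        define E where "E = {s \<in> {1/2..1::real}. w1 + s *\<^sub>R v \<in> F}"
        have E: "E \<in> sets borel" unfolding E_def F_def by measurable
        \<comment> \<open>Enough separated nodes with small values would extrapolate back to the
          origin of the ray and give \<open>b w1 \<le> \<mu> / 2\<close>.\<close>
        have "\<not> (\<exists>S\<subseteq>E. finite S \<and> card S = K \<and> (\<forall>s\<in>S. \<forall>s'\<in>S. s \<noteq> s' \<longrightarrow> \<eta> \<le> \<bar>s - s'\<bar>))"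
        proof
          assume "\<exists>S\<subseteq>E. finite S \<and> card S = K \<and> (\<forall>s\<in>S. \<forall>s'\<in>S. s \<noteq> s' \<longrightarrow> \<eta> \<le> \<bar>s - s'\<bar>)"
          then obtain S where S: "S \<subseteq> E" "finite S" "card S = K"
            "\<And>s s'. s \<in> S \<Longrightarrow> s' \<in> S \<Longrightarrow> s \<noteq> s' \<Longrightarrow> \<eta> \<le> \<bar>s - s'\<bar>" by blast
          have "\<bar>b (w1 + 0 *\<^sub>R v)\<bar> \<le> (\<delta> * \<mu> + M * (2 * R1) ^ K) * (1 + 2 * 1 / \<eta>) ^ K + M * (2 * R1) ^ K"
          proof (rule tame_node_bound[OF b S(2,3) _ \<eta> S(4)])
            show "S \<subseteq> {0..1}" using S(1) by (auto simp: E_def)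
            show "\<bar>b (w1 + s *\<^sub>R v)\<bar> \<le> \<delta> * \<mu>" if "s \<in> S" for s
              using S(1) that pos by (auto simp: E_def F_def intro: less_imp_le)
          qed (use v in auto)
          then have "b w1 \<le> (\<delta> * \<mu> + M * (2 * R1) ^ K) * \<Lambda> + M * (2 * R1) ^ K"
            using pos by (simp add: \<Lambda>_def)
          also have "\<dots> = \<mu> / 4 + (C * M) / 4" using \<Lambda> by (simp add: \<delta>_def C_def field_simps)
          also have "\<dots> \<le> \<mu> / 4 + \<mu> / 4" using CM by simp
          finally show False using w1 \<mu> by simp
        qed
        then show "emeasure lborel {s \<in> {1/2..1::real}. w1 + s *\<^sub>R v \<in> F} \<le> ennreal (2 * real K * \<eta>)"
          using separated_nodes_or_small[OF E \<eta>, of K] unfolding E_def by blast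
      qed
      also have "\<dots> = ennreal (2 * (2 * real K * \<eta>) * VB)"
        unfolding VB(2) using \<eta> VB(1) by (intro ennreal_mult[symmetric]) auto
      finally show ?thesis by (simp add: mult.assoc)
    qed
    \<comment> \<open>A ball of radius \<open>R\<close> that meets the region beyond
      \<open>R0'\<close> has its centre beyond \<open>R0\<close>, where the hypothesis supplies a
      point with a large value.\<close>
    define R0' where "R0' = \<bar>R0\<bar> + R"
    define F' where "F' = F \<inter> {w. R0' \<le> norm w}"
    have F' [measurable]: "F' \<in> sets borel" unfolding F'_def by measurable
    have small: "(\<integral>\<^sup>+w. ennreal (kernel (z - w)) * indicator F' w \<partial>lborel) \<le> ennreal \<epsilon>" for z
    proof -
      have near: "emeasure lborel (F' \<inter> cball z R) \<le> ennreal (4 * real K * \<eta> * VB)"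
      proof (cases "F' \<inter> cball z R = {}")
        case True
        then show ?thesis by simp
      next
        case False
        then obtain w where w: "R0' \<le> norm w" "dist z w \<le> R" by (auto simp: F'_def)
        have "norm w \<le> norm z + dist z w"
          by (metis dist_norm norm_minus_commute norm_triangle_sub)
        then have "R0 \<le> norm z" using w by (simp add: R0'_def)
        then obtain w1 where w1: "w1 \<in> ball z 1" "\<mu> \<le> b w1" using big by blast
        have "F' \<inter> cball z R \<subseteq> F \<inter> cball w1 R1"
        proof
          fix x assume x: "x \<in> F' \<inter> cball z R"
          have "dist w1 x \<le> dist w1 z + dist z x" by (rule dist_triangle)
          then show "x \<in> F \<inter> cball w1 R1" using x w1(1) by (simp add: F'_def R1_def dist_commute)
        qed
        then have "emeasure lborel (F' \<inter> cball z R) \<le> emeasure lborel (F \<inter> cball w1 R1)"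
          by (rule emeasure_mono) measurable
        also note local_small[OF w1(2)]
        finally show ?thesis .
      qed
      have [measurable]: "F' \<inter> cball z R \<in> sets borel" by (intro sets.Int F') simp
      have "(\<integral>\<^sup>+w. ennreal (kernel (z - w)) * indicator F' w \<partial>lborel)
          \<le> (\<integral>\<^sup>+w. ennreal G * indicator (F' \<inter> cball z R) w
              + ennreal (G / (1 + R)) * ennreal (1 / (1 + norm (w - z)) ^ (2 * DIM('w))) \<partial>lborel)"
      proof (rule nn_integral_mono)
        fix w
        show "ennreal (kernel (z - w)) * indicator F' w \<le> ennreal G * indicator (F' \<inter> cball z R) w
              + ennreal (G / (1 + R)) * ennreal (1 / (1 + norm (w - z)) ^ (2 * DIM('w)))"
        proof (cases "w \<in> F'")
          case True
          show ?thesis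
          proof (cases "dist z w \<le> R")
            case near: True
            have "ennreal (kernel (z - w)) \<le> ennreal G" unfolding G_def by (rule ennreal_leI[OF kernel_le])
            then show ?thesis using True near by (simp add: add_increasing2)
          next
            case far: False
            have "kernel (z - w) \<le> G / (1 + R) * (1 / (1 + norm (w - z)) ^ (2 * DIM('w)))"
              using kernel_le_far[of R "z - w"] far R by (simp add: G_def dist_norm norm_minus_commute)
            then have "ennreal (kernel (z - w)) \<le> ennreal (G / (1 + R)) * ennreal (1 / (1 + norm (w - z)) ^ (2 * DIM('w)))"
              using G R by (subst ennreal_mult[symmetric]) (auto intro!: ennreal_leI simp: add_nonneg_nonneg)
            then show ?thesis using True far by (simp add: add_increasing)
          qed
        qed simp
      qed
      also have "\<dots> = ennreal G * emeasure lborel (F' \<inter> cball z R) + ennreal (G / (1 + R)) * ennreal I"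
        by (subst nn_integral_add) (simp_all add: nn_integral_cmult nn_integral_decay nn_integral_cmult_indicator I_def)
      also have "\<dots> \<le> ennreal G * ennreal (4 * real K * \<eta> * VB) + ennreal (G / (1 + R)) * ennreal I"
        by (intro add_right_mono mult_left_mono near) simp
      also have "\<dots> = ennreal (G * (4 * real K * \<eta> * VB) + G / (1 + R) * I)"
      proof -
        have "ennreal (x * p + r * y) = ennreal x * ennreal p + ennreal r * ennreal y"
          if "0 \<le> x" "0 \<le> p" "0 \<le> r" "0 \<le> y" for x p r y
          using that by (simp add: ennreal_mult ennreal_plus)
        from this[of G "4 * real K * \<eta> * VB" "G / (1 + R)" I] show ?thesis using G I R \<eta> VB by simp
      qed
      also have "\<dots> \<le> ennreal \<epsilon>"
      proof (rule ennreal_leI)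
        have "G / (1 + R) * I = N1 / (1 + R)" by (simp add: N1_def)
        then show "G * (4 * real K * \<eta> * VB) + G / (1 + R) * I \<le> \<epsilon>"
          using \<eta>small Rtail by linarith
      qed
      finally show ?thesis .
    qed
    have [measurable]: "cball (0::'w) R0' \<in> sets borel" by simp
    define VB0 where "VB0 = measure lborel (cball (0::'w) R0')"
    have VB0: "0 \<le> VB0" "emeasure lborel (cball (0::'w) R0') = ennreal VB0"
      unfolding VB0_def using emeasure_bounded_finite[OF bounded_cball, of "0::'w" R0']
      by (simp_all add: emeasure_eq_ennreal_measure less_top)
    \<comment> \<open>Radius of the net; its contribution over the bounded region is at most a
      quarter of the squared norm of \<open>f\<close>.\<close>
    define e where "e = sqrt (1 / (8 * \<kappa> * (VB0 + 1)))"
    have e: "0 < e" using \<kappa> VB0 by (simp add: e_def)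
    have esq: "2 * \<kappa> * VB0 * e\<^sup>2 \<le> 1/4"
    proof -
      have "e\<^sup>2 = 1 / (8 * \<kappa> * (VB0 + 1))" using \<kappa> VB0 by (simp add: e_def)
      moreover have "2 * \<kappa> * VB0 * (1 / (8 * \<kappa> * W)) = (VB0 / W) / 4" for W using \<kappa> by simp
      ultimately have "2 * \<kappa> * VB0 * e\<^sup>2 = (VB0 / (VB0 + 1)) / 4" by simp
      also have "\<dots> \<le> 1 / 4" using VB0 by (intro divide_right_mono) auto
      finally show ?thesis .
    qed
    \<comment> \<open>The frame vectors of the bounded region form a compact set. A finite net
      \<open>B\<close> replaces them by finitely many functionals, the source of the finite-rank
      error.\<close>
    have "seq_compact (\<psi> ` cball 0 R0')"
      unfolding compact_eq_seq_compact_metric[symmetric]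
      by (rule compact_continuous_image) (auto intro: continuous_on_subset[OF continuous_\<psi>])
    from seq_compact_imp_totally_bounded[OF this, rule_format, OF e]
    obtain B where B: "finite B" "\<psi> ` cball 0 R0' \<subseteq> (\<Union>x\<in>B. ball x e)" by (elim exE conjE)
    have main: "ennreal (\<delta> / 4 * \<mu> * (norm f)\<^sup>2 - 2 * \<kappa> * VB0 * \<delta> * \<mu> * (\<Sum>k\<in>B. (cmod (cinner f k))\<^sup>2))
      \<le> ennreal \<kappa> * (\<integral>\<^sup>+w. ennreal (b w * (cmod (cinner f (\<psi> w)))\<^sup>2) \<partial>lborel)" for f
    proof -
      let ?Q = "ennreal \<kappa> * (\<integral>\<^sup>+w. ennreal (b w * (cmod (cinner f (\<psi> w)))\<^sup>2) \<partial>lborel)"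
      let ?V = "\<lambda>w. ennreal ((cmod (cinner f (\<psi> w)))\<^sup>2)"
      define \<Sigma> where "\<Sigma> = (\<Sum>k\<in>B. (cmod (cinner f k))\<^sup>2)"
      have \<Sigma>: "0 \<le> \<Sigma>" unfolding \<Sigma>_def by (intro sum_nonneg) simp
      define S where "S = 2 * \<Sigma> + 2 * (e\<^sup>2 * (norm f)\<^sup>2)"
      have S: "0 \<le> S" using \<Sigma> by (simp add: S_def)
      have ball: "(cmod (cinner f (\<psi> w)))\<^sup>2 \<le> S" if w: "w \<in> cball 0 R0'" for w
      proof -
        have "\<psi> w \<in> (\<Union>x\<in>B. ball x e)" using B(2) w by blast
        then obtain k where k: "k \<in> B" "dist k (\<psi> w) < e" by auto
        have "cinner f (\<psi> w) = cinner f k + cinner f (\<psi> w - k)" by (simp add: cinner_diff_right)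
        then have "cmod (cinner f (\<psi> w)) \<le> cmod (cinner f k) + cmod (cinner f (\<psi> w - k))"
          by (metis norm_triangle_ineq)
        also have "cmod (cinner f (\<psi> w - k)) \<le> norm f * norm (\<psi> w - k)" by (rule cmod_cinner_le)
        also have "\<dots> \<le> norm f * e" using k(2) by (intro mult_left_mono) (auto simp: dist_norm norm_minus_commute)
        finally have "(cmod (cinner f (\<psi> w)))\<^sup>2 \<le> (cmod (cinner f k) + norm f * e)\<^sup>2"
          by (intro power_mono) auto
        also have "\<dots> \<le> 2 * (cmod (cinner f k))\<^sup>2 + 2 * (norm f * e)\<^sup>2"
          using sum_squares_bound[of "cmod (cinner f k)" "norm f * e"] by (simp add: power2_sum)
        also have "(cmod (cinner f k))\<^sup>2 \<le> \<Sigma>"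
          unfolding \<Sigma>_def by (rule member_le_sum[OF k(1) _ B(1)]) simp
        finally show ?thesis by (simp add: S_def power_mult_distrib mult.commute)
      qed
      \<comment> \<open>Three regions cover phase space: the distant part of the bad set (Schur
        bound), the bounded region (net), and the complement of the bad set, where the form itself
        controls the coefficients.\<close>
      have pt: "?V w \<le> ?V w * indicator F' w + (ennreal S * indicator (cball 0 R0') w
          + ennreal (1 / (\<delta> * \<mu>)) * ennreal (b w * (cmod (cinner f (\<psi> w)))\<^sup>2))" for w
      proof -
        consider "w \<in> F'" | "w \<in> cball 0 R0'" | "w \<notin> F" unfolding F'_def by fastforce
        then show ?thesis
        proof cases
          case 1
          then show ?thesis by (simp add: add_increasing2)
        next
          case 2
          then have "?V w \<le> ennreal S * indicator (cball 0 R0') w" using ennreal_leI[OF ball[OF 2]] by simp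
          then show ?thesis by (simp add: add_increasing add_increasing2)
        next
          case 3
          then have "1 \<le> b w / (\<delta> * \<mu>)" using \<delta> \<mu> by (simp add: F_def pos_le_divide_eq)
          then have "1 * (cmod (cinner f (\<psi> w)))\<^sup>2 \<le> (b w / (\<delta> * \<mu>)) * (cmod (cinner f (\<psi> w)))\<^sup>2"
            by (rule mult_right_mono) simp
          then have "?V w \<le> ennreal (1 / (\<delta> * \<mu>)) * ennreal (b w * (cmod (cinner f (\<psi> w)))\<^sup>2)"
            using \<delta> \<mu> pos by (subst ennreal_mult[symmetric]) (auto intro!: ennreal_leI)
          then show ?thesis by (simp add: add_increasing)
        qed
      qed
      have "ennreal ((norm f)\<^sup>2) = ennreal \<kappa> * (\<integral>\<^sup>+w. ?V w \<partial>lborel)" by (rule parseval[symmetric])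
      also have "\<dots> \<le> ennreal \<kappa> * (\<integral>\<^sup>+w. ?V w * indicator F' w + (ennreal S * indicator (cball 0 R0') w
          + ennreal (1 / (\<delta> * \<mu>)) * ennreal (b w * (cmod (cinner f (\<psi> w)))\<^sup>2)) \<partial>lborel)"
        by (intro mult_left_mono nn_integral_mono pt) simp
      also have "\<dots> = ennreal \<kappa> * (\<integral>\<^sup>+w. ?V w * indicator F' w \<partial>lborel)
          + (ennreal \<kappa> * (ennreal S * ennreal VB0) + ennreal (1 / (\<delta> * \<mu>)) * ?Q)"
        by (subst nn_integral_add, measurable, subst nn_integral_add, measurable)
           (simp add: nn_integral_cmult nn_integral_cmult_indicator VB0(2) distrib_left mult.left_commute)
      also have "\<dots> \<le> ennreal (\<kappa>\<^sup>2 * kernel_mass * \<epsilon> * (norm f)\<^sup>2)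
          + (ennreal \<kappa> * (ennreal S * ennreal VB0) + ennreal (1 / (\<delta> * \<mu>)) * ?Q)"
        by (intro add_right_mono schur_bound F' small) (use \<epsilon> in simp)
      finally have ineq: "ennreal ((norm f)\<^sup>2) \<le> ennreal (\<kappa>\<^sup>2 * kernel_mass * \<epsilon> * (norm f)\<^sup>2)
          + (ennreal \<kappa> * (ennreal S * ennreal VB0) + ennreal (1 / (\<delta> * \<mu>)) * ?Q)" .
      show ?thesis
      proof (cases "?Q = \<infinity>")
        case True
        then show ?thesis by simp
      next
        case False
        then obtain Q where Q: "0 \<le> Q" "?Q = ennreal Q"
          by (cases "?Q") auto
        have km: "kernel_mass = N1" by (simp add: kernel_mass_def N1_def G_def I_def)
        have conv: "x \<le> a + (k * (s * v) + t * y)"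
          if le: "ennreal x \<le> ennreal a + (ennreal k * (ennreal s * ennreal v) + ennreal t * ennreal y)"
            and nn: "0 \<le> a" "0 \<le> k" "0 \<le> s" "0 \<le> v" "0 \<le> t" "0 \<le> y" for x a k s v t y
        proof -
          have "ennreal (a + (k * (s * v) + t * y))
              = ennreal a + (ennreal k * (ennreal s * ennreal v) + ennreal t * ennreal y)"
            using nn by (simp add: ennreal_mult ennreal_plus)
          then have "ennreal x \<le> ennreal (a + (k * (s * v) + t * y))" using le by simp
          then show ?thesis using nn by (subst (asm) ennreal_le_iff) auto
        qed
        have "(norm f)\<^sup>2 \<le> \<kappa>\<^sup>2 * N1 * \<epsilon> * (norm f)\<^sup>2 + (\<kappa> * (S * VB0) + 1 / (\<delta> * \<mu>) * Q)"
          by (rule conv[OF ineq[unfolded Q(2) km]]) (use N1 \<epsilon> \<kappa> S VB0 \<delta> \<mu> Q in simp_all)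
        moreover have "\<kappa>\<^sup>2 * N1 * \<epsilon> * (norm f)\<^sup>2 \<le> 1/2 * (norm f)\<^sup>2"
          by (rule mult_right_mono[OF \<epsilon>half]) simp
        moreover have "\<kappa> * (S * VB0) = 2 * \<kappa> * VB0 * \<Sigma> + 2 * \<kappa> * VB0 * e\<^sup>2 * (norm f)\<^sup>2"
          by (simp add: S_def algebra_simps)
        moreover have "2 * \<kappa> * VB0 * e\<^sup>2 * (norm f)\<^sup>2 \<le> 1/4 * (norm f)\<^sup>2"
          by (rule mult_right_mono[OF esq]) simp
        \<comment> \<open>What remains after one half goes to the Schur bound and one quarter to the
          net.\<close>
        ultimately have "1/4 * (norm f)\<^sup>2 \<le> 2 * \<kappa> * VB0 * \<Sigma> + 1 / (\<delta> * \<mu>) * Q" by linarith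
        then have "(\<delta> * \<mu>) * (1/4 * (norm f)\<^sup>2) \<le> (\<delta> * \<mu>) * (2 * \<kappa> * VB0 * \<Sigma> + 1 / (\<delta> * \<mu>) * Q)"
          using \<delta> \<mu> by (intro mult_left_mono) auto
        also have "\<dots> = 2 * \<kappa> * VB0 * \<delta> * \<mu> * \<Sigma> + Q" using \<delta> \<mu> by (simp add: algebra_simps)
        finally have "\<delta> / 4 * \<mu> * (norm f)\<^sup>2 - 2 * \<kappa> * VB0 * \<delta> * \<mu> * \<Sigma> \<le> Q" by simp
        then show ?thesis unfolding Q(2) \<Sigma>_def by (rule ennreal_leI)
      qed
    qed
    show "\<exists>B C'. finite B \<and> 0 \<le> C' \<and> (\<forall>f.
      ennreal (\<delta> / 4 * \<mu> * (norm f)\<^sup>2 - C' * (\<Sum>k\<in>B. (cmod (cinner f k))\<^sup>2))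
      \<le> ennreal \<kappa> * (\<integral>\<^sup>+w. ennreal (b w * (cmod (cinner f (\<psi> w)))\<^sup>2) \<partial>lborel))"
      by (rule exI[of _ B], rule exI[of _ "2 * \<kappa> * VB0 * \<delta> * \<mu>"])
         (use B(1) main \<kappa> VB0(1) \<delta> \<mu> in auto)
  qed
qed

subsection \<open>The form of a symbol\<close>

context localized_frame
begin

definition symbol_quad :: "('w \<Rightarrow> real) \<Rightarrow> 'a l2 \<Rightarrow> ennreal" where
  "symbol_quad b f = ennreal \<kappa> * (\<integral>\<^sup>+w. ennreal (b w * (cmod (cinner f (\<psi> w)))\<^sup>2) \<partial>lborel)"

definition symbol_domain :: "('w \<Rightarrow> real) \<Rightarrow> 'a l2 set" where
  "symbol_domain b = {f. symbol_quad b f < \<infinity>}"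

definition symbol_form :: "('w \<Rightarrow> real) \<Rightarrow> 'a l2 \<Rightarrow> 'a l2 \<Rightarrow> complex" where
  "symbol_form b f g = complex_of_real \<kappa> *
     (\<integral>w. complex_of_real (b w) * cinner f (\<psi> w) * cinner (\<psi> w) g \<partial>lborel)"

context
  fixes b :: "'w \<Rightarrow> real"
  assumes b_measurable [measurable]: "b \<in> borel_measurable borel" and b_nonneg: "\<And>w. 0 \<le> b w"
begin

lemma measurable_coeff' [measurable]: "(\<lambda>w. cinner (\<psi> w) g) \<in> borel_measurable borel"
  by (intro borel_measurable_continuous_onI continuous_intros continuous_\<psi>)

lemma symbol_domain_iff:
  "f \<in> symbol_domain b \<longleftrightarrow> integrable lborel (\<lambda>w. b w * (cmod (cinner f (\<psi> w)))\<^sup>2)"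
proof -
  have "f \<in> symbol_domain b \<longleftrightarrow> (\<integral>\<^sup>+w. ennreal (b w * (cmod (cinner f (\<psi> w)))\<^sup>2) \<partial>lborel) < \<infinity>"
    using \<kappa>_pos by (auto simp: symbol_domain_def symbol_quad_def ennreal_mult_less_top)
  then show ?thesis by (simp add: integrable_iff_bounded b_nonneg)
qed

lemma integrable_symbol_mult:
  assumes "f \<in> symbol_domain b" "g \<in> symbol_domain b"
  shows "integrable lborel (\<lambda>w. complex_of_real (b w) * cinner f (\<psi> w) * cinner (\<psi> w) g)"
proof (rule Bochner_Integration.integrable_bound)
  show "integrable lborel (\<lambda>w. b w * (cmod (cinner f (\<psi> w)))\<^sup>2 + b w * (cmod (cinner g (\<psi> w)))\<^sup>2)"
    using assms by (intro Bochner_Integration.integrable_add) (simp_all add: symbol_domain_iff)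
  show "AE w in lborel. norm (complex_of_real (b w) * cinner f (\<psi> w) * cinner (\<psi> w) g)
      \<le> norm (b w * (cmod (cinner f (\<psi> w)))\<^sup>2 + b w * (cmod (cinner g (\<psi> w)))\<^sup>2)"
  proof (rule AE_I2)
    fix w
    have "x * y \<le> x\<^sup>2 + y\<^sup>2" if "0 \<le> x" "0 \<le> y" for x y :: real
      using sum_squares_bound[of x y] mult_nonneg_nonneg[OF that] by linarith
    then have "b w * (cmod (cinner f (\<psi> w)) * cmod (cinner g (\<psi> w)))
        \<le> b w * ((cmod (cinner f (\<psi> w)))\<^sup>2 + (cmod (cinner g (\<psi> w)))\<^sup>2)"
      by (intro mult_left_mono b_nonneg) simp
    moreover have "cmod (cinner (\<psi> w) g) = cmod (cinner g (\<psi> w))"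
      by (subst cinner_commute) simp
    ultimately show "norm (complex_of_real (b w) * cinner f (\<psi> w) * cinner (\<psi> w) g)
      \<le> norm (b w * (cmod (cinner f (\<psi> w)))\<^sup>2 + b w * (cmod (cinner g (\<psi> w)))\<^sup>2)"
      using b_nonneg[of w] by (simp add: norm_mult distrib_left mult.assoc)
  qed
qed measurable

lemma symbol_form_self:
  "symbol_form b f f = complex_of_real (\<kappa> * (\<integral>w. b w * (cmod (cinner f (\<psi> w)))\<^sup>2 \<partial>lborel))"
proof -
  have eq: "complex_of_real (b w) * cinner f (\<psi> w) * cinner (\<psi> w) f
      = complex_of_real (b w * (cmod (cinner f (\<psi> w)))\<^sup>2)" for w
    by (subst cinner_commute[of "\<psi> w" f]) (simp add: complex_norm_square[symmetric] mult.assoc)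
  show ?thesis unfolding symbol_form_def eq integral_complex_of_real by simp
qed

lemma symbol_quad_eq:
  assumes "f \<in> symbol_domain b"
  shows "symbol_quad b f = ennreal (Re (symbol_form b f f))"
  unfolding symbol_form_self symbol_quad_def using assms \<kappa>_pos
  by (subst nn_integral_eq_integral) (simp_all add: symbol_domain_iff b_nonneg ennreal_mult')

lemma symbol_form_nonneg: "0 \<le> Re (symbol_form b f f)"
  unfolding symbol_form_self using \<kappa>_pos
  by (simp add: b_nonneg integral_nonneg_AE)

text \<open>Norm convergence makes the frame coefficients converge pointwise, so Fatou's lemma
  applies even to unbounded \<open>b\<close>.\<close>

lemma symbol_quad_lsc:
  assumes F: "\<And>n. symbol_quad b (F n) \<le> c" and lim: "F \<longlonglongrightarrow> f"
  shows "symbol_quad b f \<le> c"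
proof -
  have quad: "symbol_quad b g = (\<integral>\<^sup>+w. ennreal (\<kappa> * (b w * (cmod (cinner g (\<psi> w)))\<^sup>2)) \<partial>lborel)" for g
    unfolding symbol_quad_def using \<kappa>_pos
    by (subst nn_integral_cmult[symmetric]) (simp_all add: ennreal_mult b_nonneg)
  have "symbol_quad b f = (\<integral>\<^sup>+w. liminf (\<lambda>n. ennreal (\<kappa> * (b w * (cmod (cinner (F n) (\<psi> w)))\<^sup>2))) \<partial>lborel)"
    unfolding quad
  proof (rule nn_integral_cong)
    fix w
    have "(\<lambda>n. ennreal (\<kappa> * (b w * (cmod (cinner (F n) (\<psi> w)))\<^sup>2)))
        \<longlonglongrightarrow> ennreal (\<kappa> * (b w * (cmod (cinner f (\<psi> w)))\<^sup>2))"
      by (intro tendsto_ennrealI tendsto_mult tendsto_const tendsto_power tendsto_norm tendsto_cinner lim)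
    then show "ennreal (\<kappa> * (b w * (cmod (cinner f (\<psi> w)))\<^sup>2))
        = liminf (\<lambda>n. ennreal (\<kappa> * (b w * (cmod (cinner (F n) (\<psi> w)))\<^sup>2)))"
      by (rule lim_imp_Liminf[OF sequentially_bot, symmetric])
  qed
  also have "\<dots> \<le> liminf (\<lambda>n. symbol_quad b (F n))"
    unfolding quad by (rule nn_integral_liminf) measurable
  also have "\<dots> \<le> c" by (rule Liminf_le) (use F in auto)
  finally show ?thesis .
qed

text \<open>Density follows from the Parseval identity: a vector orthogonal to all frame vectors is
  zero. Closedness is \<open>symbol_quad_lsc\<close>.\<close>

lemma dense_closed_form_symbol:
  assumes dom: "\<And>w. \<psi> w \<in> symbol_domain b"
  shows "dense_closed_form (symbol_domain b) (symbol_form b)"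
proof unfold_locales
  show sub: "csubspace (symbol_domain b)"
    unfolding csubspace_def
  proof (intro conjI ballI allI)
    show "0 \<in> symbol_domain b" by (simp add: symbol_domain_iff)
    show "c *\<^sub>C f \<in> symbol_domain b" if "f \<in> symbol_domain b" for c f
    proof -
      have "integrable lborel (\<lambda>w. (cmod c)\<^sup>2 * (b w * (cmod (cinner f (\<psi> w)))\<^sup>2))"
        using that by (simp add: symbol_domain_iff)
      then show ?thesis
        by (simp add: symbol_domain_iff cinner_scaleC_left norm_mult power_mult_distrib mult.left_commute)
    qed
    show "f + g \<in> symbol_domain b" if fg: "f \<in> symbol_domain b" "g \<in> symbol_domain b" for f g
      unfolding symbol_domain_iff
    proof (rule Bochner_Integration.integrable_bound)
      show "integrable lborel (\<lambda>w. 2 * (b w * (cmod (cinner f (\<psi> w)))\<^sup>2) + 2 * (b w * (cmod (cinner g (\<psi> w)))\<^sup>2))"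
        using fg by (intro Bochner_Integration.integrable_add integrable_mult_right)
          (simp_all add: symbol_domain_iff)
      show "AE w in lborel. norm (b w * (cmod (cinner (f + g) (\<psi> w)))\<^sup>2)
          \<le> norm (2 * (b w * (cmod (cinner f (\<psi> w)))\<^sup>2) + 2 * (b w * (cmod (cinner g (\<psi> w)))\<^sup>2))"
      proof (rule AE_I2)
        fix w
        have "(cmod (cinner (f + g) (\<psi> w)))\<^sup>2 \<le> (cmod (cinner f (\<psi> w)) + cmod (cinner g (\<psi> w)))\<^sup>2"
          unfolding cinner_add_left by (intro power_mono norm_triangle_ineq) simp
        also have "\<dots> \<le> 2 * (cmod (cinner f (\<psi> w)))\<^sup>2 + 2 * (cmod (cinner g (\<psi> w)))\<^sup>2"
          using sum_squares_bound[of "cmod (cinner f (\<psi> w))" "cmod (cinner g (\<psi> w))"] by (simp add: power2_sum)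
        finally have "b w * (cmod (cinner (f + g) (\<psi> w)))\<^sup>2
            \<le> b w * (2 * (cmod (cinner f (\<psi> w)))\<^sup>2 + 2 * (cmod (cinner g (\<psi> w)))\<^sup>2)"
          by (rule mult_left_mono[OF _ b_nonneg])
        then show "norm (b w * (cmod (cinner (f + g) (\<psi> w)))\<^sup>2)
          \<le> norm (2 * (b w * (cmod (cinner f (\<psi> w)))\<^sup>2) + 2 * (b w * (cmod (cinner g (\<psi> w)))\<^sup>2))"
          using b_nonneg[of w] by (simp add: distrib_left mult.left_commute)
      qed
    qed measurable
  qed
  show "symbol_form b (f + g) k = symbol_form b f k + symbol_form b g k"
    if "f \<in> symbol_domain b" "g \<in> symbol_domain b" "k \<in> symbol_domain b" for f g k
    using integrable_symbol_mult[OF that(1,3)] integrable_symbol_mult[OF that(2,3)]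
    by (simp add: symbol_form_def cinner_add_left distrib_left distrib_right)
  show "symbol_form b (c *\<^sub>C f) k = c * symbol_form b f k" for c f k
  proof -
    have "(\<lambda>w. complex_of_real (b w) * cinner (c *\<^sub>C f) (\<psi> w) * cinner (\<psi> w) k)
        = (\<lambda>w. c * (complex_of_real (b w) * cinner f (\<psi> w) * cinner (\<psi> w) k))"
      by (simp add: cinner_scaleC_left mult_ac)
    then show ?thesis by (simp add: symbol_form_def)
  qed
  show "symbol_form b f g = cnj (symbol_form b g f)" for f g
  proof -
    have eq: "complex_of_real (b w) * cinner f (\<psi> w) * cinner (\<psi> w) g
        = cnj (complex_of_real (b w) * cinner g (\<psi> w) * cinner (\<psi> w) f)" for w
      using cinner_commute[of f "\<psi> w"] cinner_commute[of "\<psi> w" g] by simp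
    have "(\<integral>w. complex_of_real (b w) * cinner f (\<psi> w) * cinner (\<psi> w) g \<partial>lborel)
        = (\<integral>w. cnj (complex_of_real (b w) * cinner g (\<psi> w) * cinner (\<psi> w) f) \<partial>lborel)"
      by (rule Bochner_Integration.integral_cong[OF refl eq])
    also have "\<dots> = cnj (\<integral>w. complex_of_real (b w) * cinner g (\<psi> w) * cinner (\<psi> w) f \<partial>lborel)"
      by (rule Bochner_Integration.integral_cnj)
    finally show ?thesis by (simp only: symbol_form_def complex_cnj_mult complex_cnj_complex_of_real)
  qed
  show "0 \<le> Re (symbol_form b f f)" for f by (rule symbol_form_nonneg)
  show "f \<in> symbol_domain b \<and> Re (symbol_form b f f) \<le> r"
    if F: "\<And>n. F n \<in> symbol_domain b" "\<And>n. Re (symbol_form b (F n) (F n)) \<le> r" "F \<longlonglongrightarrow> f" for F r f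
  proof -
    have r: "0 \<le> r" using symbol_form_nonneg[of "F 0"] F(2)[of 0] by simp
    have le: "symbol_quad b f \<le> ennreal r"
      by (rule symbol_quad_lsc[OF _ F(3)]) (simp add: symbol_quad_eq[OF F(1)] ennreal_leI F(2))
    then have "f \<in> symbol_domain b" by (simp add: symbol_domain_def le_less_trans)
    moreover have "Re (symbol_form b f f) \<le> r"
      using le unfolding symbol_quad_eq[OF \<open>f \<in> symbol_domain b\<close>] using r by (simp add: ennreal_le_iff)
    ultimately show ?thesis by blast
  qed
  show "closure (symbol_domain b) = UNIV"
    by (rule csubspace_dense[OF sub]) (use dom eq_zero_if_orthogonal in blast)
qed

end

lemma tame_measurable: "tame K M b \<Longrightarrow> b \<in> borel_measurable borel"
  by (rule borel_measurable_continuous_onI[OF tame_continuous])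

text \<open>Continuity bounds \<open>b\<close> on one unit ball, and
  \<open>form_at_frame_vector\<close> converts such a local bound into finite energy.\<close>

lemma frame_vector_in_symbol_domain:
  assumes b: "tame K M b" and pos: "\<And>w. 0 \<le> b w"
  shows "\<psi> w0 \<in> symbol_domain b"
proof -
  have "compact (b ` cball w0 1)"
    by (rule compact_continuous_image) (auto intro: continuous_on_subset[OF tame_continuous[OF b]])
  then have "bounded (b ` cball w0 1)" by (rule compact_imp_bounded)
  then obtain s where "\<And>w. w \<in> cball w0 1 \<Longrightarrow> norm (b w) \<le> s" unfolding bounded_iff by blast
  then have bs: "b w \<le> s" if "w \<in> ball w0 1" for w using that ball_subset_cball by fastforce
  have "symbol_quad b (\<psi> w0) < \<infinity>"
    unfolding symbol_quad_def by (rule le_less_trans[OF form_at_frame_vector[OF b pos bs]]) simp_all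
  then show ?thesis by (simp add: symbol_domain_def)
qed

lemma dense_closed_form_tame:
  assumes "tame K M b" "\<And>w. 0 \<le> b w"
  shows "dense_closed_form (symbol_domain b) (symbol_form b)"
  by (intro dense_closed_form_symbol frame_vector_in_symbol_domain[OF assms] assms(2) tame_measurable[OF assms(1)])

abbreviation symbol_operator :: "('w \<Rightarrow> real) \<Rightarrow> ('a l2 \<times> 'a l2) set" where
  "symbol_operator b \<equiv> dense_closed_form.form_operator (symbol_domain b) (symbol_form b)"

lemma inf_ess_symbol_operator_nonneg:
  assumes b: "tame K M b" and pos: "\<And>w. 0 \<le> b w"
  shows "0 \<le> inf_ess_spectrum (symbol_operator b)"
proof -
  interpret dense_closed_form "symbol_domain b" "symbol_form b" by (rule dense_closed_form_tame[OF b pos])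
  have "ereal 0 \<le> inf_ess_spectrum (symbol_operator b)"
    by (rule inf_ess_spectrum_ge[of "{}" 0]) (simp_all add: q_nonneg)
  then show ?thesis by (simp add: zero_ereal_def)
qed

lemma inf_ess_symbol_operator_le:
  assumes b: "tame K M b" and pos: "\<And>w. 0 \<le> b w"
    and W: "filterlim W at_infinity sequentially"
    and s: "\<And>n w. w \<in> ball (W n) 1 \<Longrightarrow> b w \<le> s"
  shows "inf_ess_spectrum (symbol_operator b)
    \<le> ereal (\<kappa> * ((1 + 2 * real K) ^ K + 1) * (\<Gamma> (K + DIM('w)))\<^sup>2 * decay_integral TYPE('w) * (s + M))"
    (is "_ \<le> ereal ?C")
proof -
  interpret dense_closed_form "symbol_domain b" "symbol_form b" by (rule dense_closed_form_tame[OF b pos])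
  have s0: "0 \<le> s" using s[of "W 0" 0] pos[of "W 0"] by simp
  have M: "0 \<le> M" using b by (simp add: tame_def)
  have C: "0 \<le> ?C"
    using \<kappa>_pos s0 M decay_integral_nonneg[where 'a='w]
    by (intro mult_nonneg_nonneg add_nonneg_nonneg) auto
  show ?thesis
  proof (rule inf_ess_spectrum_le)
    fix n
    show dom: "\<psi> (W n) \<in> symbol_domain b" by (rule frame_vector_in_symbol_domain[OF b pos])
    show "norm (\<psi> (W n)) = 1" by (rule norm_\<psi>)
    have "symbol_quad b (\<psi> (W n)) \<le> ennreal ?C"
      unfolding symbol_quad_def by (rule form_at_frame_vector[OF b pos s])
    then show "Re (symbol_form b (\<psi> (W n)) (\<psi> (W n))) \<le> ?C"
      unfolding symbol_quad_eq[OF tame_measurable[OF b] pos dom] using C by (simp add: ennreal_le_iff)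
  next
    fix g
    have "(\<lambda>n. cnj (cinner g (\<psi> (W n)))) \<longlonglongrightarrow> cnj 0"
      by (intro tendsto_cnj coeff_tendsto_zero[OF W])
    then show "(\<lambda>n. cinner (\<psi> (W n)) g) \<longlonglongrightarrow> 0" by (simp add: cinner_commute[symmetric])
  qed
qed

end

text \<open>The order of quantifiers matters: one choice of constants has to serve the frames and
  symbols of all \<open>h\<close> simultaneously.\<close>

lemma inf_ess_symbol_operator_ge:
  fixes \<kappa> :: real and \<Gamma> :: "nat \<Rightarrow> real" and K :: nat
  assumes K: "0 < K"
  shows "\<exists>c>0. \<exists>C>0. \<forall>(\<psi> :: 'w::euclidean_space \<Rightarrow> 'a::euclidean_space l2) b M \<mu> R0.
    localized_frame \<kappa> \<Gamma> \<psi> \<longrightarrow> tame K M b \<longrightarrow> (\<forall>w. 0 \<le> b w) \<longrightarrow> 0 < \<mu> \<longrightarrow> C * M \<le> \<mu> \<longrightarrow>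
    (\<forall>w. R0 \<le> norm w \<longrightarrow> (\<exists>w1\<in>ball w 1. \<mu> \<le> b w1)) \<longrightarrow>
    ereal (c * \<mu>) \<le> inf_ess_spectrum (localized_frame.symbol_operator \<kappa> \<psi> b)"
proof -
  from frame_form_lower_bound[OF K, of \<kappa> \<Gamma>]
  obtain c C where c: "0 < c" and C: "0 < C" and bound:
    "\<forall>(\<psi> :: 'w \<Rightarrow> 'a l2) b M \<mu> R0. localized_frame \<kappa> \<Gamma> \<psi> \<longrightarrow> tame K M b \<longrightarrow> (\<forall>w. 0 \<le> b w) \<longrightarrow>
      0 < \<mu> \<longrightarrow> C * M \<le> \<mu> \<longrightarrow> (\<forall>w. R0 \<le> norm w \<longrightarrow> (\<exists>w1\<in>ball w 1. \<mu> \<le> b w1)) \<longrightarrow>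
      (\<exists>B C'. finite B \<and> 0 \<le> C' \<and> (\<forall>f.
        ennreal (c * \<mu> * (norm f)\<^sup>2 - C' * (\<Sum>k\<in>B. (cmod (cinner f k))\<^sup>2))
        \<le> ennreal \<kappa> * (\<integral>\<^sup>+w. ennreal (b w * (cmod (cinner f (\<psi> w)))\<^sup>2) \<partial>lborel)))"
    by (elim exE conjE) (rule that)
  have "ereal (c * \<mu>) \<le> inf_ess_spectrum (localized_frame.symbol_operator \<kappa> \<psi> b)"
    if fr: "localized_frame \<kappa> \<Gamma> \<psi>" and b: "tame K M b" and pos: "\<forall>w. 0 \<le> b w" and \<mu>: "0 < \<mu>" "C * M \<le> \<mu>"
      and big: "\<forall>w. R0 \<le> norm w \<longrightarrow> (\<exists>w1\<in>ball w 1. \<mu> \<le> b w1)"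
    for \<psi> :: "'w \<Rightarrow> 'a l2" and b M \<mu> R0
  proof -
    interpret localized_frame \<kappa> \<Gamma> \<psi> by (rule fr)
    have pos': "0 \<le> b w" for w using pos by blast
    interpret dense_closed_form "symbol_domain b" "symbol_form b"
      by (rule dense_closed_form_tame[OF b pos'])
    obtain B C' where B: "finite B" "0 \<le> C'" and low: "\<And>f.
        ennreal (c * \<mu> * (norm f)\<^sup>2 - C' * (\<Sum>k\<in>B. (cmod (cinner f k))\<^sup>2)) \<le> symbol_quad b f"
      using bound[rule_format, OF fr b pos' \<mu>] big unfolding symbol_quad_def by blast
    show ?thesis
    proof (rule inf_ess_spectrum_ge[OF B])
      fix f assume f: "f \<in> symbol_domain b"
      show "c * \<mu> * (norm f)\<^sup>2 - C' * (\<Sum>k\<in>B. (cmod (cinner f k))\<^sup>2) \<le> Re (symbol_form b f f)"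
        using low[of f] unfolding symbol_quad_eq[OF tame_measurable[OF b] pos' f]
        using symbol_form_nonneg[OF tame_measurable[OF b] pos', of f] by (simp add: ennreal_le_iff)
    qed
  qed
  then have "\<forall>(\<psi> :: 'w \<Rightarrow> 'a l2) b M \<mu> R0.
    localized_frame \<kappa> \<Gamma> \<psi> \<longrightarrow> tame K M b \<longrightarrow> (\<forall>w. 0 \<le> b w) \<longrightarrow> 0 < \<mu> \<longrightarrow> C * M \<le> \<mu> \<longrightarrow>
    (\<forall>w. R0 \<le> norm w \<longrightarrow> (\<exists>w1\<in>ball w 1. \<mu> \<le> b w1)) \<longrightarrow>
    ereal (c * \<mu>) \<le> inf_ess_spectrum (localized_frame.symbol_operator \<kappa> \<psi> b)"
    by (intro allI impI)
  note bnd = this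
  show ?thesis by (rule exI[of _ c], rule conjI[OF c], rule exI[of _ C], rule conjI[OF C], rule bnd)
qed

subsection \<open>Density of continuous functions and continuity of translations\<close>

lemma square_integrable_bounded_support:
  fixes F :: "'a::euclidean_space \<Rightarrow> complex"
  assumes [measurable]: "F \<in> borel_measurable borel" and bd: "\<And>x. cmod (F x) \<le> B"
    and supp: "\<And>x. R < norm x \<Longrightarrow> F x = 0"
  shows "square_integrable F"
proof (rule square_integrableI_nn)
  have "(\<integral>\<^sup>+x. ennreal ((cmod (F x))\<^sup>2) \<partial>lborel) \<le> (\<integral>\<^sup>+x. ennreal (B\<^sup>2) * indicator (cball (0::'a) R) x \<partial>lborel)"
  proof (rule nn_integral_mono)
    fix x
    show "ennreal ((cmod (F x))\<^sup>2) \<le> ennreal (B\<^sup>2) * indicator (cball 0 R) x"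
      using supp[of x] power_mono[OF bd[of x], of 2] by (cases "norm x \<le> R") (auto intro!: ennreal_leI)
  qed
  also have "\<dots> < \<infinity>"
    using emeasure_bounded_finite[OF bounded_cball, of "0::'a" R]
    by (simp add: nn_integral_cmult_indicator ennreal_mult_less_top)
  finally show "(\<integral>\<^sup>+x. ennreal ((cmod (F x))\<^sup>2) \<partial>lborel) < \<infinity>" .
qed simp

lemma abs_l2_tendstoI:
  assumes F: "square_integrable F" "\<And>n. square_integrable (G n)"
    and lim: "AE x in lborel. (\<lambda>n. G n x) \<longlonglongrightarrow> F x"
    and w: "integrable lborel w" "\<And>n. AE x in lborel. (cmod (G n x - F x))\<^sup>2 \<le> w x"
  shows "(\<lambda>n. abs_l2 (G n)) \<longlonglongrightarrow> abs_l2 F"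
proof -
  have [measurable]: "F \<in> borel_measurable borel" "G n \<in> borel_measurable borel" for n
    using F by (auto simp: square_integrable_def)
  have "(\<lambda>n. \<integral>x. (cmod (G n x - F x))\<^sup>2 \<partial>lborel) \<longlonglongrightarrow> (\<integral>x. 0 \<partial>(lborel :: 'a measure))"
  proof (rule integral_dominated_convergence[OF _ _ w(1)])
    show "AE x in lborel. (\<lambda>n. (cmod (G n x - F x))\<^sup>2) \<longlonglongrightarrow> 0"
      using lim
    proof eventually_elim
      case (elim x)
      have "(\<lambda>n. (cmod (G n x - F x))\<^sup>2) \<longlonglongrightarrow> (cmod (F x - F x))\<^sup>2" by (intro tendsto_intros elim)
      then show ?case by simp
    qed
    show "AE x in lborel. norm ((cmod (G n x - F x))\<^sup>2) \<le> w x" for n using w(2)[of n] by simp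
  qed measurable
  moreover have "(norm (abs_l2 (G n) - abs_l2 F))\<^sup>2 = (\<integral>x. (cmod (G n x - F x))\<^sup>2 \<partial>lborel)" for n
    unfolding abs_l2_diff[OF F(2,1)] by (rule norm_abs_l2[OF square_integrable_diff[OF F(2,1)]])
  ultimately have "(\<lambda>n. (norm (abs_l2 (G n) - abs_l2 F))\<^sup>2) \<longlonglongrightarrow> 0" by simp
  then have "(\<lambda>n. sqrt ((norm (abs_l2 (G n) - abs_l2 F))\<^sup>2)) \<longlonglongrightarrow> sqrt 0" by (intro tendsto_intros)
  then have "(\<lambda>n. abs_l2 (G n) - abs_l2 F) \<longlonglongrightarrow> 0" by (simp add: tendsto_norm_zero_iff)
  then show ?thesis by (simp add: LIM_zero_iff)
qed

text \<open>For positive \<open>k\<close>, the radial retraction of the plane onto the disc of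
  radius \<open>k\<close>.\<close>

definition clip :: "real \<Rightarrow> complex \<Rightarrow> complex" where
  "clip k z = complex_of_real (k / max k (cmod z)) * z"

lemma clip_bound: "0 < k \<Longrightarrow> cmod (clip k z) \<le> k"
  by (auto simp: clip_def norm_mult norm_divide max_def divide_le_eq)

lemma clip_id: "0 < k \<Longrightarrow> cmod z \<le> k \<Longrightarrow> clip k z = z"
  by (simp add: clip_def max_def)

lemma continuous_clip: "0 < k \<Longrightarrow> continuous_on UNIV (clip k)"
  unfolding clip_def by (intro continuous_intros) (auto simp: max_def)

text \<open>A measurable function is an almost everywhere limit of continuous ones. Clipping the
  values and cutting off the support, both continuously, preserve the limit and provide a dominating
  function.\<close>

lemma approximable_bounded:
  fixes F :: "'a::euclidean_space \<Rightarrow> complex"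
  assumes F: "F \<in> borel_measurable borel" and k: "0 < k" and bd: "\<And>x. cmod (F x) \<le> k"
    and supp: "\<And>x. k < norm x \<Longrightarrow> F x = 0" and e: "0 < e"
  shows "\<exists>H R. continuous_on UNIV H \<and> (\<forall>x. R < norm x \<longrightarrow> H x = 0) \<and> square_integrable H
    \<and> norm (abs_l2 F - abs_l2 H) < e"
proof -
  have "F \<in> borel_measurable lebesgue" using F by (simp add: measurable_completion)
  then have "F measurable_on UNIV" by (rule lebesgue_measurable_imp_measurable_on) simp
  then obtain N g where N: "negligible N" and g: "\<And>n. continuous_on UNIV (g n)"
    "\<And>x. x \<notin> N \<Longrightarrow> (\<lambda>n. g n x) \<longlonglongrightarrow> F x"
    unfolding measurable_on_def by auto
  define cut where "cut x = max 0 (min 1 (k + 1 - norm x))" for x :: 'a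
  define H where "H n x = complex_of_real (cut x) * clip k (g n x)" for n x
  have cut: "0 \<le> cut x" "cut x \<le> 1" for x by (auto simp: cut_def)
  have cont: "continuous_on UNIV (H n)" for n
    unfolding H_def cut_def
    by (intro continuous_intros continuous_on_compose2[OF continuous_clip[OF k] g(1)]) auto
  have bdH: "cmod (H n x) \<le> k" for n x
  proof -
    have "cmod (H n x) = cut x * cmod (clip k (g n x))" using cut[of x] by (simp add: H_def norm_mult)
    also have "\<dots> \<le> 1 * k" using cut[of x] clip_bound[OF k] k by (intro mult_mono) auto
    finally show ?thesis by simp
  qed
  have suppH: "H n x = 0" if "k + 1 < norm x" for n x using that by (simp add: H_def cut_def)
  have mH [measurable]: "H n \<in> borel_measurable borel" for n by (rule borel_measurable_continuous_onI[OF cont])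
  have sH: "square_integrable (H n)" for n by (rule square_integrable_bounded_support[OF mH bdH suppH])
  have sF: "square_integrable F" by (rule square_integrable_bounded_support[OF F bd supp])
  have "(\<lambda>n. abs_l2 (H n)) \<longlonglongrightarrow> abs_l2 F"
  proof (rule abs_l2_tendstoI[OF sF sH])
    have "N \<in> null_sets lebesgue" using N by (simp add: negligible_iff_null_sets)
    then have "AE x in lebesgue. x \<notin> N" by (rule AE_not_in)
    then have "AE x in lborel. x \<notin> N" by (simp add: AE_completion_iff)
    then show "AE x in lborel. (\<lambda>n. H n x) \<longlonglongrightarrow> F x"
    proof eventually_elim
      case (elim x)
      have "isCont (clip k) (F x)" using continuous_clip[OF k] by (simp add: continuous_on_eq_continuous_at)
      then have "(\<lambda>n. clip k (g n x)) \<longlonglongrightarrow> clip k (F x)" by (rule isCont_tendsto_compose[OF _ g(2)[OF elim]])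
      then have "(\<lambda>n. H n x) \<longlonglongrightarrow> complex_of_real (cut x) * clip k (F x)"
        unfolding H_def by (intro tendsto_intros)
      moreover have "complex_of_real (cut x) * clip k (F x) = F x"
      proof (cases "k < norm x")
        case True
        then show ?thesis by (simp add: supp clip_def)
      next
        case False
        then show ?thesis using clip_id[OF k bd[of x]] by (simp add: cut_def)
      qed
      ultimately show ?case by simp
    qed
    show "integrable lborel (\<lambda>x. (2 * k)\<^sup>2 * indicator (cball (0::'a) (k + 1)) x)"
      using emeasure_bounded_finite[OF bounded_cball, of "0::'a" "k + 1"]
      by (intro integrable_mult_right integrable_real_indicator) auto
    show "AE x in lborel. (cmod (H n x - F x))\<^sup>2 \<le> (2 * k)\<^sup>2 * indicator (cball 0 (k + 1)) x" for n
    proof (rule AE_I2)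
      fix x
      show "(cmod (H n x - F x))\<^sup>2 \<le> (2 * k)\<^sup>2 * indicator (cball 0 (k + 1)) x"
      proof (cases "norm x \<le> k + 1")
        case True
        have "cmod (H n x - F x) \<le> 2 * k"
          using norm_triangle_ineq4[of "H n x" "F x"] bdH[of n x] bd[of x] by linarith
        then have "(cmod (H n x - F x))\<^sup>2 \<le> (2 * k)\<^sup>2" by (intro power_mono) auto
        then show ?thesis using True by simp
      next
        case False
        then show ?thesis using suppH[of x n] supp[of x] by simp
      qed
    qed
  qed
  then obtain n where "norm (abs_l2 (H n) - abs_l2 F) < e"
    using LIMSEQ_D[OF _ e] by blast
  then have "norm (abs_l2 F - abs_l2 (H n)) < e" by (simp add: norm_minus_commute)
  then show ?thesis using cont suppH sH by blast
qed

lemma l2_approximable: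
  fixes F :: "'a::euclidean_space \<Rightarrow> complex"
  assumes F: "square_integrable F" and e: "0 < e"
  shows "\<exists>H R. continuous_on UNIV H \<and> (\<forall>x. R < norm x \<longrightarrow> H x = 0) \<and> square_integrable H
    \<and> norm (abs_l2 F - abs_l2 H) < e"
proof -
  have [measurable]: "F \<in> borel_measurable borel" using F by (simp add: square_integrable_def)
  define T where "T n x = (if cmod (F x) \<le> real (Suc n) \<and> norm x \<le> real (Suc n) then F x else 0)" for n :: nat and x
  have [measurable]: "T n \<in> borel_measurable borel" for n unfolding T_def by measurable
  have sT: "square_integrable (T n)" for n
    by (rule square_integrable_bounded_support[of _ "real (Suc n)" "real (Suc n)"]) (auto simp: T_def)
  have "(\<lambda>n. abs_l2 (T n)) \<longlonglongrightarrow> abs_l2 F"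
  proof (rule abs_l2_tendstoI[OF F sT])
    have "(\<lambda>n. T n x) \<longlonglongrightarrow> F x" for x
    proof (rule tendsto_eventually)
      obtain M :: nat where M: "max (cmod (F x)) (norm x) < real M" using reals_Archimedean2 by blast
      show "\<forall>\<^sub>F n in sequentially. T n x = F x"
        using eventually_ge_at_top[of M]
      proof eventually_elim
        case (elim n)
        then have "real M \<le> real (Suc n)" by simp
        then show ?case using M unfolding T_def by auto
      qed
    qed
    then show "AE x in lborel. (\<lambda>n. T n x) \<longlonglongrightarrow> F x" by simp
    show "integrable lborel (\<lambda>x. (cmod (F x))\<^sup>2)" using F by (simp add: square_integrable_def)
    show "AE x in lborel. (cmod (T n x - F x))\<^sup>2 \<le> (cmod (F x))\<^sup>2" for n
      by (rule AE_I2) (simp add: T_def)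
  qed
  then obtain n where n: "norm (abs_l2 (T n) - abs_l2 F) < e/2"
    using LIMSEQ_D[of _ _ "e/2"] e by (metis half_gt_zero order_refl)
  have "\<exists>H R. continuous_on UNIV H \<and> (\<forall>x. R < norm x \<longrightarrow> H x = 0) \<and> square_integrable H
    \<and> norm (abs_l2 (T n) - abs_l2 H) < e/2"
    by (rule approximable_bounded[of _ "real (Suc n)"]) (use e in \<open>auto simp: T_def\<close>)
  then obtain H R where H: "continuous_on UNIV H" "\<forall>x. R < norm x \<longrightarrow> H x = 0" "square_integrable H"
    "norm (abs_l2 (T n) - abs_l2 H) < e/2"
    by blast
  have "norm (abs_l2 F - abs_l2 H) \<le> norm (abs_l2 F - abs_l2 (T n)) + norm (abs_l2 (T n) - abs_l2 H)"
    using norm_triangle_ineq[of "abs_l2 F - abs_l2 (T n)" "abs_l2 (T n) - abs_l2 H"] by simp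
  then have "norm (abs_l2 F - abs_l2 H) < e" using n H(4) by (simp add: norm_minus_commute)
  then show ?thesis using H by blast
qed

lemma square_integrable_translate:
  assumes "square_integrable F"
  shows "square_integrable (\<lambda>x. F (x + t))"
proof -
  have [measurable]: "F \<in> borel_measurable borel" using assms by (simp add: square_integrable_def)
  show ?thesis
    using assms integrable_lborel_translate[of "\<lambda>x. (cmod (F x))\<^sup>2" t] by (simp add: square_integrable_def)
qed

lemma norm_abs_l2_translate:
  assumes F: "square_integrable F"
  shows "norm (abs_l2 (\<lambda>x. F (x + t))) = norm (abs_l2 F)"
proof -
  have "F \<in> borel_measurable borel" using assms by (simp add: square_integrable_def)
  then have "(norm (abs_l2 (\<lambda>x. F (x + t))))\<^sup>2 = (norm (abs_l2 F))\<^sup>2"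
    unfolding norm_abs_l2[OF F] norm_abs_l2[OF square_integrable_translate[OF F]]
    by (intro integral_lborel_translate) measurable
  then show ?thesis by simp
qed

text \<open>Translation is isometric, so it suffices to treat a nearby continuous function of
  bounded support, where pointwise continuity and dominated convergence apply.\<close>

lemma translate_tendsto:
  assumes F: "square_integrable F" and t: "t \<longlonglongrightarrow> (0 :: 'a::euclidean_space)"
  shows "(\<lambda>n. abs_l2 (\<lambda>x. F (x + t n))) \<longlonglongrightarrow> abs_l2 F"
proof (rule LIMSEQ_I)
  fix e :: real assume e: "0 < e"
  obtain H R where H: "continuous_on UNIV H" "\<And>x. R < norm x \<Longrightarrow> H x = 0" "square_integrable H"
    "norm (abs_l2 F - abs_l2 H) < e/3"
  proof -
    have "0 < e/3" using e by simp
    from l2_approximable[OF F this] show ?thesis using that by blast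
  qed
  have "compact (H ` cball 0 R)"
    by (rule compact_continuous_image) (auto intro: continuous_on_subset[OF H(1)])
  then have "bounded (H ` cball 0 R)" by (rule compact_imp_bounded)
  then obtain B where B: "\<And>x. x \<in> cball 0 R \<Longrightarrow> cmod (H x) \<le> B"
    unfolding bounded_iff by blast
  have bd: "cmod (H x) \<le> \<bar>B\<bar>" for x
    using B[of x] H(2)[of x] by (cases "norm x \<le> R") auto
  \<comment> \<open>Shifts shorter than 1 keep all translated supports in the ball of radius
    \<open>R + 1\<close>.\<close>
  obtain M where M: "\<And>n. n \<ge> M \<Longrightarrow> norm (t n) < 1"
    using LIMSEQ_D[OF t, of 1] by auto
  define s where "s n = t (n + M)" for n
  have s: "s \<longlonglongrightarrow> 0" unfolding s_def by (rule LIMSEQ_ignore_initial_segment[OF t])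
  have s1: "norm (s n) < 1" for n unfolding s_def by (rule M) simp
  note mt = square_integrable_translate[OF H(3)]
  have "(\<lambda>n. abs_l2 (\<lambda>x. H (x + s n))) \<longlonglongrightarrow> abs_l2 H"
  proof (rule abs_l2_tendstoI[OF H(3) mt])
    have "(\<lambda>n. H (x + s n)) \<longlonglongrightarrow> H x" for x
    proof -
      have "isCont H x" using H(1) by (simp add: continuous_on_eq_continuous_at)
      moreover have "(\<lambda>n. x + s n) \<longlonglongrightarrow> x" using tendsto_add[OF tendsto_const[of x] s] by simp
      ultimately show ?thesis by (rule isCont_tendsto_compose)
    qed
    then show "AE x in lborel. (\<lambda>n. H (x + s n)) \<longlonglongrightarrow> H x" by simp
    show "integrable lborel (\<lambda>x. (2 * \<bar>B\<bar>)\<^sup>2 * indicator (cball (0::'a) (R + 1)) x)"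
      using emeasure_bounded_finite[OF bounded_cball, of "0::'a" "R + 1"]
      by (intro integrable_mult_right integrable_real_indicator) auto
    show "AE x in lborel. (cmod (H (x + s n) - H x))\<^sup>2 \<le> (2 * \<bar>B\<bar>)\<^sup>2 * indicator (cball 0 (R + 1)) x" for n
    proof (rule AE_I2)
      fix x
      show "(cmod (H (x + s n) - H x))\<^sup>2 \<le> (2 * \<bar>B\<bar>)\<^sup>2 * indicator (cball 0 (R + 1)) x"
      proof (cases "norm x \<le> R + 1")
        case True
        have "cmod (H (x + s n) - H x) \<le> 2 * \<bar>B\<bar>"
          using norm_triangle_ineq4[of "H (x + s n)" "H x"] bd[of "x + s n"] bd[of x] by linarith
        then have "(cmod (H (x + s n) - H x))\<^sup>2 \<le> (2 * \<bar>B\<bar>)\<^sup>2" by (intro power_mono) auto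
        then show ?thesis using True by simp
      next
        case False
        have "norm x \<le> norm (x + s n) + norm (s n)"
          using norm_triangle_ineq4[of "x + s n" "s n"] by simp
        then have "R < norm (x + s n)" "R < norm x" using False s1[of n] by auto
        then show ?thesis using H(2) by simp
      qed
    qed
  qed
  then obtain N where N: "\<And>n. n \<ge> N \<Longrightarrow> norm (abs_l2 (\<lambda>x. H (x + s n)) - abs_l2 H) < e/3"
    using LIMSEQ_D[of _ _ "e/3"] e by (metis zero_less_divide_iff zero_less_numeral)
  have "norm (abs_l2 (\<lambda>x. F (x + t n)) - abs_l2 F) < e" if n: "n \<ge> N + M" for n
  proof -
    have tn: "t n = s (n - M)" using n by (simp add: s_def)
    let ?F = "abs_l2 F" and ?H = "abs_l2 H" and ?Ft = "abs_l2 (\<lambda>x. F (x + t n))" and ?Ht = "abs_l2 (\<lambda>x. H (x + t n))"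
    have "?Ft - ?Ht = abs_l2 (\<lambda>x. (\<lambda>x. F x - H x) (x + t n))"
      by (simp add: abs_l2_diff square_integrable_translate F H(3))
    also have "norm \<dots> = norm (abs_l2 (\<lambda>x. F x - H x))"
      by (rule norm_abs_l2_translate) (rule square_integrable_diff[OF F H(3)])
    also have "\<dots> < e/3" using H(4) by (simp add: abs_l2_diff F H(3))
    finally have 1: "norm (?Ft - ?Ht) < e/3" .
    have 2: "norm (?Ht - ?H) < e/3" unfolding tn by (rule N) (use n in simp)
    have 3: "norm (?H - ?F) < e/3" using H(4) by (simp add: norm_minus_commute)
    have "?Ft - ?F = (?Ft - ?Ht) + (?Ht - ?H) + (?H - ?F)" by simp
    then have "norm (?Ft - ?F) \<le> norm (?Ft - ?Ht) + norm (?Ht - ?H) + norm (?H - ?F)"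
      by (metis add_mono norm_triangle_ineq norm_triangle_le order_refl)
    then show ?thesis using 1 2 3 by linarith
  qed
  then show "\<exists>no. \<forall>n\<ge>no. norm (abs_l2 (\<lambda>x. F (x + t n)) - abs_l2 F) < e" by blast
qed

subsection \<open>Gaussian integrals\<close>

lemma integral_lborel_prod:
  fixes h :: "'a::euclidean_space \<Rightarrow> real \<Rightarrow> complex"
  assumes h: "\<And>b. b \<in> Basis \<Longrightarrow> integrable lborel (h b)"
  shows "integrable lborel (\<lambda>x::'a. \<Prod>b\<in>Basis. h b (x \<bullet> b))"
    and "(\<integral>x. (\<Prod>b\<in>Basis. h b (x \<bullet> b)) \<partial>(lborel :: 'a measure)) = (\<Prod>b\<in>Basis. (\<integral>t. h b t \<partial>lborel))"
proof -
  interpret product_sigma_finite "\<lambda>_::'a. lborel :: real measure" by unfold_locales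
  have [measurable]: "h b \<in> borel_measurable borel" if "b \<in> Basis" for b
    using borel_measurable_integrable[OF h[OF that]] by simp
  have m [measurable]: "(\<lambda>x::'a. \<Prod>b\<in>Basis. h b (x \<bullet> b)) \<in> borel_measurable borel"
    by measurable
  have T [measurable]: "(\<lambda>f. \<Sum>b\<in>Basis. f b *\<^sub>R b) \<in> (\<Pi>\<^sub>M b\<in>(Basis::'a set). lborel) \<rightarrow>\<^sub>M borel"
    by measurable
  have eq: "(\<Prod>b\<in>Basis. h b ((\<Sum>b'\<in>Basis. f b' *\<^sub>R b') \<bullet> b)) = (\<Prod>b\<in>(Basis::'a set). h b (f b))" for f
    by (intro prod.cong refl) simp
  show "integrable lborel (\<lambda>x::'a. \<Prod>b\<in>Basis. h b (x \<bullet> b))"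
    by (subst lborel_eq, subst integrable_distr_eq[OF T m]) (simp add: eq product_integrable_prod h)
  show "(\<integral>x. (\<Prod>b\<in>Basis. h b (x \<bullet> b)) \<partial>(lborel :: 'a measure)) = (\<Prod>b\<in>Basis. (\<integral>t. h b t \<partial>lborel))"
    by (subst lborel_eq, subst integral_distr[OF T m]) (simp add: eq product_integral_prod h)
qed

definition gauss :: "'a::euclidean_space \<Rightarrow> real" where
  "gauss x = exp (- ((norm x)\<^sup>2 / 2))"

lemma gauss_measurable [measurable]: "gauss \<in> borel_measurable borel"
  unfolding gauss_def by measurable

lemma gauss_pos: "0 < gauss x" and gauss_le_1: "gauss x \<le> 1" and gauss_minus: "gauss (- x) = gauss x"
  by (simp_all add: gauss_def)

text \<open>This is the characteristic function of the standard normal distribution up to the factor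
  \<open>sqrt (2 * pi)\<close>.\<close>

lemma gauss_1d:
  fixes t :: real
  shows "integrable lborel (\<lambda>x. exp (\<i> * complex_of_real (t * x)) * complex_of_real (exp (- (x\<^sup>2 / 2))))" (is "integrable _ ?f")
    and "(\<integral>x. exp (\<i> * complex_of_real (t * x)) * complex_of_real (exp (- (x\<^sup>2 / 2))) \<partial>lborel)
      = complex_of_real (sqrt (2 * pi) * exp (- (t\<^sup>2 / 2)))"
proof -
  have dens: "complex_of_real (exp (- (x\<^sup>2 / 2))) = complex_of_real (sqrt (2 * pi)) * complex_of_real (std_normal_density x)" for x
    by (simp add: std_normal_density_def)
  have int: "integrable lborel (\<lambda>x. std_normal_density x *\<^sub>R iexp (t * x))"
  proof (rule Bochner_Integration.integrable_bound)
    show "integrable lborel std_normal_density" by simp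
  qed (auto simp: norm_exp_imaginary)
  have f: "?f = (\<lambda>x. complex_of_real (sqrt (2 * pi)) * (std_normal_density x *\<^sub>R iexp (t * x)))"
    by (simp add: dens scaleR_conv_of_real fun_eq_iff)
  show "integrable lborel ?f" unfolding f by (intro integrable_mult_right int)
  have "(\<integral>x. std_normal_density x *\<^sub>R iexp (t * x) \<partial>lborel) = char std_normal_distribution t"
    unfolding char_def by (subst integral_density) auto
  then show "(\<integral>x. ?f x \<partial>lborel) = complex_of_real (sqrt (2 * pi) * exp (- (t\<^sup>2 / 2)))"
    unfolding f integral_mult_right_zero by (simp only: char_std_normal_distribution of_real_mult) simp
qed

lemma gauss_fourier:
  fixes t :: "'a::euclidean_space"
  shows "integrable lborel (\<lambda>x. exp (\<i> * complex_of_real (t \<bullet> x)) * complex_of_real (gauss x))"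
    and "(\<integral>x. exp (\<i> * complex_of_real (t \<bullet> x)) * complex_of_real (gauss x) \<partial>lborel)
      = complex_of_real (sqrt (2 * pi) ^ DIM('a) * gauss t)"
proof -
  have nrm: "(norm x)\<^sup>2 = (\<Sum>b\<in>Basis. (x \<bullet> b)\<^sup>2)" for x :: 'a
    unfolding power2_norm_eq_inner by (subst euclidean_inner) (simp add: power2_eq_square)
  have g: "gauss x = (\<Prod>b\<in>Basis. exp (- ((x \<bullet> b)\<^sup>2 / 2)))" for x :: 'a
    by (simp add: gauss_def nrm sum_divide_distrib sum_negf[symmetric] exp_sum)
  have f: "exp (\<i> * complex_of_real (t \<bullet> x)) * complex_of_real (gauss x)
      = (\<Prod>b\<in>Basis. exp (\<i> * complex_of_real ((t \<bullet> b) * (x \<bullet> b))) * complex_of_real (exp (- ((x \<bullet> b)\<^sup>2 / 2))))" for x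
  proof -
    have "exp (\<i> * complex_of_real (t \<bullet> x)) = (\<Prod>b\<in>Basis. exp (\<i> * complex_of_real ((t \<bullet> b) * (x \<bullet> b))))"
      by (subst euclidean_inner) (simp add: sum_distrib_left exp_sum)
    then show ?thesis by (simp add: g prod.distrib)
  qed
  show "integrable lborel (\<lambda>x. exp (\<i> * complex_of_real (t \<bullet> x)) * complex_of_real (gauss x))"
    unfolding f by (rule integral_lborel_prod(1)) (rule gauss_1d(1))
  have "(\<integral>x. exp (\<i> * complex_of_real (t \<bullet> x)) * complex_of_real (gauss x) \<partial>lborel)
      = (\<Prod>b\<in>Basis. complex_of_real (sqrt (2 * pi) * exp (- ((t \<bullet> b)\<^sup>2 / 2))))"
    unfolding f by (subst integral_lborel_prod(2)[OF gauss_1d(1)]) (simp_all only: gauss_1d(2))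
  also have "\<dots> = complex_of_real (sqrt (2 * pi) ^ DIM('a) * gauss t)"
    by (simp add: g prod.distrib)
  finally show "(\<integral>x. exp (\<i> * complex_of_real (t \<bullet> x)) * complex_of_real (gauss x) \<partial>lborel)
      = complex_of_real (sqrt (2 * pi) ^ DIM('a) * gauss t)" .
qed

lemma gauss_integral:
  "integrable lborel (gauss :: 'a::euclidean_space \<Rightarrow> real)"
  "(\<integral>x. gauss (x::'a) \<partial>lborel) = sqrt (2 * pi) ^ DIM('a)"
proof -
  have "integrable lborel (\<lambda>x::'a. complex_of_real (gauss x))" using gauss_fourier(1)[of 0] by simp
  then show int: "integrable lborel (gauss :: 'a \<Rightarrow> real)"
    using integrable_Re by fastforce
  have "(\<integral>x. complex_of_real (gauss (x::'a)) \<partial>lborel) = complex_of_real (sqrt (2 * pi) ^ DIM('a))"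
    using gauss_fourier(2)[of 0] by (simp add: gauss_def[of 0])
  then show "(\<integral>x. gauss (x::'a) \<partial>lborel) = sqrt (2 * pi) ^ DIM('a)"
    by (simp only: integral_complex_of_real of_real_eq_iff)
qed

subsection \<open>The Plancherel and Moyal identities\<close>

lemma integrable_lborel_affine:
  fixes t :: "'a::euclidean_space" and f :: "'a \<Rightarrow> 'b::{banach, second_countable_topology}"
  assumes c: "c \<noteq> 0" and f: "integrable lborel f"
  shows "integrable lborel (\<lambda>x. f (t + c *\<^sub>R x))"
proof (rule integrableI_bounded)
  have [measurable]: "f \<in> borel_measurable borel" using borel_measurable_integrable[OF f] by simp
  show "(\<lambda>x. f (t + c *\<^sub>R x)) \<in> borel_measurable lborel" by measurable
  have "ennreal (\<bar>c\<bar> ^ DIM('a)) * (\<integral>\<^sup>+x. ennreal (norm (f (t + c *\<^sub>R x))) \<partial>lborel) < \<infinity>"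
    using f nn_integral_lborel_affine[OF c, of "\<lambda>x. ennreal (norm (f x))" t]
    by (simp add: integrable_iff_bounded)
  then show "(\<integral>\<^sup>+x. ennreal (norm (f (t + c *\<^sub>R x))) \<partial>lborel) < \<infinity>"
    using c by (auto simp: ennreal_mult_less_top)
qed

lemma integrable_pairI:
  fixes f :: "'a::euclidean_space \<times> 'b::euclidean_space \<Rightarrow> complex"
  assumes [measurable]: "f \<in> borel_measurable (lborel \<Otimes>\<^sub>M lborel)"
    and a: "integrable lborel a" and b: "integrable lborel b"
    and bound: "\<And>x y. cmod (f (x, y)) \<le> a x * b y"
    and nn: "\<And>x. 0 \<le> a x" "\<And>y. 0 \<le> b y"
  shows "integrable (lborel \<Otimes>\<^sub>M lborel) f"
proof (rule integrableI_bounded)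
  have [measurable]: "a \<in> borel_measurable borel" "b \<in> borel_measurable borel"
    using borel_measurable_integrable[OF a] borel_measurable_integrable[OF b] by simp_all
  have "(\<integral>\<^sup>+p. ennreal (norm (f p)) \<partial>(lborel \<Otimes>\<^sub>M lborel)) = (\<integral>\<^sup>+x. (\<integral>\<^sup>+y. ennreal (norm (f (x, y))) \<partial>lborel) \<partial>lborel)"
    by (rule lborel.nn_integral_fst[symmetric]) measurable
  also have "\<dots> \<le> (\<integral>\<^sup>+x. (\<integral>\<^sup>+y. ennreal (a x) * ennreal (b y) \<partial>lborel) \<partial>lborel)"
    by (intro nn_integral_mono) (simp add: ennreal_mult[symmetric] nn bound ennreal_leI)
  also have "\<dots> = (\<integral>\<^sup>+x. ennreal (a x) * (\<integral>\<^sup>+y. ennreal (b y) \<partial>lborel) \<partial>lborel)"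
    by (intro nn_integral_cong nn_integral_cmult) measurable
  also have "\<dots> = (\<integral>\<^sup>+x. ennreal (a x) \<partial>lborel) * (\<integral>\<^sup>+y. ennreal (b y) \<partial>lborel)"
    by (rule nn_integral_multc) measurable
  also have "\<dots> < \<infinity>"
    using a b nn by (simp add: integrable_iff_bounded ennreal_mult_less_top)
  finally show "(\<integral>\<^sup>+p. ennreal (norm (f p)) \<partial>(lborel \<Otimes>\<^sub>M lborel)) < \<infinity>" .
qed measurable

text \<open>Angular frequency without prefactor; the powers of \<open>2 * pi\<close> appear in the
  Plancherel identity and cancel against the normalization of the frame.\<close>

definition fourier :: "('a::euclidean_space \<Rightarrow> complex) \<Rightarrow> 'a \<Rightarrow> complex" where
  "fourier g \<omega> = (\<integral>x. g x * exp (- (\<i> * complex_of_real (\<omega> \<bullet> x))) \<partial>lborel)"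

lemma norm_exp_minus_i [simp]: "cmod (exp (- (\<i> * complex_of_real t))) = 1"
  using norm_exp_i_times[of "- t"] by simp

context
  fixes g :: "'a::euclidean_space \<Rightarrow> complex"
  assumes g1: "integrable lborel g" and g2: "square_integrable g"
begin

lemma g_measurable [measurable]: "g \<in> borel_measurable borel"
  using g2 by (simp add: square_integrable_def)

lemma fourier_measurable [measurable]: "fourier g \<in> borel_measurable borel"
  unfolding fourier_def by measurable

lemma fourier_bound: "cmod (fourier g \<omega>) \<le> (\<integral>x. cmod (g x) \<partial>lborel)"
proof -
  have "cmod (fourier g \<omega>) \<le> (\<integral>x. cmod (g x * exp (- (\<i> * complex_of_real (\<omega> \<bullet> x)))) \<partial>lborel)"
    unfolding fourier_def by (rule integral_norm_bound)
  then show ?thesis by (simp add: norm_mult)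
qed

lemma gauss_scaled_fourier:
  fixes u :: 'a
  assumes \<epsilon>: "0 < \<epsilon>"
  shows "(\<integral>\<omega>. complex_of_real (gauss (\<epsilon> *\<^sub>R \<omega>)) * exp (\<i> * complex_of_real (\<omega> \<bullet> u)) \<partial>lborel)
    = complex_of_real (sqrt (2 * pi) ^ DIM('a) / \<epsilon> ^ DIM('a) * gauss ((1 / \<epsilon>) *\<^sub>R u))"
proof -
  let ?k = "\<lambda>z. exp (\<i> * complex_of_real (((1 / \<epsilon>) *\<^sub>R u) \<bullet> z)) * complex_of_real (gauss z)"
  have "complex_of_real (sqrt (2 * pi) ^ DIM('a) * gauss ((1 / \<epsilon>) *\<^sub>R u)) = (\<integral>z. ?k z \<partial>lborel)"
    by (rule gauss_fourier(2)[symmetric])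
  also have "\<dots> = (\<bar>\<epsilon>\<bar> ^ DIM('a)) *\<^sub>R (\<integral>\<omega>. ?k (0 + \<epsilon> *\<^sub>R \<omega>) \<partial>lborel)"
    by (rule integral_lborel_affine) (use \<epsilon> in simp_all)
  also have "(\<lambda>\<omega>. ?k (0 + \<epsilon> *\<^sub>R \<omega>)) = (\<lambda>\<omega>. complex_of_real (gauss (\<epsilon> *\<^sub>R \<omega>)) * exp (\<i> * complex_of_real (\<omega> \<bullet> u)))"
    using \<epsilon> by (simp add: inner_commute mult.commute fun_eq_iff)
  finally show ?thesis using \<epsilon> by (simp add: scaleR_conv_of_real field_simps)
qed

lemma integrable_gauss_scaled:
  assumes "0 < \<epsilon>"
  shows "integrable lborel (\<lambda>x::'a. gauss (\<epsilon> *\<^sub>R x))"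
  using integrable_lborel_affine[OF _ gauss_integral(1), of \<epsilon> 0] assms by simp

text \<open>Gaussian damping makes the double integral absolutely convergent. Integrating the
  frequency out turns the damped inversion formula into a Gaussian average of translates of
  \<open>g\<close>.\<close>

lemma regularized_inverse:
  fixes y :: 'a
  assumes \<epsilon>: "0 < \<epsilon>"
  shows "(\<integral>\<omega>. complex_of_real (gauss (\<epsilon> *\<^sub>R \<omega>)) * fourier g \<omega> * exp (\<i> * complex_of_real (\<omega> \<bullet> y)) \<partial>lborel)
    = complex_of_real (sqrt (2 * pi) ^ DIM('a)) * (\<integral>s. g (y + \<epsilon> *\<^sub>R s) * complex_of_real (gauss s) \<partial>lborel)"
proof -
  let ?f = "\<lambda>x \<omega>. g x * (complex_of_real (gauss (\<epsilon> *\<^sub>R \<omega>)) * exp (\<i> * complex_of_real (\<omega> \<bullet> (y - x))))"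
  have "(\<integral>\<omega>. complex_of_real (gauss (\<epsilon> *\<^sub>R \<omega>)) * fourier g \<omega> * exp (\<i> * complex_of_real (\<omega> \<bullet> y)) \<partial>lborel)
      = (\<integral>\<omega>. (\<integral>x. ?f x \<omega> \<partial>lborel) \<partial>lborel)"
  proof (rule Bochner_Integration.integral_cong[OF refl])
    fix \<omega> :: 'a
    have "?f x \<omega> = (complex_of_real (gauss (\<epsilon> *\<^sub>R \<omega>)) * exp (\<i> * complex_of_real (\<omega> \<bullet> y)))
        * (g x * exp (- (\<i> * complex_of_real (\<omega> \<bullet> x))))" for x
      by (simp add: inner_diff_right right_diff_distrib exp_diff exp_minus field_simps)
    then have "(\<integral>x. ?f x \<omega> \<partial>lborel) = (complex_of_real (gauss (\<epsilon> *\<^sub>R \<omega>)) * exp (\<i> * complex_of_real (\<omega> \<bullet> y))) * fourier g \<omega>"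
      unfolding fourier_def by (simp only: integral_mult_right_zero)
    then show "complex_of_real (gauss (\<epsilon> *\<^sub>R \<omega>)) * fourier g \<omega> * exp (\<i> * complex_of_real (\<omega> \<bullet> y)) = (\<integral>x. ?f x \<omega> \<partial>lborel)"
      by (simp only: mult_ac)
  qed
  also have "\<dots> = (\<integral>x. (\<integral>\<omega>. ?f x \<omega> \<partial>lborel) \<partial>lborel)"
  proof (rule lborel_pair.Fubini_integral)
    show "integrable (lborel \<Otimes>\<^sub>M lborel) (case_prod ?f)"
    proof (rule integrable_pairI[where a = "\<lambda>x. cmod (g x)" and b = "\<lambda>\<omega>. gauss (\<epsilon> *\<^sub>R \<omega>)"])
      show "integrable lborel (\<lambda>x. cmod (g x))" using g1 by (rule integrable_norm)
      show "integrable lborel (\<lambda>\<omega>::'a. gauss (\<epsilon> *\<^sub>R \<omega>))" by (rule integrable_gauss_scaled[OF \<epsilon>])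
    qed (auto simp: norm_mult less_imp_le[OF gauss_pos])
  qed
  also have "\<dots> = (\<integral>x. g x * complex_of_real (sqrt (2 * pi) ^ DIM('a) / \<epsilon> ^ DIM('a) * gauss ((1 / \<epsilon>) *\<^sub>R (y - x))) \<partial>lborel)"
    by (simp only: integral_mult_right_zero gauss_scaled_fourier[OF \<epsilon>])
  also have "\<dots> = (\<bar>\<epsilon>\<bar> ^ DIM('a)) *\<^sub>R (\<integral>s. g (y + \<epsilon> *\<^sub>R s)
      * complex_of_real (sqrt (2 * pi) ^ DIM('a) / \<epsilon> ^ DIM('a) * gauss ((1 / \<epsilon>) *\<^sub>R (y - (y + \<epsilon> *\<^sub>R s)))) \<partial>lborel)"
    by (rule integral_lborel_affine) (use \<epsilon> in simp_all)
  also have "(\<lambda>s. g (y + \<epsilon> *\<^sub>R s) * complex_of_real (sqrt (2 * pi) ^ DIM('a) / \<epsilon> ^ DIM('a) * gauss ((1 / \<epsilon>) *\<^sub>R (y - (y + \<epsilon> *\<^sub>R s)))))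
      = (\<lambda>s. complex_of_real (sqrt (2 * pi) ^ DIM('a) / \<epsilon> ^ DIM('a)) * (g (y + \<epsilon> *\<^sub>R s) * complex_of_real (gauss s)))"
    using \<epsilon> by (simp add: fun_eq_iff gauss_minus)
  finally show ?thesis
    unfolding integral_mult_right_zero using \<epsilon> by (simp add: scaleR_conv_of_real)
qed

text \<open>The damped inversion formula paired with \<open>g\<close>: the damped energy of the
  transform is a Gaussian average of autocorrelations of \<open>g\<close>.\<close>

lemma regularized_plancherel:
  assumes \<epsilon>: "0 < \<epsilon>"
  shows "(\<integral>\<omega>. complex_of_real (gauss (\<epsilon> *\<^sub>R \<omega>) * (cmod (fourier g \<omega>))\<^sup>2) \<partial>lborel)
    = complex_of_real (sqrt (2 * pi) ^ DIM('a))
      * (\<integral>s. complex_of_real (gauss s) * cinner (abs_l2 (\<lambda>y. g (y + \<epsilon> *\<^sub>R s))) (abs_l2 g) \<partial>lborel)"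
proof -
  let ?E = "\<lambda>\<omega> y. exp (\<i> * complex_of_real (\<omega> \<bullet> y))"
  let ?f = "\<lambda>\<omega> y. complex_of_real (gauss (\<epsilon> *\<^sub>R \<omega>)) * fourier g \<omega> * (cnj (g y) * ?E \<omega> y)"
  let ?h = "\<lambda>s y. complex_of_real (gauss s) * (g (y + \<epsilon> *\<^sub>R s) * cnj (g y))"
  define N where "N = (\<integral>x. cmod (g x) \<partial>lborel)"
  have N: "0 \<le> N" unfolding N_def by (simp add: integral_nonneg_AE)
  have cnjf: "cnj (fourier g \<omega>) = (\<integral>y. cnj (g y) * ?E \<omega> y \<partial>lborel)" for \<omega>
    unfolding fourier_def by (simp add: exp_cnj flip: Bochner_Integration.integral_cnj)
  have "(\<integral>\<omega>. complex_of_real (gauss (\<epsilon> *\<^sub>R \<omega>) * (cmod (fourier g \<omega>))\<^sup>2) \<partial>lborel)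
      = (\<integral>\<omega>. (\<integral>y. ?f \<omega> y \<partial>lborel) \<partial>lborel)"
  proof (rule Bochner_Integration.integral_cong[OF refl])
    fix \<omega> :: 'a
    have "complex_of_real (gauss (\<epsilon> *\<^sub>R \<omega>) * (cmod (fourier g \<omega>))\<^sup>2)
        = complex_of_real (gauss (\<epsilon> *\<^sub>R \<omega>)) * fourier g \<omega> * cnj (fourier g \<omega>)"
      by (simp only: of_real_mult complex_norm_square mult.assoc)
    then show "complex_of_real (gauss (\<epsilon> *\<^sub>R \<omega>) * (cmod (fourier g \<omega>))\<^sup>2) = (\<integral>y. ?f \<omega> y \<partial>lborel)"
      unfolding cnjf by (simp only: integral_mult_right_zero)
  qed
  also have "\<dots> = (\<integral>y. (\<integral>\<omega>. ?f \<omega> y \<partial>lborel) \<partial>lborel)"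
  proof (rule lborel_pair.Fubini_integral[symmetric])
    show "integrable (lborel \<Otimes>\<^sub>M lborel) (case_prod ?f)"
    proof (rule integrable_pairI[where a = "\<lambda>\<omega>. gauss (\<epsilon> *\<^sub>R \<omega>) * N" and b = "\<lambda>y. cmod (g y)"])
      show "integrable lborel (\<lambda>y. cmod (g y))" using g1 by (rule integrable_norm)
      show "integrable lborel (\<lambda>\<omega>::'a. gauss (\<epsilon> *\<^sub>R \<omega>) * N)"
        by (intro integrable_mult_left integrable_gauss_scaled[OF \<epsilon>])
      show "cmod (case_prod ?f (\<omega>, y)) \<le> gauss (\<epsilon> *\<^sub>R \<omega>) * N * cmod (g y)" for \<omega> y
        using fourier_bound[of \<omega>] gauss_pos[of "\<epsilon> *\<^sub>R \<omega>"]
        by (auto simp: norm_mult N_def intro!: mult_right_mono mult_left_mono)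
    qed (auto simp: N less_imp_le[OF gauss_pos] intro!: mult_nonneg_nonneg)
  qed
  also have "\<dots> = (\<integral>y. (\<integral>s. complex_of_real (sqrt (2 * pi) ^ DIM('a)) * ?h s y \<partial>lborel) \<partial>lborel)"
  proof (rule Bochner_Integration.integral_cong[OF refl])
    fix y :: 'a
    have "(\<lambda>\<omega>. ?f \<omega> y) = (\<lambda>\<omega>. cnj (g y) * (complex_of_real (gauss (\<epsilon> *\<^sub>R \<omega>)) * fourier g \<omega> * ?E \<omega> y))"
      by (simp only: mult_ac)
    then have "(\<integral>\<omega>. ?f \<omega> y \<partial>lborel) = cnj (g y) * (complex_of_real (sqrt (2 * pi) ^ DIM('a))
        * (\<integral>s. g (y + \<epsilon> *\<^sub>R s) * complex_of_real (gauss s) \<partial>lborel))"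
      by (simp only: integral_mult_right_zero regularized_inverse[OF \<epsilon>])
    also have "\<dots> = (\<integral>s. (cnj (g y) * complex_of_real (sqrt (2 * pi) ^ DIM('a))) * (g (y + \<epsilon> *\<^sub>R s) * complex_of_real (gauss s)) \<partial>lborel)"
      by (simp only: integral_mult_right_zero mult.assoc)
    also have "\<dots> = (\<integral>s. complex_of_real (sqrt (2 * pi) ^ DIM('a)) * ?h s y \<partial>lborel)"
      by (simp only: mult_ac)
    finally show "(\<integral>\<omega>. ?f \<omega> y \<partial>lborel) = (\<integral>s. complex_of_real (sqrt (2 * pi) ^ DIM('a)) * ?h s y \<partial>lborel)" .
  qed
  also have "\<dots> = complex_of_real (sqrt (2 * pi) ^ DIM('a)) * (\<integral>y. (\<integral>s. ?h s y \<partial>lborel) \<partial>lborel)"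
    by (simp only: integral_mult_right_zero)
  also have "(\<integral>y. (\<integral>s. ?h s y \<partial>lborel) \<partial>lborel) = (\<integral>s. (\<integral>y. ?h s y \<partial>lborel) \<partial>lborel)"
  proof (rule lborel_pair.Fubini_integral)
    show "integrable (lborel \<Otimes>\<^sub>M lborel) (case_prod ?h)"
    proof (rule integrableI_bounded)
      let ?n = "ennreal ((norm (abs_l2 g))\<^sup>2)"
      have "(\<integral>\<^sup>+p. ennreal (norm (case_prod ?h p)) \<partial>(lborel \<Otimes>\<^sub>M lborel))
          = (\<integral>\<^sup>+s. (\<integral>\<^sup>+y. ennreal (norm (case_prod ?h (s, y))) \<partial>lborel) \<partial>lborel)"
        by (rule lborel.nn_integral_fst[symmetric]) measurable
      also have "\<dots> \<le> (\<integral>\<^sup>+s. ennreal (gauss s) * (?n + ?n) \<partial>(lborel :: 'a measure))"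
      proof (rule nn_integral_mono)
        fix s :: 'a
        have "(\<integral>\<^sup>+y. ennreal (norm (case_prod ?h (s, y))) \<partial>lborel)
            \<le> (\<integral>\<^sup>+y. ennreal (gauss s) * (ennreal ((cmod (g (y + \<epsilon> *\<^sub>R s)))\<^sup>2) + ennreal ((cmod (g y))\<^sup>2)) \<partial>lborel)"
        proof (rule nn_integral_mono)
          fix y
          have "x * z \<le> x\<^sup>2 + z\<^sup>2" if "0 \<le> x" "0 \<le> z" for x z :: real
            using sum_squares_bound[of x z] mult_nonneg_nonneg[OF that] by linarith
          then have "norm (case_prod ?h (s, y)) \<le> gauss s * ((cmod (g (y + \<epsilon> *\<^sub>R s)))\<^sup>2 + (cmod (g y))\<^sup>2)"
            using gauss_pos[of s] by (simp add: norm_mult)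
          then have "ennreal (norm (case_prod ?h (s, y))) \<le> ennreal (gauss s * ((cmod (g (y + \<epsilon> *\<^sub>R s)))\<^sup>2 + (cmod (g y))\<^sup>2))"
            by (rule ennreal_leI)
          also have "\<dots> = ennreal (gauss s) * (ennreal ((cmod (g (y + \<epsilon> *\<^sub>R s)))\<^sup>2) + ennreal ((cmod (g y))\<^sup>2))"
            using gauss_pos[of s] by (simp add: ennreal_mult ennreal_plus)
          finally show "ennreal (norm (case_prod ?h (s, y)))
              \<le> ennreal (gauss s) * (ennreal ((cmod (g (y + \<epsilon> *\<^sub>R s)))\<^sup>2) + ennreal ((cmod (g y))\<^sup>2))" .
        qed
        also have "\<dots> = ennreal (gauss s) * (?n + ?n)"
          using nn_norm_abs_l2[OF g2] nn_integral_lborel_translate[of "\<lambda>y. ennreal ((cmod (g y))\<^sup>2)" "\<epsilon> *\<^sub>R s"]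
          by (simp add: nn_integral_cmult nn_integral_add)
        finally show "(\<integral>\<^sup>+y. ennreal (norm (case_prod ?h (s, y))) \<partial>lborel) \<le> ennreal (gauss s) * (?n + ?n)" .
      qed
      also have "\<dots> = (\<integral>\<^sup>+s. ennreal (gauss s) \<partial>(lborel :: 'a measure)) * (?n + ?n)"
        by (rule nn_integral_multc) measurable
      also have "\<dots> < \<infinity>"
        by (subst nn_integral_eq_integral[OF gauss_integral(1)])
           (auto simp: ennreal_mult_less_top less_imp_le[OF gauss_pos])
      finally show "(\<integral>\<^sup>+p. ennreal (norm (case_prod ?h p)) \<partial>(lborel \<Otimes>\<^sub>M lborel)) < \<infinity>" .
    qed measurable
  qed
  also have "(\<lambda>s. \<integral>y. ?h s y \<partial>lborel) = (\<lambda>s. complex_of_real (gauss s) * cinner (abs_l2 (\<lambda>y. g (y + \<epsilon> *\<^sub>R s))) (abs_l2 g))"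
    by (simp only: integral_mult_right_zero cinner_abs_l2[OF square_integrable_translate[OF g2] g2])
  finally show ?thesis .
qed

text \<open>Let the damping tend to zero. The left side converges monotonically, the right side by
  continuity of translations in the Hilbert space and dominated convergence.\<close>

theorem plancherel:
  "(\<integral>\<^sup>+\<omega>. ennreal ((cmod (fourier g \<omega>))\<^sup>2) \<partial>lborel) = ennreal ((2 * pi) ^ DIM('a) * (norm (abs_l2 g))\<^sup>2)"
proof -
  define \<epsilon> where "\<epsilon> k = 1 / real (Suc k)" for k
  have \<epsilon>: "0 < \<epsilon> k" for k by (simp add: \<epsilon>_def)
  have \<epsilon>0: "\<epsilon> \<longlonglongrightarrow> 0" unfolding \<epsilon>_def by (rule LIMSEQ_inverse_real_of_nat[unfolded inverse_eq_divide])
  define N where "N = (\<integral>x. cmod (g x) \<partial>lborel)"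
  let ?I = "\<lambda>k. \<integral>\<omega>. gauss (\<epsilon> k *\<^sub>R \<omega>) * (cmod (fourier g \<omega>))\<^sup>2 \<partial>lborel"
  let ?c = "sqrt (2 * pi) ^ DIM('a)"
  have int: "integrable lborel (\<lambda>\<omega>. gauss (\<epsilon> k *\<^sub>R \<omega>) * (cmod (fourier g \<omega>))\<^sup>2)" for k
  proof (rule Bochner_Integration.integrable_bound)
    show "integrable lborel (\<lambda>\<omega>::'a. gauss (\<epsilon> k *\<^sub>R \<omega>) * N\<^sup>2)"
      by (intro integrable_mult_left integrable_gauss_scaled \<epsilon>)
    show "AE \<omega> in lborel. norm (gauss (\<epsilon> k *\<^sub>R \<omega>) * (cmod (fourier g \<omega>))\<^sup>2) \<le> norm (gauss (\<epsilon> k *\<^sub>R \<omega>) * N\<^sup>2)"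
    proof (rule AE_I2)
      fix \<omega>
      have "(cmod (fourier g \<omega>))\<^sup>2 \<le> N\<^sup>2" using fourier_bound[of \<omega>] by (intro power_mono) (auto simp: N_def)
      then show "norm (gauss (\<epsilon> k *\<^sub>R \<omega>) * (cmod (fourier g \<omega>))\<^sup>2) \<le> norm (gauss (\<epsilon> k *\<^sub>R \<omega>) * N\<^sup>2)"
        using gauss_pos[of "\<epsilon> k *\<^sub>R \<omega>"] by (simp add: abs_mult)
    qed
  qed measurable
  have "(\<lambda>k. \<integral>s. complex_of_real (gauss s) * cinner (abs_l2 (\<lambda>y. g (y + \<epsilon> k *\<^sub>R s))) (abs_l2 g) \<partial>lborel)
      \<longlonglongrightarrow> (\<integral>s. complex_of_real (gauss (s::'a)) * cinner (abs_l2 g) (abs_l2 g) \<partial>lborel)"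
  proof (rule integral_dominated_convergence)
    show "integrable lborel (\<lambda>s::'a. gauss s * (norm (abs_l2 g))\<^sup>2)"
      by (intro integrable_mult_left gauss_integral)
    have "(\<lambda>k. complex_of_real (gauss s) * cinner (abs_l2 (\<lambda>y. g (y + \<epsilon> k *\<^sub>R s))) (abs_l2 g))
        \<longlonglongrightarrow> complex_of_real (gauss s) * cinner (abs_l2 g) (abs_l2 g)" for s
    proof -
      have "(\<lambda>k. \<epsilon> k *\<^sub>R s) \<longlonglongrightarrow> 0 *\<^sub>R s" by (intro tendsto_intros \<epsilon>0)
      then have "(\<lambda>k. \<epsilon> k *\<^sub>R s) \<longlonglongrightarrow> 0" by simp
      from translate_tendsto[OF g2 this] show ?thesis by (intro tendsto_intros)
    qed
    then show "AE s in lborel. (\<lambda>k. complex_of_real (gauss s) * cinner (abs_l2 (\<lambda>y. g (y + \<epsilon> k *\<^sub>R s))) (abs_l2 g))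
        \<longlonglongrightarrow> complex_of_real (gauss s) * cinner (abs_l2 g) (abs_l2 g)" by simp
    show "AE s in lborel. norm (complex_of_real (gauss s) * cinner (abs_l2 (\<lambda>y. g (y + \<epsilon> k *\<^sub>R s))) (abs_l2 g))
        \<le> gauss s * (norm (abs_l2 g))\<^sup>2" for k
    proof (rule AE_I2)
      fix s
      show "norm (complex_of_real (gauss s) * cinner (abs_l2 (\<lambda>y. g (y + \<epsilon> k *\<^sub>R s))) (abs_l2 g))
        \<le> gauss s * (norm (abs_l2 g))\<^sup>2"
        using cmod_cinner_le[of "abs_l2 (\<lambda>y. g (y + \<epsilon> k *\<^sub>R s))" "abs_l2 g"] gauss_pos[of s]
        by (simp add: norm_mult norm_abs_l2_translate[OF g2] power2_eq_square)
    qed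
    have "cinner (abs_l2 (\<lambda>y. g (y + \<epsilon> k *\<^sub>R s))) (abs_l2 g) = (\<integral>y. g (y + \<epsilon> k *\<^sub>R s) * cnj (g y) \<partial>lborel)" for k s
      by (rule cinner_abs_l2[OF square_integrable_translate[OF g2] g2])
    then show "(\<lambda>s. complex_of_real (gauss s) * cinner (abs_l2 (\<lambda>y. g (y + \<epsilon> k *\<^sub>R s))) (abs_l2 g)) \<in> borel_measurable lborel" for k
      by simp
  qed measurable
  then have L: "(\<lambda>k. complex_of_real ?c * (\<integral>s. complex_of_real (gauss s) * cinner (abs_l2 (\<lambda>y. g (y + \<epsilon> k *\<^sub>R s))) (abs_l2 g) \<partial>lborel))
      \<longlonglongrightarrow> complex_of_real ?c * (\<integral>s. complex_of_real (gauss (s::'a)) * cinner (abs_l2 g) (abs_l2 g) \<partial>lborel)"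
    by (intro tendsto_intros)
  have V: "(\<integral>s. complex_of_real (gauss (s::'a)) * cinner (abs_l2 g) (abs_l2 g) \<partial>lborel)
      = complex_of_real (?c * (norm (abs_l2 g))\<^sup>2)"
    unfolding integral_mult_left_zero integral_complex_of_real gauss_integral(2) cinner_self by simp
  have I: "complex_of_real ?c * (\<integral>s. complex_of_real (gauss s) * cinner (abs_l2 (\<lambda>y. g (y + \<epsilon> k *\<^sub>R s))) (abs_l2 g) \<partial>lborel)
      = complex_of_real (?I k)" for k
    unfolding regularized_plancherel[OF \<epsilon>, symmetric] by (rule integral_complex_of_real)
  have "(\<lambda>k. complex_of_real (?I k)) \<longlonglongrightarrow> complex_of_real (?c * (?c * (norm (abs_l2 g))\<^sup>2))"
    using L unfolding V I of_real_mult .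
  then have lim: "?I \<longlonglongrightarrow> ?c * (?c * (norm (abs_l2 g))\<^sup>2)" unfolding tendsto_of_real_iff .
  have "?c * ?c = (sqrt (2 * pi) * sqrt (2 * pi)) ^ DIM('a)" by (rule power_mult_distrib[symmetric])
  also have "sqrt (2 * pi) * sqrt (2 * pi) = 2 * pi" by (rule real_sqrt_mult_self[THEN trans]) simp
  finally have "?I \<longlonglongrightarrow> (2 * pi) ^ DIM('a) * (norm (abs_l2 g))\<^sup>2"
    using lim by (simp only: mult.assoc[symmetric])
  then have 1: "(\<lambda>k. ennreal (?I k)) \<longlonglongrightarrow> ennreal ((2 * pi) ^ DIM('a) * (norm (abs_l2 g))\<^sup>2)"
    by (rule tendsto_ennrealI)
  have "(\<lambda>k. \<integral>\<^sup>+\<omega>. ennreal (gauss (\<epsilon> k *\<^sub>R \<omega>) * (cmod (fourier g \<omega>))\<^sup>2) \<partial>lborel)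
      \<longlonglongrightarrow> (\<integral>\<^sup>+\<omega>. ennreal ((cmod (fourier g \<omega>))\<^sup>2) \<partial>lborel)"
  proof (rule nn_integral_LIMSEQ)
    show "incseq (\<lambda>k \<omega>. ennreal (gauss (\<epsilon> k *\<^sub>R \<omega>) * (cmod (fourier g \<omega>))\<^sup>2))"
    proof (rule incseq_SucI, rule le_funI)
      fix k and \<omega> :: 'a
      have "\<epsilon> (Suc k) \<le> \<epsilon> k" unfolding \<epsilon>_def by (intro divide_left_mono) auto
      then have "norm (\<epsilon> (Suc k) *\<^sub>R \<omega>) \<le> norm (\<epsilon> k *\<^sub>R \<omega>)"
        using \<epsilon>[of k] \<epsilon>[of "Suc k"] by (simp add: mult_right_mono)
      then have "gauss (\<epsilon> k *\<^sub>R \<omega>) \<le> gauss (\<epsilon> (Suc k) *\<^sub>R \<omega>)"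
        unfolding gauss_def by (simp add: power_mono)
      then show "ennreal (gauss (\<epsilon> k *\<^sub>R \<omega>) * (cmod (fourier g \<omega>))\<^sup>2)
          \<le> ennreal (gauss (\<epsilon> (Suc k) *\<^sub>R \<omega>) * (cmod (fourier g \<omega>))\<^sup>2)"
        by (intro ennreal_leI mult_right_mono) auto
    qed
    show "(\<lambda>k. ennreal (gauss (\<epsilon> k *\<^sub>R \<omega>) * (cmod (fourier g \<omega>))\<^sup>2)) \<longlonglongrightarrow> ennreal ((cmod (fourier g \<omega>))\<^sup>2)" for \<omega>
    proof -
      have "(\<lambda>k. gauss (\<epsilon> k *\<^sub>R \<omega>) * (cmod (fourier g \<omega>))\<^sup>2) \<longlonglongrightarrow> exp (- ((norm (0 *\<^sub>R \<omega>))\<^sup>2 / 2)) * (cmod (fourier g \<omega>))\<^sup>2"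
        unfolding gauss_def by (intro tendsto_intros \<epsilon>0) simp
      then show ?thesis by (intro tendsto_ennrealI) simp
    qed
  qed measurable
  moreover have "(\<integral>\<^sup>+\<omega>. ennreal (gauss (\<epsilon> k *\<^sub>R \<omega>) * (cmod (fourier g \<omega>))\<^sup>2) \<partial>lborel) = ennreal (?I k)" for k
    by (rule nn_integral_eq_integral[OF int]) (simp add: less_imp_le[OF gauss_pos])
  ultimately have "(\<lambda>k. ennreal (?I k)) \<longlonglongrightarrow> (\<integral>\<^sup>+\<omega>. ennreal ((cmod (fourier g \<omega>))\<^sup>2) \<partial>lborel)" by simp
  from LIMSEQ_unique[OF this 1] show ?thesis .
qed

end

text \<open>The short-time Fourier transform of \<open>F\<close> with window
  \<open>\<phi>\<close>.\<close>

definition stft :: "('a::euclidean_space \<Rightarrow> complex) \<Rightarrow> ('a \<Rightarrow> complex) \<Rightarrow> 'a \<times> 'a \<Rightarrow> complex" where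
  "stft \<phi> F = (\<lambda>(x, \<omega>). fourier (\<lambda>y. F y * cnj (\<phi> (y - x))) \<omega>)"

text \<open>Plancherel in the frequency for each fixed position, then Tonelli in the position. The
  bound on the window makes the windowed function square-integrable as well as integrable.\<close>

theorem moyal:
  fixes F \<phi> :: "'a::euclidean_space \<Rightarrow> complex"
  assumes F: "square_integrable F" and \<phi>: "square_integrable \<phi>" and bd: "\<And>y. cmod (\<phi> y) \<le> B"
  shows "(\<integral>\<^sup>+z. ennreal ((cmod (stft \<phi> F z))\<^sup>2) \<partial>lborel)
    = ennreal ((2 * pi) ^ DIM('a) * (norm (abs_l2 F))\<^sup>2 * (norm (abs_l2 \<phi>))\<^sup>2)"
proof -
  have [measurable]: "F \<in> borel_measurable borel" "\<phi> \<in> borel_measurable borel"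
    using F \<phi> by (simp_all add: square_integrable_def)
  have m [measurable]: "stft \<phi> F \<in> borel_measurable (lborel \<Otimes>\<^sub>M lborel)"
    unfolding stft_def fourier_def by measurable
  have \<phi>t: "square_integrable (\<lambda>y. \<phi> (y - x))" for x
    using square_integrable_translate[OF \<phi>, of "- x"] by simp
  have g1: "integrable lborel (\<lambda>y. F y * cnj (\<phi> (y - x)))" for x
    by (rule square_integrable_mult_cnj[OF F \<phi>t])
  have g2: "square_integrable (\<lambda>y. F y * cnj (\<phi> (y - x)))" for x
    unfolding square_integrable_def
  proof
    show "integrable lborel (\<lambda>y. (cmod (F y * cnj (\<phi> (y - x))))\<^sup>2)"
    proof (rule Bochner_Integration.integrable_bound)
      show "integrable lborel (\<lambda>y. (cmod (F y))\<^sup>2 * B\<^sup>2)"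
        using F by (simp add: square_integrable_def)
      show "AE y in lborel. norm ((cmod (F y * cnj (\<phi> (y - x))))\<^sup>2) \<le> norm ((cmod (F y))\<^sup>2 * B\<^sup>2)"
      proof (rule AE_I2)
        fix y
        have "(cmod (\<phi> (y - x)))\<^sup>2 \<le> B\<^sup>2" by (intro power_mono bd) simp
        then show "norm ((cmod (F y * cnj (\<phi> (y - x))))\<^sup>2) \<le> norm ((cmod (F y))\<^sup>2 * B\<^sup>2)"
          by (simp add: norm_mult power_mult_distrib mult_left_mono)
      qed
    qed measurable
  qed measurable
  let ?f = "\<lambda>y. ennreal ((cmod (F y))\<^sup>2)" and ?p = "\<lambda>y. ennreal ((cmod (\<phi> y))\<^sup>2)"
  let ?c = "ennreal ((2 * pi) ^ DIM('a))"
  have "(\<integral>\<^sup>+z. ennreal ((cmod (stft \<phi> F z))\<^sup>2) \<partial>lborel)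
      = (\<integral>\<^sup>+x. (\<integral>\<^sup>+\<omega>. ennreal ((cmod (stft \<phi> F (x, \<omega>)))\<^sup>2) \<partial>lborel) \<partial>lborel)"
    unfolding lborel_prod[symmetric] by (rule lborel.nn_integral_fst[symmetric]) measurable
  also have "\<dots> = (\<integral>\<^sup>+x. ?c * (\<integral>\<^sup>+y. ?f y * ?p (y - x) \<partial>lborel) \<partial>lborel)"
  proof (rule nn_integral_cong)
    fix x :: 'a
    have "(\<integral>\<^sup>+\<omega>. ennreal ((cmod (stft \<phi> F (x, \<omega>)))\<^sup>2) \<partial>lborel)
        = ?c * ennreal ((norm (abs_l2 (\<lambda>y. F y * cnj (\<phi> (y - x)))))\<^sup>2)"
      unfolding stft_def prod.case plancherel[OF g1 g2] by (rule ennreal_mult) simp_all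
    also have "ennreal ((norm (abs_l2 (\<lambda>y. F y * cnj (\<phi> (y - x)))))\<^sup>2) = (\<integral>\<^sup>+y. ?f y * ?p (y - x) \<partial>lborel)"
      unfolding nn_norm_abs_l2[OF g2] by (simp add: norm_mult power_mult_distrib ennreal_mult)
    finally show "(\<integral>\<^sup>+\<omega>. ennreal ((cmod (stft \<phi> F (x, \<omega>)))\<^sup>2) \<partial>lborel) = ?c * (\<integral>\<^sup>+y. ?f y * ?p (y - x) \<partial>lborel)" .
  qed
  also have "\<dots> = ?c * (\<integral>\<^sup>+x. (\<integral>\<^sup>+y. ?f y * ?p (y - x) \<partial>lborel) \<partial>lborel)"
    by (rule nn_integral_cmult) measurable
  also have "(\<integral>\<^sup>+x. (\<integral>\<^sup>+y. ?f y * ?p (y - x) \<partial>lborel) \<partial>lborel) = (\<integral>\<^sup>+y. (\<integral>\<^sup>+x. ?f y * ?p (y - x) \<partial>lborel) \<partial>lborel)"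
    by (rule lborel_pair.Fubini') measurable
  also have "\<dots> = (\<integral>\<^sup>+y. ?f y * ennreal ((norm (abs_l2 \<phi>))\<^sup>2) \<partial>lborel)"
  proof (rule nn_integral_cong)
    fix y :: 'a
    have "(\<integral>\<^sup>+x. ?p (y - x) \<partial>lborel) = (\<integral>\<^sup>+x. ?p x \<partial>lborel)"
      using nn_integral_lborel_affine[of "-1" ?p y] by simp
    then show "(\<integral>\<^sup>+x. ?f y * ?p (y - x) \<partial>lborel) = ?f y * ennreal ((norm (abs_l2 \<phi>))\<^sup>2)"
      by (simp add: nn_integral_cmult nn_norm_abs_l2[OF \<phi>])
  qed
  also have "\<dots> = ennreal ((norm (abs_l2 F))\<^sup>2) * ennreal ((norm (abs_l2 \<phi>))\<^sup>2)"
    by (simp add: nn_integral_multc nn_norm_abs_l2[OF F])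
  finally show ?thesis by (simp add: ennreal_mult mult.assoc)
qed

subsection \<open>Schwartz functions\<close>

lemma partials_append: "partials (bs @ cs) f = partials bs (partials cs f)"
  by (induction bs) simp_all

lemma schwartz_partial:
  assumes "schwartz \<psi>" "b \<in> Basis"
  shows "schwartz (\<lambda>x. frechet_derivative \<psi> (at x) b)"
proof -
  have eq: "partials bs (\<lambda>x. frechet_derivative \<psi> (at x) b) = partials (bs @ [b]) \<psi>" for bs
    by (simp add: partials_append)
  have mem: "bs @ [b] \<in> lists Basis" if "bs \<in> lists Basis" for bs using that assms(2) by simp
  show ?thesis
    using assms(1) mem unfolding schwartz_def smooth_def eq by blast
qed

lemma schwartz_differentiable: "schwartz \<psi> \<Longrightarrow> \<psi> differentiable (at x)"
  unfolding schwartz_def smooth_def by (metis lists.Nil partials.simps(1))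

lemma schwartz_continuous: "schwartz \<psi> \<Longrightarrow> continuous_on UNIV \<psi>"
  by (simp add: continuous_on_eq_continuous_at differentiable_imp_continuous_within schwartz_differentiable)

lemma schwartz_measurable: "schwartz \<psi> \<Longrightarrow> \<psi> \<in> borel_measurable borel"
  by (rule borel_measurable_continuous_onI[OF schwartz_continuous])

lemma schwartz_bound:
  assumes "schwartz \<psi>"
  shows "\<exists>C\<ge>0. \<forall>x. norm x ^ k * cmod (\<psi> x) \<le> C"
proof -
  obtain C where C: "\<And>x. norm x ^ k * cmod (partials [] \<psi> x) \<le> C"
    using assms unfolding schwartz_def by (metis lists.Nil)
  have "0 \<le> C" by (rule order_trans[OF _ C[of 0]]) simp
  then show ?thesis using C by auto
qed

lemma power_add_le:
  fixes x y :: real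
  assumes "0 \<le> x" "0 \<le> y"
  shows "(x + y) ^ k \<le> 2 ^ k * (x ^ k + y ^ k)"
proof -
  have "(x + y) ^ k \<le> (2 * max x y) ^ k" using assms by (intro power_mono) auto
  also have "\<dots> = 2 ^ k * (max x y) ^ k" by (rule power_mult_distrib)
  also have "\<dots> \<le> 2 ^ k * (x ^ k + y ^ k)" using assms by (intro mult_left_mono) (auto simp: max_def)
  finally show ?thesis .
qed

lemma schwartz_decay:
  assumes "schwartz \<psi>"
  shows "\<exists>C\<ge>0. \<forall>x. cmod (\<psi> x) \<le> C / (1 + norm x) ^ k"
proof -
  obtain C0 where C0: "0 \<le> C0" "\<And>x. norm x ^ 0 * cmod (\<psi> x) \<le> C0" using schwartz_bound[OF assms] by blast
  obtain C1 where C1: "0 \<le> C1" "\<And>x. norm x ^ k * cmod (\<psi> x) \<le> C1" using schwartz_bound[OF assms] by blast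
  have "cmod (\<psi> x) \<le> (2 ^ k * (C0 + C1)) / (1 + norm x) ^ k" for x
  proof -
    have "(1 + norm x) ^ k * cmod (\<psi> x) \<le> (2 ^ k * (1 ^ k + norm x ^ k)) * cmod (\<psi> x)"
      by (intro mult_right_mono power_add_le) auto
    also have "\<dots> = 2 ^ k * (cmod (\<psi> x) + norm x ^ k * cmod (\<psi> x))" by (simp add: algebra_simps)
    also have "\<dots> \<le> 2 ^ k * (C0 + C1)" using C0(2)[of x] C1(2)[of x] by (intro mult_left_mono add_mono) auto
    finally show ?thesis by (simp add: pos_le_divide_eq add_pos_nonneg mult.commute)
  qed
  then show ?thesis using C0(1) C1(1) by (intro exI[of _ "2 ^ k * (C0 + C1)"]) simp
qed

lemma schwartz_integrable_moment:
  fixes \<psi> :: "'a::euclidean_space \<Rightarrow> complex"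
  assumes "schwartz \<psi>"
  shows "integrable lborel (\<lambda>x. norm x ^ k * cmod (\<psi> x))"
proof -
  have [measurable]: "\<psi> \<in> borel_measurable borel" by (rule schwartz_measurable[OF assms])
  obtain C where C: "0 \<le> C" "\<And>x. cmod (\<psi> x) \<le> C / (1 + norm x) ^ (k + 2 * DIM('a))"
    using schwartz_decay[OF assms] by blast
  show ?thesis
  proof (rule Bochner_Integration.integrable_bound)
    show "integrable lborel (\<lambda>x::'a. C * (1 / (1 + norm x) ^ (2 * DIM('a))))"
      by (intro integrable_mult_right integrable_decay)
    show "AE x in lborel. norm (norm x ^ k * cmod (\<psi> x)) \<le> norm (C * (1 / (1 + norm x) ^ (2 * DIM('a))))"
    proof (rule AE_I2)
      fix x :: 'a
      have pos: "0 < (1 + norm x) ^ j" for j by (simp add: add_pos_nonneg)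
      have "norm x ^ k * cmod (\<psi> x) \<le> (1 + norm x) ^ k * (C / (1 + norm x) ^ (k + 2 * DIM('a)))"
        using C by (intro mult_mono power_mono) auto
      also have "\<dots> = C * (1 / (1 + norm x) ^ (2 * DIM('a)))"
        using pos[of k] by (simp add: power_add)
      finally show "norm (norm x ^ k * cmod (\<psi> x)) \<le> norm (C * (1 / (1 + norm x) ^ (2 * DIM('a))))"
        using C(1) by simp
    qed
  qed measurable
qed

lemma schwartz_integrable:
  fixes \<psi> :: "'a::euclidean_space \<Rightarrow> complex"
  assumes "schwartz \<psi>"
  shows "integrable lborel \<psi>"
proof -
  have "\<psi> \<in> borel_measurable lborel" using schwartz_measurable[OF assms] by simp
  moreover have "integrable lborel (\<lambda>x. cmod (\<psi> x))" using schwartz_integrable_moment[OF assms, of 0] by simp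
  ultimately show ?thesis by (simp add: integrable_norm_iff)
qed

lemma schwartz_square_integrable:
  fixes \<psi> :: "'a::euclidean_space \<Rightarrow> complex"
  assumes "schwartz \<psi>"
  shows "square_integrable \<psi>"
proof -
  have [measurable]: "\<psi> \<in> borel_measurable borel" by (rule schwartz_measurable[OF assms])
  obtain C where C: "0 \<le> C" "\<And>x. norm x ^ 0 * cmod (\<psi> x) \<le> C" using schwartz_bound[OF assms] by blast
  have "integrable lborel (\<lambda>x. (cmod (\<psi> x))\<^sup>2)"
  proof (rule Bochner_Integration.integrable_bound)
    show "integrable lborel (\<lambda>x. C * cmod (\<psi> x))"
      by (intro integrable_mult_right integrable_norm schwartz_integrable[OF assms])
    show "AE x in lborel. norm ((cmod (\<psi> x))\<^sup>2) \<le> norm (C * cmod (\<psi> x))"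
      using C by (intro AE_I2) (simp add: power2_eq_square mult_right_mono)
  qed measurable
  then show ?thesis by (simp add: square_integrable_def)
qed

lemma line_derivative:
  fixes f :: "'a::euclidean_space \<Rightarrow> 'b::real_normed_vector"
  assumes "f differentiable (at (y + t *\<^sub>R v))"
  shows "((\<lambda>t. f (y + t *\<^sub>R v)) has_vector_derivative frechet_derivative f (at (y + t *\<^sub>R v)) v) (at t)"
proof -
  let ?D = "frechet_derivative f (at (y + t *\<^sub>R v))"
  have D: "(f has_derivative ?D) (at (y + t *\<^sub>R v))"
    using assms by (simp add: frechet_derivative_works)
  have "((\<lambda>t. y + t *\<^sub>R v) has_derivative (\<lambda>s. s *\<^sub>R v)) (at t)"
    by (auto intro!: derivative_eq_intros)
  from has_derivative_compose[OF this D]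
  have "((\<lambda>t. f (y + t *\<^sub>R v)) has_derivative (\<lambda>s. ?D (s *\<^sub>R v))) (at t)" .
  then show ?thesis
    unfolding has_vector_derivative_def
    by (simp add: linear_scale[OF has_derivative_linear[OF D]])
qed

text \<open>Difference quotients of an integrable function integrate to zero by translation
  invariance; the mean value theorem and the decay of \<open>u'\<close> justify the passage to the
  limit. This replaces integration by parts.\<close>

lemma integral_directional_derivative_zero:
  fixes u u' :: "'a::euclidean_space \<Rightarrow> complex"
  assumes u: "integrable lborel u" and b: "norm b = 1"
    and deriv: "\<And>y t. ((\<lambda>t. u (y + t *\<^sub>R b)) has_vector_derivative u' (y + t *\<^sub>R b)) (at t)"
    and bound: "\<And>y. cmod (u' y) \<le> C / (1 + norm y) ^ (2 * DIM('a))"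
    and [measurable]: "u' \<in> borel_measurable borel"
  shows "(\<integral>y. u' y \<partial>lborel) = 0"
proof -
  have [measurable]: "u \<in> borel_measurable borel" using borel_measurable_integrable[OF u] by simp
  have C: "0 \<le> C" using order_trans[OF norm_ge_zero bound[of 0]] by simp
  define t where "t n = 1 / real (Suc n)" for n
  have t: "0 < t n" "t n \<le> 1" for n by (simp_all add: t_def)
  have t0: "t \<longlonglongrightarrow> 0" unfolding t_def by (rule LIMSEQ_inverse_real_of_nat[unfolded inverse_eq_divide])
  let ?q = "\<lambda>n y. (u (y + t n *\<^sub>R b) - u y) /\<^sub>R t n"
  have "(\<lambda>n. \<integral>y. ?q n y \<partial>lborel) \<longlonglongrightarrow> (\<integral>y. u' y \<partial>lborel)"
  proof (rule integral_dominated_convergence)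
    show "integrable lborel (\<lambda>y::'a. (2 ^ (2 * DIM('a)) * C) * (1 / (1 + norm y) ^ (2 * DIM('a))))"
      by (intro integrable_mult_right integrable_decay)
    have "(\<lambda>n. ?q n y) \<longlonglongrightarrow> u' y" for y
    proof -
      have "(\<lambda>s. norm (u (y + s *\<^sub>R b) - u y - s *\<^sub>R u' y) / norm s) \<midarrow>0\<rightarrow> 0"
        using deriv[of y 0] unfolding has_vector_derivative_def has_derivative_at by simp
      moreover have "eventually (\<lambda>s. norm (u (y + s *\<^sub>R b) - u y - s *\<^sub>R u' y) / norm s
          = norm ((u (y + s *\<^sub>R b) - u y) /\<^sub>R s - u' y)) (at 0)"
        unfolding eventually_at_filter
      proof (intro always_eventually allI impI)
        fix s :: real
        assume "s \<noteq> 0"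
        then have "(u (y + s *\<^sub>R b) - u y) /\<^sub>R s - u' y = (u (y + s *\<^sub>R b) - u y - s *\<^sub>R u' y) /\<^sub>R s"
          by (simp add: scaleR_diff_right)
        then show "norm (u (y + s *\<^sub>R b) - u y - s *\<^sub>R u' y) / norm s
            = norm ((u (y + s *\<^sub>R b) - u y) /\<^sub>R s - u' y)"
          by (simp add: divide_inverse mult.commute)
      qed
      ultimately have "((\<lambda>s. norm ((u (y + s *\<^sub>R b) - u y) /\<^sub>R s - u' y)) \<longlongrightarrow> 0) (at 0)"
        by (rule Lim_transform_eventually)
      then have lim: "((\<lambda>s. (u (y + s *\<^sub>R b) - u y) /\<^sub>R s) \<longlongrightarrow> u' y) (at 0)"
        by (rule LIM_zero_cancel[OF tendsto_norm_zero_cancel])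
      have "filterlim t (at 0) sequentially"
        by (rule filterlim_atI[OF t0]) (simp add: t_def)
      from filterlim_compose[OF lim this] show ?thesis .
    qed
    then show "AE y in lborel. (\<lambda>n. ?q n y) \<longlonglongrightarrow> u' y" by simp
    show "AE y in lborel. norm (?q n y) \<le> (2 ^ (2 * DIM('a)) * C) * (1 / (1 + norm y) ^ (2 * DIM('a)))" for n
    proof (rule AE_I2)
      fix y :: 'a
      \<comment> \<open>The quotient is controlled by \<open>u'\<close> at a point less than one
        unit away; moving the weight back to \<open>y\<close> costs a factor 2 per power.\<close>
      have "\<exists>s\<in>{0<..<t n}. norm (u (y + t n *\<^sub>R b) - u (y + 0 *\<^sub>R b)) \<le> norm ((t n - 0) *\<^sub>R u' (y + s *\<^sub>R b))"
      proof (rule mvt_general[of 0 "t n" "\<lambda>s. u (y + s *\<^sub>R b)" "\<lambda>s x. x *\<^sub>R u' (y + s *\<^sub>R b)"])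
        show "continuous_on {0..t n} (\<lambda>s. u (y + s *\<^sub>R b))"
          by (rule continuous_at_imp_continuous_on) (blast intro: has_vector_derivative_continuous deriv)
        show "((\<lambda>s. u (y + s *\<^sub>R b)) has_derivative (\<lambda>x. x *\<^sub>R u' (y + s *\<^sub>R b))) (at s)" for s
          using deriv[of y s] unfolding has_vector_derivative_def .
      qed (rule t)
      then obtain s where s: "0 < s" "s < t n" "norm (u (y + t n *\<^sub>R b) - u y) \<le> t n * cmod (u' (y + s *\<^sub>R b))"
        using t(1)[of n] by auto
      have "norm y \<le> norm (y + s *\<^sub>R b) + norm (s *\<^sub>R b)"
        using norm_triangle_ineq4[of "y + s *\<^sub>R b" "s *\<^sub>R b"] by simp
      then have "1 + norm y \<le> 2 * (1 + norm (y + s *\<^sub>R b))"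
        using s(1,2) t(2)[of n] b norm_ge_zero[of "y + s *\<^sub>R b"] by (simp del: norm_ge_zero)
      then have "(1 + norm y) ^ (2 * DIM('a)) \<le> (2 * (1 + norm (y + s *\<^sub>R b))) ^ (2 * DIM('a))"
        by (intro power_mono) auto
      then have le: "(1 + norm y) ^ (2 * DIM('a)) \<le> 2 ^ (2 * DIM('a)) * (1 + norm (y + s *\<^sub>R b)) ^ (2 * DIM('a))"
        unfolding power_mult_distrib .
      have pos: "0 < (1 + norm z) ^ (2 * DIM('a))" for z :: 'a by (simp add: add_pos_nonneg)
      have "norm (?q n y) = norm (u (y + t n *\<^sub>R b) - u y) / t n"
        using t(1)[of n] by (simp add: divide_inverse_commute)
      also have "\<dots> \<le> cmod (u' (y + s *\<^sub>R b))" using s(3) t(1)[of n] by (simp add: pos_divide_le_eq mult.commute)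
      also have "\<dots> \<le> C / (1 + norm (y + s *\<^sub>R b)) ^ (2 * DIM('a))" by (rule bound)
      also have "\<dots> \<le> (2 ^ (2 * DIM('a)) * C) * (1 / (1 + norm y) ^ (2 * DIM('a)))"
      proof -
        have "C * (1 + norm y) ^ (2 * DIM('a)) \<le> C * (2 ^ (2 * DIM('a)) * (1 + norm (y + s *\<^sub>R b)) ^ (2 * DIM('a)))"
          by (rule mult_left_mono[OF le C])
        then show ?thesis using pos[of y] pos[of "y + s *\<^sub>R b"]
          by (simp add: pos_divide_le_eq pos_le_divide_eq mult_ac)
      qed
      finally show "norm (?q n y) \<le> (2 ^ (2 * DIM('a)) * C) * (1 / (1 + norm y) ^ (2 * DIM('a)))" .
    qed
  qed measurable
  moreover have "(\<integral>y. ?q n y \<partial>lborel) = 0" for n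
    using integrable_lborel_translate[OF u, of "t n *\<^sub>R b"] u integral_lborel_translate[of u "t n *\<^sub>R b"]
    by simp
  ultimately have "(\<lambda>n. 0 :: complex) \<longlonglongrightarrow> (\<integral>y. u' y \<partial>lborel)" by (simp only:)
  then show ?thesis by (simp only: LIMSEQ_const_iff)
qed

section \<open>Decay of the short-time Fourier transform\<close>

lemma stft_eq: "stft \<phi> F z = (\<integral>y. F y * cnj (\<phi> (y - fst z)) * exp (- (\<i> * complex_of_real (snd z \<bullet> y))) \<partial>lborel)"
  by (simp add: stft_def fourier_def split: prod.split)

lemma stft_integrable:
  assumes F: "square_integrable F" and \<phi>: "square_integrable \<phi>"
  shows "integrable lborel (\<lambda>y. F y * cnj (\<phi> (y - x)) * exp (- (\<i> * complex_of_real (\<omega> \<bullet> y))))"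
proof -
  have [measurable]: "F \<in> borel_measurable borel" "\<phi> \<in> borel_measurable borel"
    using F \<phi> by (simp_all add: square_integrable_def)
  have "square_integrable (\<lambda>y. \<phi> (y - x))"
    using square_integrable_translate[OF \<phi>, of "- x"] by simp
  from square_integrable_mult_cnj[OF F this] show ?thesis
    by (rule Bochner_Integration.integrable_bound) (auto simp: norm_mult)
qed

lemma stft_norm_le:
  "cmod (stft \<phi> F z) \<le> (\<integral>y. cmod (F y) * cmod (\<phi> (y - fst z)) \<partial>lborel)"
proof -
  have "cmod (stft \<phi> F z) \<le> (\<integral>y. cmod (F y * cnj (\<phi> (y - fst z)) * exp (- (\<i> * complex_of_real (snd z \<bullet> y)))) \<partial>lborel)"
    unfolding stft_eq by (rule integral_norm_bound)
  then show ?thesis by (simp add: norm_mult)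
qed

text \<open>The position \<open>fst z\<close> is \<open>y\<close> minus \<open>y - fst z\<close>, so
  its powers distribute over the decay of \<open>\<psi>1\<close> and of
  \<open>\<psi>2\<close>.\<close>

lemma stft_moment_bound:
  fixes \<psi>1 \<psi>2 :: "'a::euclidean_space \<Rightarrow> complex"
  assumes \<psi>1: "schwartz \<psi>1" and \<psi>2: "schwartz \<psi>2"
  shows "\<exists>C. \<forall>z. norm (fst z) ^ k * cmod (stft \<psi>2 \<psi>1 z) \<le> C"
proof -
  obtain B where B: "0 \<le> B" "\<And>x. norm x ^ 0 * cmod (\<psi>2 x) \<le> B" using schwartz_bound[OF \<psi>2] by blast
  obtain Ck where Ck: "0 \<le> Ck" "\<And>x. norm x ^ k * cmod (\<psi>2 x) \<le> Ck" using schwartz_bound[OF \<psi>2] by blast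
  let ?w = "\<lambda>y. 2 ^ k * (norm y ^ k * cmod (\<psi>1 y) * B + cmod (\<psi>1 y) * Ck)"
  have w: "integrable lborel ?w"
    by (intro integrable_mult_right Bochner_Integration.integrable_add integrable_mult_left
        schwartz_integrable_moment[OF \<psi>1] integrable_norm schwartz_integrable[OF \<psi>1])
  have "norm (fst z) ^ k * cmod (stft \<psi>2 \<psi>1 z) \<le> (\<integral>y. ?w y \<partial>lborel)" for z
  proof -
    have pt: "norm (fst z) ^ k * (cmod (\<psi>1 y) * cmod (\<psi>2 (y - fst z))) \<le> ?w y" for y
    proof -
      have "norm (fst z) \<le> norm y + norm (y - fst z)" using norm_triangle_ineq4[of y "y - fst z"] by simp
      then have "norm (fst z) ^ k \<le> (norm y + norm (y - fst z)) ^ k" by (intro power_mono) auto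
      also have "\<dots> \<le> 2 ^ k * (norm y ^ k + norm (y - fst z) ^ k)" by (rule power_add_le) auto
      finally have "norm (fst z) ^ k * (cmod (\<psi>1 y) * cmod (\<psi>2 (y - fst z)))
          \<le> 2 ^ k * (norm y ^ k + norm (y - fst z) ^ k) * (cmod (\<psi>1 y) * cmod (\<psi>2 (y - fst z)))"
        by (rule mult_right_mono) simp
      also have "\<dots> = 2 ^ k * (norm y ^ k * cmod (\<psi>1 y) * cmod (\<psi>2 (y - fst z))
          + cmod (\<psi>1 y) * (norm (y - fst z) ^ k * cmod (\<psi>2 (y - fst z))))"
        by (simp add: algebra_simps)
      also have "\<dots> \<le> ?w y"
        using B(2)[of "y - fst z"] Ck(2)[of "y - fst z"] by (intro mult_left_mono add_mono) auto
      finally show ?thesis .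
    qed
    have "norm (fst z) ^ k * cmod (stft \<psi>2 \<psi>1 z)
        \<le> norm (fst z) ^ k * (\<integral>y. cmod (\<psi>1 y) * cmod (\<psi>2 (y - fst z)) \<partial>lborel)"
      by (intro mult_left_mono stft_norm_le) simp
    also have "\<dots> = (\<integral>y. norm (fst z) ^ k * (cmod (\<psi>1 y) * cmod (\<psi>2 (y - fst z))) \<partial>lborel)" by simp
    also have "\<dots> \<le> (\<integral>y. ?w y \<partial>lborel)"
      by (rule integral_mono_AE'[OF w]) (use pt B(1) Ck(1) in \<open>auto intro!: mult_nonneg_nonneg add_nonneg_nonneg\<close>)
    finally show ?thesis .
  qed
  then show ?thesis by blast
qed

text \<open>Integration by parts: the product of \<open>\<psi>1\<close>, the shifted window and the
  exponential has a derivative of integral zero, and its three terms are those of the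
  identity.\<close>

lemma stft_frequency_derivative:
  fixes \<psi>1 \<psi>2 :: "'a::euclidean_space \<Rightarrow> complex"
  assumes \<psi>1: "schwartz \<psi>1" and \<psi>2: "schwartz \<psi>2" and b: "b \<in> Basis"
  shows "\<i> * complex_of_real (\<omega> \<bullet> b) * stft \<psi>2 \<psi>1 (x, \<omega>)
    = stft \<psi>2 (\<lambda>y. frechet_derivative \<psi>1 (at y) b) (x, \<omega>)
      + stft (\<lambda>y. frechet_derivative \<psi>2 (at y) b) \<psi>1 (x, \<omega>)"
proof -
  define d1 where "d1 y = frechet_derivative \<psi>1 (at y) b" for y
  define d2 where "d2 y = frechet_derivative \<psi>2 (at y) b" for y
  have d1: "schwartz d1" and d2: "schwartz d2" unfolding d1_def d2_def by (rule schwartz_partial; fact)+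
  note [measurable] = schwartz_measurable[OF \<psi>1] schwartz_measurable[OF \<psi>2] schwartz_measurable[OF d1] schwartz_measurable[OF d2]
  let ?e = "\<lambda>y. exp (- (\<i> * complex_of_real (\<omega> \<bullet> y)))"
  define u where "u y = \<psi>1 y * cnj (\<psi>2 (y - x)) * ?e y" for y
  \<comment> \<open>The product rule along \<open>b\<close>: derivative on \<open>\<psi>1\<close>,
    on the window, and on the exponential.\<close>
  define u' where "u' y = d1 y * cnj (\<psi>2 (y - x)) * ?e y + \<psi>1 y * cnj (d2 (y - x)) * ?e y
      - (\<i> * complex_of_real (\<omega> \<bullet> b)) * u y" for y
  note sq = schwartz_square_integrable
  have iu: "integrable lborel u" unfolding u_def by (rule stft_integrable[OF sq[OF \<psi>1] sq[OF \<psi>2]])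
  obtain A1 where A1: "0 \<le> A1" "\<And>y. cmod (\<psi>1 y) \<le> A1 / (1 + norm y) ^ (2 * DIM('a))"
    using schwartz_decay[OF \<psi>1] by blast
  obtain A2 where A2: "0 \<le> A2" "\<And>y. cmod (d1 y) \<le> A2 / (1 + norm y) ^ (2 * DIM('a))"
    using schwartz_decay[OF d1] by blast
  obtain B1 where B1: "0 \<le> B1" "\<And>y. norm y ^ 0 * cmod (\<psi>2 y) \<le> B1" using schwartz_bound[OF \<psi>2] by blast
  obtain B2 where B2: "0 \<le> B2" "\<And>y. norm y ^ 0 * cmod (d2 y) \<le> B2" using schwartz_bound[OF d2] by blast
  have "(\<integral>y. u' y \<partial>lborel) = 0"
  proof (rule integral_directional_derivative_zero[OF iu])
    show "norm b = 1" using b by simp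
    show "u' \<in> borel_measurable borel" unfolding u'_def u_def by measurable
    fix y
    show "((\<lambda>t. u (y + t *\<^sub>R b)) has_vector_derivative u' (y + t *\<^sub>R b)) (at t)" for t
    proof -
      have D1: "((\<lambda>t. \<psi>1 (y + t *\<^sub>R b)) has_vector_derivative d1 (y + t *\<^sub>R b)) (at t)"
        unfolding d1_def by (rule line_derivative[OF schwartz_differentiable[OF \<psi>1]])
      have "((\<lambda>t. \<psi>2 ((y - x) + t *\<^sub>R b)) has_vector_derivative d2 ((y - x) + t *\<^sub>R b)) (at t)"
        unfolding d2_def by (rule line_derivative[OF schwartz_differentiable[OF \<psi>2]])
      then have "((\<lambda>t. cnj (\<psi>2 ((y - x) + t *\<^sub>R b))) has_vector_derivative cnj (d2 ((y - x) + t *\<^sub>R b))) (at t)"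
        by (rule has_vector_derivative_cnj)
      then have D2: "((\<lambda>t. cnj (\<psi>2 (y + t *\<^sub>R b - x))) has_vector_derivative cnj (d2 (y + t *\<^sub>R b - x))) (at t)"
        by (simp add: algebra_simps)
      have "((\<lambda>t. - (\<i> * complex_of_real (\<omega> \<bullet> (y + t *\<^sub>R b)))) has_vector_derivative - (\<i> * complex_of_real (\<omega> \<bullet> b))) (at t)"
        unfolding has_vector_derivative_def inner_add_right
        by (auto intro!: derivative_eq_intros simp: scaleR_conv_of_real)
      from field_vector_diff_chain_at[OF this DERIV_exp]
      have D3: "((\<lambda>t. ?e (y + t *\<^sub>R b)) has_vector_derivative
          - (\<i> * complex_of_real (\<omega> \<bullet> b)) * ?e (y + t *\<^sub>R b)) (at t)"
        by (simp add: o_def)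
      show ?thesis
        using has_vector_derivative_mult[OF has_vector_derivative_mult[OF D1 D2] D3]
        by (simp add: u_def u'_def algebra_simps)
    qed
    have e1: "cmod (?e y) = 1" by simp
    have pos: "0 < (1 + norm y) ^ (2 * DIM('a))" by (simp add: add_pos_nonneg)
    have t1: "cmod (d1 y * cnj (\<psi>2 (y - x)) * ?e y) \<le> A2 / (1 + norm y) ^ (2 * DIM('a)) * B1"
      using mult_mono[OF A2(2)[of y] B1(2)[of "y - x"]] A2(1) pos by (simp add: norm_mult)
    have t2: "cmod (\<psi>1 y * cnj (d2 (y - x)) * ?e y) \<le> A1 / (1 + norm y) ^ (2 * DIM('a)) * B2"
      using mult_mono[OF A1(2)[of y] B2(2)[of "y - x"]] A1(1) pos by (simp add: norm_mult)
    have t3: "cmod (u y) \<le> A1 / (1 + norm y) ^ (2 * DIM('a)) * B1"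
      using mult_mono[OF A1(2)[of y] B1(2)[of "y - x"]] A1(1) pos by (simp add: u_def norm_mult)
    have "cmod (u' y) \<le> (cmod (d1 y * cnj (\<psi>2 (y - x)) * ?e y) + cmod (\<psi>1 y * cnj (d2 (y - x)) * ?e y))
        + cmod ((\<i> * complex_of_real (\<omega> \<bullet> b)) * u y)"
      unfolding u'_def by (rule order_trans[OF norm_triangle_ineq4 add_right_mono[OF norm_triangle_ineq]])
    also have "cmod ((\<i> * complex_of_real (\<omega> \<bullet> b)) * u y) = \<bar>\<omega> \<bullet> b\<bar> * cmod (u y)"
      by (simp add: norm_mult)
    also have "(cmod (d1 y * cnj (\<psi>2 (y - x)) * ?e y) + cmod (\<psi>1 y * cnj (d2 (y - x)) * ?e y)) + \<bar>\<omega> \<bullet> b\<bar> * cmod (u y)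
        \<le> (A2 / (1 + norm y) ^ (2 * DIM('a)) * B1 + A1 / (1 + norm y) ^ (2 * DIM('a)) * B2)
          + \<bar>\<omega> \<bullet> b\<bar> * (A1 / (1 + norm y) ^ (2 * DIM('a)) * B1)"
      by (intro add_mono mult_left_mono t1 t2 t3) simp
    also have "\<dots> = (A2 * B1 + A1 * B2 + \<bar>\<omega> \<bullet> b\<bar> * (A1 * B1)) / (1 + norm y) ^ (2 * DIM('a))"
      by (simp add: add_divide_distrib)
    finally show "cmod (u' y) \<le> (A2 * B1 + A1 * B2 + \<bar>\<omega> \<bullet> b\<bar> * (A1 * B1)) / (1 + norm y) ^ (2 * DIM('a))" .
  qed
  moreover have "(\<integral>y. u' y \<partial>lborel) = stft \<psi>2 d1 (x, \<omega>) + stft d2 \<psi>1 (x, \<omega>)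
      - (\<i> * complex_of_real (\<omega> \<bullet> b)) * stft \<psi>2 \<psi>1 (x, \<omega>)"
    unfolding u'_def u_def stft_eq fst_conv snd_conv
    using stft_integrable[OF sq[OF d1] sq[OF \<psi>2], of x \<omega>] stft_integrable[OF sq[OF \<psi>1] sq[OF d2], of x \<omega>]
      stft_integrable[OF sq[OF \<psi>1] sq[OF \<psi>2], of x \<omega>]
    by simp
  ultimately show ?thesis unfolding d1_def d2_def by simp
qed

text \<open>Each factor of the frequency is traded for a derivative on one of the two functions, so
  the induction must range over both; Schwartz functions are stable under this.\<close>

lemma stft_frequency_bound:
  fixes \<psi>1 \<psi>2 :: "'a::euclidean_space \<Rightarrow> complex"
  assumes "schwartz \<psi>1" "schwartz \<psi>2" "b \<in> Basis"
  shows "\<exists>C. \<forall>z. \<bar>snd z \<bullet> b\<bar> ^ k * cmod (stft \<psi>2 \<psi>1 z) \<le> C"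
  using assms
proof (induction k arbitrary: \<psi>1 \<psi>2)
  case 0
  then show ?case using stft_moment_bound[of \<psi>1 \<psi>2 0] by simp
next
  case (Suc k)
  obtain C1 where C1: "\<And>z. \<bar>snd z \<bullet> b\<bar> ^ k * cmod (stft \<psi>2 (\<lambda>y. frechet_derivative \<psi>1 (at y) b) z) \<le> C1"
    using Suc.IH[OF schwartz_partial[OF Suc.prems(1,3)] Suc.prems(2,3)] by blast
  obtain C2 where C2: "\<And>z. \<bar>snd z \<bullet> b\<bar> ^ k * cmod (stft (\<lambda>y. frechet_derivative \<psi>2 (at y) b) \<psi>1 z) \<le> C2"
    using Suc.IH[OF Suc.prems(1) schwartz_partial[OF Suc.prems(2,3)] Suc.prems(3)] by blast
  have "\<bar>snd z \<bullet> b\<bar> ^ Suc k * cmod (stft \<psi>2 \<psi>1 z) \<le> C1 + C2" for z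
  proof -
    obtain x \<omega> where z: "z = (x, \<omega>)" by (cases z)
    have "\<bar>\<omega> \<bullet> b\<bar> * cmod (stft \<psi>2 \<psi>1 z) = cmod (\<i> * complex_of_real (\<omega> \<bullet> b) * stft \<psi>2 \<psi>1 (x, \<omega>))"
      by (simp add: norm_mult z)
    also have "\<dots> \<le> cmod (stft \<psi>2 (\<lambda>y. frechet_derivative \<psi>1 (at y) b) z)
        + cmod (stft (\<lambda>y. frechet_derivative \<psi>2 (at y) b) \<psi>1 z)"
      unfolding stft_frequency_derivative[OF Suc.prems] z by (rule norm_triangle_ineq)
    finally have "\<bar>\<omega> \<bullet> b\<bar> ^ k * (\<bar>\<omega> \<bullet> b\<bar> * cmod (stft \<psi>2 \<psi>1 z))
        \<le> \<bar>\<omega> \<bullet> b\<bar> ^ k * (cmod (stft \<psi>2 (\<lambda>y. frechet_derivative \<psi>1 (at y) b) z)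
        + cmod (stft (\<lambda>y. frechet_derivative \<psi>2 (at y) b) \<psi>1 z))"
      by (rule mult_left_mono) simp
    also have "\<dots> \<le> C1 + C2" using C1[of z] C2[of z] by (simp add: z distrib_left)
    finally show ?thesis by (simp add: z mult_ac)
  qed
  then show ?case by blast
qed

lemma sum_power_le:
  fixes a :: "'i \<Rightarrow> real"
  assumes S: "finite S" "S \<noteq> {}" and a: "\<And>i. i \<in> S \<Longrightarrow> 0 \<le> a i"
  shows "(\<Sum>i\<in>S. a i) ^ k \<le> real (card S) ^ k * (\<Sum>i\<in>S. a i ^ k)"
proof -
  have "Max (a ` S) \<in> a ` S" using S by (intro Max_in) auto
  then obtain j where j: "j \<in> S" "a j = Max (a ` S)" by auto
  have "(\<Sum>i\<in>S. a i) \<le> (\<Sum>i\<in>S. a j)" using S j by (intro sum_mono) simp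
  then have "(\<Sum>i\<in>S. a i) ^ k \<le> (real (card S) * a j) ^ k" using a by (intro power_mono sum_nonneg) auto
  also have "\<dots> = real (card S) ^ k * a j ^ k" by (rule power_mult_distrib)
  also have "a j ^ k \<le> (\<Sum>i\<in>S. a i ^ k)" using a S j by (intro member_le_sum) auto
  finally show ?thesis by (simp add: mult_left_mono)
qed

text \<open>The weight is split into a position moment and one frequency moment for each basis
  direction.\<close>

lemma stft_decay:
  fixes \<phi> :: "'a::euclidean_space \<Rightarrow> complex"
  assumes \<phi>: "schwartz \<phi>"
  shows "\<exists>C. \<forall>z. (1 + norm z) ^ k * cmod (stft \<phi> \<phi> z) \<le> C"
proof -
  obtain C1 where C1: "\<And>z. norm (fst z) ^ k * cmod (stft \<phi> \<phi> z) \<le> C1"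
    using stft_moment_bound[OF \<phi> \<phi>] by blast
  obtain C0 where C0: "\<And>z. norm (fst z) ^ 0 * cmod (stft \<phi> \<phi> z) \<le> C0"
    using stft_moment_bound[OF \<phi> \<phi>] by blast
  have "\<forall>b\<in>Basis. \<exists>C. \<forall>z. \<bar>snd z \<bullet> b\<bar> ^ k * cmod (stft \<phi> \<phi> z) \<le> C"
    using stft_frequency_bound[OF \<phi> \<phi>] by blast
  then obtain C2 where C2: "\<And>b z. b \<in> Basis \<Longrightarrow> \<bar>snd z \<bullet> b\<bar> ^ k * cmod (stft \<phi> \<phi> z) \<le> C2 b"
    by metis
  define A where "A = (\<Sum>b\<in>(Basis::'a set). C2 b)"
  have "(1 + norm z) ^ k * cmod (stft \<phi> \<phi> z)
      \<le> 2 ^ k * (2 ^ k * (C0 + C1) + real DIM('a) ^ k * A)" for z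
  proof -
    let ?V = "cmod (stft \<phi> \<phi> z)"
    have "norm z \<le> norm (fst z) + norm (snd z)" using norm_Pair_le[of "fst z" "snd z"] by simp
    moreover have "norm (snd z) \<le> (\<Sum>b\<in>Basis. \<bar>snd z \<bullet> b\<bar>)" by (rule norm_le_l1)
    ultimately have "(1 + norm z) ^ k \<le> ((1 + norm (fst z)) + (\<Sum>b\<in>Basis. \<bar>snd z \<bullet> b\<bar>)) ^ k"
      by (intro power_mono) auto
    also have "\<dots> \<le> 2 ^ k * ((1 + norm (fst z)) ^ k + (\<Sum>b\<in>Basis. \<bar>snd z \<bullet> b\<bar>) ^ k)"
      by (rule power_add_le) (auto intro: sum_nonneg)
    also have "\<dots> \<le> 2 ^ k * (2 ^ k * (1 ^ k + norm (fst z) ^ k) + real DIM('a) ^ k * (\<Sum>b\<in>Basis. \<bar>snd z \<bullet> b\<bar> ^ k))"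
      by (intro mult_left_mono add_mono power_add_le sum_power_le) auto
    finally have "(1 + norm z) ^ k * ?V
        \<le> 2 ^ k * (2 ^ k * (1 ^ k + norm (fst z) ^ k) + real DIM('a) ^ k * (\<Sum>b\<in>Basis. \<bar>snd z \<bullet> b\<bar> ^ k)) * ?V"
      by (rule mult_right_mono) simp
    also have "\<dots> = 2 ^ k * (2 ^ k * (norm (fst z) ^ 0 * ?V + norm (fst z) ^ k * ?V)
        + real DIM('a) ^ k * (\<Sum>b\<in>Basis. \<bar>snd z \<bullet> b\<bar> ^ k * ?V))"
      by (simp add: algebra_simps sum_distrib_left sum_distrib_right)
    also have "\<dots> \<le> 2 ^ k * (2 ^ k * (C0 + C1) + real DIM('a) ^ k * A)"
      unfolding A_def by (intro mult_left_mono add_mono C0 C1 sum_mono C2) auto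
    finally show ?thesis .
  qed
  then show ?thesis by blast
qed

subsection \<open>The frame of coherent states\<close>

text \<open>The exponent is the one that makes the dilation unitary.\<close>

definition dilate :: "real \<Rightarrow> ('a::euclidean_space \<Rightarrow> complex) \<Rightarrow> 'a \<Rightarrow> complex" where
  "dilate s F y = complex_of_real (s powr (- (real DIM('a) / 2))) * F ((1 / s) *\<^sub>R y)"

lemma square_integrable_dilate:
  assumes s: "0 < s" and F: "square_integrable F"
  shows "square_integrable (dilate s F)"
proof -
  have [measurable]: "F \<in> borel_measurable borel" and I: "integrable lborel (\<lambda>x. (cmod (F x))\<^sup>2)"
    using F by (simp_all add: square_integrable_def)
  have "integrable lborel (\<lambda>x. (cmod (F (0 + (1 / s) *\<^sub>R x)))\<^sup>2)"
    using integrable_lborel_affine[OF _ I, of "1 / s" 0] s by simp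
  then have "square_integrable (\<lambda>x. F ((1 / s) *\<^sub>R x))"
    by (simp add: square_integrable_def)
  then show ?thesis unfolding dilate_def by (rule square_integrable_scale)
qed

lemma dilate_inverse: "0 < s \<Longrightarrow> dilate (1 / s) (dilate s F) = F"
  by (simp add: dilate_def fun_eq_iff powr_minus powr_divide divide_simps flip: of_real_mult)

lemma cinner_dilate:
  fixes F G :: "'a::euclidean_space \<Rightarrow> complex"
  assumes s: "0 < s" and F: "square_integrable F" and G: "square_integrable G"
  shows "cinner (abs_l2 F) (abs_l2 (dilate s G)) = cinner (abs_l2 (dilate (1 / s) F)) (abs_l2 G)"
proof -
  have [measurable]: "F \<in> borel_measurable borel" "G \<in> borel_measurable borel"
    using F G by (simp_all add: square_integrable_def)
  have [measurable]: "dilate s G \<in> borel_measurable borel"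
    using square_integrable_dilate[OF s G] by (simp add: square_integrable_def)
  define c where "c = s powr (real DIM('a) / 2)"
  have c: "0 < c" "s powr (- (real DIM('a) / 2)) = 1 / c" "(1 / s) powr (- (real DIM('a) / 2)) = c"
    using s by (simp_all add: c_def powr_minus powr_divide divide_simps)
  have "c * c = s powr real DIM('a)" by (simp add: c_def flip: powr_add)
  then have cc: "s ^ DIM('a) = c * c" using s by (simp add: powr_realpow)
  have "cinner (abs_l2 F) (abs_l2 (dilate s G)) = (\<integral>y. F y * cnj (dilate s G y) \<partial>lborel)"
    by (rule cinner_abs_l2[OF F square_integrable_dilate[OF s G]])
  also have "\<dots> = (\<bar>s\<bar> ^ DIM('a)) *\<^sub>R (\<integral>y. F (0 + s *\<^sub>R y) * cnj (dilate s G (0 + s *\<^sub>R y)) \<partial>lborel)"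
    by (rule integral_lborel_affine) (use s in auto)
  also have "\<dots> = (\<integral>y. complex_of_real (c * c) * (F (s *\<^sub>R y) * cnj (dilate s G (s *\<^sub>R y))) \<partial>lborel)"
    using s by (simp add: scaleR_conv_of_real cc)
  also have "\<dots> = (\<integral>y. dilate (1 / s) F y * cnj (G y) \<partial>lborel)"
    using s c(1) by (intro Bochner_Integration.integral_cong refl) (simp add: dilate_def c(2,3) mult_ac)
  also have "\<dots> = cinner (abs_l2 (dilate (1 / s) F)) (abs_l2 G)"
    using s by (intro cinner_abs_l2[OF square_integrable_dilate[OF _ F] G, symmetric]) simp
  finally show ?thesis .
qed

lemma cinner_dilate_dilate:
  assumes s: "0 < s" and F: "square_integrable F" and G: "square_integrable G"
  shows "cinner (abs_l2 (dilate s F)) (abs_l2 (dilate s G)) = cinner (abs_l2 F) (abs_l2 G)"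
  unfolding cinner_dilate[OF s square_integrable_dilate[OF s F] G] dilate_inverse[OF s] ..

lemma norm_dilate:
  assumes "0 < s" "square_integrable F"
  shows "norm (abs_l2 (dilate s F)) = norm (abs_l2 F)"
  unfolding norm_l2_def inner_l2_def using cinner_dilate_dilate[OF assms assms(2)] by simp

text \<open>The time-frequency shift by \<open>w\<close>, which is the coherent state at
  \<open>h = 1\<close>.\<close>

definition phase_shift :: "('a::euclidean_space \<Rightarrow> complex) \<Rightarrow> 'a \<times> 'a \<Rightarrow> 'a \<Rightarrow> complex" where
  "phase_shift \<phi> w u = exp (\<i> * complex_of_real (snd w \<bullet> u)) * \<phi> (u - fst w)"

lemma cmod_phase_shift: "cmod (phase_shift \<phi> w u) = cmod (\<phi> (u - fst w))"
  by (simp add: phase_shift_def norm_mult)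

lemma square_integrable_phase_shift:
  assumes "square_integrable \<phi>"
  shows "square_integrable (phase_shift \<phi> w)"
proof -
  have sh: "square_integrable (\<lambda>u. \<phi> (u + - fst w))" by (rule square_integrable_translate[OF assms])
  have [measurable]: "\<phi> \<in> borel_measurable borel" using assms by (simp add: square_integrable_def)
  have "phase_shift \<phi> w \<in> borel_measurable borel" unfolding phase_shift_def by measurable
  then show ?thesis using sh by (simp add: square_integrable_def cmod_phase_shift)
qed

lemma stft_eq_cinner:
  assumes F: "square_integrable F" and \<phi>: "square_integrable \<phi>"
  shows "stft \<phi> F w = cinner (abs_l2 F) (abs_l2 (phase_shift \<phi> w))"
  unfolding cinner_abs_l2[OF F square_integrable_phase_shift[OF \<phi>]] stft_eq phase_shift_def
  by (simp add: exp_cnj mult_ac)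

text \<open>Covariance of time-frequency shifts: composing two of them produces only a unimodular
  factor, so the Gram kernel has the modulus of a function of the difference.\<close>

lemma cmod_cinner_phase_shift:
  assumes \<phi>: "square_integrable \<phi>"
  shows "cmod (cinner (abs_l2 (phase_shift \<phi> w)) (abs_l2 (phase_shift \<phi> w'))) = cmod (stft \<phi> \<phi> (w' - w))"
proof -
  note sq = square_integrable_phase_shift[OF \<phi>]
  have [measurable]: "\<phi> \<in> borel_measurable borel" using \<phi> by (simp add: square_integrable_def)
  have [measurable]: "phase_shift \<phi> v \<in> borel_measurable borel" for v
    using sq by (simp add: square_integrable_def)
  obtain x \<omega> where w: "w = (x, \<omega>)" by (cases w)
  obtain x' \<omega>' where w': "w' = (x', \<omega>')" by (cases w')
  define c where "c = exp (\<i> * complex_of_real ((\<omega> - \<omega>') \<bullet> x))"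
  have pt: "phase_shift \<phi> w (u + x) * cnj (phase_shift \<phi> w' (u + x))
      = c * (\<phi> u * cnj (\<phi> (u + x - x')) * exp (- (\<i> * complex_of_real ((\<omega>' - \<omega>) \<bullet> u))))" for u
  proof -
    have "exp (\<i> * complex_of_real (\<omega> \<bullet> (u + x))) * exp (- (\<i> * complex_of_real (\<omega>' \<bullet> (u + x))))
        = c * exp (- (\<i> * complex_of_real ((\<omega>' - \<omega>) \<bullet> u)))"
      unfolding c_def exp_add[symmetric] by (simp add: inner_diff_left inner_add_right algebra_simps)
    then show ?thesis by (simp add: phase_shift_def w w' exp_cnj mult_ac)
  qed
  have "cinner (abs_l2 (phase_shift \<phi> w)) (abs_l2 (phase_shift \<phi> w'))
      = (\<integral>u. phase_shift \<phi> w u * cnj (phase_shift \<phi> w' u) \<partial>lborel)"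
    by (rule cinner_abs_l2[OF sq sq])
  also have "\<dots> = (\<integral>u. phase_shift \<phi> w (u + x) * cnj (phase_shift \<phi> w' (u + x)) \<partial>lborel)"
    by (rule integral_lborel_translate[symmetric]) measurable
  also have "\<dots> = c * stft \<phi> \<phi> (w' - w)"
  proof -
    have "u - fst (w' - w) = u + x - x'" for u by (simp add: w w')
    then show ?thesis unfolding pt stft_eq by (simp only: w w' snd_conv snd_diff integral_mult_right_zero)
  qed
  finally show ?thesis by (simp add: norm_mult c_def)
qed

lemma stft_tendsto:
  assumes F: "integrable lborel F" and \<phi>: "continuous_on UNIV \<phi>" "\<And>y. cmod (\<phi> y) \<le> B"
    and z: "z \<longlonglongrightarrow> w"
  shows "(\<lambda>n. stft \<phi> F (z n)) \<longlonglongrightarrow> stft \<phi> F w"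
  unfolding stft_eq
proof (rule integral_dominated_convergence)
  have [measurable]: "\<phi> \<in> borel_measurable borel" by (rule borel_measurable_continuous_onI[OF \<phi>(1)])
  have [measurable]: "F \<in> borel_measurable borel" using borel_measurable_integrable[OF F] by simp
  show "(\<lambda>y. F y * cnj (\<phi> (y - fst w)) * exp (- (\<i> * complex_of_real (snd w \<bullet> y)))) \<in> borel_measurable lborel"
    by measurable
  show "(\<lambda>y. F y * cnj (\<phi> (y - fst (z n))) * exp (- (\<i> * complex_of_real (snd (z n) \<bullet> y)))) \<in> borel_measurable lborel" for n
    by measurable
  show "integrable lborel (\<lambda>y. cmod (F y) * B)" using F by simp
  have "(\<lambda>n. \<phi> (y - fst (z n))) \<longlonglongrightarrow> \<phi> (y - fst w)" for y
    by (rule continuous_on_tendsto_compose[OF \<phi>(1)]) (auto intro!: tendsto_intros z)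
  then show "AE y in lborel. (\<lambda>n. F y * cnj (\<phi> (y - fst (z n))) * exp (- (\<i> * complex_of_real (snd (z n) \<bullet> y))))
      \<longlonglongrightarrow> F y * cnj (\<phi> (y - fst w)) * exp (- (\<i> * complex_of_real (snd w \<bullet> y)))"
    by (intro AE_I2 tendsto_mult tendsto_const tendsto_cnj tendsto_exp tendsto_minus tendsto_of_real
        tendsto_inner tendsto_snd z)
  show "AE y in lborel. norm (F y * cnj (\<phi> (y - fst (z n))) * exp (- (\<i> * complex_of_real (snd (z n) \<bullet> y))))
      \<le> cmod (F y) * B" for n
    by (intro AE_I2) (simp add: norm_mult mult_left_mono \<phi>(2))
qed

definition coherent_frame :: "('a::euclidean_space \<Rightarrow> complex) \<Rightarrow> real \<Rightarrow> 'a \<times> 'a \<Rightarrow> 'a l2" where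
  "coherent_frame \<phi> h w = abs_l2 (coherent_state \<phi> h (h powr (1/2) *\<^sub>R w))"

text \<open>In scaled coordinates all dependence on \<open>h\<close> sits in one unitary dilation,
  so the Gram kernel is the same for every \<open>h\<close>.\<close>

lemma coherent_frame_eq:
  fixes \<phi> :: "'a::euclidean_space \<Rightarrow> complex"
  assumes h: "0 < h"
  shows "coherent_frame \<phi> h w = abs_l2 (dilate (h powr (1/2)) (phase_shift \<phi> w))"
proof -
  define r where "r = h powr (1/2)"
  have r: "0 < r" using h by (simp add: r_def)
  have rr: "r * r = h" using h by (simp add: r_def powr_half_sqrt)
  have ri: "h powr (- (1/2)) = 1 / r" by (simp add: r_def powr_minus_divide)
  have c: "h powr (- (real DIM('a) / 4)) = r powr (- (real DIM('a) / 2))"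
    by (simp add: r_def powr_powr)
  obtain x \<omega> where w: "w = (x, \<omega>)" by (cases w)
  have "coherent_state \<phi> h (r *\<^sub>R w) y = dilate r (phase_shift \<phi> w) y" for y
  proof -
    have "\<i> / complex_of_real h * complex_of_real ((r *\<^sub>R \<omega>) \<bullet> y) = \<i> * complex_of_real (\<omega> \<bullet> ((1 / r) *\<^sub>R y))"
      using r by (simp add: rr[symmetric])
    moreover have "(1 / r) *\<^sub>R (y - r *\<^sub>R x) = (1 / r) *\<^sub>R y - x"
      using r by (simp add: scaleR_diff_right)
    ultimately show ?thesis
      unfolding coherent_state_def dilate_def phase_shift_def c ri w
      by (simp only: scaleR_Pair prod.case fst_conv snd_conv mult.assoc)
  qed
  then have "coherent_state \<phi> h (r *\<^sub>R w) = dilate r (phase_shift \<phi> w)" by (rule ext)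
  then show ?thesis unfolding coherent_frame_def r_def[symmetric] by (rule arg_cong)
qed

text \<open>The decay constants are those of the transform of \<open>\<phi>\<close> with its own
  window and precede \<open>h\<close>; the Parseval identity is Moyal's identity for the dilated
  function.\<close>

lemma localized_coherent_frame:
  fixes \<phi> :: "'a::euclidean_space \<Rightarrow> complex"
  assumes \<phi>: "schwartz \<phi>" and n1: "norm (abs_l2 \<phi>) = 1"
  shows "\<exists>\<Gamma>. \<forall>h>0. localized_frame (1 / (2 * pi) ^ DIM('a)) \<Gamma> (coherent_frame \<phi> h)"
proof -
  note sq = schwartz_square_integrable[OF \<phi>]
  note sqp = square_integrable_phase_shift[OF sq]
  obtain B where B: "\<And>y. norm y ^ 0 * cmod (\<phi> y) \<le> B" using schwartz_bound[OF \<phi>] by blast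
  then have B: "\<And>y. cmod (\<phi> y) \<le> B" by simp
  have "\<forall>k. \<exists>C. \<forall>z. (1 + norm z) ^ k * cmod (stft \<phi> \<phi> z) \<le> C" using stft_decay[OF \<phi>] by blast
  then obtain \<Gamma> where \<Gamma>: "\<And>k z. (1 + norm z) ^ k * cmod (stft \<phi> \<phi> z) \<le> \<Gamma> k" by metis
  have "localized_frame (1 / (2 * pi) ^ DIM('a)) \<Gamma> (coherent_frame \<phi> h)" if h: "0 < h" for h
  proof
    have r: "0 < h powr (1/2)" using h by simp
    have cin: "cinner (coherent_frame \<phi> h z) (coherent_frame \<phi> h w)
        = cinner (abs_l2 (phase_shift \<phi> z)) (abs_l2 (phase_shift \<phi> w))" for z w
      unfolding coherent_frame_eq[OF h] by (rule cinner_dilate_dilate[OF r sqp sqp])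
    have cm: "cmod (cinner (coherent_frame \<phi> h z) (coherent_frame \<phi> h w)) = cmod (stft \<phi> \<phi> (w - z))" for z w
      unfolding cin by (rule cmod_cinner_phase_shift[OF sq])
    show "0 < 1 / (2 * pi) ^ DIM('a)" by simp
    show "(1 + norm (z - w)) ^ k * cmod (cinner (coherent_frame \<phi> h z) (coherent_frame \<phi> h w)) \<le> \<Gamma> k" for z w k
      using \<Gamma>[of "w - z" k] unfolding cm by (simp add: norm_minus_commute)
    have p0: "phase_shift \<phi> 0 = \<phi>" by (simp add: phase_shift_def fun_eq_iff)
    have "stft \<phi> \<phi> 0 = 1" unfolding stft_eq_cinner[OF sq sq] p0 cinner_self n1 by simp
    then have "(norm (coherent_frame \<phi> h w))\<^sup>2 = 1" for w
      using cm[of w w] unfolding cinner_self by (simp add: norm_power)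
    then show n: "norm (coherent_frame \<phi> h w) = 1" for w by (simp add: power2_eq_1_iff) (metis norm_ge_zero not_one_le_zero neg_0_le_iff_le)
    \<comment> \<open>All frame vectors are unit vectors, so convergence of the pairing with the
      limit vector already gives convergence in norm.\<close>
    show "continuous_on UNIV (coherent_frame \<phi> h)"
      unfolding continuous_on_sequentially
    proof (intro ballI allI impI)
      fix z and w :: "'a \<times> 'a"
      assume "(\<forall>n. z n \<in> UNIV) \<and> z \<longlonglongrightarrow> w"
      then have z: "z \<longlonglongrightarrow> w" by simp
      have I: "integrable lborel (phase_shift \<phi> w)"
      proof (rule integrable_norm_cancel)
        show "integrable lborel (\<lambda>u. norm (phase_shift \<phi> w u))"
          using integrable_norm[OF integrable_lborel_translate[OF schwartz_integrable[OF \<phi>], of "- fst w"]]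
          by (simp add: cmod_phase_shift)
        show "phase_shift \<phi> w \<in> borel_measurable lborel" using sqp by (simp add: square_integrable_def)
      qed
      have "(\<lambda>n. cinner (coherent_frame \<phi> h w) (coherent_frame \<phi> h (z n))) \<longlonglongrightarrow> cinner (coherent_frame \<phi> h w) (coherent_frame \<phi> h w)"
        unfolding cin stft_eq_cinner[OF sqp sq, symmetric]
        by (rule stft_tendsto[OF I schwartz_continuous[OF \<phi>] B z])
      then have "(\<lambda>n. 1 - 2 * Re (cinner (coherent_frame \<phi> h w) (coherent_frame \<phi> h (z n))) + 1) \<longlonglongrightarrow> 1 - 2 * Re (cinner (coherent_frame \<phi> h w) (coherent_frame \<phi> h w)) + 1"
        by (intro tendsto_diff tendsto_add tendsto_mult tendsto_const tendsto_Re)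
      moreover have "1 - 2 * Re (cinner (coherent_frame \<phi> h w) (coherent_frame \<phi> h (z n))) + 1
          = (norm (coherent_frame \<phi> h w - coherent_frame \<phi> h (z n)))\<^sup>2" for n
        unfolding norm_diff_sq n by simp
      moreover have "1 - 2 * Re (cinner (coherent_frame \<phi> h w) (coherent_frame \<phi> h w)) + 1 = 0"
        unfolding Re_cinner_self n by simp
      ultimately have "(\<lambda>n. (norm (coherent_frame \<phi> h w - coherent_frame \<phi> h (z n)))\<^sup>2) \<longlonglongrightarrow> 0"
        by (simp only:)
      then have "(\<lambda>n. sqrt ((norm (coherent_frame \<phi> h w - coherent_frame \<phi> h (z n)))\<^sup>2)) \<longlonglongrightarrow> sqrt 0"
        by (rule tendsto_real_sqrt)
      then have "(\<lambda>n. norm (coherent_frame \<phi> h (z n) - coherent_frame \<phi> h w)) \<longlonglongrightarrow> 0"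
        by (simp add: norm_minus_commute del: tendsto_norm_zero_iff)
      then show "(coherent_frame \<phi> h \<circ> z) \<longlonglongrightarrow> coherent_frame \<phi> h w"
        unfolding o_def by (rule LIM_zero_cancel[OF tendsto_norm_zero_cancel])
    qed
    show "ennreal (1 / (2 * pi) ^ DIM('a)) * (\<integral>\<^sup>+w. ennreal ((cmod (cinner f (coherent_frame \<phi> h w)))\<^sup>2) \<partial>lborel)
        = ennreal ((norm f)\<^sup>2)" for f
    proof -
      obtain F where F: "square_integrable F" "f = abs_l2 F" by (rule l2_cases)
      have sF: "square_integrable (dilate (1 / h powr (1/2)) F)"
        using r by (intro square_integrable_dilate F) simp
      have eq: "cinner f (coherent_frame \<phi> h w) = stft \<phi> (dilate (1 / h powr (1/2)) F) w" for w
        unfolding coherent_frame_eq[OF h] F(2) cinner_dilate[OF r F(1) sqp] stft_eq_cinner[OF sF sq] ..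
      have nF: "norm (abs_l2 (dilate (1 / h powr (1/2)) F)) = norm f"
        using r unfolding F(2) by (intro norm_dilate F) simp
      show ?thesis unfolding eq moyal[OF sF sq B] nF n1
        by (simp flip: ennreal_mult')
    qed
  qed
  then show ?thesis by blast
qed

subsection \<open>Anti-Wick operators as frame operators\<close>

text \<open>The substitution \<open>z = sqrt h * w\<close> identifies forms and form domains;
  uniqueness of the operator of a closed form then resolves the definite description.\<close>

lemma antiwick_operator_eq:
  fixes \<phi> :: "'a::euclidean_space \<Rightarrow> complex"
  assumes h: "0 < h"
    and frame: "localized_frame (1 / (2 * pi) ^ DIM('a)) \<Gamma> (coherent_frame \<phi> h)"
    and tame: "tame K M (\<lambda>w. b (h powr (1/2) *\<^sub>R w))" and pos: "\<And>z. 0 \<le> b z"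
  shows "antiwick_operator \<phi> h b
    = localized_frame.symbol_operator (1 / (2 * pi) ^ DIM('a)) (coherent_frame \<phi> h) (\<lambda>w. b (h powr (1/2) *\<^sub>R w))"
proof -
  interpret localized_frame "1 / (2 * pi) ^ DIM('a)" \<Gamma> "coherent_frame \<phi> h" by (rule frame)
  define r where "r = h powr (1/2)"
  have r: "0 < r" using h by (simp add: r_def)
  have rr: "r * r = h" using h by (simp add: r_def powr_half_sqrt)
  define b' where "b' w = b (r *\<^sub>R w)" for w
  have tame': "tame K M b'" using tame by (simp add: b'_def[abs_def] r_def)
  have pos': "0 \<le> b' w" for w by (simp add: b'_def pos)
  have m1 [measurable]: "b' \<in> borel_measurable borel" by (rule tame_measurable[OF tame'])
  have m2 [measurable]: "(\<lambda>w. cinner (coherent_frame \<phi> h w) g) \<in> borel_measurable borel" for g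
    by (intro borel_measurable_continuous_onI continuous_intros continuous_\<psi>)
  have m3 [measurable]: "(\<lambda>w. cinner g (coherent_frame \<phi> h w)) \<in> borel_measurable borel" for g
    by (intro borel_measurable_continuous_onI continuous_intros continuous_\<psi>)
  have m4: "(\<lambda>w. complex_of_real (b' w)) \<in> borel_measurable borel" by measurable
  \<comment> \<open>Phase space has twice the dimension, so the Jacobian is the power
    \<open>DIM('a)\<close> of \<open>h\<close> and cancels the \<open>h\<close> in the
    prefactor.\<close>
  have scale: "1 / (2 * pi * h) ^ DIM('a) * r ^ DIM('a \<times> 'a) = 1 / (2 * pi) ^ DIM('a)"
    using r by (simp add: rr[symmetric] power_mult_distrib power_add)
  have b: "b z = b' ((1 / r) *\<^sub>R z)" for z using r by (simp add: b'_def)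
  have cs: "abs_l2 (coherent_state \<phi> h z) = coherent_frame \<phi> h ((1 / r) *\<^sub>R z)" for z
    using r by (simp add: coherent_frame_def r_def)
  have quad: "antiwick_quadratic_form \<phi> h b f = symbol_quad b' f" for f
  proof -
    have "(\<integral>\<^sup>+z. ennreal (b z * (cmod (cinner f (abs_l2 (coherent_state \<phi> h z))))\<^sup>2) \<partial>lborel)
        = (\<integral>\<^sup>+z. ennreal (b' ((1 / r) *\<^sub>R z) * (cmod (cinner f (coherent_frame \<phi> h ((1 / r) *\<^sub>R z))))\<^sup>2) \<partial>lborel)"
      unfolding b cs ..
    also have "\<dots> = ennreal (\<bar>r\<bar> ^ DIM('a \<times> 'a)) * (\<integral>\<^sup>+w. ennreal (b' ((1 / r) *\<^sub>R (0 + r *\<^sub>R w))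
        * (cmod (cinner f (coherent_frame \<phi> h ((1 / r) *\<^sub>R (0 + r *\<^sub>R w)))))\<^sup>2) \<partial>lborel)"
      by (rule nn_integral_lborel_affine) (use r in \<open>simp, measurable\<close>)
    finally have "antiwick_quadratic_form \<phi> h b f
        = ennreal (1 / (2 * pi * h) ^ DIM('a)) * (ennreal (r ^ DIM('a \<times> 'a)) * (\<integral>\<^sup>+w. ennreal (b' w
          * (cmod (cinner f (coherent_frame \<phi> h w)))\<^sup>2) \<partial>lborel))"
      using r by (simp add: antiwick_quadratic_form_def)
    also have "\<dots> = ennreal (1 / (2 * pi * h) ^ DIM('a) * r ^ DIM('a \<times> 'a)) * (\<integral>\<^sup>+w. ennreal (b' w
          * (cmod (cinner f (coherent_frame \<phi> h w)))\<^sup>2) \<partial>lborel)"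
      using r h by (subst ennreal_mult) (simp_all add: mult.assoc)
    finally show ?thesis unfolding scale symbol_quad_def .
  qed
  have dom: "antiwick_form_domain \<phi> h b = symbol_domain b'"
    unfolding antiwick_form_domain_def symbol_domain_def quad ..
  have form: "antiwick_form \<phi> h b = symbol_form b'"
  proof (intro ext)
    fix f g
    define G where "G w = complex_of_real (b' w) * cinner f (coherent_frame \<phi> h w) * cinner (coherent_frame \<phi> h w) g" for w
    have [measurable]: "G \<in> borel_measurable borel"
      unfolding G_def[abs_def] by (intro borel_measurable_times m4 m2 m3)
    have "(\<integral>z. complex_of_real (b z) * cinner f (abs_l2 (coherent_state \<phi> h z))
        * cinner (abs_l2 (coherent_state \<phi> h z)) g \<partial>lborel) = (\<integral>z. G ((1 / r) *\<^sub>R z) \<partial>lborel)"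
      unfolding b cs G_def ..
    also have "\<dots> = (\<bar>r\<bar> ^ DIM('a \<times> 'a)) *\<^sub>R (\<integral>w. G ((1 / r) *\<^sub>R (0 + r *\<^sub>R w)) \<partial>lborel)"
    proof (rule integral_lborel_affine)
      show "r \<noteq> 0" using r by simp
    qed measurable
    also have "(\<lambda>w. G ((1 / r) *\<^sub>R (0 + r *\<^sub>R w))) = G" using r by simp
    finally have "antiwick_form \<phi> h b f g
        = complex_of_real (1 / (2 * pi * h) ^ DIM('a) * r ^ DIM('a \<times> 'a)) * (\<integral>w. complex_of_real (b' w)
          * cinner f (coherent_frame \<phi> h w) * cinner (coherent_frame \<phi> h w) g \<partial>lborel)"
      using r by (simp add: antiwick_form_def scaleR_conv_of_real G_def)
    then show "antiwick_form \<phi> h b f g = symbol_form b' f g" unfolding scale symbol_form_def .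
  qed
  interpret dense_closed_form "symbol_domain b'" "symbol_form b'"
    by (rule dense_closed_form_tame[OF tame' pos'])
  have "antiwick_operator \<phi> h b = form_operator"
    unfolding antiwick_operator_def dom form
  proof (rule the_equality)
    show "self_adjoint form_operator \<and> Domain form_operator \<subseteq> symbol_domain b' \<and>
        (\<forall>(f, u)\<in>form_operator. \<forall>g\<in>symbol_domain b'. cinner u g = symbol_form b' f g)"
      using form_operator_self_adjoint form_operatorD by blast
    show "A = form_operator" if "self_adjoint A \<and> Domain A \<subseteq> symbol_domain b' \<and>
        (\<forall>(f, u)\<in>A. \<forall>g\<in>symbol_domain b'. cinner u g = symbol_form b' f g)" for A
      using that by (intro form_operator_unique) auto
  qed
  then show ?thesis by (simp add: b'_def[abs_def] r_def)
qed

subsection \<open>Symbols\<close>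

text \<open>The iterated derivative along \<open>v\<close>, expanded in basis directions because the
  symbol estimates bound partial derivatives along basis lists.\<close>

fun line_partials :: "nat \<Rightarrow> 'a::euclidean_space \<Rightarrow> 'a list \<Rightarrow> ('a \<Rightarrow> real) \<Rightarrow> 'a \<Rightarrow> real" where
  "line_partials 0 v bs f x = partials bs f x"
| "line_partials (Suc k) v bs f x = (\<Sum>b\<in>Basis. (v \<bullet> b) * line_partials k v (b # bs) f x)"

lemma line_partials_deriv:
  fixes f :: "'a::euclidean_space \<Rightarrow> real"
  assumes f: "smooth f" and bs: "bs \<in> lists Basis"
  shows "DERIV (\<lambda>t. line_partials k v bs f (y + t *\<^sub>R v)) t :> line_partials (Suc k) v bs f (y + t *\<^sub>R v)"
  using bs
proof (induction k arbitrary: bs)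
  case 0
  have d: "partials bs f differentiable (at (y + t *\<^sub>R v))" using f 0 by (simp add: smooth_def)
  have lin: "linear (frechet_derivative (partials bs f) (at (y + t *\<^sub>R v)))"
    by (rule linear_frechet_derivative[OF d])
  have "frechet_derivative (partials bs f) (at (y + t *\<^sub>R v)) v
      = frechet_derivative (partials bs f) (at (y + t *\<^sub>R v)) (\<Sum>b\<in>Basis. (v \<bullet> b) *\<^sub>R b)"
    by (simp add: euclidean_representation)
  also have "\<dots> = (\<Sum>b\<in>Basis. (v \<bullet> b) * frechet_derivative (partials bs f) (at (y + t *\<^sub>R v)) b)"
    by (simp add: linear_sum[OF lin] linear_scale[OF lin])
  finally show ?case
    using line_derivative[OF d] by (simp add: has_real_derivative_iff_has_vector_derivative)
next
  case (Suc k)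
  have "DERIV (\<lambda>t. \<Sum>b\<in>Basis. (v \<bullet> b) * line_partials k v (b # bs) f (y + t *\<^sub>R v)) t
      :> (\<Sum>b\<in>Basis. (v \<bullet> b) * line_partials (Suc k) v (b # bs) f (y + t *\<^sub>R v))"
    by (intro DERIV_sum DERIV_cmult Suc.IH) (use Suc.prems in simp)
  then show ?case by (simp only: line_partials.simps)
qed

lemma line_partials_bound:
  fixes f :: "'a::euclidean_space \<Rightarrow> real"
  assumes bs: "bs \<in> lists Basis"
    and B: "\<And>cs. cs \<in> lists Basis \<Longrightarrow> length cs = k + length bs \<Longrightarrow> \<bar>partials cs f x\<bar> \<le> B"
  shows "\<bar>line_partials k v bs f x\<bar> \<le> (real DIM('a) * norm v) ^ k * B"
  using assms
proof (induction k arbitrary: bs)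
  case 0
  then show ?case by simp
next
  case (Suc k)
  have "\<bar>line_partials (Suc k) v bs f x\<bar> \<le> (\<Sum>b\<in>Basis. \<bar>(v \<bullet> b) * line_partials k v (b # bs) f x\<bar>)"
    unfolding line_partials.simps by (rule sum_abs)
  also have "\<dots> \<le> (\<Sum>b\<in>(Basis :: 'a set). norm v * ((real DIM('a) * norm v) ^ k * B))"
  proof (rule sum_mono)
    fix b :: 'a
    assume b: "b \<in> Basis"
    have "\<bar>line_partials k v (b # bs) f x\<bar> \<le> (real DIM('a) * norm v) ^ k * B"
      by (rule Suc.IH) (use b Suc.prems in auto)
    then show "\<bar>(v \<bullet> b) * line_partials k v (b # bs) f x\<bar> \<le> norm v * ((real DIM('a) * norm v) ^ k * B)"
      unfolding abs_mult by (intro mult_mono Basis_le_norm b) auto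
  qed
  finally show ?case by (simp add: mult_ac)
qed

text \<open>Maclaurin's formula with Lagrange remainder for the restriction to the line. The
  factorial in the remainder is discarded; expanding \<open>K\<close> directional derivatives gives
  the power of the dimension.\<close>

lemma taylor_along_line:
  fixes f :: "'a::euclidean_space \<Rightarrow> real"
  assumes f: "smooth f" and K: "0 < K"
    and B: "\<And>cs z. cs \<in> lists Basis \<Longrightarrow> length cs = K \<Longrightarrow> \<bar>partials cs f z\<bar> \<le> B"
  shows "\<exists>p. degree p < K \<and> (\<forall>t\<ge>0. \<bar>f (y + t *\<^sub>R v) - poly p t\<bar> \<le> real DIM('a) ^ K * B * (t * norm v) ^ K)"
proof -
  let ?g = "\<lambda>k t. line_partials k v [] f (y + t *\<^sub>R v)"
  define p where "p = (\<Sum>m<K. monom (?g m 0 / fact m) m)"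
  have "\<bar>f (y + t *\<^sub>R v) - poly p t\<bar> \<le> real DIM('a) ^ K * B * (t * norm v) ^ K" if t: "0 \<le> t" for t
  proof -
    have "\<exists>s. \<bar>s\<bar> \<le> \<bar>t\<bar> \<and> ?g 0 t = (\<Sum>m<K. ?g m 0 / fact m * t ^ m) + ?g K s / fact K * t ^ K"
      by (rule Maclaurin_all_le[of ?g "?g 0"]) (use line_partials_deriv[OF f] in \<open>auto simp del: line_partials.simps\<close>)
    then obtain s where s: "?g 0 t = (\<Sum>m<K. ?g m 0 / fact m * t ^ m) + ?g K s / fact K * t ^ K" by blast
    have "f (y + t *\<^sub>R v) - poly p t = ?g K s / fact K * t ^ K"
      using s by (simp add: p_def poly_sum poly_monom)
    then have "\<bar>f (y + t *\<^sub>R v) - poly p t\<bar> = \<bar>?g K s\<bar> / fact K * t ^ K"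
      using t by (simp add: abs_mult)
    also have "\<dots> \<le> ((real DIM('a) * norm v) ^ K * B) * t ^ K"
    proof (rule mult_right_mono)
      have "\<bar>?g K s\<bar> / fact K \<le> \<bar>?g K s\<bar>"
        by (simp add: divide_le_eq mult_le_cancel_left1 fact_ge_1)
      also have "\<dots> \<le> (real DIM('a) * norm v) ^ K * B"
        by (rule line_partials_bound) (auto intro: B)
      finally show "\<bar>?g K s\<bar> / fact K \<le> (real DIM('a) * norm v) ^ K * B" .
    qed (use t in simp)
    finally have "\<bar>f (y + t *\<^sub>R v) - poly p t\<bar> \<le> ((real DIM('a) * norm v) ^ K * B) * t ^ K" .
    then show ?thesis by (simp add: power_mult_distrib mult_ac)
  qed
  moreover have "degree p < K"
    unfolding p_def using K by (intro degree_sum_less) (auto intro: le_less_trans[OF degree_monom_le])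
  ultimately show ?thesis by blast
qed

text \<open>Each derivative of the scaled symbol gains \<open>sqrt h\<close> and loses at most
  \<open>h\<close> to the power \<open>- \<rho>\<close>. As \<open>\<rho> < 1/2\<close>, a high
  enough order \<open>K\<close> beats both \<open>h^N\<close> and the order
  \<open>m\<close>.\<close>

lemma symbol_tame:
  fixes a :: "real \<Rightarrow> 'a::euclidean_space \<Rightarrow> real"
  assumes a: "a \<in> symbol_class m \<rho>" and \<rho>: "\<rho> < 1/2"
  shows "\<exists>K>0. \<exists>C\<ge>0. \<forall>h\<in>{0<..1}. tame K (C * h ^ N) (\<lambda>w. a h (h powr (1/2) *\<^sub>R w))"
proof -
  have smooth: "\<And>h. h \<in> {0<..1} \<Longrightarrow> smooth (a h)" using a by (simp add: symbol_class_def)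
  obtain N0 where N0: "\<And>bs. bs \<in> lists Basis \<Longrightarrow> N0 \<le> length bs \<Longrightarrow>
      \<exists>C. \<forall>h\<in>{0<..1}. \<forall>z. \<bar>partials bs (a h) z\<bar> * h powr (m + \<rho> * real (length bs)) \<le> C"
    using a unfolding symbol_class_def by blast
  \<comment> \<open>The order from which \<open>K * (1/2 - \<rho>)\<close> reaches
    \<open>N + m\<close>.\<close>
  define L where "L = (real N + m) / (1/2 - \<rho>)"
  obtain K where K: "max (real (Suc N0)) L \<le> real K" using real_arch_simple by blast
  have K0: "0 < K" "N0 \<le> K" using K by auto
  have "real N + m \<le> real K * (1/2 - \<rho>)"
    using K \<rho> by (simp add: L_def pos_divide_le_eq)
  then have KN: "real N \<le> real K / 2 - (m + \<rho> * real K)" by (simp add: algebra_simps)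
  define S where "S = {bs :: 'a list. set bs \<subseteq> Basis \<and> length bs = K}"
  have S: "finite S" unfolding S_def by (rule finite_lists_length_eq) simp
  have "\<forall>bs\<in>S. \<exists>C. \<forall>h\<in>{0<..1}. \<forall>z. \<bar>partials bs (a h) z\<bar> * h powr (m + \<rho> * real K) \<le> C"
    using N0 K0 unfolding S_def by (force simp: in_lists_conv_set)
  then obtain C where C: "\<And>bs h z. bs \<in> S \<Longrightarrow> h \<in> {0<..1} \<Longrightarrow> \<bar>partials bs (a h) z\<bar> * h powr (m + \<rho> * real K) \<le> C bs"
    by metis
  define A where "A = (\<Sum>bs\<in>S. \<bar>C bs\<bar>)"
  have A: "0 \<le> A" unfolding A_def by (rule sum_nonneg) simp
  have "tame K (real DIM('a) ^ K * A * h ^ N) (\<lambda>w. a h (h powr (1/2) *\<^sub>R w))" if h: "h \<in> {0<..1}" for h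
    unfolding tame_def
  proof (intro conjI allI)
    have h0: "0 < h" "h \<le> 1" using h by auto
    have "a h differentiable (at x)" for x
      using smooth[OF h] unfolding smooth_def by (metis lists.Nil partials.simps(1))
    then have "continuous_on UNIV (a h)"
      by (simp add: continuous_on_eq_continuous_at differentiable_imp_continuous_within)
    then show "continuous_on UNIV (\<lambda>w. a h (h powr (1/2) *\<^sub>R w))"
      by (rule continuous_on_compose2) (auto intro!: continuous_intros)
    show "0 < K" by (rule K0)
    show "0 \<le> real DIM('a) ^ K * A * h ^ N" using A h0 by simp
    define q where "q = m + \<rho> * real K"
    define B where "B = A * h powr (- q)"
    have B: "\<bar>partials cs (a h) z\<bar> \<le> B" if "cs \<in> lists Basis" "length cs = K" for cs z
    proof -
      have cs: "cs \<in> S" using that by (auto simp: S_def)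
      have "\<bar>partials cs (a h) z\<bar> * h powr q \<le> \<bar>C cs\<bar>" using C[OF cs h, of z] unfolding q_def by linarith
      also have "\<dots> \<le> A" unfolding A_def using S cs by (intro member_le_sum) auto
      finally show ?thesis using h0 by (simp add: B_def powr_minus_divide pos_le_divide_eq)
    qed
    \<comment> \<open>The total exponent \<open>K / 2 - q\<close> is at least \<open>N\<close>, and
      \<open>h \<le> 1\<close>.\<close>
    have hB: "B * (h powr (1/2)) ^ K \<le> A * h ^ N"
    proof -
      have "(h powr (1/2)) ^ K = h powr (real K / 2)"
        using h0 by (simp add: powr_realpow[symmetric] powr_powr)
      then have "B * (h powr (1/2)) ^ K = A * (h powr (real K / 2) * h powr (- q))"
        by (simp add: B_def mult_ac)
      then have "B * (h powr (1/2)) ^ K = A * h powr (real K / 2 - q)"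
        unfolding powr_add[symmetric] by simp
      also have "\<dots> \<le> A * h powr real N" using h0 KN A unfolding q_def by (intro mult_left_mono powr_mono') auto
      finally show ?thesis using h0 by (simp add: powr_realpow)
    qed
    fix w v :: 'a
    obtain p where p: "degree p < K" "\<And>t. 0 \<le> t \<Longrightarrow>
        \<bar>a h (h powr (1/2) *\<^sub>R w + t *\<^sub>R (h powr (1/2) *\<^sub>R v)) - poly p t\<bar>
        \<le> real DIM('a) ^ K * B * (t * norm (h powr (1/2) *\<^sub>R v)) ^ K"
      using taylor_along_line[OF smooth[OF h] K0(1) B] by blast
    have "\<bar>a h (h powr (1/2) *\<^sub>R (w + t *\<^sub>R v)) - poly p t\<bar> \<le> real DIM('a) ^ K * A * h ^ N * (t * norm v) ^ K"
      if t: "0 \<le> t" for t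
    proof -
      have "\<bar>a h (h powr (1/2) *\<^sub>R (w + t *\<^sub>R v)) - poly p t\<bar>
          \<le> real DIM('a) ^ K * B * (t * norm (h powr (1/2) *\<^sub>R v)) ^ K"
        using p(2)[OF t] by (simp add: scaleR_add_right mult.commute)
      also have "\<dots> = real DIM('a) ^ K * (B * (h powr (1/2)) ^ K) * (t * norm v) ^ K"
        by (simp add: power_mult_distrib mult_ac)
      also have "\<dots> \<le> real DIM('a) ^ K * (A * h ^ N) * (t * norm v) ^ K"
        using t by (intro mult_right_mono mult_left_mono hB) auto
      finally show ?thesis by (simp add: mult.assoc)
    qed
    then show "\<exists>p. degree p < K \<and> (\<forall>t\<ge>0. \<bar>a h (h powr (1/2) *\<^sub>R (w + t *\<^sub>R v)) - poly p t\<bar>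
        \<le> real DIM('a) ^ K * A * h ^ N * (t * norm v) ^ K)"
      using p(1) by blast
  qed
  then show ?thesis using K0 A by (intro exI[of _ K] conjI exI[of _ "real DIM('a) ^ K * A"]) auto
qed

subsection \<open>The bottom of the essential spectrum\<close>

text \<open>In scaled coordinates the balls of radius \<open>sqrt h\<close> become unit balls. A
  strict inequality for the supremum supplies an actual point.\<close>

lemma local_sup_lower_frequency:
  fixes a :: "real \<Rightarrow> 'a::euclidean_space \<times> 'a \<Rightarrow> real"
  assumes h: "0 < h" and \<mu>: "ereal \<mu> < lambda_ess a h"
  shows "\<exists>R0. \<forall>w. R0 \<le> norm w \<longrightarrow> (\<exists>w1\<in>ball w 1. \<mu> \<le> a h (h powr (1/2) *\<^sub>R w1))"
proof -
  define r where "r = h powr (1/2)"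
  have r: "0 < r" using h by (simp add: r_def)
  have "eventually (\<lambda>p. ereal \<mu> < local_sup a h p) at_infinity"
    using \<mu> unfolding lambda_ess_def by (rule less_LiminfD)
  then obtain R where R: "\<And>p. R \<le> norm p \<Longrightarrow> ereal \<mu> < local_sup a h p"
    unfolding eventually_at_infinity by blast
  have "\<exists>w1\<in>ball w 1. \<mu> \<le> a h (r *\<^sub>R w1)" if w: "R / r \<le> norm w" for w
  proof -
    have "R \<le> norm (r *\<^sub>R w)" using w r by (simp add: pos_divide_le_eq mult.commute)
    from R[OF this] obtain z where z: "z \<in> ball (r *\<^sub>R w) r" "\<mu> < a h z"
      unfolding local_sup_def r_def[symmetric] less_SUP_iff by auto
    define w1 where "w1 = (1 / r) *\<^sub>R z"
    have z1: "z = r *\<^sub>R w1" using r by (simp add: w1_def)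
    have "dist (r *\<^sub>R w) (r *\<^sub>R w1) = r * dist w w1" using r by (simp add: dist_norm flip: scaleR_diff_right)
    then have "r * dist w w1 < r * 1" using z(1) unfolding z1 by simp
    then have "w1 \<in> ball w 1" using r by simp
    then show ?thesis using z(2) unfolding z1 by (intro bexI[of _ w1]) auto
  qed
  then show ?thesis unfolding r_def by blast
qed

lemma local_sup_small_balls:
  fixes a :: "real \<Rightarrow> 'a::euclidean_space \<times> 'a \<Rightarrow> real"
  assumes h: "0 < h" "h \<le> 1" and s: "lambda_ess a h < ereal s"
  shows "\<exists>W. filterlim W at_infinity sequentially \<and> (\<forall>n. \<forall>w\<in>ball (W n) 1. a h (h powr (1/2) *\<^sub>R w) \<le> s)"
proof -
  define r where "r = h powr (1/2)"
  have r: "0 < r" "r \<le> 1" using h by (simp_all add: r_def powr_le1)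
  have "\<not> eventually (\<lambda>p. ereal s \<le> local_sup a h p) at_infinity"
  proof
    assume "eventually (\<lambda>p. ereal s \<le> local_sup a h p) at_infinity"
    then have "ereal s \<le> lambda_ess a h" unfolding lambda_ess_def by (rule Liminf_bounded)
    then show False using s by simp
  qed
  then have "\<exists>p. real n \<le> norm p \<and> local_sup a h p < ereal s" for n
    unfolding eventually_at_infinity not_ex not_all not_imp not_le by blast
  then obtain p where p: "\<And>n. real n \<le> norm (p n)" "\<And>n. local_sup a h (p n) < ereal s" by metis
  define W where "W n = (1 / r) *\<^sub>R p n" for n
  have "real n \<le> norm (W n)" for n
  proof -
    have "norm (p n) * r \<le> norm (p n) * 1" using r by (intro mult_left_mono) auto
    then have "norm (p n) \<le> norm (W n)" using r by (simp add: W_def pos_le_divide_eq)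
    then show ?thesis using p(1)[of n] by linarith
  qed
  then have "filterlim (\<lambda>n. norm (W n)) at_top sequentially"
    by (intro filterlim_at_top_mono[OF filterlim_real_sequentially]) simp
  then have "filterlim W at_infinity sequentially" by (rule filterlim_norm_at_top_imp_at_infinity)
  moreover have "a h (r *\<^sub>R w) \<le> s" if w: "w \<in> ball (W n) 1" for n w
  proof -
    have "dist (p n) (r *\<^sub>R w) = dist (r *\<^sub>R W n) (r *\<^sub>R w)" using r by (simp add: W_def)
    also have "\<dots> = r * dist (W n) w" using r by (simp add: dist_norm flip: scaleR_diff_right)
    also have "\<dots> < r * 1" using w r by (intro mult_strict_left_mono) auto
    finally have "r *\<^sub>R w \<in> ball (p n) r" by simp
    then have "ereal (a h (r *\<^sub>R w)) \<le> local_sup a h (p n)"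
      unfolding local_sup_def r_def[symmetric] by (rule SUP_upper)
    then have "ereal (a h (r *\<^sub>R w)) < ereal s" using p(2)[of n] by (rule le_less_trans)
    then show ?thesis by simp
  qed
  ultimately show ?thesis unfolding r_def by blast
qed

text \<open>The arithmetic of constants, with \<open>\<mu>\<close> increasing and \<open>s\<close>
  decreasing to \<open>\<Lambda>\<close>. Infinite values are treated separately, since
  \<open>\<Lambda>\<close> and \<open>I\<close> may both be infinite.\<close>

lemma two_sided_bound:
  fixes I \<Lambda> :: ereal and c C C1 C2 e Cf :: real
  assumes Cf: "1 \<le> Cf" "1 / Cf \<le> c" "C * C2 \<le> Cf" "C1 \<le> Cf" "C1 * C2 \<le> Cf"
    and e: "0 \<le> e" and I: "0 \<le> I" and \<Lambda>: "0 \<le> \<Lambda>"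
    and lower: "\<And>\<mu>. 0 < \<mu> \<Longrightarrow> ereal \<mu> < \<Lambda> \<Longrightarrow> C * (C2 * e) \<le> \<mu> \<Longrightarrow> ereal (c * \<mu>) \<le> I"
    and upper: "\<And>s. \<Lambda> < ereal s \<Longrightarrow> I \<le> ereal (C1 * (s + C2 * e))"
  shows "ereal (1 / Cf) * \<Lambda> - ereal (Cf * e) \<le> I" and "I \<le> ereal Cf * (\<Lambda> + ereal e)"
proof -
  have Cf0: "0 < Cf" using Cf(1) by simp
  \<comment> \<open>The error constant enters twice, so \<open>Cf^2 * e\<close> exceeds the
    threshold below which \<open>lower\<close> says nothing.\<close>
  have CC: "C * (C2 * e) \<le> Cf * (Cf * e)"
  proof -
    have "C * C2 * e \<le> Cf * e" using Cf(3) e by (rule mult_right_mono)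
    also have "\<dots> \<le> Cf * (Cf * e)" using mult_right_mono[OF Cf(1), of "Cf * e"] Cf0 e by simp
    finally show ?thesis by (simp add: mult.assoc)
  qed
  have low: "ereal (\<mu> / Cf - Cf * e) \<le> I" if \<mu>: "ereal \<mu> < \<Lambda>" for \<mu>
  proof (cases "0 < \<mu> \<and> C * (C2 * e) \<le> \<mu>")
    case True
    have "\<mu> / Cf \<le> c * \<mu>" using mult_right_mono[OF Cf(2), of \<mu>] True by simp
    moreover have "0 \<le> Cf * e" using Cf0 e by simp
    ultimately have "ereal (\<mu> / Cf - Cf * e) \<le> ereal (c * \<mu>)" by simp
    also have "\<dots> \<le> I" using True \<mu> by (intro lower) auto
    finally show ?thesis .
  next
    \<comment> \<open>Below the threshold the left side is nonpositive, and \<open>I\<close> is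
      nonnegative.\<close>
    case False
    have "0 \<le> Cf * (Cf * e)" using Cf0 e by simp
    then have "\<mu> \<le> Cf * (Cf * e)" using False CC by linarith
    then have "\<mu> / Cf - Cf * e \<le> 0" using Cf0 by (simp add: pos_divide_le_eq mult.commute)
    then have "ereal (\<mu> / Cf - Cf * e) \<le> 0" by (simp add: zero_ereal_def)
    then show ?thesis using I by (rule order_trans)
  qed
  show "ereal (1 / Cf) * \<Lambda> - ereal (Cf * e) \<le> I"
  proof (cases I)
    case (real i)
    have bound: "\<mu> \<le> Cf * (i + Cf * e)" if "ereal \<mu> < \<Lambda>" for \<mu>
    proof -
      have "\<mu> / Cf \<le> i + Cf * e" using low[OF that] unfolding real by simp
      then show ?thesis using Cf0 by (simp add: pos_divide_le_eq mult.commute)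
    qed
    show ?thesis
    proof (cases \<Lambda>)
      case (real l)
      have "l \<le> Cf * (i + Cf * e)" by (rule dense_le) (use bound real in simp)
      then have "l / Cf - Cf * e \<le> i" using Cf0 by (simp add: pos_divide_le_eq mult.commute diff_le_eq)
      then show ?thesis using real \<open>I = ereal i\<close> by simp
    next
      case PInf
      then show ?thesis using bound[of "Cf * (i + Cf * e) + 1"] by simp
    qed (use \<Lambda> in simp)
  qed (use I in simp_all)
  show "I \<le> ereal Cf * (\<Lambda> + ereal e)"
  proof (cases \<Lambda>)
    case (real l)
    have l: "0 \<le> l" using \<Lambda> real by simp
    have up: "I \<le> ereal (Cf * (s + e))" if s: "l < s" for s
    proof -
      have "C1 * s \<le> Cf * s" using s l Cf(4) by (intro mult_right_mono) auto
      moreover have "C1 * C2 * e \<le> Cf * e" using Cf(5) e by (rule mult_right_mono)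
      ultimately have "C1 * (s + C2 * e) \<le> Cf * (s + e)" by (simp add: distrib_left mult.assoc)
      moreover have "I \<le> ereal (C1 * (s + C2 * e))" using s real by (intro upper) simp
      ultimately show ?thesis by (meson ereal_less_eq(3) order_trans)
    qed
    obtain i where i: "I = ereal i" using up[of "l + 1"] I by (cases I) auto
    have "i / Cf - e \<le> l"
    proof (rule dense_ge)
      fix s assume "l < s"
      from up[OF this] show "i / Cf - e \<le> s"
        using Cf0 unfolding i by (simp add: diff_le_eq pos_divide_le_eq mult.commute)
    qed
    then have "i \<le> Cf * (l + e)" using Cf0 by (simp add: diff_le_eq pos_divide_le_eq mult.commute)
    then show ?thesis unfolding i real by simp
  next
    case PInf
    then show ?thesis using Cf0 by simp
  qed (use \<Lambda> in simp)
qed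

lemma lambda_ess_nonneg:
  fixes a :: "real \<Rightarrow> 'a::euclidean_space \<times> 'a \<Rightarrow> real"
  assumes "0 < h" "\<And>z. 0 \<le> a h z"
  shows "0 \<le> lambda_ess a h"
  unfolding lambda_ess_def
proof (rule Liminf_bounded, rule always_eventually, rule allI)
  fix p
  have "ereal (a h p) \<le> local_sup a h p"
    unfolding local_sup_def by (rule SUP_upper) (use assms(1) in simp)
  then show "0 \<le> local_sup a h p" using assms(2)[of p] by (meson ereal_less_eq(5) order_trans)
qed

text \<open>Only the empty set has infimum \<open>\<infinity>\<close> here, because every spectral
  point contributes a finite real part.\<close>

lemma purely_discrete_iff_inf_ess: "purely_discrete_spectrum A \<longleftrightarrow> inf_ess_spectrum A = \<infinity>"
proof -
  have "purely_discrete_spectrum A \<longleftrightarrow> ess_spectrum A = {}"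
    by (auto simp: purely_discrete_spectrum_def ess_spectrum_def)
  also have "\<dots> \<longleftrightarrow> inf_ess_spectrum A = \<infinity>"
  proof
    show "inf_ess_spectrum A = \<infinity>" if "ess_spectrum A = {}"
      using that by (simp add: inf_ess_spectrum_def top_ereal_def)
    show "ess_spectrum A = {}" if inf: "inf_ess_spectrum A = \<infinity>"
    proof (rule equals0I)
      fix z assume "z \<in> ess_spectrum A"
      then have "inf_ess_spectrum A \<le> ereal (Re z)" unfolding inf_ess_spectrum_def by (rule INF_lower)
      then show False using inf by simp
    qed
  qed
  finally show ?thesis .
qed

lemma antiwick_inf_ess_spectrum_bounds:
  fixes \<phi> :: "'a::euclidean_space \<Rightarrow> complex" and a :: "real \<Rightarrow> 'a \<times> 'a \<Rightarrow> real"
  assumes \<phi>: "schwartz \<phi>" "norm (abs_l2 \<phi>) = 1" and \<rho>: "\<rho> < 1/2" and a: "a \<in> symbol_class m \<rho>"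
    and pos: "\<And>h z. h \<in> {0<..1} \<Longrightarrow> 0 \<le> a h z"
  shows "\<exists>C>0. \<forall>h\<in>{0<..1}.
      ereal (1 / C) * lambda_ess a h - ereal (C * h ^ N) \<le> inf_ess_spectrum (antiwick_operator \<phi> h (a h)) \<and>
      inf_ess_spectrum (antiwick_operator \<phi> h (a h)) \<le> ereal C * (lambda_ess a h + ereal (h ^ N))"
proof -
  define \<kappa> where "\<kappa> = 1 / (2 * pi) ^ DIM('a)"
  obtain \<Gamma> where frame: "\<And>h. 0 < h \<Longrightarrow> localized_frame \<kappa> \<Gamma> (coherent_frame \<phi> h)"
    using localized_coherent_frame[OF \<phi>] unfolding \<kappa>_def by blast
  obtain K C2 where K: "0 < K" and C2: "0 \<le> C2"
    and tame: "\<And>h. h \<in> {0<..1} \<Longrightarrow> tame K (C2 * h ^ N) (\<lambda>w. a h (h powr (1/2) *\<^sub>R w))"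
    using symbol_tame[OF a \<rho>] by blast
  obtain c C where c: "0 < c" and C: "0 < C" and ge: "\<And>(\<psi> :: 'a \<times> 'a \<Rightarrow> 'a l2) b M \<mu> R0.
      localized_frame \<kappa> \<Gamma> \<psi> \<Longrightarrow> tame K M b \<Longrightarrow> \<forall>w. 0 \<le> b w \<Longrightarrow> 0 < \<mu> \<Longrightarrow> C * M \<le> \<mu> \<Longrightarrow>
      \<forall>w. R0 \<le> norm w \<longrightarrow> (\<exists>w1\<in>ball w 1. \<mu> \<le> b w1) \<Longrightarrow>
      ereal (c * \<mu>) \<le> inf_ess_spectrum (localized_frame.symbol_operator \<kappa> \<psi> b)"
    using inf_ess_symbol_operator_ge[OF K, of \<kappa> \<Gamma>] by metis
  define C1 where "C1 = \<kappa> * ((1 + 2 * real K) ^ K + 1) * (\<Gamma> (K + DIM('a \<times> 'a)))\<^sup>2 * decay_integral TYPE('a \<times> 'a)"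
  have C1: "0 \<le> C1" unfolding C1_def \<kappa>_def by (simp add: decay_integral_nonneg)
  \<comment> \<open>A sum of nonnegative constants, large enough for all the comparisons that
    \<open>two_sided_bound\<close> requires.\<close>
  define Cf where "Cf = 1 + 1 / c + C1 + C1 * C2 + C * C2"
  have "0 \<le> 1 / c" "0 \<le> C1 * C2" "0 \<le> C * C2" using c C C1 C2 by simp_all
  then have Cf: "1 \<le> Cf" "1 / c \<le> Cf" "C * C2 \<le> Cf" "C1 \<le> Cf" "C1 * C2 \<le> Cf"
    unfolding Cf_def using C1 by linarith+
  have cCf: "1 / Cf \<le> c" using Cf(1,2) c by (simp add: divide_le_eq mult.commute)
  have "ereal (1 / Cf) * lambda_ess a h - ereal (Cf * h ^ N) \<le> inf_ess_spectrum (antiwick_operator \<phi> h (a h)) \<and>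
      inf_ess_spectrum (antiwick_operator \<phi> h (a h)) \<le> ereal Cf * (lambda_ess a h + ereal (h ^ N))"
    if h: "h \<in> {0<..1}" for h
  proof -
    have h0: "0 < h" "h \<le> 1" using h by auto
    define b where "b = (\<lambda>w. a h (h powr (1/2) *\<^sub>R w))"
    have tb: "tame K (C2 * h ^ N) b" unfolding b_def by (rule tame[OF h])
    have bpos: "0 \<le> b w" for w unfolding b_def by (rule pos[OF h])
    interpret localized_frame \<kappa> \<Gamma> "coherent_frame \<phi> h" by (rule frame[OF h0(1)])
    have op: "antiwick_operator \<phi> h (a h) = symbol_operator b"
      using antiwick_operator_eq[OF h0(1) frame[OF h0(1), unfolded \<kappa>_def] tame[OF h] pos[OF h]]
      unfolding \<kappa>_def b_def .
    have e: "0 \<le> h ^ N" using h0 by simp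
    have I: "0 \<le> inf_ess_spectrum (symbol_operator b)" by (rule inf_ess_symbol_operator_nonneg[OF tb bpos])
    have \<Lambda>: "0 \<le> lambda_ess a h" by (intro lambda_ess_nonneg h0 pos h)
    have lower: "ereal (c * \<mu>) \<le> inf_ess_spectrum (symbol_operator b)"
      if \<mu>: "0 < \<mu>" "ereal \<mu> < lambda_ess a h" "C * (C2 * h ^ N) \<le> \<mu>" for \<mu>
    proof -
      obtain R0 where "\<forall>w. R0 \<le> norm w \<longrightarrow> (\<exists>w1\<in>ball w 1. \<mu> \<le> b w1)"
        using local_sup_lower_frequency[OF h0(1) \<mu>(2)] unfolding b_def by blast
      then show ?thesis by (rule ge[OF frame[OF h0(1)] tb _ \<mu>(1,3), rotated]) (simp add: bpos)
    qed
    have upper: "inf_ess_spectrum (symbol_operator b) \<le> ereal (C1 * (s + C2 * h ^ N))"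
      if s: "lambda_ess a h < ereal s" for s
    proof -
      obtain W where W: "filterlim W at_infinity sequentially" "\<And>n w. w \<in> ball (W n) 1 \<Longrightarrow> b w \<le> s"
        using local_sup_small_balls[OF h0 s] unfolding b_def by blast
      show ?thesis unfolding C1_def by (rule inf_ess_symbol_operator_le[OF tb bpos W])
    qed
    show ?thesis unfolding op
      using two_sided_bound[OF Cf(1) cCf Cf(3-5) e I \<Lambda> lower upper] by blast
  qed
  then show ?thesis using Cf(1) by (intro exI[of _ Cf]) auto
qed

theorem corollary6p3:
  fixes \<phi> :: "real ^ 'n \<Rightarrow> complex"
    and a :: "real \<Rightarrow> (real ^ 'n) \<times> (real ^ 'n) \<Rightarrow> real"
    and m \<rho> :: real
  assumes "schwartz \<phi>" and "norm (abs_l2 \<phi>) = 1"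
    and "0 \<le> \<rho>" and "\<rho> < 1/2"
    and "a \<in> symbol_class m \<rho>"
    and "\<And>h z. h \<in> {0<..1} \<Longrightarrow> 0 \<le> a h z"
  shows "(\<forall>N::nat. \<exists>C>0. \<forall>h\<in>{0<..1}.
            ereal (1 / C) * lambda_ess a h - ereal (C * h ^ N)
              \<le> inf_ess_spectrum (antiwick_operator \<phi> h (a h)) \<and>
            inf_ess_spectrum (antiwick_operator \<phi> h (a h))
              \<le> ereal C * (lambda_ess a h + ereal (h ^ N))) \<and>
         (\<forall>h\<in>{0<..1}.
            purely_discrete_spectrum (antiwick_operator \<phi> h (a h)) \<longleftrightarrow>
            (local_sup a h \<longlongrightarrow> \<infinity>) at_infinity)"
proof (intro conjI allI ballI)
  note bounds = antiwick_inf_ess_spectrum_bounds[OF assms(1,2,4-6)]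
  show "\<exists>C>0. \<forall>h\<in>{0<..1}.
      ereal (1 / C) * lambda_ess a h - ereal (C * h ^ N) \<le> inf_ess_spectrum (antiwick_operator \<phi> h (a h)) \<and>
      inf_ess_spectrum (antiwick_operator \<phi> h (a h)) \<le> ereal C * (lambda_ess a h + ereal (h ^ N))" for N
    by (rule bounds)
  fix h :: real
  assume h: "h \<in> {0<..1}"
  \<comment> \<open>The case \<open>N = 0\<close> suffices: a finite error cannot affect whether the
    two quantities are infinite.\<close>
  obtain C where C: "0 < C"
    "ereal (1 / C) * lambda_ess a h - ereal (C * h ^ 0) \<le> inf_ess_spectrum (antiwick_operator \<phi> h (a h))"
    "inf_ess_spectrum (antiwick_operator \<phi> h (a h)) \<le> ereal C * (lambda_ess a h + ereal (h ^ 0))"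
    using bounds[of 0] h by blast
  have "inf_ess_spectrum (antiwick_operator \<phi> h (a h)) = \<infinity> \<longleftrightarrow> lambda_ess a h = \<infinity>"
    using C by (cases "lambda_ess a h") auto
  also have "\<dots> \<longleftrightarrow> (local_sup a h \<longlongrightarrow> \<infinity>) at_infinity"
    unfolding lambda_ess_def by (rule Liminf_PInfty[OF trivial_limit_at_infinity, symmetric])
  finally show "purely_discrete_spectrum (antiwick_operator \<phi> h (a h)) \<longleftrightarrow> (local_sup a h \<longlongrightarrow> \<infinity>) at_infinity"
    unfolding purely_discrete_iff_inf_ess .
qed

end
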